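(* Let $d\ge3$. There exists $\eta>0$ such that for every $\xi$ with $|\xi-\xi_o|<\eta$ the following holds, where $\theta$ is the unique solution of $\xi=\nabla\Lambda_c(\theta)$. There exists a $\mathcal{B}_0^+$-measurable function $u^\theta>0$ with $\int u^\theta\,\mathrm{d}\mathbb{P}=1$ and, $\mathbb{P}$-a.s., $$u^\theta(\omega)=\sum_{z\in U}\overline{\pi}(\omega,T_{1,z}\omega)\mathrm{e}^{\langle\theta,z\rangle-\Lambda_c(\theta)}u^\theta(T_{1,z}\omega).$$ Define the kernel $\overline{\pi}^\theta(\omega,T_{1,z}\omega):=\overline{\pi}(\omega,T_{1,z}\omega)\frac{u^\theta(T_{1,z}\omega)}{u^\theta(\omega)}\mathrm{e}^{\langle\theta,z\rangle-\Lambda_c(\theta)}$ on $\Omega$. Then $\mu_\xi^\infty$ is the unique stationary Markov process with transition kernel $\overline{\pi}^\theta$ whose marginal is absolutely continuous relative to $\mathbb{P}$ on every $\mathcal{B}_n^+$.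
   Context: Space-time RWRE on $\mathbb{Z}^d$: environment $\omega=(\omega_{n,x})_{n\in\mathbb{Z},x\in\mathbb{Z}^d}$, $\omega_{n,x}=(\pi_{n,n+1}(x,x+z))_{z\in U}$ probability vectors, $U:=\{z:|z_1|+\cdots+|z_d|=1\}$; the $\omega_{n,x}$ are i.i.d. under $\mathbb{P}$ and $\mathbb{P}(\pi_{0,1}(0,z)\ge c_1)=1$ for all $z\in U$, some $c_1>0$. Quenched law $P_{k,x}^\omega$ of the walk with $X_k=x$ and $P(X_{n+1}=y+z\mid X_n=y)=\pi_{n,n+1}(y,y+z)$; averaged $P_{k,x}=\int P^\omega_{k,x}\,\mathrm{d}\mathbb{P}$, expectation $E_{k,x}$. $Z_i:=X_i-X_{i-1}$; shifts $(T_{m,y}\omega)_{n,x}=\omega_{n+m,x+y}$; $\overline\pi(\omega,T_{1,z}\omega):=\pi_{0,1}(0,z)$ is the kernel of the environment chain $(T_{n,X_n}\omega)_n$. $\mathcal{B}_n^-$ (resp. $\mathcal{B}_n^+$) is generated by $\omega_{m,x}$ with $m\le n$ (resp. $m\ge n$). $q(z):=\mathbb{E}[\pi_{0,1}(0,z)]$, $\xi_o:=\sum_zq(z)z$, $\Lambda_c(\theta):=\log\sum_zq(z)\mathrm{e}^{\langle\theta,z\rangle}$. $\bar\mu_\xi^\infty$ is the measure on $\Omega\times U^{\mathbb{N}}$ defined, for all $N,M,K\in\mathbb{N}$ and bounded $f$ with $f(\cdot,(z_i))$ independent of $(z_i)_{i>K}$ and $\mathcal{B}_{-N}^+\cap\mathcal{B}_M^-$-measurable,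 by $\int f\,\mathrm{d}\bar\mu_\xi^\infty:=E_{0,0}[\mathrm{e}^{\langle\theta,X_{N+M+K+1}\rangle-(N+M+K+1)\Lambda_c(\theta)}f(T_{N,X_N}\omega,(Z_{N+i})_{i\ge1})]$. $\mu_\xi^\infty$ is the law on $\Omega^{\mathbb{N}}$ of $(\omega,T_{1,z_1}\omega,T_{2,z_1+z_2}\omega,\ldots)$ when $(\omega,(z_i)_{i\ge1})\sim\bar\mu_\xi^\infty$ (a stationary process). *)

theory Defs
  imports "HOL-Probability.Probability"
begin

text \<open>Space-time random walk in random environment on Z^d (d = CARD('d)).
 An environment is omega :: int \<times> Z^d \<Rightarrow> Z^d \<Rightarrow> real, with
 omega (n,x) z = pi_{n,n+1}(x,x+z).\<close>

type_synonym 'd env = "int \<times> (int^'d) \<Rightarrow> (int^'d) \<Rightarrow> real"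

definition Ustep :: "(int^'d::finite) set" where
  "Ustep = {z. (\<Sum>i\<in>UNIV. \<bar>z$i\<bar>) = 1}"

definition vecR :: "int^'d::finite \<Rightarrow> real^'d" where
  "vecR z = (\<chi> i. real_of_int (z$i))"

definition shift :: "int \<Rightarrow> int^'d::finite \<Rightarrow> 'd env \<Rightarrow> 'd env" where
  "shift m y \<omega> = (\<lambda>(n,x). \<omega> (n+m, x+y))"

definition env_measure :: "((int^'d::finite) \<Rightarrow> real) measure \<Rightarrow> 'd env measure" where
  "env_measure \<nu> = PiM UNIV (\<lambda>_. \<nu>)"

definition Bplus :: "((int^'d::finite) \<Rightarrow> real) measure \<Rightarrow> int \<Rightarrow> 'd env measure" where
  "Bplus \<nu> n = sigma (space (env_measure \<nu>))
     {(\<lambda>\<omega>. \<omega> i) -` A \<inter> space (env_measure \<nu>) | i A. fst i \<ge> n \<and> A \<in> sets \<nu>}"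

definition Bminus :: "((int^'d::finite) \<Rightarrow> real) measure \<Rightarrow> int \<Rightarrow> 'd env measure" where
  "Bminus \<nu> n = sigma (space (env_measure \<nu>))
     {(\<lambda>\<omega>. \<omega> i) -` A \<inter> space (env_measure \<nu>) | i A. fst i \<le> n \<and> A \<in> sets \<nu>}"

definition Bbox :: "((int^'d::finite) \<Rightarrow> real) measure \<Rightarrow> nat \<Rightarrow> nat \<Rightarrow> 'd env measure" where
  "Bbox \<nu> N M = sigma (space (env_measure \<nu>))
     (sets (Bplus \<nu> (- int N)) \<inter> sets (Bminus \<nu> (int M)))"

definition qmean :: "((int^'d::finite) \<Rightarrow> real) measure \<Rightarrow> int^'d \<Rightarrow> real" where
  "qmean \<nu> z = (\<integral>p. p z \<partial>\<nu>)"

definition Lambda_c :: "((int^'d::finite) \<Rightarrow> real) measure \<Rightarrow> real^'d \<Rightarrow> real" where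
  "Lambda_c \<nu> \<theta> = ln (\<Sum>z\<in>Ustep. qmean \<nu> z * exp (\<theta> \<bullet> vecR z))"

definition xi_o :: "((int^'d::finite) \<Rightarrow> real) measure \<Rightarrow> real^'d" where
  "xi_o \<nu> = (\<Sum>z\<in>Ustep. qmean \<nu> z *\<^sub>R vecR z)"

text \<open>Walk from (0,0) with step list zs: zs!j = Z_{j+1}, position X_k.\<close>
definition pos :: "(int^'d::finite) list \<Rightarrow> nat \<Rightarrow> int^'d" where
  "pos zs k = (\<Sum>j<k. zs ! j)"

definition qpath :: "'d::finite env \<Rightarrow> (int^'d) list \<Rightarrow> real" where
  "qpath \<omega> zs = (\<Prod>j<length zs. \<omega> (int j, pos zs j) (zs ! j))"

definition steps_measure :: "(nat \<Rightarrow> int^'d::finite) measure" where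
  "steps_measure = PiM UNIV (\<lambda>_. count_space Ustep)"

text \<open>E_{0,0}[exp(<theta,X_L> - L Lambda_c(theta)) f(T_{N,X_N} omega, (Z_{N+i})_{i\<ge>1})],
 L = N+M+K+1; the step sequence after time L is irrelevant for f and is padded.\<close>
definition tilted_exp ::
  "((int^'d::finite) \<Rightarrow> real) measure \<Rightarrow> real^'d \<Rightarrow> nat \<Rightarrow> nat \<Rightarrow> nat
     \<Rightarrow> ('d env \<times> (nat \<Rightarrow> int^'d) \<Rightarrow> real) \<Rightarrow> real" where
  "tilted_exp \<nu> \<theta> N M K f =
     (let L = N + M + K + 1 in
      \<integral>\<omega>. (\<Sum>zs\<in>{zs. set zs \<subseteq> Ustep \<and> length zs = L}.
             qpath \<omega> zs * exp (\<theta> \<bullet> vecR (pos zs L) - real L * Lambda_c \<nu> \<theta>)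
             * f (shift (int N) (pos zs N) \<omega>, \<lambda>i. zs ! (N + min i (M + K)))) \<partial>env_measure \<nu>)"

definition is_barmu ::
  "((int^'d::finite) \<Rightarrow> real) measure \<Rightarrow> real^'d \<Rightarrow> ('d env \<times> (nat \<Rightarrow> int^'d)) measure \<Rightarrow> bool" where
  "is_barmu \<nu> \<theta> Mu \<longleftrightarrow>
     sets Mu = sets (env_measure \<nu> \<Otimes>\<^sub>M steps_measure) \<and>
     (\<forall>N M K f. f \<in> borel_measurable (Bbox \<nu> N M \<Otimes>\<^sub>M steps_measure)
        \<and> (\<exists>B. \<forall>x. \<bar>f x\<bar> \<le> B)
        \<and> (\<forall>\<omega> s s'. (\<forall>i<K. s i = s' i) \<longrightarrow> f (\<omega>, s) = f (\<omega>, s'))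
        \<longrightarrow> integrable Mu f \<and> (\<integral>x. f x \<partial>Mu) = tilted_exp \<nu> \<theta> N M K f)"

definition env_seq_measure :: "((int^'d::finite) \<Rightarrow> real) measure \<Rightarrow> (nat \<Rightarrow> 'd env) measure" where
  "env_seq_measure \<nu> = PiM UNIV (\<lambda>_. env_measure \<nu>)"

definition mu_inf ::
  "((int^'d::finite) \<Rightarrow> real) measure \<Rightarrow> ('d env \<times> (nat \<Rightarrow> int^'d)) measure \<Rightarrow> (nat \<Rightarrow> 'd env) measure" where
  "mu_inf \<nu> Mu = distr Mu (env_seq_measure \<nu>) (\<lambda>(\<omega>, s) n. shift (int n) (\<Sum>i<n. s i) \<omega>)"

definition pi_theta ::
  "((int^'d::finite) \<Rightarrow> real) measure \<Rightarrow> real^'d \<Rightarrow> ('d env \<Rightarrow> real) \<Rightarrow> 'd env \<Rightarrow> int^'d \<Rightarrow> real" where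
  "pi_theta \<nu> \<theta> u \<omega> z = \<omega> (0,0) z * u (shift 1 z \<omega>) / u \<omega> * exp (\<theta> \<bullet> vecR z - Lambda_c \<nu> \<theta>)"

definition tilted_kernel ::
  "((int^'d::finite) \<Rightarrow> real) measure \<Rightarrow> real^'d \<Rightarrow> ('d env \<Rightarrow> real) \<Rightarrow> 'd env \<Rightarrow> 'd env set \<Rightarrow> real" where
  "tilted_kernel \<nu> \<theta> u \<omega> B = (\<Sum>z\<in>Ustep. pi_theta \<nu> \<theta> u \<omega> z * indicator B (shift 1 z \<omega>))"

definition past :: "'a measure \<Rightarrow> nat \<Rightarrow> (nat \<Rightarrow> 'a) measure" where
  "past Om n = sigma (space (PiM UNIV (\<lambda>_. Om)))
     {(\<lambda>w. w i) -` B \<inter> space (PiM UNIV (\<lambda>_. Om)) | i B. i \<le> n \<and> B \<in> sets Om}"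

definition stationary_markov :: "'a measure \<Rightarrow> ('a \<Rightarrow> 'a set \<Rightarrow> real) \<Rightarrow> (nat \<Rightarrow> 'a) measure \<Rightarrow> bool" where
  "stationary_markov Om Kr mu \<longleftrightarrow>
     prob_space mu \<and> sets mu = sets (PiM UNIV (\<lambda>_. Om)) \<and>
     distr mu (PiM UNIV (\<lambda>_. Om)) (\<lambda>w n. w (Suc n)) = mu \<and>
     (\<forall>n A B. A \<in> sets (past Om n) \<longrightarrow> B \<in> sets Om \<longrightarrow>
        measure mu (A \<inter> {w \<in> space mu. w (Suc n) \<in> B}) = (\<integral>w. indicator A w * Kr (w n) B \<partial>mu))"

definition SMP_ac ::
  "((int^'d::finite) \<Rightarrow> real) measure \<Rightarrow> ('d env \<Rightarrow> 'd env set \<Rightarrow> real) \<Rightarrow> (nat \<Rightarrow> 'd env) measure \<Rightarrow> bool" where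
  "SMP_ac \<nu> Kr mu \<longleftrightarrow> stationary_markov (env_measure \<nu>) Kr mu \<and>
     (\<forall>n::int. absolutely_continuous (restr_to_subalg (env_measure \<nu>) (Bplus \<nu> n))
                 (restr_to_subalg (distr mu (env_measure \<nu>) (\<lambda>w. w 0)) (Bplus \<nu> n)))"

end

theory Submission
  imports Defs
begin

text \<open>For small \<open>\<theta>\<close> the partition functions \<open>u\<^sub>n(\<omega>) = E\<^sup>\<omega>[exp(\<theta> \<bullet> X\<^sub>n - n \<Lambda>(\<theta>))]\<close> form a martingale bounded in \<open>L\<^sup>2\<close>:
  their second moment counts collisions of two walks in the same environment, which are controlled in
  dimension at least three by an explicit superharmonic function. The limit \<open>u\<close> is harmonic, and a zero-one
  law for sets invariant under one space-time shift makes it positive. The tilted measure itself is explicit: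
  the two-sided path has i.i.d. steps, the environment is size-biased at the sites visited and untouched
  elsewhere. Passing to the limit in the defining formula gives the density of the environment seen from the
  walker on each half-space, hence the Markov property. For uniqueness, the set where one invariant density
  exceeds another is closed under the kernel, so it is trivial by the zero-one law; the kernel then carries
  equality of the marginals from \<open>B\<^sub>0\<^sup>+\<close> to every \<open>B\<^sub>-\<^sub>N\<^sup>+\<close>.\<close>

section \<open>Environments, walks and sigma-algebras\<close>

text \<open>The law of the environment seen from the walker has infinitely many size-biased sites in
  the past, so a density is computed only on one half-space \<open>Bplus \<nu> (- N)\<close> at a
  time, and it changes with \<open>N\<close>. What does not change is the conditional law of the
  next steps: the backward factor cancels in the ratio \<open>path_dens\<close>. Statements about
  the process are therefore reduced to initial step segments and half-spaces, and extended by
  pi-systems.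

  In the second moment argument the drift of the steps costs up to one dimension in the mean
  increase of the quadratic form adapted to them. Three dimensions minus this loss is exactly the
  critical value; uniform ellipticity supplies the strict excess. As the excess is small, only a
  small power \<open>s\<close> of the form is shown to be superharmonic, and the offset
  \<open>R\<close> makes relative increments so small that a second-order expansion is legitimate.
  The restriction to small \<theta> comes from the diagonal, where the two walkers read the same
  site, and the neighbourhood of \<open>xi_o \<nu>\<close> is the one whose conjugate tilts are that
  small.\<close>

declare split_paired_All [simp del] split_paired_Ex [simp del]

lemma Ustep_subset_box: "(z::int^'d::finite) \<in> Ustep \<Longrightarrow> \<bar>z$i\<bar> \<le> 1"
proof -
  assume "z \<in> Ustep"
  then have "(\<Sum>i\<in>UNIV. \<bar>z$i\<bar>) = 1" by (simp add: Ustep_def)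
  moreover have "\<bar>z$i\<bar> \<le> (\<Sum>i\<in>UNIV. \<bar>z$i\<bar>)" by (rule member_le_sum) auto
  ultimately show ?thesis by simp
qed

lemma finite_Ustep: "finite (Ustep :: (int^'d::finite) set)"
proof -
  have "finite (PiE (UNIV::'d set) (\<lambda>_. {-1..1::int}))" by (intro finite_PiE) auto
  then have "finite (vec_lambda ` PiE (UNIV::'d set) (\<lambda>_. {-1..1::int}))" by simp
  moreover have "(Ustep :: (int^'d) set) \<subseteq> vec_lambda ` PiE UNIV (\<lambda>_. {-1..1})"
  proof
    fix z :: "int^'d" assume "z \<in> Ustep"
    from Ustep_subset_box[OF this] have "(\<lambda>i. z$i) \<in> PiE UNIV (\<lambda>_. {-1..1})" by (auto simp: abs_le_iff minus_le_iff)
    moreover have "z = vec_lambda (\<lambda>i. z$i)" by simp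
    ultimately show "z \<in> vec_lambda ` PiE UNIV (\<lambda>_. {-1..1})" by blast
  qed
  ultimately show ?thesis by (rule finite_subset[rotated])
qed

lemma axis_in_Ustep: "axis i 1 \<in> Ustep" "axis i (-1) \<in> Ustep"
  by (simp_all add: Ustep_def axis_def if_distrib[of abs] cong: if_cong)

section \<open>Finite step lists, positions and space-time shifts\<close>

definition Ulists :: "nat \<Rightarrow> (int^'d::finite) list set" where
  "Ulists n = {zs. set zs \<subseteq> Ustep \<and> length zs = n}"

lemma finite_Ulists [simp]: "finite (Ulists n)"
  unfolding Ulists_def by (rule finite_lists_length_eq[OF finite_Ustep])

lemma Ulists_0 [simp]: "Ulists 0 = {[]}"
  by (auto simp: Ulists_def)

lemma length_Ulists: "zs \<in> Ulists n \<Longrightarrow> length zs = n"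
  by (simp add: Ulists_def)

lemma sum_Ulists_add:
  "(\<Sum>zs\<in>Ulists (m + n). f zs) = (\<Sum>xs\<in>Ulists m. \<Sum>ys\<in>Ulists n. f (xs @ ys))"
proof -
  have "(\<Sum>xs\<in>Ulists m. \<Sum>ys\<in>Ulists n. f (xs @ ys)) = (\<Sum>(xs,ys)\<in>Ulists m \<times> Ulists n. f (xs @ ys))"
    by (rule sum.cartesian_product)
  also have "\<dots> = (\<Sum>zs\<in>Ulists (m + n). f zs)"
    by (rule sum.reindex_bij_witness[of _ "\<lambda>zs. (take m zs, drop m zs)" "\<lambda>(xs,ys). xs @ ys"])
       (auto simp: Ulists_def dest: in_set_takeD in_set_dropD)
  finally show ?thesis by simp
qed

lemma sum_Ulists_1: "(\<Sum>zs\<in>Ulists (Suc 0). f zs) = (\<Sum>z\<in>Ustep. f [z])"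
  by (rule sum.reindex_bij_witness[of _ "\<lambda>z. [z]" hd]) (auto simp: Ulists_def length_Suc_conv)

lemma sum_Ulists_Suc: "(\<Sum>zs\<in>Ulists (Suc n). f zs) = (\<Sum>z\<in>Ustep. \<Sum>zs\<in>Ulists n. f (z # zs))"
  using sum_Ulists_add[of f "Suc 0" n] by (simp add: sum_Ulists_1)

lemma vecR_add: "vecR (x + y) = vecR x + vecR y"
  by (simp add: vecR_def vec_eq_iff)

lemma vecR_0 [simp]: "vecR 0 = 0"
  by (simp add: vecR_def vec_eq_iff)

lemma pos_0 [simp]: "pos zs 0 = 0"
  by (simp add: pos_def)

lemma pos_Cons_Suc: "pos (z # zs) (Suc j) = z + pos zs j"
  unfolding pos_def by (simp only: sum.lessThan_Suc_shift) simp

text \<open>The two descriptions part ways beyond the end of the list, where \<open>!\<close> is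
  unspecified and \<open>take\<close> is not; hence the bound on \<open>k\<close>.\<close>

lemma pos_eq_sum_list: "k \<le> length zs \<Longrightarrow> pos zs k = sum_list (take k zs)"
proof (induction zs arbitrary: k)
  case (Cons z zs) then show ?case by (cases k) (auto simp: pos_Cons_Suc)
qed simp

lemma shift_apply: "shift m y \<omega> (n, x) = \<omega> (n + m, x + y)"
  by (simp add: shift_def)

lemma shift_apply': "shift m y \<omega> i = \<omega> (fst i + m, snd i + y)"
  by (cases i) (simp add: shift_def)

lemma shift_shift [simp]: "shift m y (shift n x \<omega>) = shift (m + n) (x + y) \<omega>"
  by (simp add: shift_def fun_eq_iff ac_simps)

lemma shift_0 [simp]: "shift 0 0 \<omega> = \<omega>"
  by (simp add: shift_def fun_eq_iff)

section \<open>Tilted path weights and partition functions\<close>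

definition step_wt :: "((int^'d::finite) \<Rightarrow> real) measure \<Rightarrow> real^'d \<Rightarrow> int^'d \<Rightarrow> real" where
  "step_wt \<nu> \<theta> z = exp (\<theta> \<bullet> vecR z - Lambda_c \<nu> \<theta>)"

text \<open>Recursion along the environment seen from the walker rather than a product over absolute
  positions: a step always reads the origin, and cutting a path in two becomes the cocycle identity
  \<open>path_wt_append\<close>. Each step carries its own share of the exponential tilt.\<close>

primrec path_wt :: "((int^'d::finite) \<Rightarrow> real) measure \<Rightarrow> real^'d \<Rightarrow> (int^'d) list \<Rightarrow> 'd env \<Rightarrow> real" where
  "path_wt \<nu> \<theta> [] \<omega> = 1"
| "path_wt \<nu> \<theta> (z # zs) \<omega> = \<omega> (0,0) z * step_wt \<nu> \<theta> z * path_wt \<nu> \<theta> zs (shift 1 z \<omega>)"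

lemma step_wt_pos [simp]: "step_wt \<nu> \<theta> z > 0"
  by (simp add: step_wt_def)

lemma qpath_Cons: "qpath \<omega> (z # zs) = \<omega> (0,0) z * qpath (shift 1 z \<omega>) zs"
  unfolding qpath_def length_Cons
  by (subst prod.lessThan_Suc_shift) (simp add: pos_Cons_Suc shift_apply ac_simps)

text \<open>Link with the integrand of \<open>tilted_exp\<close>: the exponential of endpoint and
  length factors over the steps.\<close>

lemma path_wt_eq:
  "path_wt \<nu> \<theta> zs \<omega> = qpath \<omega> zs * exp (\<theta> \<bullet> vecR (pos zs (length zs)) - real (length zs) * Lambda_c \<nu> \<theta>)"
proof (induction zs arbitrary: \<omega>)
  case Nil then show ?case by (simp add: qpath_def)
next
  case (Cons z zs)
  show ?case
    by (simp add: Cons.IH qpath_Cons step_wt_def pos_Cons_Suc vecR_add inner_add_right exp_add exp_diff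
        distrib_right field_simps)
qed

lemma path_wt_append:
  "path_wt \<nu> \<theta> (xs @ ys) \<omega> = path_wt \<nu> \<theta> xs \<omega> * path_wt \<nu> \<theta> ys (shift (int (length xs)) (sum_list xs) \<omega>)"
  by (induction xs arbitrary: \<omega>) (simp_all add: ac_simps)

definition part_fn :: "((int^'d::finite) \<Rightarrow> real) measure \<Rightarrow> real^'d \<Rightarrow> nat \<Rightarrow> 'd env \<Rightarrow> real" where
  "part_fn \<nu> \<theta> n \<omega> = (\<Sum>zs\<in>Ulists n. path_wt \<nu> \<theta> zs \<omega>)"

lemma part_fn_0 [simp]: "part_fn \<nu> \<theta> 0 \<omega> = 1"
  by (simp add: part_fn_def)

text \<open>Markov property of the quenched walk at time \<open>m\<close>: after the first block the
  walk restarts in the environment seen from its endpoint.\<close>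

lemma part_fn_add:
  "part_fn \<nu> \<theta> (m + n) \<omega> = (\<Sum>zs\<in>Ulists m. path_wt \<nu> \<theta> zs \<omega> * part_fn \<nu> \<theta> n (shift (int m) (sum_list zs) \<omega>))"
  unfolding part_fn_def sum_Ulists_add sum_distrib_left
  by (intro sum.cong refl) (auto simp: path_wt_append length_Ulists)

lemma part_fn_Suc:
  "part_fn \<nu> \<theta> (Suc n) \<omega> = (\<Sum>z\<in>Ustep. \<omega> (0,0) z * step_wt \<nu> \<theta> z * part_fn \<nu> \<theta> n (shift 1 z \<omega>))"
  using part_fn_add[of \<nu> \<theta> "Suc 0" n \<omega>] by (simp add: sum_Ulists_1)

section \<open>Sigma-algebras generated by the sites of a space-time set: half-spaces, boxes, single
  sites\<close>

definition Bidx :: "((int^'d::finite) \<Rightarrow> real) measure \<Rightarrow> (int \<times> (int^'d)) set \<Rightarrow> 'd env measure" where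
  "Bidx \<nu> I = sigma (space (env_measure \<nu>))
     {(\<lambda>\<omega>. \<omega> i) -` A \<inter> space (env_measure \<nu>) | i A. i \<in> I \<and> A \<in> sets \<nu>}"

lemma Bplus_eq: "Bplus \<nu> n = Bidx \<nu> {i. n \<le> fst i}"
  by (simp add: Bplus_def Bidx_def)

lemma Bminus_eq: "Bminus \<nu> n = Bidx \<nu> {i. fst i \<le> n}"
  by (simp add: Bminus_def Bidx_def)

lemma space_env_measure: "space (env_measure \<nu>) = (UNIV \<rightarrow>\<^sub>E space \<nu>)"
  by (simp add: env_measure_def space_PiM)

lemma space_env_measure_iff: "\<omega> \<in> space (env_measure \<nu>) \<longleftrightarrow> (\<forall>i. \<omega> i \<in> space \<nu>)"
  by (auto simp: space_env_measure PiE_iff)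

lemma space_Bidx [simp]: "space (Bidx \<nu> I) = space (env_measure \<nu>)"
  unfolding Bidx_def by (auto intro!: space_measure_of)

lemma sets_Bidx:
  "sets (Bidx \<nu> I) = sigma_sets (space (env_measure \<nu>))
     {(\<lambda>\<omega>. \<omega> i) -` A \<inter> space (env_measure \<nu>) | i A. i \<in> I \<and> A \<in> sets \<nu>}"
  unfolding Bidx_def by (rule sets_measure_of) auto

lemma measurable_Bidx_component: "i \<in> I \<Longrightarrow> (\<lambda>\<omega>. \<omega> i) \<in> Bidx \<nu> I \<rightarrow>\<^sub>M \<nu>"
  by (rule measurableI) (auto simp: space_env_measure_iff sets_Bidx)

lemma measurable_BidxI:
  assumes "\<And>x. x \<in> space N \<Longrightarrow> f x \<in> space (env_measure \<nu>)" "\<And>i. i \<in> I \<Longrightarrow> (\<lambda>x. f x i) \<in> N \<rightarrow>\<^sub>M \<nu>"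
  shows "f \<in> N \<rightarrow>\<^sub>M Bidx \<nu> I"
proof (rule measurable_sigma_sets[OF sets_Bidx])
  show "f \<in> space N \<rightarrow> space (env_measure \<nu>)" using assms(1) by auto
next
  fix y assume "y \<in> {(\<lambda>\<omega>. \<omega> i) -` A \<inter> space (env_measure \<nu>) |i A. i \<in> I \<and> A \<in> sets \<nu>}"
  then obtain i A where y: "y = (\<lambda>\<omega>. \<omega> i) -` A \<inter> space (env_measure \<nu>)" "i \<in> I" "A \<in> sets \<nu>" by blast
  have "f -` y \<inter> space N = (\<lambda>x. f x i) -` A \<inter> space N" using y(1) assms(1) by auto
  then show "f -` y \<inter> space N \<in> sets N" using measurable_sets[OF assms(2)[OF y(2)] y(3)] by simp
qed auto

lemma sets_eq_if_measurable_id: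
  assumes "(\<lambda>x. x) \<in> M \<rightarrow>\<^sub>M N" "space M = space N"
  shows "sets N \<subseteq> sets M"
proof
  fix A assume A: "A \<in> sets N"
  then have "A \<inter> space M = A" using sets.sets_into_space[OF A] assms(2) by auto
  then show "A \<in> sets M" using measurable_sets[OF assms(1) A] by simp
qed

lemma sets_Bidx_UNIV: "sets (Bidx \<nu> UNIV) = sets (env_measure \<nu>)"
proof (rule antisym)
  have "(\<lambda>x. x) \<in> env_measure \<nu> \<rightarrow>\<^sub>M Bidx \<nu> UNIV"
    by (rule measurable_BidxI) (auto simp: env_measure_def)
  then show "sets (Bidx \<nu> UNIV) \<subseteq> sets (env_measure \<nu>)"
    by (rule sets_eq_if_measurable_id) simp
  have "(\<lambda>x. x) \<in> Bidx \<nu> UNIV \<rightarrow>\<^sub>M env_measure \<nu>"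
    unfolding env_measure_def
    by (rule measurable_PiM_single') (auto simp: measurable_Bidx_component space_env_measure)
  then show "sets (env_measure \<nu>) \<subseteq> sets (Bidx \<nu> UNIV)"
    by (rule sets_eq_if_measurable_id) simp
qed

lemma sets_Bidx_mono: "I \<subseteq> J \<Longrightarrow> sets (Bidx \<nu> I) \<subseteq> sets (Bidx \<nu> J)"
  unfolding sets_Bidx by (rule sigma_sets_mono') auto

lemma subalgebra_Bidx: "subalgebra (env_measure \<nu>) (Bidx \<nu> I)"
  using sets_Bidx_mono[of I UNIV \<nu>] by (simp add: subalgebra_def sets_Bidx_UNIV)

lemma subalgebra_Bidx_mono: "I \<subseteq> J \<Longrightarrow> subalgebra (Bidx \<nu> J) (Bidx \<nu> I)"
  using sets_Bidx_mono[of I J \<nu>] by (simp add: subalgebra_def)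

lemma measurable_Bidx_mono: "f \<in> Bidx \<nu> I \<rightarrow>\<^sub>M N \<Longrightarrow> I \<subseteq> J \<Longrightarrow> f \<in> Bidx \<nu> J \<rightarrow>\<^sub>M N"
  by (rule measurable_from_subalg[OF subalgebra_Bidx_mono])

lemma measurable_Bidx_env: "f \<in> Bidx \<nu> I \<rightarrow>\<^sub>M N \<Longrightarrow> f \<in> env_measure \<nu> \<rightarrow>\<^sub>M N"
  by (rule measurable_from_subalg[OF subalgebra_Bidx])

text \<open>Turns measurability into literal dependence on the coordinates in \<open>I\<close>;
  agreement is preserved by complements and countable unions.\<close>

lemma Bidx_agree:
  assumes "A \<in> sets (Bidx \<nu> I)" "\<omega> \<in> space (env_measure \<nu>)" "\<omega>' \<in> space (env_measure \<nu>)" "\<And>i. i \<in> I \<Longrightarrow> \<omega> i = \<omega>' i"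
  shows "\<omega> \<in> A \<longleftrightarrow> \<omega>' \<in> A"
  using assms(1) unfolding sets_Bidx
proof (induction rule: sigma_sets.induct)
  case (Basic a) then show ?case using assms(2-4) by auto
qed (use assms in auto)

lemma shift_in_space: "\<omega> \<in> space (env_measure \<nu>) \<Longrightarrow> shift m y \<omega> \<in> space (env_measure \<nu>)"
  by (simp add: space_env_measure_iff shift_apply')

lemma measurable_shift:
  assumes "\<And>i. i \<in> I \<Longrightarrow> (fst i + m, snd i + y) \<in> J"
  shows "shift m y \<in> Bidx \<nu> J \<rightarrow>\<^sub>M Bidx \<nu> I"
  by (rule measurable_BidxI) (auto simp: shift_in_space shift_apply' intro!: measurable_Bidx_component assms)

lemma measurable_shift_env [measurable]: "shift m y \<in> env_measure \<nu> \<rightarrow>\<^sub>M env_measure \<nu>"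
  using measurable_shift[of UNIV m y UNIV \<nu>] by (simp cong: measurable_cong_sets add: sets_Bidx_UNIV)

lemma sets_Bbox:
  assumes "space \<nu> \<noteq> {}"
  shows "sets (Bbox \<nu> N M) = sets (Bidx \<nu> {i. - int N \<le> fst i \<and> fst i \<le> int M})" (is "_ = sets (Bidx \<nu> ?I)")
proof -
  from assms obtain p where p: "p \<in> space \<nu>" by auto
  have "sets (Bplus \<nu> (- int N)) \<inter> sets (Bminus \<nu> (int M)) = sets (Bidx \<nu> ?I)"
  proof (intro antisym subsetI)
    fix A assume A: "A \<in> sets (Bplus \<nu> (- int N)) \<inter> sets (Bminus \<nu> (int M))"
    define r where "r \<omega> = (\<lambda>i. if fst i \<le> int M then \<omega> i else p)" for \<omega> :: "'a env"
    have rs: "r \<omega> \<in> space (env_measure \<nu>)" if "\<omega> \<in> space (env_measure \<nu>)" for \<omega>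
      using that p by (auto simp: space_env_measure_iff r_def)
    have "r \<in> Bidx \<nu> ?I \<rightarrow>\<^sub>M Bidx \<nu> {i. - int N \<le> fst i}"
    proof (rule measurable_BidxI)
      fix i :: "int \<times> (int^'a)" assume "i \<in> {i. - int N \<le> fst i}"
      then show "(\<lambda>x. r x i) \<in> Bidx \<nu> ?I \<rightarrow>\<^sub>M \<nu>"
        by (cases "fst i \<le> int M") (auto simp: r_def p intro!: measurable_Bidx_component)
    qed (use rs in auto)
    then have "r -` A \<inter> space (env_measure \<nu>) \<in> sets (Bidx \<nu> ?I)"
      using A measurable_sets[of r "Bidx \<nu> ?I" "Bidx \<nu> {i. - int N \<le> fst i}" A] by (simp add: Bplus_eq)
    moreover have "r -` A \<inter> space (env_measure \<nu>) = A"
    proof -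
      have "r \<omega> \<in> A \<longleftrightarrow> \<omega> \<in> A" if "\<omega> \<in> space (env_measure \<nu>)" for \<omega>
        by (rule Bidx_agree[of A \<nu> "{i. fst i \<le> int M}"]) (use A rs that in \<open>simp_all add: Bminus_eq r_def\<close>)
      moreover have "A \<subseteq> space (env_measure \<nu>)"
        using A sets.sets_into_space[of A "Bplus \<nu> (- int N)"] by (auto simp: Bplus_eq)
      ultimately show ?thesis by auto
    qed
    ultimately show "A \<in> sets (Bidx \<nu> ?I)" by simp
  next
    fix A assume "A \<in> sets (Bidx \<nu> ?I)"
    then show "A \<in> sets (Bplus \<nu> (- int N)) \<inter> sets (Bminus \<nu> (int M))"
      unfolding Bplus_eq Bminus_eq
      using sets_Bidx_mono[of ?I "{i. - int N \<le> fst i}" \<nu>] sets_Bidx_mono[of ?I "{i. fst i \<le> int M}" \<nu>] by blast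
  qed
  then have "sets (Bbox \<nu> N M) = sigma_sets (space (Bidx \<nu> ?I)) (sets (Bidx \<nu> ?I))"
    unfolding Bbox_def using sets.space_closed[of "Bidx \<nu> ?I"] by (simp del: sets.sigma_sets_eq)
  then show ?thesis by (simp only: sets.sigma_sets_eq)
qed

lemma indep_vars_PiM_UNIV:
  assumes "\<And>i. prob_space (M i)"
  shows "prob_space.indep_vars (PiM UNIV M) M (\<lambda>i \<omega>. \<omega> i) UNIV"
proof -
  interpret product_prob_space M UNIV
    using assms by (intro product_prob_spaceI) auto
  have "distr (PiM UNIV M) (PiM UNIV M) (\<lambda>x. \<lambda>i\<in>UNIV. x i) = PiM UNIV (\<lambda>i. distr (PiM UNIV M) (M i) (\<lambda>\<omega>. \<omega> i))"
    using distr_id2[of "PiM UNIV M" "PiM UNIV M"] by (simp add: PiM_component restrict_UNIV)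
  then show ?thesis by (subst indep_vars_iff_distr_eq_PiM) auto
qed

section \<open>The i.i.d. environment: stationarity, ellipticity and independence\<close>

locale rwre =
  fixes \<nu> :: "((int^'d::finite) \<Rightarrow> real) measure" and c1 :: real
  assumes prob_nu: "prob_space \<nu>"
    and sets_nu: "sets \<nu> = sets (PiM Ustep (\<lambda>_. borel))"
    and c1_pos: "c1 > 0"
    and elliptic: "AE p in \<nu>. (\<forall>z\<in>Ustep. p z \<ge> c1) \<and> (\<Sum>z\<in>Ustep. p z) = 1"
begin

abbreviation "\<P> \<equiv> env_measure \<nu>"

sublocale nu: prob_space \<nu> by (rule prob_nu)
sublocale PP: product_prob_space "\<lambda>_. \<nu>" UNIV ..
sublocale P: prob_space \<P>
  unfolding env_measure_def by (rule prob_space_PiM) (rule prob_nu)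

lemma space_nu_ne: "space \<nu> \<noteq> {}" by (rule nu.not_empty)

lemma measurable_weight [measurable]: "z \<in> Ustep \<Longrightarrow> (\<lambda>p. p z) \<in> borel_measurable \<nu>"
  using measurable_component_singleton[of z Ustep "\<lambda>_. borel"] measurable_cong_sets[OF sets_nu refl] by blast

lemma measurable_weight_Bidx: "z \<in> Ustep \<Longrightarrow> i \<in> I \<Longrightarrow> (\<lambda>\<omega>. \<omega> i z) \<in> borel_measurable (Bidx \<nu> I)"
  using measurable_compose[OF measurable_Bidx_component measurable_weight] by blast

lemma measurable_path_wt:
  "zs \<in> Ulists n \<Longrightarrow> path_wt \<nu> \<theta> zs \<in> borel_measurable (Bidx \<nu> {i. 0 \<le> fst i \<and> fst i < int n})"
proof (induction zs arbitrary: n)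
  case Nil then show ?case by simp
next
  case (Cons z zs)
  then obtain m where m: "n = Suc m" "zs \<in> Ulists m" "z \<in> Ustep" by (auto simp: Ulists_def)
  have "(\<lambda>\<omega>. path_wt \<nu> \<theta> zs (shift 1 z \<omega>)) \<in> borel_measurable (Bidx \<nu> {i. 0 \<le> fst i \<and> fst i < int n})"
    by (rule measurable_compose[OF measurable_shift Cons.IH[OF m(2)]]) (auto simp: m(1))
  then show ?case using m by (auto intro!: borel_measurable_times measurable_weight_Bidx)
qed

lemma measurable_part_fn: "part_fn \<nu> \<theta> n \<in> borel_measurable (Bidx \<nu> {i. 0 \<le> fst i \<and> fst i < int n})"
  unfolding part_fn_def[abs_def] by (intro borel_measurable_sum measurable_path_wt)

lemma measurable_path_wt_env [measurable]: "zs \<in> Ulists n \<Longrightarrow> path_wt \<nu> \<theta> zs \<in> borel_measurable \<P>"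
  using measurable_path_wt by (rule measurable_Bidx_env)

lemma measurable_part_fn_env [measurable]: "part_fn \<nu> \<theta> n \<in> borel_measurable \<P>"
  using measurable_part_fn by (rule measurable_Bidx_env)

lemma distr_shift: "distr \<P> \<P> (shift m y) = \<P>"
proof -
  let ?f = "\<lambda>i::int \<times> (int^'d). (fst i + m, snd i + y)"
  have "distr (PiM UNIV (\<lambda>_. \<nu>)) (PiM UNIV (\<lambda>_. \<nu>)) (\<lambda>\<omega>. \<lambda>n\<in>UNIV. \<omega> (?f n)) = PiM UNIV (\<lambda>_. \<nu>)"
    by (rule distr_PiM_reindex) (auto simp: inj_on_def prob_nu)
  moreover have "(\<lambda>\<omega>. \<lambda>n\<in>UNIV. \<omega> (?f n)) = (shift m y :: 'd env \<Rightarrow> 'd env)"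
    by (auto simp: fun_eq_iff shift_def)
  ultimately show ?thesis by (simp add: env_measure_def)
qed

lemma integral_shift: "f \<in> borel_measurable \<P> \<Longrightarrow> (\<integral>\<omega>. f (shift m y \<omega>) \<partial>\<P>) = (\<integral>\<omega>. (f \<omega> :: real) \<partial>\<P>)"
  using integral_distr[OF measurable_shift_env, of f \<nu> m y] by (simp add: distr_shift)

lemma integrable_shift: "integrable \<P> (f :: _ \<Rightarrow> real) \<Longrightarrow> integrable \<P> (\<lambda>\<omega>. f (shift m y \<omega>))"
  using integrable_distr[OF measurable_shift_env, of \<nu> m y f] by (simp add: distr_shift)

lemma AE_shift: "AE \<omega> in \<P>. Q \<omega> \<Longrightarrow> AE \<omega> in \<P>. Q (shift m y \<omega>)"
  using AE_distrD[OF measurable_shift_env[of m y \<nu>], of Q] unfolding distr_shift .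

text \<open>Ellipticity and normalization at all sites at once. There are countably many sites, so
  this is almost sure, and it is stable under every shift; pointwise estimates made on it need no
  further exceptional sets.\<close>

definition good :: "'d env \<Rightarrow> bool" where
  "good \<omega> \<longleftrightarrow> (\<forall>i. (\<forall>z\<in>Ustep. \<omega> i z \<ge> c1) \<and> (\<Sum>z\<in>Ustep. \<omega> i z) = 1)"

lemma AE_good: "AE \<omega> in \<P>. good \<omega>"
proof -
  have "AE \<omega> in \<P>. (\<forall>z\<in>Ustep. \<omega> i z \<ge> c1) \<and> (\<Sum>z\<in>Ustep. \<omega> i z) = 1" for i
    unfolding env_measure_def using elliptic by (intro PP.AE_component) auto
  then show ?thesis unfolding good_def by (rule AE_all_countable[THEN iffD2, OF allI])
qed

lemma good_shift: "good \<omega> \<Longrightarrow> good (shift m y \<omega>)"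
  by (simp add: good_def shift_apply')

lemma good_bounds: "good \<omega> \<Longrightarrow> z \<in> Ustep \<Longrightarrow> c1 \<le> \<omega> i z" "good \<omega> \<Longrightarrow> z \<in> Ustep \<Longrightarrow> \<omega> i z \<le> 1"
proof -
  assume a: "good \<omega>" "z \<in> Ustep"
  then show "c1 \<le> \<omega> i z" by (simp add: good_def)
  have "\<omega> i z \<le> (\<Sum>z\<in>Ustep. \<omega> i z)"
    using a c1_pos by (intro member_le_sum) (auto simp: finite_Ustep good_def intro: order_trans less_imp_le)
  then show "\<omega> i z \<le> 1" using a by (simp add: good_def)
qed

lemma good_pos: "good \<omega> \<Longrightarrow> z \<in> Ustep \<Longrightarrow> 0 < \<omega> i z"
  using good_bounds(1)[of \<omega> z i] c1_pos by simp

lemma path_wt_bounds: "good \<omega> \<Longrightarrow> zs \<in> Ulists n \<Longrightarrow> 0 < path_wt \<nu> \<theta> zs \<omega> \<and> path_wt \<nu> \<theta> zs \<omega> \<le> prod_list (map (step_wt \<nu> \<theta>) zs)"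
proof (induction zs arbitrary: \<omega> n)
  case (Cons z zs)
  then have z: "z \<in> Ustep" "zs \<in> Ulists (length zs)" by (auto simp: Ulists_def)
  note IH = Cons.IH[OF good_shift[OF Cons.prems(1)] z(2), of 1 z]
  have w: "0 < \<omega> (0,0) z" "\<omega> (0,0) z \<le> 1" using good_pos good_bounds(2) Cons.prems(1) z(1) by blast+
  have "\<omega> (0,0) z * step_wt \<nu> \<theta> z * path_wt \<nu> \<theta> zs (shift 1 z \<omega>) \<le> 1 * step_wt \<nu> \<theta> z * prod_list (map (step_wt \<nu> \<theta>) zs)"
    using w IH by (intro mult_mono) (auto intro: less_imp_le)
  then show ?case using IH w by auto
qed simp

lemma part_fn_pos: "good \<omega> \<Longrightarrow> 0 < part_fn \<nu> \<theta> n \<omega>"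
proof -
  assume g: "good \<omega>"
  have "replicate n (axis undefined 1) \<in> (Ulists n :: (int^'d) list set)"
    by (auto simp: Ulists_def axis_in_Ustep)
  then show ?thesis unfolding part_fn_def
    using path_wt_bounds[OF g] by (intro sum_pos) auto
qed

text \<open>Each transition probability is replaced by 1. The resulting bound is deterministic but
  makes no claim of uniformity in \<open>n\<close>; it serves integrability and estimates at a fixed
  path length.\<close>

definition path_bd :: "real^'d \<Rightarrow> nat \<Rightarrow> real" where
  "path_bd \<theta> n = (\<Sum>zs\<in>Ulists n. prod_list (map (step_wt \<nu> \<theta>) zs))"

lemma prod_list_step_wt_pos: "0 < prod_list (map (step_wt \<nu> \<theta>) zs)"
  by (induction zs) auto

lemma path_bd_nonneg: "0 \<le> path_bd \<theta> n"
  unfolding path_bd_def by (intro sum_nonneg less_imp_le prod_list_step_wt_pos)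

lemma part_fn_le: "good \<omega> \<Longrightarrow> part_fn \<nu> \<theta> n \<omega> \<le> path_bd \<theta> n"
  unfolding part_fn_def path_bd_def using path_wt_bounds by (intro sum_mono) auto

lemma path_wt_le: "good \<omega> \<Longrightarrow> zs \<in> Ulists n \<Longrightarrow> path_wt \<nu> \<theta> zs \<omega> \<le> path_bd \<theta> n"
  unfolding path_bd_def using path_wt_bounds[of \<omega> zs n \<theta>] prod_list_step_wt_pos
  by (meson finite_Ulists member_le_sum order_trans less_imp_le)

lemma AE_abs_part_fn: "AE \<omega> in \<P>. \<bar>part_fn \<nu> \<theta> n \<omega>\<bar> \<le> path_bd \<theta> n"
  using AE_good
proof eventually_elim
  case (elim \<omega>)
  then show ?case using part_fn_pos[OF elim, of \<theta> n] part_fn_le[OF elim, of \<theta> n] by simp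
qed

lemma AE_abs_path_wt: "zs \<in> Ulists n \<Longrightarrow> AE \<omega> in \<P>. \<bar>path_wt \<nu> \<theta> zs \<omega>\<bar> \<le> path_bd \<theta> n"
  using AE_good
proof eventually_elim
  case (elim \<omega>)
  then show ?case using path_wt_bounds[OF elim(2,1), of \<theta>] path_wt_le[OF elim(2,1), of \<theta>] by simp
qed

lemma integrable_bounded: "f \<in> borel_measurable \<P> \<Longrightarrow> AE \<omega> in \<P>. \<bar>f \<omega>\<bar> \<le> B \<Longrightarrow> integrable \<P> (f :: _ \<Rightarrow> real)"
  by (rule P.integrable_const_bound[where B=B]) auto

lemma integrable_mult_bounded:
  assumes "integrable \<P> (g :: _ \<Rightarrow> real)" "f \<in> borel_measurable \<P>" "AE \<omega> in \<P>. \<bar>f \<omega>\<bar> \<le> B"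
  shows "integrable \<P> (\<lambda>\<omega>. f \<omega> * g \<omega>)"
proof (rule Bochner_Integration.integrable_bound)
  show "integrable \<P> (\<lambda>\<omega>. B * \<bar>g \<omega>\<bar>)" using assms by auto
  show "(\<lambda>\<omega>. f \<omega> * g \<omega>) \<in> borel_measurable \<P>" using assms by measurable
  show "AE \<omega> in \<P>. norm (f \<omega> * g \<omega>) \<le> norm (B * \<bar>g \<omega>\<bar>)"
    using assms(3) by eventually_elim (auto simp: abs_mult intro!: mult_right_mono)
qed

text \<open>Grouping of independent coordinates into two blocks: the generators at a site are closed
  under intersection, so independence passes to the sigma-algebras they generate. The Boolean index
  of \<open>case_bool\<close> encodes the pair of blocks.\<close>

lemma indep_Bidx:
  assumes "I \<inter> J = {}"
  shows "P.indep_set (sets (Bidx \<nu> I)) (sets (Bidx \<nu> J))"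
proof -
  have ind: "P.indep_vars (\<lambda>_. \<nu>) (\<lambda>i \<omega>. \<omega> i) UNIV"
    unfolding env_measure_def by (rule indep_vars_PiM_UNIV) (rule prob_nu)
  let ?E = "\<lambda>i. {(\<lambda>\<omega>. \<omega> i) -` A \<inter> space \<P> |A. A \<in> sets \<nu>}"
  have "P.indep_sets ?E UNIV" using ind unfolding P.indep_vars_def2 by simp
  then have "P.indep_sets ?E (\<Union>j\<in>UNIV. case_bool I J j)" by (rule P.indep_sets_mono_index[rotated]) simp
  then have "P.indep_sets (\<lambda>j. sigma_sets (space \<P>) (\<Union>i\<in>case_bool I J j. ?E i)) UNIV"
  proof (rule P.indep_sets_collect_sigma)
    fix i j show "Int_stable (?E i)"
    proof (rule Int_stableI)
      fix a b assume "a \<in> ?E i" "b \<in> ?E i"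
      then obtain A B where "a = (\<lambda>\<omega>. \<omega> i) -` A \<inter> space \<P>" "b = (\<lambda>\<omega>. \<omega> i) -` B \<inter> space \<P>" "A \<in> sets \<nu>" "B \<in> sets \<nu>" by blast
      then have "a \<inter> b = (\<lambda>\<omega>. \<omega> i) -` (A \<inter> B) \<inter> space \<P>" "A \<inter> B \<in> sets \<nu>" by auto
      then show "a \<inter> b \<in> ?E i" by blast
    qed
  next
    show "disjoint_family_on (case_bool I J) UNIV"
      using assms by (auto simp: disjoint_family_on_def split: bool.splits)
  qed
  moreover have "sigma_sets (space \<P>) (\<Union>i\<in>K. ?E i) = sets (Bidx \<nu> K)" for K
  proof -
    have "(\<Union>i\<in>K. ?E i) = {(\<lambda>\<omega>. \<omega> i) -` A \<inter> space \<P> | i A. i \<in> K \<and> A \<in> sets \<nu>}" by auto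
    then show ?thesis by (simp add: sets_Bidx)
  qed
  ultimately have "P.indep_sets (\<lambda>j. sets (Bidx \<nu> (case_bool I J j))) UNIV" by simp
  moreover have "(\<lambda>j. sets (Bidx \<nu> (case_bool I J j))) = case_bool (sets (Bidx \<nu> I)) (sets (Bidx \<nu> J))"
    by (auto simp: fun_eq_iff split: bool.split)
  ultimately show ?thesis unfolding P.indep_set_def by (simp only:)
qed

text \<open>The form in which independence is used: factors that read disjoint sets of sites,
  typically the present time slice and the later ones, can be integrated separately.\<close>

lemma integral_mult_indep:
  fixes f g :: "'d env \<Rightarrow> real"
  assumes "f \<in> borel_measurable (Bidx \<nu> I)" "g \<in> borel_measurable (Bidx \<nu> J)" "I \<inter> J = {}"
    "integrable \<P> f" "integrable \<P> g"
  shows "(\<integral>\<omega>. f \<omega> * g \<omega> \<partial>\<P>) = (\<integral>\<omega>. f \<omega> \<partial>\<P>) * (\<integral>\<omega>. g \<omega> \<partial>\<P>)"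
proof -
  have "P.indep_var borel f borel g"
    unfolding P.indep_var_eq
  proof (intro conjI)
    show "P.random_variable borel f" "P.random_variable borel g"
      using assms(1,2) by (auto intro: measurable_Bidx_env)
    have *: "sigma_sets (space \<P>) {h -` A \<inter> space \<P> |A. A \<in> sets borel} \<subseteq> sets (Bidx \<nu> K)"
      if "h \<in> borel_measurable (Bidx \<nu> K)" for h :: "'d env \<Rightarrow> real" and K
      using sets.sigma_sets_subset[of "{h -` A \<inter> space \<P> |A. A \<in> sets borel}" "Bidx \<nu> K"] measurable_sets[OF that]
      by (auto simp: )
    show "P.indep_set (sigma_sets (space \<P>) {f -` A \<inter> space \<P> |A. A \<in> sets borel})
     (sigma_sets (space \<P>) {g -` A \<inter> space \<P> |A. A \<in> sets borel})"
      using indep_Bidx[OF assms(3)]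
      unfolding P.indep_set_def
      by (rule P.indep_sets_mono_sets) (use *[OF assms(1)] *[OF assms(2)] in \<open>simp split: bool.split\<close>)
  qed
  from P.indep_var_lebesgue_integral[OF this assms(4,5)] show ?thesis .
qed

end

section \<open>A superharmonic function for the difference walk\<close>

text \<open>The second Taylor coefficient of the left side at 0 is \<open>s * (s + 1) / 2\<close>,
  which is below \<open>s * (1/2 + \<beta>)\<close> for small \<open>s\<close>; the remaining room
  absorbs the higher orders on a short interval. The difference of the two sides is convex there
  with value and slope 0 at the origin.\<close>

lemma powr_minus_le_quadratic:
  fixes \<beta> :: real
  assumes "\<beta> > 0"
  obtains s \<epsilon> where "0 < s" "0 < \<epsilon>" "\<epsilon> \<le> 1/2"
    "\<And>\<tau>. \<bar>\<tau>\<bar> \<le> \<epsilon> \<Longrightarrow> (1 + \<tau>) powr (-s) \<le> 1 - s * \<tau> + s * (1/2 + \<beta>) * \<tau>\<^sup>2"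
proof -
  define b where "b = min \<beta> 1"
  have b: "0 < b" "b \<le> 1" "b \<le> \<beta>" using assms by (auto simp: b_def)
  define s where "s = b / 2"
  \<comment> \<open>Bernoulli's inequality gives
    \<open>(1 - \<epsilon>) ^ 3 \<ge> 1 - b / 4\<close>, and
    \<open>(1 + b / 2) * (1 - b / 4) \<ge> 1\<close> for \<open>b \<le> 2\<close>. Together with
    \<open>1 + s = 1 + b / 2\<close> this keeps the second derivative nonnegative.\<close>
  define \<epsilon> where "\<epsilon> = b / 12"
  have s: "0 < s" "s \<le> 1" and e: "0 < \<epsilon>" "\<epsilon> \<le> 1/2" using b by (auto simp: s_def \<epsilon>_def)
  have key: "(1 + \<tau>) powr (-s - 2) \<le> 1 + b/2" if t: "\<tau> \<in> {-\<epsilon>..\<epsilon>}" for \<tau>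
  proof -
    have t1: "0 < 1 + \<tau>" "1 - \<epsilon> \<le> 1 + \<tau>" using t e by auto
    have e0: "0 < 1 - \<epsilon>" "1 - \<epsilon> \<le> 1" using e by auto
    have "(1 + \<tau>) powr (-s - 2) \<le> (1 - \<epsilon>) powr (-s - 2)"
      using s t1 e0 by (intro powr_mono2') auto
    also have "\<dots> \<le> (1 - \<epsilon>) powr (-3)" using e0 s by (intro powr_mono') auto
    also have "\<dots> = 1 / (1 - \<epsilon>) ^ 3" using e0 by (simp add: powr_minus powr_numeral divide_inverse)
    also have "\<dots> \<le> 1 + b / 2"
    proof -
      have "1 + of_nat 3 * (-\<epsilon>) \<le> (1 + (-\<epsilon>)) ^ 3" by (rule Bernoulli_inequality) (use e in auto)
      then have "1 - 3 * \<epsilon> \<le> (1 - \<epsilon>) ^ 3" by simp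
      then have "(1 + b / 2) * (1 - 3 * \<epsilon>) \<le> (1 + b / 2) * (1 - \<epsilon>) ^ 3" using b by (intro mult_left_mono) auto
      moreover have "1 \<le> (1 + b / 2) * (1 - 3 * \<epsilon>)"
      proof -
        have "b * b \<le> b * 2" using b by (intro mult_left_mono) auto
        then show ?thesis using b by (simp add: \<epsilon>_def field_simps)
      qed
      ultimately have "1 \<le> (1 + b / 2) * (1 - \<epsilon>) ^ 3" by linarith
      then show ?thesis using e0 by (simp add: pos_divide_le_eq)
    qed
    finally show ?thesis .
  qed
  have main: "(1 + \<tau>) powr (-s) \<le> 1 - s * \<tau> + s * (1/2 + \<beta>) * \<tau>\<^sup>2" if t: "\<bar>\<tau>\<bar> \<le> \<epsilon>" for \<tau>
  proof -
    define g where "g \<tau> = 1 - s * \<tau> + s * (1/2 + \<beta>) * \<tau>\<^sup>2 - (1 + \<tau>) powr (-s)" for \<tau>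
    define g' where "g' \<tau> = - s + s * (1 + 2 * \<beta>) * \<tau> + s * (1 + \<tau>) powr (-s - 1)" for \<tau>
    define g'' where "g'' \<tau> = s * (1 + 2 * \<beta>) - s * (s + 1) * (1 + \<tau>) powr (-s - 2)" for \<tau>
    have p: "0 < 1 + \<tau>" if "\<tau> \<in> {-\<epsilon>..\<epsilon>}" for \<tau> using that e by auto
    have d1: "(g has_real_derivative g' \<tau>) (at \<tau>)" if "\<tau> \<in> {-\<epsilon>..\<epsilon>}" for \<tau>
      unfolding g_def[abs_def] g'_def using p[OF that]
      by (auto intro!: derivative_eq_intros simp: field_simps)
    have d2: "(g' has_real_derivative g'' \<tau>) (at \<tau>)" if "\<tau> \<in> {-\<epsilon>..\<epsilon>}" for \<tau>
      unfolding g'_def[abs_def] g''_def using p[OF that]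
      by (auto intro!: derivative_eq_intros simp: field_simps)
    have d3: "0 \<le> g'' \<tau>" if "\<tau> \<in> {-\<epsilon>..\<epsilon>}" for \<tau>
    proof -
      have "(s + 1) * (1 + \<tau>) powr (-s - 2) \<le> (1 + b/2) * (1 + b/2)"
        using key[OF that] s b by (intro mult_mono) (auto simp: s_def)
      also have "\<dots> \<le> 1 + 2 * b"
      proof -
        have "b * b \<le> b * 4" using b by (intro mult_left_mono) auto
        then show ?thesis by (simp add: field_simps)
      qed
      also have "\<dots> \<le> 1 + 2 * \<beta>" using b by simp
      finally have "s * ((s + 1) * (1 + \<tau>) powr (-s - 2)) \<le> s * (1 + 2 * \<beta>)" using s by (intro mult_left_mono) auto
      then show ?thesis by (simp add: g''_def mult.assoc)
    qed
    have "convex_on {-\<epsilon>..\<epsilon>} g" by (rule f''_ge0_imp_convex[OF _ d1 d2 d3]) auto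
    then have "g \<tau> - g 0 \<ge> g' 0 * (\<tau> - 0)"
      by (rule convex_on_imp_above_tangent)
         (use t e in \<open>auto intro!: has_field_derivative_at_within d1 connected_Icc\<close>)
    moreover have "g 0 = 0" "g' 0 = 0" by (simp_all add: g_def g'_def)
    ultimately have "0 \<le> g \<tau>" by simp
    then show ?thesis by (simp add: g_def)
  qed
  show ?thesis by (rule that[OF s(1) e main])
qed

lemma Ustep_eq: "(Ustep :: (int^'d::finite) set) = (\<Union>i. {axis i 1, axis i (-1)})"
proof (intro antisym subsetI)
  fix z :: "int^'d" assume z: "z \<in> Ustep"
  then have s: "(\<Sum>i\<in>UNIV. \<bar>z$i\<bar>) = 1" by (simp add: Ustep_def)
  then obtain i where i: "z $ i \<noteq> 0" by (metis abs_zero sum.neutral zero_neq_one)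
  have "(\<Sum>i\<in>UNIV. \<bar>z$i\<bar>) = \<bar>z$i\<bar> + (\<Sum>j\<in>UNIV-{i}. \<bar>z$j\<bar>)" by (rule sum.remove) auto
  moreover have "(\<Sum>j\<in>UNIV-{i}. \<bar>z$j\<bar>) \<ge> 0" by (intro sum_nonneg) auto
  ultimately have a: "\<bar>z$i\<bar> = 1" "(\<Sum>j\<in>UNIV-{i}. \<bar>z$j\<bar>) = 0" using s i by linarith+
  then have "\<forall>j\<in>UNIV-{i}. \<bar>z$j\<bar> = 0" by (subst (asm) sum_nonneg_eq_0_iff) auto
  then have "z = axis i (z$i)" by (auto simp: vec_eq_iff axis_def)
  moreover have "z$i = 1 \<or> z$i = -1" using a(1) by auto
  ultimately show "z \<in> (\<Union>i. {axis i 1, axis i (-1)})" by (metis UNIV_I UN_I insertCI)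
qed (auto simp: axis_in_Ustep)

lemma sum_Ustep: "(\<Sum>z\<in>Ustep. f z) = (\<Sum>i\<in>(UNIV::'d::finite set). f (axis i 1) + f (axis i (-1) :: int^'d))"
proof -
  have "(\<Sum>z\<in>Ustep. f z) = (\<Sum>i\<in>(UNIV::'d set). \<Sum>z\<in>{axis i 1, axis i (-1) :: int^'d}. f z)"
    unfolding Ustep_eq by (rule sum.UNION_disjoint) (auto simp: axis_eq_axis)
  also have "\<dots> = (\<Sum>i\<in>(UNIV::'d set). f (axis i 1) + f (axis i (-1)))"
    by (intro sum.cong refl) (auto simp: axis_eq_axis)
  finally show ?thesis .
qed

section \<open>The difference of two independent nearest-neighbour steps\<close>

locale step_dist =
  fixes q :: "int^'d::finite \<Rightarrow> real" and c :: real
  assumes c_pos: "c > 0" and q_ge: "\<And>z. z \<in> Ustep \<Longrightarrow> c \<le> q z" and q_sum: "(\<Sum>z\<in>Ustep. q z) = 1"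
begin

definition "ax i = q (axis i 1) + q (axis i (-1))"
text \<open>Quadratic form of the inverse second moment matrix of one step. That matrix is diagonal
  with entries \<open>ax i\<close>, because a step moves a single coordinate. The companion
  \<open>lf\<close> on the next line is its polarization.\<close>

definition "Qf x = (\<Sum>i\<in>UNIV. (real_of_int (x$i))\<^sup>2 / ax i)"
definition "lf x z = (\<Sum>i\<in>UNIV. real_of_int (x$i) * real_of_int (z$i) / ax i)"
definition "EE f = (\<Sum>z\<in>Ustep. \<Sum>z'\<in>Ustep. q z * q z' * f (z' - z))"

lemma ax_ge: "2 * c \<le> ax i"
  using q_ge[OF axis_in_Ustep(1)[of i]] q_ge[OF axis_in_Ustep(2)[of i]] by (simp add: ax_def)

lemma ax_pos: "0 < ax i" using ax_ge[of i] c_pos by simp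

lemma q_nonneg: "z \<in> Ustep \<Longrightarrow> 0 \<le> q z" using q_ge[of z] c_pos by simp

lemma sum_ax: "(\<Sum>i\<in>UNIV. ax i) = 1"
  using q_sum unfolding sum_Ustep ax_def by simp

lemma Qf_nonneg: "0 \<le> Qf x" unfolding Qf_def by (intro sum_nonneg divide_nonneg_pos ax_pos) auto

lemma Qf_add: "Qf (x + y) = Qf x + (2 * lf x y + Qf y)"
proof -
  have "(real_of_int ((x + y)$i))\<^sup>2 / ax i = (real_of_int (x$i))\<^sup>2 / ax i
      + (2 * (real_of_int (x$i) * real_of_int (y$i) / ax i) + (real_of_int (y$i))\<^sup>2 / ax i)" for i
    using ax_pos[of i] by (simp add: power2_eq_square field_simps)
  then show ?thesis unfolding Qf_def lf_def by (simp add: sum.distrib sum_distrib_left)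
qed

lemma Qf_minus: "Qf (- x) = Qf x" by (simp add: Qf_def)

lemma lf_minus: "lf x (- z) = - lf x z" by (simp add: lf_def sum_negf)

lemma lf_diff: "lf x (z' - z) = lf x z' - lf x z"
  by (simp add: lf_def algebra_simps diff_divide_distrib sum_subtractf)

lemma lf_axis: "lf x (axis i k) = real_of_int (x$i) * real_of_int k / ax i"
  unfolding lf_def by (subst sum.remove[of _ i]) (auto simp: axis_def)

lemma EE_add: "EE (\<lambda>y. f y + g y) = EE f + EE g"
  by (simp add: EE_def distrib_left sum.distrib)

lemma EE_cmult: "EE (\<lambda>y. k * f y) = k * EE f"
  by (simp add: EE_def sum_distrib_left mult.assoc mult.left_commute)

lemma EE_const: "EE (\<lambda>y. k) = k"
proof -
  have "EE (\<lambda>y. k) = (\<Sum>z\<in>Ustep. q z) * (\<Sum>z\<in>Ustep. q z) * k"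
    unfolding EE_def sum_product by (simp only: sum_distrib_right)
  then show ?thesis by (simp add: q_sum)
qed

lemma EE_mono: "(\<And>z z'. z \<in> Ustep \<Longrightarrow> z' \<in> Ustep \<Longrightarrow> f (z' - z) \<le> g (z' - z)) \<Longrightarrow> EE f \<le> EE g"
  unfolding EE_def by (intro sum_mono mult_left_mono) (auto intro!: mult_nonneg_nonneg q_nonneg)

text \<open>Exchanging the two independent steps reflects their difference.\<close>

lemma EE_odd: assumes "\<And>y. f (- y) = - f y" shows "EE f = 0"
proof -
  have "EE f = (\<Sum>z'\<in>Ustep. \<Sum>z\<in>Ustep. q z * q z' * f (z' - z))" unfolding EE_def by (rule sum.swap)
  also have "\<dots> = - EE f"
    unfolding EE_def sum_negf[symmetric]
  proof (intro sum.cong refl)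
    fix z z' :: "int^'d"
    show "q z' * q z * f (z - z') = - (q z * q z' * f (z' - z))" using assms[of "z' - z"] by simp
  qed
  finally show ?thesis by simp
qed

text \<open>Twice the variance of \<open>h\<close> under a single step.\<close>

lemma EE_square_diff: "EE (\<lambda>y. (h y)\<^sup>2) = 2 * (\<Sum>z\<in>Ustep. q z * (h z)\<^sup>2) - 2 * (\<Sum>z\<in>Ustep. q z * h z)\<^sup>2"
  if "\<And>z z'. h (z' - z) = h z' - h z"
proof -
  have "EE (\<lambda>y. (h y)\<^sup>2) = (\<Sum>z\<in>Ustep. \<Sum>z'\<in>Ustep. q z * (q z' * (h z')\<^sup>2) + q z' * (q z * (h z)\<^sup>2) - 2 * ((q z * h z) * (q z' * h z')))"
    unfolding EE_def that by (intro sum.cong refl) (simp add: power2_eq_square algebra_simps)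
  also have "\<dots> = (\<Sum>z\<in>Ustep. q z) * (\<Sum>z\<in>Ustep. q z * (h z)\<^sup>2) + (\<Sum>z\<in>Ustep. q z) * (\<Sum>z\<in>Ustep. q z * (h z)\<^sup>2)
      - 2 * ((\<Sum>z\<in>Ustep. q z * h z) * (\<Sum>z\<in>Ustep. q z * h z))"
    unfolding sum.distrib sum_subtractf sum_distrib_left[symmetric] sum_distrib_right[symmetric] by simp
  finally show ?thesis by (simp add: q_sum power2_eq_square)
qed

text \<open>The choice of \<open>Qf\<close> makes the uncentred second moment of \<open>lf x\<close>
  under one step equal to \<open>Qf x\<close>; passing to the variance only decreases it.\<close>

lemma EE_lf_square: "EE (\<lambda>y. (lf x y)\<^sup>2) \<le> 2 * Qf x"
proof -
  have "(\<Sum>z\<in>Ustep. q z * (lf x z)\<^sup>2) = Qf x"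
    unfolding sum_Ustep lf_axis Qf_def
  proof (intro sum.cong refl)
    fix i show "q (axis i 1) * (real_of_int (x $ i) * real_of_int 1 / ax i)\<^sup>2 +
         q (axis i (- 1)) * (real_of_int (x $ i) * real_of_int (- 1) / ax i)\<^sup>2 = (real_of_int (x $ i))\<^sup>2 / ax i"
    proof -
      have "q (axis i 1) * (real_of_int (x $ i) * real_of_int 1 / ax i)\<^sup>2 +
         q (axis i (- 1)) * (real_of_int (x $ i) * real_of_int (- 1) / ax i)\<^sup>2
         = ax i * ((real_of_int (x $ i))\<^sup>2 / (ax i)\<^sup>2)"
        by (simp add: ax_def power_divide distrib_right add_divide_distrib)
      then show ?thesis using ax_pos[of i] by (simp add: power2_eq_square)
    qed
  qed
  then show ?thesis using EE_square_diff[of "lf x"] by (simp add: lf_diff)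
qed

lemma EE_sum: "finite I \<Longrightarrow> EE (\<lambda>y. \<Sum>i\<in>I. f i y) = (\<Sum>i\<in>I. EE (f i))"
proof (induction I rule: finite_induct)
  case empty then show ?case using EE_const[of 0] by simp
qed (simp add: EE_add)

text \<open>Coordinate \<open>i\<close> contributes 2 minus twice the squared drift
  \<open>m i\<close> divided by \<open>ax i\<close>. Ellipticity bounds that quotient by
  \<open>ax i - 2 * c\<close>, and the \<open>ax i\<close> sum to 1, so the total is at least
  \<open>2 * d - 2 + 4 * c * d\<close>. With \<open>d = 3\<close> the value 4 is the threshold in
  \<open>superharmonic\<close>, and \<open>12 * c\<close> the excess that makes it work.\<close>

lemma EE_Qf_ge:
  assumes "CARD('d) \<ge> 3"
  shows "4 + 12 * c \<le> EE Qf"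
proof -
  define m where "m i = q (axis i 1) - q (axis i (-1))" for i
  have E1: "EE (\<lambda>y. (real_of_int (y$i))\<^sup>2) = 2 * ax i - 2 * (m i)\<^sup>2" for i
  proof -
    have "(\<Sum>z\<in>Ustep. q z * (real_of_int (z$i))\<^sup>2) = ax i"
      unfolding sum_Ustep ax_def
      by (subst sum.remove[of _ i]) (auto simp: axis_def)
    moreover have "(\<Sum>z\<in>Ustep. q z * real_of_int (z$i)) = m i"
      unfolding sum_Ustep m_def
      by (subst sum.remove[of _ i]) (auto simp: axis_def)
    ultimately show ?thesis using EE_square_diff[of "\<lambda>y. real_of_int (y$i)"] by simp
  qed
  have "EE Qf = (\<Sum>i\<in>UNIV. EE (\<lambda>y. (1 / ax i) * (real_of_int (y$i))\<^sup>2))"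
    unfolding Qf_def[abs_def] by (subst EE_sum[symmetric]) simp_all
  also have "\<dots> = (\<Sum>i\<in>UNIV. (1 / ax i) * (2 * ax i - 2 * (m i)\<^sup>2))" by (simp only: EE_cmult E1)
  also have "\<dots> \<ge> (\<Sum>i\<in>UNIV. 2 - 2 * (ax i - 2 * c))"
  proof (intro sum_mono)
    fix i
    have mb: "\<bar>m i\<bar> \<le> ax i - 2 * c"
      using q_ge[OF axis_in_Ustep(1)[of i]] q_ge[OF axis_in_Ustep(2)[of i]] by (auto simp: m_def ax_def abs_le_iff)
    have mb2: "\<bar>m i\<bar> \<le> ax i" using mb c_pos by simp
    have "(m i)\<^sup>2 = \<bar>m i\<bar> * \<bar>m i\<bar>" by (simp add: power2_eq_square)
    also have "\<dots> \<le> (ax i - 2 * c) * ax i" using mb mb2 by (intro mult_mono) auto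
    finally have "(m i)\<^sup>2 / ax i \<le> ax i - 2 * c" using ax_pos[of i] by (simp add: pos_divide_le_eq)
    moreover have "(1 / ax i) * (2 * ax i - 2 * (m i)\<^sup>2) = 2 - 2 * ((m i)\<^sup>2 / ax i)"
      using ax_pos[of i] by (simp add: field_simps)
    ultimately show "2 - 2 * (ax i - 2 * c) \<le> (1 / ax i) * (2 * ax i - 2 * (m i)\<^sup>2)" by simp
  qed
  moreover have "(\<Sum>i\<in>UNIV. 2 - 2 * (ax i - 2 * c)) = (2 + 4 * c) * real CARD('d) - 2"
    by (simp add: sum_subtractf sum_distrib_left[symmetric] sum_ax algebra_simps)
  moreover have "(2 + 4 * c) * real CARD('d) \<ge> (2 + 4 * c) * 3"
    using assms c_pos by (intro mult_left_mono) auto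
  ultimately show ?thesis by simp
qed

lemma Qf_diff_le: "z \<in> Ustep \<Longrightarrow> z' \<in> Ustep \<Longrightarrow> Qf (z' - z) \<le> 2 / c"
proof -
  assume z: "z \<in> Ustep" "z' \<in> Ustep"
  have sq: "(\<Sum>i\<in>UNIV. (real_of_int (z$i))\<^sup>2) = 1" if "z \<in> Ustep" for z :: "int^'d"
  proof -
    have "(real_of_int (z$i))\<^sup>2 = real_of_int \<bar>z$i\<bar>" for i
    proof -
      have "\<bar>z$i\<bar> \<le> 1" by (rule Ustep_subset_box[OF that])
      then have "z$i = 0 \<or> z$i = 1 \<or> z$i = -1" by linarith
      then show ?thesis by auto
    qed
    then have "(\<Sum>i\<in>UNIV. (real_of_int (z$i))\<^sup>2) = real_of_int (\<Sum>i\<in>UNIV. \<bar>z$i\<bar>)"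
      by (simp only: of_int_sum)
    moreover have "(\<Sum>i\<in>UNIV. \<bar>z$i\<bar>) = 1" using that by (simp add: Ustep_def)
    ultimately show ?thesis by (simp only: of_int_1)
  qed
  have "Qf (z' - z) \<le> (\<Sum>i\<in>UNIV. ((real_of_int (z'$i))\<^sup>2 + (real_of_int (z$i))\<^sup>2) / c)"
    unfolding Qf_def
  proof (intro sum_mono)
    fix i
    have "(real_of_int ((z' - z)$i))\<^sup>2 \<le> 2 * ((real_of_int (z'$i))\<^sup>2 + (real_of_int (z$i))\<^sup>2)"
      using zero_le_power2[of "real_of_int (z'$i) + real_of_int (z$i)"]
      by (simp add: power2_eq_square algebra_simps)
    then have "(real_of_int ((z' - z)$i))\<^sup>2 / ax i \<le> 2 * ((real_of_int (z'$i))\<^sup>2 + (real_of_int (z$i))\<^sup>2) / (2 * c)"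
      using ax_ge[of i] c_pos by (intro frac_le) auto
    then show "(real_of_int ((z' - z)$i))\<^sup>2 / ax i \<le> ((real_of_int (z'$i))\<^sup>2 + (real_of_int (z$i))\<^sup>2) / c"
      by (simp only: mult_divide_mult_cancel_left_if) simp
  qed
  also have "\<dots> = 2 / c"
    unfolding sum_divide_distrib[symmetric] sum.distrib sq[OF z(1)] sq[OF z(2)] by simp
  finally show ?thesis .
qed

lemma lf_square_le: "z \<in> Ustep \<Longrightarrow> (lf x z)\<^sup>2 \<le> Qf x / (2 * c)"
proof -
  assume "z \<in> Ustep"
  then obtain i k where z: "z = axis i k" "k = 1 \<or> k = -1" unfolding Ustep_eq by blast
  have "(lf x z)\<^sup>2 = (real_of_int (x$i))\<^sup>2 / ax i / ax i"
    using z(2) by (auto simp: z(1) lf_axis power2_eq_square)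
  also have "\<dots> \<le> Qf x / (2 * c)"
  proof (rule frac_le)
    show "(real_of_int (x$i))\<^sup>2 / ax i \<le> Qf x"
      unfolding Qf_def by (rule member_le_sum) (auto intro!: divide_nonneg_pos ax_pos)
  qed (use Qf_nonneg ax_ge c_pos in auto)
  finally show ?thesis .
qed

text \<open>With \<open>T = Qf x + R\<close> and increment \<open>\<xi>\<close> of the form, the
  quadratic majorant reduces the claim to \<open>(1/2 + c) * EE \<xi>^2 \<le> T * EE \<xi>\<close>.
  The left side is at most \<open>(4 + 8 * c) * T\<close> plus a constant, the right side at least
  \<open>(4 + 12 * c) * T\<close>, so the constant only has to be below
  \<open>4 * c * T\<close>.\<close>

lemma superharmonic:
  assumes d: "CARD('d) \<ge> 3"
    and s: "0 < s" and e: "0 < \<epsilon>"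
    and quad: "\<And>\<tau>. \<bar>\<tau>\<bar> \<le> \<epsilon> \<Longrightarrow> (1 + \<tau>) powr (-s) \<le> 1 - s * \<tau> + s * (1/2 + c) * \<tau>\<^sup>2"
    and R: "32 / (c * \<epsilon>\<^sup>2) \<le> R" "4 / (c * \<epsilon>) \<le> R" "(1/2 + c) / c ^ 3 \<le> R" and e1: "\<epsilon> \<le> 1/2"
  shows "EE (\<lambda>y. (Qf (x + y) + R) powr (-s)) \<le> (Qf x + R) powr (-s)"
proof -
  define T where "T = Qf x + R"
  have R0: "0 < R" using R(1) c_pos e by (meson divide_pos_pos less_le_trans mult_pos_pos zero_less_numeral zero_less_power)
  have T: "0 < T" "R \<le> T" using R0 Qf_nonneg[of x] by (auto simp: T_def)
  define \<xi> where "\<xi> y = 2 * lf x y + Qf y" for y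
  \<comment> \<open>The increment is \<open>2 * lf + Qf\<close>. The first threshold on
    \<open>R\<close> bounds each single-step value of \<open>lf\<close> by
    \<open>\<epsilon> * T / 8\<close>, the second bounds \<open>Qf\<close> of the difference by
    \<open>\<epsilon> * T / 2\<close>.\<close>
  have xi: "\<bar>\<xi> (z' - z)\<bar> \<le> \<epsilon> * T" if z: "z \<in> Ustep" "z' \<in> Ustep" for z z'
  proof -
    have l: "\<bar>lf x z\<bar> \<le> \<epsilon> * T / 8" if "z \<in> Ustep" for z
    proof -
      have "(lf x z)\<^sup>2 \<le> Qf x / (2 * c)" by (rule lf_square_le[OF that])
      also have "\<dots> \<le> T / (2 * c)" using c_pos R0 by (intro divide_right_mono) (auto simp: T_def)
      also have "\<dots> \<le> (\<epsilon> * T / 8)\<^sup>2"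
      proof -
        have "32 / (c * \<epsilon>\<^sup>2) \<le> T" using R(1) T by linarith
        then have "32 \<le> T * (c * \<epsilon>\<^sup>2)" using c_pos e by (simp add: pos_divide_le_eq)
        then have "32 * T \<le> T * (c * \<epsilon>\<^sup>2) * T" using T by (intro mult_right_mono) auto
        then show ?thesis using c_pos by (simp add: field_simps power2_eq_square)
      qed
      finally have "\<bar>lf x z\<bar> \<le> \<bar>\<epsilon> * T / 8\<bar>" by (simp only: abs_le_square_iff)
      then show ?thesis using e T by simp
    qed
    have "Qf (z' - z) \<le> 2 / c" by (rule Qf_diff_le[OF z])
    also have "\<dots> \<le> \<epsilon> * T / 2"
    proof -
      have "4 / (c * \<epsilon>) \<le> T" using R(2) T by linarith
      then have "4 \<le> T * (c * \<epsilon>)" using c_pos e by (simp add: pos_divide_le_eq)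
      then show ?thesis using c_pos by (simp add: field_simps)
    qed
    finally have "Qf (z' - z) \<le> \<epsilon> * T / 2" .
    moreover have "\<bar>lf x (z' - z)\<bar> \<le> \<epsilon> * T / 4" using l[OF z(1)] l[OF z(2)] unfolding lf_diff by linarith
    ultimately show ?thesis using Qf_nonneg[of "z' - z"] unfolding \<xi>_def by linarith
  qed
  have "EE (\<lambda>y. (Qf (x + y) + R) powr (-s))
     \<le> EE (\<lambda>y. T powr (-s) * (1 + ((- s / T) * \<xi> y + (s * (1/2 + c) / T\<^sup>2) * (\<xi> y)\<^sup>2)))"
  proof (rule EE_mono)
    fix z z' :: "int^'d" assume z: "z \<in> Ustep" "z' \<in> Ustep"
    let ?y = "z' - z"
    define \<tau> where "\<tau> = \<xi> ?y / T"
    have tau: "\<bar>\<tau>\<bar> \<le> \<epsilon>" using xi[OF z] T by (simp add: \<tau>_def pos_divide_le_eq)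
    have "Qf (x + ?y) + R = T * (1 + \<tau>)" 
    proof -
      have "T * (1 + \<tau>) = T + \<xi> ?y" using T by (simp add: \<tau>_def distrib_left)
      then show ?thesis by (simp only: Qf_add T_def \<xi>_def)
    qed
    then have "(Qf (x + ?y) + R) powr (-s) = T powr (-s) * (1 + \<tau>) powr (-s)"
      using T tau e1 by (simp add: powr_mult)
    also have "\<dots> \<le> T powr (-s) * (1 - s * \<tau> + s * (1/2 + c) * \<tau>\<^sup>2)"
      by (intro mult_left_mono quad tau) auto
    also have "1 - s * \<tau> + s * (1/2 + c) * \<tau>\<^sup>2 = 1 + ((- s / T) * \<xi> ?y + (s * (1/2 + c) / T\<^sup>2) * (\<xi> ?y)\<^sup>2)"
      by (simp add: \<tau>_def power_divide)
    finally show "(Qf (x + ?y) + R) powr (-s) \<le> T powr (-s) * (1 + ((- s / T) * \<xi> ?y + (s * (1/2 + c) / T\<^sup>2) * (\<xi> ?y)\<^sup>2))" .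
  qed
  also have "\<dots> = T powr (-s) * (1 + ((- s / T) * EE \<xi> + (s * (1/2 + c) / T\<^sup>2) * EE (\<lambda>y. (\<xi> y)\<^sup>2)))"
    by (simp only: EE_cmult EE_add EE_const)
  also have "\<dots> \<le> T powr (-s) * 1"
  proof (intro mult_left_mono)
    have E1: "4 + 12 * c \<le> EE \<xi>"
      using EE_Qf_ge[OF d] EE_odd[of "lf x"] unfolding \<xi>_def[abs_def] EE_add EE_cmult by (simp add: lf_minus)
    \<comment> \<open>The mixed term is an odd function times an even one, so its expectation
      vanishes.\<close>
    have "EE (\<lambda>y. (\<xi> y)\<^sup>2) = EE (\<lambda>y. 4 * (lf x y)\<^sup>2 + (4 * (lf x y * Qf y) + (Qf y)\<^sup>2))"
      by (simp add: \<xi>_def power2_eq_square algebra_simps)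
    also have "\<dots> = 4 * EE (\<lambda>y. (lf x y)\<^sup>2) + EE (\<lambda>y. (Qf y)\<^sup>2)"
      unfolding EE_add EE_cmult using EE_odd[of "\<lambda>y. lf x y * Qf y"] by (simp add: lf_minus Qf_minus)
    also have "EE (\<lambda>y. (Qf y)\<^sup>2) \<le> EE (\<lambda>y. (2 / c)\<^sup>2)"
      by (intro EE_mono power_mono Qf_diff_le Qf_nonneg)
    finally have E2: "EE (\<lambda>y. (\<xi> y)\<^sup>2) \<le> 8 * T + 4 / c\<^sup>2"
      using EE_lf_square[of x] R0 by (simp add: EE_const T_def power_divide)
    have "(1/2 + c) * EE (\<lambda>y. (\<xi> y)\<^sup>2) \<le> (1/2 + c) * (8 * T + 4 / c\<^sup>2)"
      using E2 c_pos by (intro mult_left_mono) auto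
    \<comment> \<open>The constant left over is \<open>4 * c\<close> times the third threshold on
      \<open>R\<close>.\<close>
    also have "\<dots> = 4 * T + 8 * c * T + 4 * c * ((1/2 + c) / c ^ 3)"
      using c_pos by (simp add: field_simps power2_eq_square power3_eq_cube)
    also have "\<dots> \<le> 4 * T + 8 * c * T + 4 * c * T"
      using R(3) T c_pos by (intro add_left_mono mult_left_mono) auto
    also have "\<dots> = T * (4 + 12 * c)" by (simp add: algebra_simps)
    also have "\<dots> \<le> T * EE \<xi>" using E1 T by (intro mult_left_mono) auto
    finally have "(s / T\<^sup>2) * ((1/2 + c) * EE (\<lambda>y. (\<xi> y)\<^sup>2)) \<le> (s / T\<^sup>2) * (T * EE \<xi>)"
      using s by (intro mult_left_mono) auto
    also have "\<dots> = s / T * EE \<xi>" using T by (simp add: power2_eq_square)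
    finally show "1 + ((- s / T) * EE \<xi> + (s * (1/2 + c) / T\<^sup>2) * EE (\<lambda>y. (\<xi> y)\<^sup>2)) \<le> 1"
      by (simp add: mult.assoc)
  qed auto
  finally show ?thesis by (simp add: T_def)
qed

lemma Qf_0 [simp]: "Qf 0 = 0" by (simp add: Qf_def)

text \<open>The axis weights are at most 1, so the form dominates the square of a nonzero integer.
  This separates the diagonal from all other sites by a fixed gap.\<close>

lemma Qf_ge_1: "x \<noteq> 0 \<Longrightarrow> 1 \<le> Qf x"
proof -
  assume "x \<noteq> 0"
  then obtain i where i: "x $ i \<noteq> 0" by (auto simp: vec_eq_iff)
  have "ax i \<le> (\<Sum>i\<in>UNIV. ax i)" by (rule member_le_sum) (auto simp: ax_pos less_imp_le)
  then have "ax i \<le> 1" by (simp add: sum_ax)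
  moreover have "1 \<le> \<bar>real_of_int (x$i)\<bar>" using i by linarith
  then have "1 \<le> (real_of_int (x$i))\<^sup>2" using abs_le_square_iff[of 1 "real_of_int (x$i)"] by simp
  ultimately have "1 \<le> (real_of_int (x$i))\<^sup>2 / ax i" using ax_pos[of i] by (simp add: pos_le_divide_eq)
  also have "\<dots> \<le> Qf x" unfolding Qf_def by (rule member_le_sum) (auto intro!: divide_nonneg_pos ax_pos)
  finally show ?thesis .
qed

end

section \<open>The tilt\<close>

lemma exp_minus_1_mult_nonneg: "0 \<le> (exp a - 1) * (a::real)"
proof (cases "a \<ge> 0")
  case False then show ?thesis by (intro mult_nonpos_nonpos) auto
qed simp

lemma vecR_axis: "vecR (axis i k) = axis i (real_of_int k)"
  by (simp add: vecR_def axis_def vec_eq_iff)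

lemma inner_axis_vecR: "v \<bullet> vecR (axis i k) = v $ i * real_of_int k"
  by (simp add: vecR_axis inner_axis)

lemma norm_vecR_le: "z \<in> Ustep \<Longrightarrow> norm (vecR z) \<le> 1"
  unfolding Ustep_eq by (auto simp: vecR_axis norm_eq_sqrt_inner inner_axis_axis)

lemma one_plus_less_exp: "x \<noteq> 0 \<Longrightarrow> 1 + x < exp (x::real)"
proof (rule ccontr)
  assume x: "x \<noteq> 0" "\<not> 1 + x < exp x"
  then have "exp x = 1 + x" using exp_ge_add_one_self[of x] by linarith
  then have "ln (exp x) = exp x - 1" unfolding ln_exp by linarith
  then have "exp x = 1" by (intro ln_eq_minus_one) auto
  then show False using x(1) by simp
qed

context rwre
begin

lemma qmean_weights:
  shows integrable_weight: "z \<in> Ustep \<Longrightarrow> integrable \<nu> (\<lambda>p. p z)"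
    and qmean_ge: "z \<in> Ustep \<Longrightarrow> c1 \<le> qmean \<nu> z"
    and sum_qmean: "(\<Sum>z\<in>Ustep. qmean \<nu> z) = 1"
proof -
  have bd: "AE p in \<nu>. \<forall>z\<in>Ustep. c1 \<le> p z \<and> p z \<le> 1"
    using elliptic
  proof eventually_elim
    case (elim p)
    then have "p z \<le> (\<Sum>z\<in>Ustep. p z)" if "z \<in> Ustep" for z
      using that c1_pos by (intro member_le_sum) (auto simp: finite_Ustep intro: order_trans less_imp_le)
    then show ?case using elim by auto
  qed
  have int: "integrable \<nu> (\<lambda>p. p z)" if "z \<in> Ustep" for z
    using bd c1_pos that
    by (intro nu.integrable_const_bound[where B=1]) (auto elim!: eventually_mono intro: measurable_weight)
  then show "z \<in> Ustep \<Longrightarrow> integrable \<nu> (\<lambda>p. p z)" .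
  show "c1 \<le> qmean \<nu> z" if "z \<in> Ustep"
    unfolding qmean_def using bd that by (intro nu.integral_ge_const int) (auto elim!: eventually_mono)
  have "(\<Sum>z\<in>Ustep. qmean \<nu> z) = (\<integral>p. (\<Sum>z\<in>Ustep. p z) \<partial>\<nu>)"
    unfolding qmean_def by (subst Bochner_Integration.integral_sum) (auto intro: int)
  also have "\<dots> = (\<integral>p. 1 \<partial>\<nu>)"
    using elliptic by (intro integral_cong_AE) (auto elim!: eventually_mono intro!: borel_measurable_sum measurable_weight)
  finally show "(\<Sum>z\<in>Ustep. qmean \<nu> z) = 1" by (simp add: nu.prob_space)
qed

lemma qmean_pos: "z \<in> Ustep \<Longrightarrow> 0 < qmean \<nu> z"
  using qmean_ge[of z] c1_pos by simp

section \<open>Existence and uniqueness of the conjugate tilt\<close>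

definition mgf :: "real^'d \<Rightarrow> real" where
  "mgf \<theta> = (\<Sum>z\<in>Ustep. qmean \<nu> z * exp (\<theta> \<bullet> vecR z))"

text \<open>The equation of \<xi> with the gradient of \<open>Lambda_c\<close> at \<theta>, tested
  in every direction and cleared of the denominator \<open>mgf \<theta>\<close>.\<close>

definition critical :: "real^'d \<Rightarrow> real^'d \<Rightarrow> bool" where
  "critical \<xi> \<theta> \<longleftrightarrow> (\<forall>h. (\<Sum>z\<in>Ustep. qmean \<nu> z * exp (\<theta> \<bullet> vecR z) * (h \<bullet> (vecR z - \<xi>))) = 0)"

lemma Ustep_ne: "(Ustep :: (int^'d) set) \<noteq> {}"
  using axis_in_Ustep(1) by blast

lemma mgf_pos: "0 < mgf \<theta>"
  unfolding mgf_def by (intro sum_pos finite_Ustep Ustep_ne) (simp add: qmean_pos)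

lemma Lambda_c_eq: "Lambda_c \<nu> \<theta> = ln (mgf \<theta>)"
  by (simp add: Lambda_c_def mgf_def)

lemma mgf_eq_exp: "mgf \<theta> = exp (Lambda_c \<nu> \<theta>)"
  using mgf_pos by (simp add: Lambda_c_eq)

lemma has_derivative_mgf:
  "(mgf has_derivative (\<lambda>h. \<Sum>z\<in>Ustep. qmean \<nu> z * (exp (\<theta> \<bullet> vecR z) * (h \<bullet> vecR z)))) (at \<theta>)"
  unfolding mgf_def[abs_def]
  by (auto intro!: derivative_eq_intros simp: fun_eq_iff ac_simps intro!: sum.cong)

lemma has_derivative_Lambda_c:
  "(Lambda_c \<nu> has_derivative
     (\<lambda>h. (\<Sum>z\<in>Ustep. qmean \<nu> z * (exp (\<theta> \<bullet> vecR z) * (h \<bullet> vecR z))) / mgf \<theta>)) (at \<theta>)"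
proof -
  have "((\<lambda>\<theta>. ln (mgf \<theta>)) has_derivative
     (\<lambda>h. (\<Sum>z\<in>Ustep. qmean \<nu> z * (exp (\<theta> \<bullet> vecR z) * (h \<bullet> vecR z))) * inverse (mgf \<theta>))) (at \<theta>)"
    by (rule has_derivative_ln[OF mgf_pos has_derivative_mgf, THEN has_derivative_eq_rhs]) (simp add: fun_eq_iff)
  then show ?thesis by (simp add: Lambda_c_eq[abs_def] divide_inverse)
qed

lemma Lambda_c_derivative_iff: "(Lambda_c \<nu> has_derivative (\<lambda>h. \<xi> \<bullet> h)) (at \<theta>) \<longleftrightarrow> critical \<xi> \<theta>"
proof -
  have "(Lambda_c \<nu> has_derivative (\<lambda>h. \<xi> \<bullet> h)) (at \<theta>) \<longleftrightarrow>
      (\<lambda>h. \<xi> \<bullet> h) = (\<lambda>h. (\<Sum>z\<in>Ustep. qmean \<nu> z * (exp (\<theta> \<bullet> vecR z) * (h \<bullet> vecR z))) / mgf \<theta>)"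
  proof
    assume "(Lambda_c \<nu> has_derivative (\<lambda>h. \<xi> \<bullet> h)) (at \<theta>)"
    then show "(\<lambda>h. \<xi> \<bullet> h) = (\<lambda>h. (\<Sum>z\<in>Ustep. qmean \<nu> z * (exp (\<theta> \<bullet> vecR z) * (h \<bullet> vecR z))) / mgf \<theta>)"
      by (rule has_derivative_unique[OF _ has_derivative_Lambda_c])
  qed (use has_derivative_Lambda_c[of \<theta>] in simp)
  also have "\<dots> \<longleftrightarrow> (\<forall>h. (\<xi> \<bullet> h) * mgf \<theta> = (\<Sum>z\<in>Ustep. qmean \<nu> z * (exp (\<theta> \<bullet> vecR z) * (h \<bullet> vecR z))))"
    using mgf_pos[of \<theta>] by (auto simp: fun_eq_iff eq_divide_eq)
  also have "\<dots> \<longleftrightarrow> critical \<xi> \<theta>"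
    unfolding critical_def
  proof (intro iff_allI)
    fix h
    have "(\<Sum>z\<in>Ustep. qmean \<nu> z * exp (\<theta> \<bullet> vecR z) * (h \<bullet> (vecR z - \<xi>)))
      = (\<Sum>z\<in>Ustep. qmean \<nu> z * (exp (\<theta> \<bullet> vecR z) * (h \<bullet> vecR z))) - (\<xi> \<bullet> h) * mgf \<theta>"
      unfolding mgf_def sum_distrib_left sum_subtractf[symmetric]
      by (intro sum.cong refl) (simp add: inner_diff_right inner_commute[of h \<xi>] algebra_simps)
    then show "((\<xi> \<bullet> h) * mgf \<theta> = (\<Sum>z\<in>Ustep. qmean \<nu> z * (exp (\<theta> \<bullet> vecR z) * (h \<bullet> vecR z)))) =
      ((\<Sum>z\<in>Ustep. qmean \<nu> z * exp (\<theta> \<bullet> vecR z) * (h \<bullet> (vecR z - \<xi>))) = 0)" by auto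
  qed
  finally show ?thesis .
qed

text \<open>A unit step and its opposite give \<open>v $ i\<close> and \<open>- v $ i\<close> the
  same value \<open>v \<bullet> \<xi>\<close>.\<close>

lemma zero_if_inner_const:
  assumes "\<And>z. z \<in> Ustep \<Longrightarrow> v \<bullet> (vecR z - \<xi>) = 0"
  shows "(v :: real^'d) = 0"
proof -
  have "v $ i = 0" for i
    using assms[OF axis_in_Ustep(1)[of i]] assms[OF axis_in_Ustep(2)[of i]]
    by (simp add: inner_diff_right inner_axis_vecR)
  then show ?thesis by (simp add: vec_eq_iff)
qed

text \<open>Strict monotonicity of the gradient. Along \<open>v = \<theta>2 - \<theta>1\<close> the
  weights at \<open>\<theta>2\<close> are those at \<open>\<theta>1\<close> times
  \<open>exp (a z)\<close>, up to a constant factor. Subtracting the two critical equations leaves a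
  vanishing sum of nonnegative terms \<open>(exp (a z) - 1) * a z\<close>, each of which must
  therefore be 0.\<close>

lemma critical_unique:
  assumes "critical \<xi> \<theta>1" "critical \<xi> \<theta>2" shows "\<theta>1 = \<theta>2"
proof -
  define v where "v = \<theta>2 - \<theta>1"
  define a where "a z = v \<bullet> (vecR z - \<xi>)" for z
  have "(\<Sum>z\<in>Ustep. qmean \<nu> z * exp (\<theta>1 \<bullet> vecR z) * ((exp (a z) - 1) * a z))
    = exp (- (v \<bullet> \<xi>)) * (\<Sum>z\<in>Ustep. qmean \<nu> z * exp (\<theta>2 \<bullet> vecR z) * a z)
      - (\<Sum>z\<in>Ustep. qmean \<nu> z * exp (\<theta>1 \<bullet> vecR z) * a z)"
  proof -
    have "exp (\<theta>1 \<bullet> vecR z) * exp (a z) = exp (- (v \<bullet> \<xi>)) * exp (\<theta>2 \<bullet> vecR z)" for z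
      unfolding exp_add[symmetric] by (simp add: a_def v_def inner_diff_left inner_diff_right)
    then have "qmean \<nu> z * exp (\<theta>1 \<bullet> vecR z) * ((exp (a z) - 1) * a z)
      = exp (- (v \<bullet> \<xi>)) * (qmean \<nu> z * exp (\<theta>2 \<bullet> vecR z) * a z) - qmean \<nu> z * exp (\<theta>1 \<bullet> vecR z) * a z" for z
      by (simp add: algebra_simps)
    then show ?thesis by (simp add: sum_subtractf sum_distrib_left)
  qed
  also have "\<dots> = 0" using assms by (simp add: critical_def a_def)
  finally have "\<forall>z\<in>Ustep. qmean \<nu> z * exp (\<theta>1 \<bullet> vecR z) * ((exp (a z) - 1) * a z) = 0"
    by (subst (asm) sum_nonneg_eq_0_iff)
       (auto simp: finite_Ustep intro!: mult_nonneg_nonneg exp_minus_1_mult_nonneg less_imp_le[OF qmean_pos])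
  then have "a z = 0" if "z \<in> Ustep" for z using that qmean_pos[OF that] by auto
  then have "v = 0" by (intro zero_if_inner_const[of v \<xi>]) (simp add: a_def)
  then show ?thesis by (simp add: v_def)
qed

text \<open>The exponential of \<open>Lambda_c \<nu> \<theta> - \<theta> \<bullet> \<xi>\<close>.
  Its critical points are the solutions sought, so existence becomes a minimization, as in the
  Legendre transform.\<close>

definition tilted_mgf :: "real^'d \<Rightarrow> real^'d \<Rightarrow> real" where
  "tilted_mgf \<xi> \<theta> = (\<Sum>z\<in>Ustep. qmean \<nu> z * exp (\<theta> \<bullet> (vecR z - \<xi>)))"

lemma has_derivative_tilted_mgf:
  "(tilted_mgf \<xi> has_derivative (\<lambda>h. \<Sum>z\<in>Ustep. qmean \<nu> z * (exp (\<theta> \<bullet> (vecR z - \<xi>)) * (h \<bullet> (vecR z - \<xi>))))) (at \<theta>)"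
  unfolding tilted_mgf_def[abs_def]
  by (auto intro!: derivative_eq_intros simp: fun_eq_iff ac_simps intro!: sum.cong)

lemma continuous_tilted_mgf: "continuous_on S (tilted_mgf \<xi>)"
  unfolding tilted_mgf_def[abs_def] by (intro continuous_intros)

text \<open>The linear term of the exponential averages to 0 because \<open>xi_o \<nu>\<close> is
  the mean step, and the exponential lies strictly above its tangent at some step.\<close>

lemma tilted_mgf_gt_1:
  assumes "\<theta> \<noteq> 0" shows "1 < tilted_mgf (xi_o \<nu>) \<theta>"
proof -
  define a where "a z = \<theta> \<bullet> (vecR z - xi_o \<nu>)" for z
  have "\<exists>z\<in>Ustep. a z \<noteq> 0" using zero_if_inner_const[of \<theta> "xi_o \<nu>"] assms by (auto simp: a_def)
  then obtain z0 where z0: "z0 \<in> Ustep" "a z0 \<noteq> 0" by blast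
  have "(\<Sum>z\<in>Ustep. qmean \<nu> z * (1 + a z)) < tilted_mgf (xi_o \<nu>) \<theta>"
    unfolding tilted_mgf_def a_def[symmetric]
  proof (rule sum_strict_mono_ex1)
    show "\<forall>z\<in>Ustep. qmean \<nu> z * (1 + a z) \<le> qmean \<nu> z * exp (a z)"
      by (intro ballI mult_left_mono exp_ge_add_one_self) (simp add: qmean_pos less_imp_le)
    show "\<exists>z\<in>Ustep. qmean \<nu> z * (1 + a z) < qmean \<nu> z * exp (a z)"
      using z0 one_plus_less_exp qmean_pos by (intro bexI[of _ z0] mult_strict_left_mono) auto
  qed (rule finite_Ustep)
  moreover have "(\<Sum>z\<in>Ustep. qmean \<nu> z * (1 + a z)) = 1"
  proof -
    have "(\<Sum>z\<in>Ustep. qmean \<nu> z * a z) = \<theta> \<bullet> xi_o \<nu> - (\<Sum>z\<in>Ustep. qmean \<nu> z) * (\<theta> \<bullet> xi_o \<nu>)"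
    proof -
      have "\<theta> \<bullet> xi_o \<nu> = (\<Sum>z\<in>Ustep. qmean \<nu> z * (\<theta> \<bullet> vecR z))"
        by (simp add: xi_o_def inner_sum_right)
      then show ?thesis
        by (simp add: a_def inner_diff_right right_diff_distrib sum_subtractf sum_distrib_right)
    qed
    then show ?thesis by (simp add: distrib_left sum.distrib sum_qmean)
  qed
  ultimately show ?thesis by simp
qed

text \<open>For \<xi> near \<open>xi_o \<nu>\<close> the function \<open>tilted_mgf \<xi>\<close>
  still exceeds 1 on the whole sphere of radius \<open>r\<close>, while it equals 1 at the centre.
  The minimizer over the closed ball is therefore interior, hence critical, and has norm below
  \<open>r\<close>.\<close>

lemma ex_critical:
  assumes "r > 0"
  shows "\<exists>\<eta>>0. \<forall>\<xi>. norm (\<xi> - xi_o \<nu>) < \<eta> \<longrightarrow> (\<exists>\<theta>. critical \<xi> \<theta> \<and> norm \<theta> < r)"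
proof -
  let ?S = "sphere (0::real^'d) r"
  have "?S \<noteq> {}" using assms by simp
  then obtain \<theta>m where m: "\<theta>m \<in> ?S" "\<And>\<theta>. \<theta> \<in> ?S \<Longrightarrow> tilted_mgf (xi_o \<nu>) \<theta>m \<le> tilted_mgf (xi_o \<nu>) \<theta>"
    using continuous_attains_inf[OF compact_sphere _ continuous_tilted_mgf] by blast
  define L where "L = tilted_mgf (xi_o \<nu>) \<theta>m"
  have L: "1 < L" unfolding L_def using m(1) assms by (intro tilted_mgf_gt_1) auto
  \<comment> \<open>On the sphere, moving the target by less than \<open>\<eta>\<close> changes the
    logarithm of \<open>tilted_mgf\<close> by less than \<open>r * \<eta> = ln L\<close>, the
    logarithm of its minimum there.\<close>
  define \<eta> where "\<eta> = ln L / r"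
  have eta: "\<eta> > 0" using L assms by (simp add: \<eta>_def)
  moreover have "\<exists>\<theta>. critical \<xi> \<theta> \<and> norm \<theta> < r" if xi: "norm (\<xi> - xi_o \<nu>) < \<eta>" for \<xi>
  proof -
    have rel: "tilted_mgf \<xi> \<theta> = exp (\<theta> \<bullet> (xi_o \<nu> - \<xi>)) * tilted_mgf (xi_o \<nu>) \<theta>" for \<theta>
      by (simp add: tilted_mgf_def sum_distrib_left inner_diff_right exp_add[symmetric] mult.left_commute)
    have big: "1 < tilted_mgf \<xi> \<theta>" if "\<theta> \<in> ?S" for \<theta>
    proof -
      have "\<bar>\<theta> \<bullet> (xi_o \<nu> - \<xi>)\<bar> \<le> norm \<theta> * norm (xi_o \<nu> - \<xi>)" by (rule Cauchy_Schwarz_ineq2)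
      also have "\<dots> < r * \<eta>" using that xi assms by (simp add: norm_minus_commute)
      finally have "- ln L < \<theta> \<bullet> (xi_o \<nu> - \<xi>)" using assms by (simp add: \<eta>_def)
      then have "exp (- ln L) * L < exp (\<theta> \<bullet> (xi_o \<nu> - \<xi>)) * L" using L by (intro mult_strict_right_mono) auto
      also have "\<dots> \<le> tilted_mgf \<xi> \<theta>" unfolding rel L_def by (intro mult_left_mono m(2) that) auto
      finally show ?thesis using L by (simp add: exp_minus)
    qed
    have "cball (0::real^'d) r \<noteq> {}" using assms by simp
    then obtain t where t: "t \<in> cball 0 r" "\<And>\<theta>. \<theta> \<in> cball 0 r \<Longrightarrow> tilted_mgf \<xi> t \<le> tilted_mgf \<xi> \<theta>"
      using continuous_attains_inf[OF compact_cball _ continuous_tilted_mgf] by blast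
    have "tilted_mgf \<xi> t \<le> 1" using t(2)[of 0] assms by (simp add: tilted_mgf_def sum_qmean)
    then have nt: "norm t < r" using big[of t] t(1) by (cases "norm t = r") auto
    have z: "(\<lambda>h. \<Sum>z\<in>Ustep. qmean \<nu> z * (exp (t \<bullet> (vecR z - \<xi>)) * (h \<bullet> (vecR z - \<xi>)))) = (\<lambda>v. 0)"
      by (rule differential_zero_maxmin[OF _ _ has_derivative_tilted_mgf, of _ "ball 0 r"]) (use nt t(2) in auto)
    have "critical \<xi> t"
      unfolding critical_def
    proof
      fix h
      have "(\<Sum>z\<in>Ustep. qmean \<nu> z * exp (t \<bullet> vecR z) * (h \<bullet> (vecR z - \<xi>)))
        = exp (t \<bullet> \<xi>) * (\<Sum>z\<in>Ustep. qmean \<nu> z * (exp (t \<bullet> (vecR z - \<xi>)) * (h \<bullet> (vecR z - \<xi>))))"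
        unfolding sum_distrib_left
        by (intro sum.cong refl) (simp add: inner_diff_right exp_diff)
      also have "\<dots> = 0" using fun_cong[OF z, of h] by simp
      finally show "(\<Sum>z\<in>Ustep. qmean \<nu> z * exp (t \<bullet> vecR z) * (h \<bullet> (vecR z - \<xi>))) = 0" .
    qed
    then show ?thesis using nt by blast
  qed
  ultimately show ?thesis by blast
qed

lemma ex_tilt:
  assumes "r > 0"
  shows "\<exists>\<eta>>0. \<forall>\<xi>. norm (\<xi> - xi_o \<nu>) < \<eta> \<longrightarrow>
    (\<exists>!\<theta>. (Lambda_c \<nu> has_derivative (\<lambda>h. \<xi> \<bullet> h)) (at \<theta>)) \<and>
    (\<forall>\<theta>. (Lambda_c \<nu> has_derivative (\<lambda>h. \<xi> \<bullet> h)) (at \<theta>) \<longrightarrow> norm \<theta> < r)"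
proof -
  obtain \<eta> where \<eta>: "\<eta> > 0" "\<And>\<xi>. norm (\<xi> - xi_o \<nu>) < \<eta> \<Longrightarrow> \<exists>\<theta>. critical \<xi> \<theta> \<and> norm \<theta> < r"
    using ex_critical[OF assms] by blast
  have "(\<exists>!\<theta>. critical \<xi> \<theta>) \<and> (\<forall>\<theta>. critical \<xi> \<theta> \<longrightarrow> norm \<theta> < r)" if xi: "norm (\<xi> - xi_o \<nu>) < \<eta>" for \<xi>
  proof -
    obtain t where t: "critical \<xi> t" "norm t < r" using \<eta>(2)[OF xi] by blast
    then have "\<theta> = t" if "critical \<xi> \<theta>" for \<theta> using critical_unique that by blast
    then show ?thesis using t by blast
  qed
  then show ?thesis unfolding Lambda_c_derivative_iff using \<eta>(1) by blast
qed

text \<open>Both \<open>\<theta> \<bullet> vecR z\<close> and \<open>Lambda_c \<nu> \<theta>\<close>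
  are bounded by \<open>r\<close>, whence the factor 2 in the exponent.\<close>

lemma step_wt_bounds:
  assumes "norm \<theta> \<le> r" "z \<in> Ustep"
  shows "step_wt \<nu> \<theta> z \<le> exp (2 * r)" "exp (- 2 * r) \<le> step_wt \<nu> \<theta> z"
proof -
  have ip: "\<bar>\<theta> \<bullet> vecR z\<bar> \<le> r" if "z \<in> Ustep" for z :: "int^'d"
  proof -
    have "\<bar>\<theta> \<bullet> vecR z\<bar> \<le> norm \<theta> * norm (vecR z)" by (rule Cauchy_Schwarz_ineq2)
    also have "\<dots> \<le> r * 1" using assms(1) norm_vecR_le[OF that] by (intro mult_mono) (auto intro: order_trans[OF norm_ge_zero])
    finally show ?thesis by simp
  qed
  have "mgf \<theta> \<le> (\<Sum>z\<in>Ustep. qmean \<nu> z * exp r)"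
    unfolding mgf_def using ip qmean_pos by (intro sum_mono mult_left_mono) (auto simp: abs_le_iff less_imp_le)
  then have u: "mgf \<theta> \<le> exp r" by (simp add: sum_distrib_right[symmetric] sum_qmean)
  have "(\<Sum>z\<in>Ustep. qmean \<nu> z * exp (- r)) \<le> mgf \<theta>"
    unfolding mgf_def using ip qmean_pos by (intro sum_mono mult_left_mono) (auto simp: abs_le_iff less_imp_le minus_le_iff)
  then have l: "exp (- r) \<le> mgf \<theta>" by (simp add: sum_distrib_right[symmetric] sum_qmean)
  have "\<bar>Lambda_c \<nu> \<theta>\<bar> \<le> r" using u l by (simp add: mgf_eq_exp)
  then show "step_wt \<nu> \<theta> z \<le> exp (2 * r)" "exp (- 2 * r) \<le> step_wt \<nu> \<theta> z"
    using ip[OF assms(2)] by (auto simp: step_wt_def)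
qed

text \<open>Averaged over the environment, the tilted one-step weights form a probability law. This
  is behind the mean 1 of \<open>part_fn\<close> and the total mass of the explicit
  construction.\<close>

lemma sum_qmean_step_wt: "(\<Sum>z\<in>Ustep. qmean \<nu> z * step_wt \<nu> \<theta> z) = 1"
proof -
  have "(\<Sum>z\<in>Ustep. qmean \<nu> z * step_wt \<nu> \<theta> z) = mgf \<theta> / exp (Lambda_c \<nu> \<theta>)"
    by (simp add: step_wt_def mgf_def exp_diff sum_divide_distrib)
  then show ?thesis by (simp add: mgf_eq_exp)
qed

end

section \<open>Second moments of the partition function\<close>

context rwre
begin

lemma integral_weight: "z \<in> Ustep \<Longrightarrow> (\<integral>\<omega>. \<omega> i z \<partial>\<P>) = qmean \<nu> z"
proof -
  assume z: "z \<in> Ustep"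
  have "qmean \<nu> z = (\<integral>p. p z \<partial>distr \<P> \<nu> (\<lambda>\<omega>. \<omega> i))"
    unfolding qmean_def env_measure_def by (simp add: PP.PiM_component)
  also have "\<dots> = (\<integral>\<omega>. \<omega> i z \<partial>\<P>)"
    using z by (intro integral_distr) (auto simp: env_measure_def)
  finally show ?thesis by simp
qed

lemma measurable_weight_env [measurable]: "z \<in> Ustep \<Longrightarrow> (\<lambda>\<omega>. \<omega> i z) \<in> borel_measurable \<P>"
  by (rule measurable_Bidx_env[OF measurable_weight_Bidx[of z i UNIV]]) auto

lemma AE_weight: "z \<in> Ustep \<Longrightarrow> AE \<omega> in \<P>. \<bar>\<omega> i z\<bar> \<le> 1"
proof -
  assume z: "z \<in> Ustep"
  show "AE \<omega> in \<P>. \<bar>\<omega> i z\<bar> \<le> 1"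
    using AE_good
  proof eventually_elim
    case (elim \<omega>)
    show ?case using good_pos[OF elim z, of i] good_bounds(2)[OF elim z, of i] by simp
  qed
qed

lemma integrable_weight_env: "z \<in> Ustep \<Longrightarrow> integrable \<P> (\<lambda>\<omega>. \<omega> i z)"
  by (rule integrable_bounded[OF _ AE_weight]) auto

lemma AE_weight2: "z \<in> Ustep \<Longrightarrow> z' \<in> Ustep \<Longrightarrow> AE \<omega> in \<P>. \<bar>\<omega> i z * \<omega> j z'\<bar> \<le> 1"
proof -
  assume z: "z \<in> Ustep" "z' \<in> Ustep"
  show "AE \<omega> in \<P>. \<bar>\<omega> i z * \<omega> j z'\<bar> \<le> 1"
    using AE_weight[OF z(1), of i] AE_weight[OF z(2), of j]
    by eventually_elim (auto simp: abs_mult intro!: mult_le_one)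
qed

lemma integrable_weight2: "z \<in> Ustep \<Longrightarrow> z' \<in> Ustep \<Longrightarrow> integrable \<P> (\<lambda>\<omega>. \<omega> i z * \<omega> j z')"
  by (rule integrable_bounded[OF _ AE_weight2]) auto

lemma integrable_part_fn: "integrable \<P> (part_fn \<nu> \<theta> n)"
  by (rule integrable_bounded[OF _ AE_abs_part_fn]) auto

lemma integrable_path_wt: "zs \<in> Ulists n \<Longrightarrow> integrable \<P> (path_wt \<nu> \<theta> zs)"
  by (rule integrable_bounded[OF _ AE_abs_path_wt]) auto

lemma AE_abs_part_fn_shift: "AE \<omega> in \<P>. \<bar>part_fn \<nu> \<theta> n (shift m y \<omega>)\<bar> \<le> path_bd \<theta> n"
  by (rule AE_shift[OF AE_abs_part_fn])

lemma integrable_part_fn_shift_mult: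
  "integrable \<P> f \<Longrightarrow> integrable \<P> (\<lambda>\<omega>. part_fn \<nu> \<theta> n (shift m y \<omega>) * f \<omega>)"
  by (rule integrable_mult_bounded[OF _ _ AE_abs_part_fn_shift]) auto

text \<open>The first step reads time 0, the rest of the path later times only; independence and
  stationarity give the recursion.\<close>

lemma integral_part_fn: "(\<integral>\<omega>. part_fn \<nu> \<theta> n \<omega> \<partial>\<P>) = 1"
proof (induction n)
  case 0 then show ?case by (simp add: P.prob_space)
next
  case (Suc n)
  have meas: "(\<lambda>\<omega>. part_fn \<nu> \<theta> n (shift 1 z \<omega>)) \<in> borel_measurable (Bidx \<nu> {i. 1 \<le> fst i})" for z
    by (rule measurable_compose[OF measurable_shift measurable_part_fn]) auto
  have int: "integrable \<P> (\<lambda>\<omega>. part_fn \<nu> \<theta> n (shift 1 z \<omega>))" for z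
    by (rule integrable_shift[OF integrable_part_fn])
  have t: "integrable \<P> (\<lambda>\<omega>. \<omega> (0,0) z * part_fn \<nu> \<theta> n (shift 1 z \<omega>))
      \<and> (\<integral>\<omega>. \<omega> (0,0) z * part_fn \<nu> \<theta> n (shift 1 z \<omega>) \<partial>\<P>) = qmean \<nu> z" if z: "z \<in> Ustep" for z
  proof
    show "integrable \<P> (\<lambda>\<omega>. \<omega> (0,0) z * part_fn \<nu> \<theta> n (shift 1 z \<omega>))"
      using z by (intro integrable_mult_bounded[OF int _ AE_weight]) auto
    have "(\<integral>\<omega>. \<omega> (0,0) z * part_fn \<nu> \<theta> n (shift 1 z \<omega>) \<partial>\<P>) = (\<integral>\<omega>. \<omega> (0,0) z \<partial>\<P>) * (\<integral>\<omega>. part_fn \<nu> \<theta> n (shift 1 z \<omega>) \<partial>\<P>)"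
      by (rule integral_mult_indep[OF measurable_weight_Bidx[of z _ "{(0,0)}"] meas]) (use z in \<open>auto intro: integrable_weight_env int\<close>)
    then show "(\<integral>\<omega>. \<omega> (0,0) z * part_fn \<nu> \<theta> n (shift 1 z \<omega>) \<partial>\<P>) = qmean \<nu> z"
      using z by (simp add: integral_weight integral_shift Suc.IH)
  qed
  have "(\<integral>\<omega>. part_fn \<nu> \<theta> (Suc n) \<omega> \<partial>\<P>) = (\<integral>\<omega>. (\<Sum>z\<in>Ustep. step_wt \<nu> \<theta> z * (\<omega> (0,0) z * part_fn \<nu> \<theta> n (shift 1 z \<omega>))) \<partial>\<P>)"
    by (intro Bochner_Integration.integral_cong refl) (simp add: part_fn_Suc ac_simps)
  also have "\<dots> = (\<Sum>z\<in>Ustep. step_wt \<nu> \<theta> z * qmean \<nu> z)"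
    using t by (subst Bochner_Integration.integral_sum) auto
  finally show ?case using sum_qmean_step_wt[of \<theta>] by (simp add: mult.commute)
qed

text \<open>Mixed moment for two walkers started at distance \<open>x\<close> in one environment.
  The second moment is the case \<open>x = 0\<close>; the other distances are needed because the
  walkers separate after one step.\<close>

definition overlap :: "real^'d \<Rightarrow> nat \<Rightarrow> int^'d \<Rightarrow> real" where
  "overlap \<theta> n x = (\<integral>\<omega>. part_fn \<nu> \<theta> n \<omega> * part_fn \<nu> \<theta> n (shift 0 x \<omega>) \<partial>\<P>)"

definition pair_mean :: "int^'d \<Rightarrow> int^'d \<Rightarrow> int^'d \<Rightarrow> real" where
  "pair_mean x z z' = (\<integral>\<omega>. \<omega> (0,0) z * \<omega> (0,x) z' \<partial>\<P>)"

lemma overlap_0: "overlap \<theta> 0 x = 1"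
  by (simp add: overlap_def P.prob_space)

text \<open>The present slice is independent of the later ones, and by stationarity the later ones
  see only the new difference of the walkers.\<close>

lemma overlap_Suc:
  "overlap \<theta> (Suc n) x = (\<Sum>z\<in>Ustep. \<Sum>z'\<in>Ustep.
     pair_mean x z z' * step_wt \<nu> \<theta> z * step_wt \<nu> \<theta> z' * overlap \<theta> n (x + (z' - z)))"
proof -
  let ?U = "part_fn \<nu> \<theta> n" and ?w = "step_wt \<nu> \<theta>"
  let ?g = "\<lambda>z z' \<omega>. ?U (shift 1 z \<omega>) * ?U (shift 1 (z' + x) \<omega>)"
  have meas: "?g z z' \<in> borel_measurable (Bidx \<nu> {i. 1 \<le> fst i})" for z z'
    by (intro borel_measurable_times measurable_compose[OF measurable_shift measurable_part_fn]) auto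
  have int: "integrable \<P> (?g z z')" for z z'
    by (intro integrable_part_fn_shift_mult integrable_shift integrable_part_fn)
  have g: "(\<integral>\<omega>. ?g z z' \<omega> \<partial>\<P>) = overlap \<theta> n (x + (z' - z))" for z z'
    unfolding overlap_def
    using integral_shift[of "\<lambda>\<omega>. ?U \<omega> * ?U (shift 0 (x + (z' - z)) \<omega>)" 1 z] by (simp add: add.commute)
  have t: "integrable \<P> (\<lambda>\<omega>. (\<omega> (0,0) z * \<omega> (0,x) z') * ?g z z' \<omega>)
      \<and> (\<integral>\<omega>. (\<omega> (0,0) z * \<omega> (0,x) z') * ?g z z' \<omega> \<partial>\<P>) = pair_mean x z z' * overlap \<theta> n (x + (z' - z))"
    if z: "z \<in> Ustep" "z' \<in> Ustep" for z z'
  proof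
    show "integrable \<P> (\<lambda>\<omega>. (\<omega> (0,0) z * \<omega> (0,x) z') * ?g z z' \<omega>)"
      using z by (intro integrable_mult_bounded[OF int _ AE_weight2]) auto
    have "(\<integral>\<omega>. (\<omega> (0,0) z * \<omega> (0,x) z') * ?g z z' \<omega> \<partial>\<P>) = (\<integral>\<omega>. \<omega> (0,0) z * \<omega> (0,x) z' \<partial>\<P>) * (\<integral>\<omega>. ?g z z' \<omega> \<partial>\<P>)"
    proof (rule integral_mult_indep[OF _ meas])
      show "(\<lambda>\<omega>. \<omega> (0,0) z * \<omega> (0,x) z') \<in> borel_measurable (Bidx \<nu> {i. fst i = 0})"
        using z by (intro borel_measurable_times measurable_weight_Bidx) auto
    qed (use z in \<open>auto intro: integrable_weight2 int\<close>)
    then show "(\<integral>\<omega>. (\<omega> (0,0) z * \<omega> (0,x) z') * ?g z z' \<omega> \<partial>\<P>) = pair_mean x z z' * overlap \<theta> n (x + (z' - z))"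
      by (simp only: g pair_mean_def)
  qed
  have "overlap \<theta> (Suc n) x = (\<integral>\<omega>. (\<Sum>z\<in>Ustep. \<Sum>z'\<in>Ustep. (?w z * ?w z') * ((\<omega> (0,0) z * \<omega> (0,x) z') * ?g z z' \<omega>)) \<partial>\<P>)"
    unfolding overlap_def part_fn_Suc sum_product
    by (intro Bochner_Integration.integral_cong refl sum.cong) (simp add: shift_apply ac_simps)
  also have "\<dots> = (\<Sum>z\<in>Ustep. \<Sum>z'\<in>Ustep. (?w z * ?w z') * (pair_mean x z z' * overlap \<theta> n (x + (z' - z))))"
    using t by (subst Bochner_Integration.integral_sum, force)+ (auto intro!: sum.cong)
  finally show ?thesis by (simp add: ac_simps)
qed

lemma pair_mean_indep: "x \<noteq> 0 \<Longrightarrow> z \<in> Ustep \<Longrightarrow> z' \<in> Ustep \<Longrightarrow> pair_mean x z z' = qmean \<nu> z * qmean \<nu> z'"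
  unfolding pair_mean_def
  by (subst integral_mult_indep[OF measurable_weight_Bidx[of z _ "{(0,0)}"] measurable_weight_Bidx[of z' _ "{(0,x)}"]])
     (auto intro: integrable_weight_env simp: integral_weight)

lemma pair_mean_ge: "z \<in> Ustep \<Longrightarrow> z' \<in> Ustep \<Longrightarrow> c1 * c1 \<le> pair_mean x z z'"
  unfolding pair_mean_def
proof (rule P.integral_ge_const)
  assume z: "z \<in> Ustep" "z' \<in> Ustep"
  show "AE \<omega> in \<P>. c1 * c1 \<le> \<omega> (0,0) z * \<omega> (0,x) z'"
    using AE_good
  proof eventually_elim
    case (elim \<omega>)
    show ?case
      using good_bounds(1)[OF elim z(1), of "(0,0)"] good_bounds(1)[OF elim z(2), of "(0,x)"] c1_pos
      by (intro mult_mono) auto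
  qed
qed (rule integrable_weight2)

text \<open>Also on the diagonal: two walkers at one site both use the same probability vector. The
  total pair weight can thus exceed 1 only through \<open>step_wt\<close>, by a factor that tends to
  1 with \<theta>.\<close>

lemma sum_pair_mean: "(\<Sum>z\<in>Ustep. \<Sum>z'\<in>Ustep. pair_mean x z z') = 1"
proof -
  have "(\<Sum>z\<in>Ustep. \<Sum>z'\<in>Ustep. pair_mean x z z') = (\<integral>\<omega>. (\<Sum>z\<in>Ustep. \<Sum>z'\<in>Ustep. \<omega> (0,0) z * \<omega> (0,x) z') \<partial>\<P>)"
    unfolding pair_mean_def using integrable_weight2
    by (subst Bochner_Integration.integral_sum, force)+ (auto intro!: sum.cong)
  also have "\<dots> = (\<integral>\<omega>. 1 \<partial>\<P>)"
  proof (rule integral_cong_AE)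
    show "AE \<omega> in \<P>. (\<Sum>z\<in>Ustep. \<Sum>z'\<in>Ustep. \<omega> (0,0) z * \<omega> (0,x) z') = 1"
      using AE_good by eventually_elim (simp add: sum_product[symmetric] good_def)
  qed (auto intro!: borel_measurable_sum)
  finally show ?thesis by (simp add: P.prob_space)
qed

text \<open>The tilt changes each step probability by at most a factor 2, which costs half of the
  ellipticity constant.\<close>

lemma step_dist_tilted:
  assumes "norm \<theta> \<le> r" "exp (2 * r) \<le> 2"
  shows "step_dist (\<lambda>z. qmean \<nu> z * step_wt \<nu> \<theta> z) (c1 / 2)"
proof
  show "0 < c1 / 2" using c1_pos by simp
  show "(\<Sum>z\<in>Ustep. qmean \<nu> z * step_wt \<nu> \<theta> z) = 1" by (rule sum_qmean_step_wt)
  fix z :: "int^'d" assume z: "z \<in> Ustep"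
  have "1 / 2 \<le> exp (- 2 * r)" using assms(2) by (simp add: exp_minus field_simps)
  then have "c1 * (1/2) \<le> qmean \<nu> z * step_wt \<nu> \<theta> z"
    using qmean_ge[OF z] step_wt_bounds(2)[OF assms(1) z] c1_pos by (intro mult_mono) auto
  then show "c1 / 2 \<le> qmean \<nu> z * step_wt \<nu> \<theta> z" by simp
qed

text \<open>Writing \<open>D\<close> for the difference of two walks in the same environment, \<open>1 + (Q D + R)\<^sup>-\<^sup>s\<close> is superharmonic
  for the pair weights: away from the diagonal by transience in dimension at least three, and on the
  diagonal because the gain at a collision tends to zero with \<open>\<theta>\<close> while ellipticity forces a definite
  decrease.\<close>
lemma overlap_bounded:
  assumes d: "CARD('d) \<ge> 3"
  shows "\<exists>r>0. \<exists>B. \<forall>\<theta>. norm \<theta> < r \<longrightarrow> (\<forall>n. overlap \<theta> n 0 \<le> B)"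
proof -
  define c where "c = c1 / 2"
  have c: "c > 0" using c1_pos by (simp add: c_def)
  obtain s \<epsilon> where s: "0 < s" and e: "0 < \<epsilon>" "\<epsilon> \<le> 1/2" and quad:
    "\<And>\<tau>. \<bar>\<tau>\<bar> \<le> \<epsilon> \<Longrightarrow> (1 + \<tau>) powr (-s) \<le> 1 - s * \<tau> + s * (1/2 + c) * \<tau>\<^sup>2"
    using powr_minus_le_quadratic[OF c] by blast
  define R where "R = Max {32 / (c * \<epsilon>\<^sup>2), 4 / (c * \<epsilon>), (1/2 + c) / c ^ 3, 1}"
  have R: "32 / (c * \<epsilon>\<^sup>2) \<le> R" "4 / (c * \<epsilon>) \<le> R" "(1/2 + c) / c ^ 3 \<le> R" "1 \<le> R"
    by (simp_all add: R_def)
  \<comment> \<open>Value of the decaying part on the diagonal; \<open>g1\<close> is an upper bound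
    for it off the diagonal, by \<open>Qf_ge_1\<close>.\<close>
  define g0 where "g0 = R powr (-s)"
  define g1 where "g1 = (R + 1) powr (-s)"
  have g: "0 < g1" "g1 < g0" unfolding g0_def g1_def using R(4) s by (auto intro!: powr_less_mono2_neg)
  \<comment> \<open>Solves \<open>\<rho> * (1 + g0) = c1^2 / 4 * (g0 - g1)\<close>: the largest
    relative gain of mass at a collision that the guaranteed decrease can pay for.\<close>
  define \<rho> where "\<rho> = c1\<^sup>2 / 4 * (g0 - g1) / (1 + g0)"
  have rho: "\<rho> > 0" using g c1_pos by (simp add: \<rho>_def)
  \<comment> \<open>The first entry keeps every tilted step weight within a factor 2 of 1, the
    second keeps the product of two of them below \<open>1 + \<rho>\<close>.\<close>
  define r where "r = min (ln 2 / 2) (ln (1 + \<rho>) / 4)"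
  have r: "r > 0" using rho by (simp add: r_def)
  have "2 * r \<le> ln 2" by (simp add: r_def)
  then have r2: "exp (2 * r) \<le> 2" by (metis exp_le_cancel_iff exp_ln zero_less_numeral)
  have "4 * r \<le> ln (1 + \<rho>)" by (simp add: r_def)
  then have r4: "exp (4 * r) \<le> 1 + \<rho>" using rho by (metis add_pos_pos exp_le_cancel_iff exp_ln zero_less_one)
  have "overlap \<theta> n 0 \<le> 1 + g0" if th: "norm \<theta> < r" for \<theta> n
  proof -
    let ?w = "step_wt \<nu> \<theta>"
    have th': "norm \<theta> \<le> r" using th by simp
    interpret S: step_dist "\<lambda>z. qmean \<nu> z * ?w z" c
      unfolding c_def by (rule step_dist_tilted[OF th' r2])
    \<comment> \<open>The summand 1 dominates the initial overlap, and the averaging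
      \<open>EE\<close> preserves it.\<close>
    define V where "V x = 1 + (S.Qf x + R) powr (-s)" for x
    have V0: "V x \<le> 1 + g0" for x
      using S.Qf_nonneg[of x] R(4) s by (auto simp: V_def g0_def intro!: powr_mono2')
    have V1: "V x \<le> 1 + g1" if "x \<noteq> 0" for x
      using S.Qf_ge_1[OF that] R(4) s by (auto simp: V_def g1_def intro!: powr_mono2')
    have "overlap \<theta> n x \<le> V x" for x
    proof (induction n arbitrary: x)
      case 0 then show ?case by (simp add: overlap_0 V_def)
    next
      case (Suc n)
      show ?case
      proof (cases "x = 0")
        case False
        have "overlap \<theta> (Suc n) x = S.EE (\<lambda>y. overlap \<theta> n (x + y))"
          unfolding overlap_Suc S.EE_def using False
          by (intro sum.cong refl) (simp add: pair_mean_indep ac_simps)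
        also have "\<dots> \<le> S.EE (\<lambda>y. 1 + (S.Qf (x + y) + R) powr (-s))"
          using Suc.IH unfolding V_def by (intro S.EE_mono)
        also have "\<dots> = 1 + S.EE (\<lambda>y. (S.Qf (x + y) + R) powr (-s))" by (simp only: S.EE_add S.EE_const)
        also have "\<dots> \<le> V x"
          unfolding V_def using S.superharmonic[OF d s e(1) quad R(1-3) e(2)] by simp
        finally show ?thesis .
      next
        case True
        \<comment> \<open>One pair of opposite steps suffices: it separates the walkers and has pair
          weight at least \<open>c1^2 / 4\<close>, a factor \<open>c1^2\<close> from ellipticity and
          1/2 from each tilted step.\<close>
        define a where "a = (axis undefined 1 :: int^'d)"
        define b where "b = (axis undefined (-1) :: int^'d)"
        have ab: "a \<in> Ustep" "b \<in> Ustep" "b - a \<noteq> 0" by (auto simp: a_def b_def axis_in_Ustep axis_eq_axis)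
        define K where "K z z' = pair_mean 0 z z' * ?w z * ?w z'" for z z'
        have pm0: "0 \<le> pair_mean 0 z z'" if "z \<in> Ustep" "z' \<in> Ustep" for z z'
          using pair_mean_ge[OF that, of 0] c1_pos by (meson less_imp_le mult_pos_pos order_trans)
        have K0: "0 \<le> K z z'" if "z \<in> Ustep" "z' \<in> Ustep" for z z'
          using pm0[OF that] by (simp add: K_def less_imp_le)
        have "K z z' \<le> pair_mean 0 z z' * exp (4 * r)" if z: "z \<in> Ustep" "z' \<in> Ustep" for z z'
        proof -
          have "?w z * ?w z' \<le> exp (2 * r) * exp (2 * r)"
            using step_wt_bounds(1)[OF th'] z by (intro mult_mono) (auto simp: less_imp_le)
          then have "?w z * ?w z' \<le> exp (4 * r)" by (simp add: exp_add[symmetric])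
          then show ?thesis unfolding K_def mult.assoc using pm0[OF z] by (rule mult_left_mono)
        qed
        then have "(\<Sum>z\<in>Ustep. \<Sum>z'\<in>Ustep. K z z') \<le> (\<Sum>z\<in>Ustep. \<Sum>z'\<in>Ustep. pair_mean 0 z z' * exp (4 * r))"
          by (intro sum_mono)
        also have "\<dots> = exp (4 * r)" unfolding sum_distrib_right[symmetric] sum_pair_mean by simp
        finally have KS: "(\<Sum>z\<in>Ustep. \<Sum>z'\<in>Ustep. K z z') \<le> 1 + \<rho>" using r4 by simp
        have "1 / 2 \<le> exp (- 2 * r)" using r2 by (simp add: exp_minus field_simps)
        then have "(1/2) * (1/2) \<le> ?w a * ?w b"
          using step_wt_bounds(2)[OF th' ab(1)] step_wt_bounds(2)[OF th' ab(2)] by (intro mult_mono) auto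
        then have "(c1 * c1) * ((1/2) * (1/2)) \<le> pair_mean 0 a b * (?w a * ?w b)"
          by (rule mult_mono[OF pair_mean_ge[OF ab(1,2)]]) (use pm0[OF ab(1,2)] in auto)
        then have Kab: "c1\<^sup>2 / 4 \<le> K a b" by (simp add: K_def power2_eq_square mult.assoc)
        have "overlap \<theta> (Suc n) x = (\<Sum>z\<in>Ustep. \<Sum>z'\<in>Ustep. K z z' * overlap \<theta> n (z' - z))"
          unfolding overlap_Suc True K_def by simp
        \<comment> \<open>Only the pair \<open>(a, b)\<close> is credited with the decrease
          \<open>g0 - g1\<close>; all other pairs are bounded by the maximum \<open>1 + g0\<close>
          of \<open>V\<close>.\<close>
        also have "\<dots> \<le> (\<Sum>z\<in>Ustep. \<Sum>z'\<in>Ustep. K z z' * ((1 + g0) - (if z = a then (if z' = b then g0 - g1 else 0) else 0)))"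
        proof (intro sum_mono mult_left_mono K0)
          fix z z' show "overlap \<theta> n (z' - z) \<le> (1 + g0) - (if z = a then (if z' = b then g0 - g1 else 0) else 0)"
            using Suc.IH[of "z' - z"] V0[of "z' - z"] V1[of "z' - z"] ab(3) by auto
        qed auto
        also have "\<dots> = (\<Sum>z\<in>Ustep. \<Sum>z'\<in>Ustep. K z z') * (1 + g0)
           - (\<Sum>z\<in>Ustep. if z = a then (\<Sum>z'\<in>Ustep. if z' = b then K z z' * (g0 - g1) else 0) else 0)"
          unfolding right_diff_distrib sum_subtractf sum_distrib_right
          by (intro arg_cong2[of _ _ _ _ minus] refl sum.cong) (auto intro!: sum.cong simp: right_diff_distrib)
        also have "\<dots> = (\<Sum>z\<in>Ustep. \<Sum>z'\<in>Ustep. K z z') * (1 + g0) - K a b * (g0 - g1)"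
          by (simp only: sum.delta[OF finite_Ustep] ab if_True)
        also have "\<dots> \<le> (1 + \<rho>) * (1 + g0) - c1\<^sup>2 / 4 * (g0 - g1)"
          using KS Kab g by (intro diff_mono mult_right_mono) auto
        also have "\<dots> = 1 + g0"
        proof -
          have "\<rho> * (1 + g0) = c1\<^sup>2 / 4 * (g0 - g1)" 
          proof -
            have ne: "1 + g0 \<noteq> 0" using g by simp
            have "x / y * y = x" if "y \<noteq> 0" for x y :: real using that by simp
            from this[OF ne] show ?thesis unfolding \<rho>_def .
          qed
          then show ?thesis by (simp add: distrib_right)
        qed
        also have "\<dots> = V x" by (simp add: V_def True g0_def)
        finally show ?thesis .
      qed
    qed
    then show ?thesis using V0 order_trans by blast
  qed
  then show ?thesis using r by blast
qed

end

section \<open>The harmonic function\<close>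

text \<open>Completeness of L1 with control of the sigma-algebra: the limit is taken pointwise along
  a subsequence, so it inherits measurability from \<open>F\<close>. Fatou's lemma then turns the
  Cauchy estimate into convergence of the full sequence.\<close>

lemma L1_Cauchy_limit:
  fixes s :: "nat \<Rightarrow> 'a \<Rightarrow> real"
  assumes sub: "subalgebra M F" and meas: "\<And>n. s n \<in> borel_measurable F" and int: "\<And>n. integrable M (s n)"
    and cauchy: "\<And>e. e > 0 \<Longrightarrow> \<exists>N. \<forall>i\<ge>N. \<forall>j\<ge>N. (\<integral>x. \<bar>s i x - s j x\<bar> \<partial>M) < e"
  obtains u where "u \<in> borel_measurable F" "integrable M u" "(\<lambda>n. \<integral>x. \<bar>s n x - u x\<bar> \<partial>M) \<longlonglongrightarrow> 0"
proof -
  obtain r where r: "strict_mono r" "AE x in M. Cauchy (\<lambda>i. s (r i) x)"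
    using cauchy_L1_AE_cauchy_subseq[of M s] int cauchy by auto
  \<comment> \<open>\<open>lim\<close> is total and yields an \<open>F\<close>-measurable function
    even where the subsequence diverges.\<close>
  define u where "u x = lim (\<lambda>i. s (r i) x)" for x
  have uF: "u \<in> borel_measurable F" unfolding u_def[abs_def] using meas by (intro borel_measurable_lim_metric)
  have uM [measurable]: "u \<in> borel_measurable M" by (rule measurable_from_subalg[OF sub uF])
  have sM [measurable]: "s n \<in> borel_measurable M" for n using int by auto
  have conv: "AE x in M. (\<lambda>i. s (r i) x) \<longlonglongrightarrow> u x"
    using r(2) by eventually_elim (auto simp: u_def Cauchy_convergent_iff convergent_LIMSEQ_iff)
  have bd: "\<exists>N. \<forall>n\<ge>N. (\<integral>\<^sup>+x. ennreal \<bar>s n x - u x\<bar> \<partial>M) \<le> ennreal e" if e: "e > 0" for e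
  proof -
    obtain N where N: "\<And>i j. i \<ge> N \<Longrightarrow> j \<ge> N \<Longrightarrow> (\<integral>x. \<bar>s i x - s j x\<bar> \<partial>M) < e" using cauchy[OF e] by blast
    have "(\<integral>\<^sup>+x. ennreal \<bar>s n x - u x\<bar> \<partial>M) \<le> ennreal e" if n: "n \<ge> N" for n
    proof -
      have "(\<integral>\<^sup>+x. ennreal \<bar>s n x - u x\<bar> \<partial>M) = (\<integral>\<^sup>+x. liminf (\<lambda>i. ennreal \<bar>s n x - s (r i) x\<bar>) \<partial>M)"
      proof (rule nn_integral_cong_AE)
        show "AE x in M. ennreal \<bar>s n x - u x\<bar> = liminf (\<lambda>i. ennreal \<bar>s n x - s (r i) x\<bar>)"
          using conv
        proof eventually_elim
          case (elim x)
          have "(\<lambda>i. ennreal \<bar>s n x - s (r i) x\<bar>) \<longlonglongrightarrow> ennreal \<bar>s n x - u x\<bar>"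
            by (intro tendsto_ennrealI tendsto_intros elim)
          then show ?case by (rule lim_imp_Liminf[OF sequentially_bot, symmetric])
        qed
      qed
      also have "\<dots> \<le> liminf (\<lambda>i. \<integral>\<^sup>+x. ennreal \<bar>s n x - s (r i) x\<bar> \<partial>M)"
        by (rule nn_integral_liminf) simp
      also have "\<dots> \<le> ennreal e"
      proof (rule Liminf_le)
        have "r i \<ge> N" if "i \<ge> N" for i using seq_suble[OF r(1), of i] that by linarith
        then have "(\<integral>\<^sup>+x. ennreal \<bar>s n x - s (r i) x\<bar> \<partial>M) \<le> ennreal e" if "i \<ge> N" for i
          using that less_imp_le[OF N[OF n, of "r i"]] int by (subst nn_integral_eq_integral) (auto intro!: ennreal_leI)
        then show "\<forall>\<^sub>F i in sequentially. (\<integral>\<^sup>+x. ennreal \<bar>s n x - s (r i) x\<bar> \<partial>M) \<le> ennreal e"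
          unfolding eventually_sequentially by blast
      qed simp
      finally show ?thesis .
    qed
    then show ?thesis by blast
  qed
  have dint: "integrable M (\<lambda>x. s n x - u x)" if "(\<integral>\<^sup>+x. ennreal \<bar>s n x - u x\<bar> \<partial>M) \<le> ennreal e" for n e
    using that by (intro integrableI_bounded) (auto intro: le_less_trans)
  have intu: "integrable M u"
  proof -
    obtain N where "(\<integral>\<^sup>+x. ennreal \<bar>s N x - u x\<bar> \<partial>M) \<le> ennreal 1" using bd[of 1] by auto
    from Bochner_Integration.integrable_diff[OF int[of N] dint[OF this]] show ?thesis by simp
  qed
  have "(\<lambda>n. \<integral>x. \<bar>s n x - u x\<bar> \<partial>M) \<longlonglongrightarrow> 0"
  proof (rule LIMSEQ_I)
    fix e :: real assume e: "e > 0"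
    then obtain N where N: "\<And>n. n \<ge> N \<Longrightarrow> (\<integral>\<^sup>+x. ennreal \<bar>s n x - u x\<bar> \<partial>M) \<le> ennreal (e/2)"
      using bd[of "e/2"] by auto
    have "norm ((\<integral>x. \<bar>s n x - u x\<bar> \<partial>M) - 0) < e" if "n \<ge> N" for n
    proof -
      have "(\<integral>\<^sup>+x. ennreal \<bar>s n x - u x\<bar> \<partial>M) = ennreal (\<integral>x. \<bar>s n x - u x\<bar> \<partial>M)"
        using int intu by (intro nn_integral_eq_integral) auto
      then have "(\<integral>x. \<bar>s n x - u x\<bar> \<partial>M) \<le> e/2" using N[OF that] e by simp
      then show ?thesis using e by simp
    qed
    then show "\<exists>N. \<forall>n\<ge>N. norm ((\<integral>x. \<bar>s n x - u x\<bar> \<partial>M) - 0) < e" by blast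
  qed
  then show ?thesis using that uF intu by blast
qed

section \<open>L1 limit of the partition functions and the zero-one law\<close>

context rwre
begin

text \<open>The variance of the absolute value is nonnegative.\<close>

lemma integral_abs_le_sqrt:
  assumes "f \<in> borel_measurable \<P>" "integrable \<P> (\<lambda>\<omega>. (f \<omega> :: real)\<^sup>2)" "integrable \<P> f"
  shows "(\<integral>\<omega>. \<bar>f \<omega>\<bar> \<partial>\<P>) \<le> sqrt (\<integral>\<omega>. (f \<omega>)\<^sup>2 \<partial>\<P>)"
proof -
  let ?m = "\<integral>\<omega>. \<bar>f \<omega>\<bar> \<partial>\<P>"
  have "0 \<le> (\<integral>\<omega>. (\<bar>f \<omega>\<bar> - ?m)\<^sup>2 \<partial>\<P>)" by (intro Bochner_Integration.integral_nonneg) simp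
  also have "\<dots> = (\<integral>\<omega>. (f \<omega>)\<^sup>2 - 2 * ?m * \<bar>f \<omega>\<bar> + ?m\<^sup>2 \<partial>\<P>)"
    by (intro Bochner_Integration.integral_cong refl) (simp add: power2_eq_square algebra_simps)
  also have "\<dots> = (\<integral>\<omega>. (f \<omega>)\<^sup>2 \<partial>\<P>) - ?m\<^sup>2"
    using assms by (simp add: P.prob_space power2_eq_square)
  finally show ?thesis by (intro real_le_rsqrt) simp
qed

text \<open>Martingale orthogonality without conditional expectations: cutting the longer path at
  time \<open>n\<close> leaves a factor that reads only times from \<open>n\<close> on and has mean
  1.\<close>

lemma integral_part_fn_mult: "(\<integral>\<omega>. part_fn \<nu> \<theta> (n + k) \<omega> * part_fn \<nu> \<theta> n \<omega> \<partial>\<P>) = overlap \<theta> n 0"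
proof -
  let ?U = "part_fn \<nu> \<theta>" and ?W = "path_wt \<nu> \<theta>"
  have t: "integrable \<P> (\<lambda>\<omega>. (?U n \<omega> * ?W zs \<omega>) * ?U k (shift (int n) (sum_list zs) \<omega>))
     \<and> (\<integral>\<omega>. (?U n \<omega> * ?W zs \<omega>) * ?U k (shift (int n) (sum_list zs) \<omega>) \<partial>\<P>) = (\<integral>\<omega>. ?U n \<omega> * ?W zs \<omega> \<partial>\<P>)"
    if zs: "zs \<in> Ulists n" for zs
  proof
    have int: "integrable \<P> (\<lambda>\<omega>. ?U n \<omega> * ?W zs \<omega>)"
      by (rule integrable_mult_bounded[OF integrable_path_wt[OF zs] _ AE_abs_part_fn]) auto
    have int2: "integrable \<P> (\<lambda>\<omega>. ?U k (shift (int n) (sum_list zs) \<omega>))"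
      by (rule integrable_shift[OF integrable_part_fn])
    show "integrable \<P> (\<lambda>\<omega>. (?U n \<omega> * ?W zs \<omega>) * ?U k (shift (int n) (sum_list zs) \<omega>))"
      using integrable_part_fn_shift_mult[OF int, of \<theta> k "int n" "sum_list zs"] by (simp add: mult.commute)
    have "(\<integral>\<omega>. (?U n \<omega> * ?W zs \<omega>) * ?U k (shift (int n) (sum_list zs) \<omega>) \<partial>\<P>)
      = (\<integral>\<omega>. ?U n \<omega> * ?W zs \<omega> \<partial>\<P>) * (\<integral>\<omega>. ?U k (shift (int n) (sum_list zs) \<omega>) \<partial>\<P>)"
    proof (rule integral_mult_indep[OF _ _ _ int int2])
      show "(\<lambda>\<omega>. ?U n \<omega> * ?W zs \<omega>) \<in> borel_measurable (Bidx \<nu> {i. 0 \<le> fst i \<and> fst i < int n})"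
        by (intro borel_measurable_times measurable_part_fn measurable_path_wt zs)
      show "(\<lambda>\<omega>. ?U k (shift (int n) (sum_list zs) \<omega>)) \<in> borel_measurable (Bidx \<nu> {i. int n \<le> fst i})"
        by (rule measurable_compose[OF measurable_shift measurable_part_fn]) auto
    qed auto
    then show "(\<integral>\<omega>. (?U n \<omega> * ?W zs \<omega>) * ?U k (shift (int n) (sum_list zs) \<omega>) \<partial>\<P>) = (\<integral>\<omega>. ?U n \<omega> * ?W zs \<omega> \<partial>\<P>)"
      by (simp add: integral_shift integral_part_fn)
  qed
  have "(\<integral>\<omega>. ?U (n + k) \<omega> * ?U n \<omega> \<partial>\<P>)
    = (\<integral>\<omega>. (\<Sum>zs\<in>Ulists n. (?U n \<omega> * ?W zs \<omega>) * ?U k (shift (int n) (sum_list zs) \<omega>)) \<partial>\<P>)"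
    by (intro Bochner_Integration.integral_cong refl) (simp add: part_fn_add sum_distrib_left mult_ac)
  also have "\<dots> = (\<Sum>zs\<in>Ulists n. \<integral>\<omega>. ?U n \<omega> * ?W zs \<omega> \<partial>\<P>)"
    using t by (subst Bochner_Integration.integral_sum) auto
  also have "\<dots> = (\<integral>\<omega>. (\<Sum>zs\<in>Ulists n. ?U n \<omega> * ?W zs \<omega>) \<partial>\<P>)"
    by (subst Bochner_Integration.integral_sum)
       (auto intro!: integrable_mult_bounded[OF integrable_path_wt _ AE_abs_part_fn])
  also have "\<dots> = overlap \<theta> n 0"
    unfolding overlap_def by (simp add: sum_distrib_left[symmetric] part_fn_def[symmetric])
  finally show ?thesis .
qed

lemma integrable_part_fn_mult: "integrable \<P> (\<lambda>\<omega>. part_fn \<nu> \<theta> n \<omega> * part_fn \<nu> \<theta> m \<omega>)"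
  by (rule integrable_mult_bounded[OF integrable_part_fn _ AE_abs_part_fn]) auto

text \<open>Pythagoras for martingale increments; in particular the second moments increase with the
  time.\<close>

lemma part_fn_L2_diff:
  "integrable \<P> (\<lambda>\<omega>. (part_fn \<nu> \<theta> (n + k) \<omega> - part_fn \<nu> \<theta> n \<omega>)\<^sup>2)"
  "(\<integral>\<omega>. (part_fn \<nu> \<theta> (n + k) \<omega> - part_fn \<nu> \<theta> n \<omega>)\<^sup>2 \<partial>\<P>) = overlap \<theta> (n + k) 0 - overlap \<theta> n 0"
proof -
  let ?U = "part_fn \<nu> \<theta>"
  have e: "(?U (n + k) \<omega> - ?U n \<omega>)\<^sup>2 = ?U (n + k) \<omega> * ?U (n + k) \<omega> - 2 * (?U (n + k) \<omega> * ?U n \<omega>) + ?U n \<omega> * ?U n \<omega>" for \<omega>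
    by (simp add: power2_eq_square algebra_simps)
  show "integrable \<P> (\<lambda>\<omega>. (?U (n + k) \<omega> - ?U n \<omega>)\<^sup>2)"
    unfolding e by (intro Bochner_Integration.integrable_add Bochner_Integration.integrable_diff integrable_mult_right integrable_part_fn_mult)
  have "(\<integral>\<omega>. (?U (n + k) \<omega> - ?U n \<omega>)\<^sup>2 \<partial>\<P>)
    = (\<integral>\<omega>. ?U (n + k) \<omega> * ?U (n + k) \<omega> \<partial>\<P>) - 2 * (\<integral>\<omega>. ?U (n + k) \<omega> * ?U n \<omega> \<partial>\<P>) + (\<integral>\<omega>. ?U n \<omega> * ?U n \<omega> \<partial>\<P>)"
    unfolding e by (simp add: integrable_part_fn_mult)
  then show "(\<integral>\<omega>. (?U (n + k) \<omega> - ?U n \<omega>)\<^sup>2 \<partial>\<P>) = overlap \<theta> (n + k) 0 - overlap \<theta> n 0"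
    using integral_part_fn_mult[of \<theta> "n + k" 0] integral_part_fn_mult[of \<theta> n 0]
    by (simp add: integral_part_fn_mult)
qed

text \<open>A bounded increasing sequence of second moments is Cauchy, and its increments are
  squared L2 distances.\<close>

lemma part_fn_L1_Cauchy:
  assumes B: "\<And>n. overlap \<theta> n 0 \<le> B" and e: "e > 0"
  shows "\<exists>N. \<forall>i\<ge>N. \<forall>j\<ge>N. (\<integral>\<omega>. \<bar>part_fn \<nu> \<theta> i \<omega> - part_fn \<nu> \<theta> j \<omega>\<bar> \<partial>\<P>) < e"
proof -
  have "0 \<le> overlap \<theta> (n + k) 0 - overlap \<theta> n 0" for n k
    unfolding part_fn_L2_diff(2)[symmetric] by (intro Bochner_Integration.integral_nonneg) simp
  then have inc: "incseq (\<lambda>n. overlap \<theta> n 0)" by (intro incseq_SucI) (metis Suc_eq_plus1 diff_ge_0_iff_ge)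
  then have "Cauchy (\<lambda>n. overlap \<theta> n 0)"
    by (metis B LIMSEQ_imp_Cauchy incseq_convergent)
  then obtain N where N: "\<And>m n. m \<ge> N \<Longrightarrow> n \<ge> N \<Longrightarrow> \<bar>overlap \<theta> m 0 - overlap \<theta> n 0\<bar> < e\<^sup>2"
    using e unfolding Cauchy_def dist_real_def by (metis zero_less_power)
  have le: "(\<integral>\<omega>. \<bar>part_fn \<nu> \<theta> (n + k) \<omega> - part_fn \<nu> \<theta> n \<omega>\<bar> \<partial>\<P>) < e" if "n \<ge> N" for n k
  proof -
    have "(\<integral>\<omega>. \<bar>part_fn \<nu> \<theta> (n + k) \<omega> - part_fn \<nu> \<theta> n \<omega>\<bar> \<partial>\<P>) \<le> sqrt (overlap \<theta> (n + k) 0 - overlap \<theta> n 0)"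
      unfolding part_fn_L2_diff(2)[symmetric]
      by (intro integral_abs_le_sqrt part_fn_L2_diff(1) Bochner_Integration.integrable_diff integrable_part_fn borel_measurable_diff measurable_part_fn_env)
    also have "\<dots> < sqrt (e\<^sup>2)" using N[of "n + k" n] that by (intro real_sqrt_less_mono) auto
    finally show ?thesis using e by simp
  qed
  have "(\<integral>\<omega>. \<bar>part_fn \<nu> \<theta> i \<omega> - part_fn \<nu> \<theta> j \<omega>\<bar> \<partial>\<P>) < e" if "i \<ge> N" "j \<ge> N" for i j
  proof (cases "j \<le> i")
    case True then show ?thesis using le[of j "i - j"] that by simp
  next
    case False then show ?thesis using le[of i "j - i"] that by (simp add: abs_minus_commute)
  qed
  then show ?thesis by blast
qed

text \<open>A closed set is almost surely equal to each of its preimages under iterates of the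
  shift. The \<open>n\<close>-th preimage reads only times from \<open>n\<close> on, so the set is
  independent of every slab of finitely many time slices from 0 on. These generate
  \<open>Bplus \<nu> 0\<close>, hence the set is independent of itself.\<close>

lemma zero_one_law:
  assumes A: "A \<in> sets (Bplus \<nu> 0)" and closed: "AE \<omega> in \<P>. \<omega> \<in> A \<longrightarrow> shift 1 z \<omega> \<in> A"
  shows "measure \<P> A = 0 \<or> measure \<P> A = 1"
proof -
  have AP: "A \<in> sets \<P>" using A subalgebra_Bidx[of \<nu>] by (auto simp: Bplus_eq subalgebra_def)
  define Tn where "Tn n = shift (int n) (\<Sum>i<n. z) -` A \<inter> space \<P>" for n
  have TnP: "Tn n \<in> sets \<P>" for n unfolding Tn_def using AP by measurable
  have mT: "measure \<P> (shift m y -` A \<inter> space \<P>) = measure \<P> A" for m y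
    using measure_distr[OF measurable_shift_env AP, of m y] by (simp add: distr_shift)
  \<comment> \<open>Closedness puts \<open>A\<close> inside its preimage up to a null set, and equal
    measure makes the inclusion an equality.\<close>
  have one: "AE \<omega> in \<P>. \<omega> \<in> A \<longleftrightarrow> shift 1 z \<omega> \<in> A"
  proof -
    let ?T = "shift 1 z -` A \<inter> space \<P>"
    have TP: "?T \<in> sets \<P>" using AP by measurable
    have sub: "AE \<omega> in \<P>. \<omega> \<in> A \<longrightarrow> \<omega> \<in> ?T" using closed AE_space by eventually_elim auto
    have "measure \<P> (?T - A) = measure \<P> ?T - measure \<P> (?T \<inter> A)"
      using P.finite_measure_Diff'[OF TP AP] .
    also have "measure \<P> (?T \<inter> A) = measure \<P> A"
      by (rule P.finite_measure_eq_AE) (use sub TP AP in auto)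
    finally have "measure \<P> (?T - A) = 0" using mT by simp
    then have "AE \<omega> in \<P>. \<omega> \<notin> ?T - A" using P.prob_eq_0[of "?T - A"] TP AP by simp
    then show ?thesis using closed AE_space by eventually_elim auto
  qed
  have all: "AE \<omega> in \<P>. \<omega> \<in> A \<longleftrightarrow> \<omega> \<in> Tn n" for n
  proof (induction n)
    case 0 show ?case using AE_space by eventually_elim (auto simp: Tn_def)
  next
    case (Suc n)
    from Suc AE_shift[OF one, of "int n" "\<Sum>i<n. z"] AE_space show ?case
      by eventually_elim (auto simp: Tn_def shift_in_space add.commute simp del: sum_constant)
  qed
  let ?G = "\<Union>n. sets (Bidx \<nu> {i. 0 \<le> fst i \<and> fst i < int n})"
  have ind: "P.indep_set {A} ?G"
  proof (rule P.indep_setI)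
    show "?G \<subseteq> P.events" using subalgebra_Bidx[of \<nu>] by (auto simp: subalgebra_def)
    fix a b assume "a \<in> {A}" "b \<in> ?G"
    then obtain n where a: "a = A" and b: "b \<in> sets (Bidx \<nu> {i. 0 \<le> fst i \<and> fst i < int n})" by blast
    have bP: "b \<in> sets \<P>" using b subalgebra_Bidx[of \<nu>] by (auto simp: subalgebra_def)
    have T: "Tn n \<in> sets (Bidx \<nu> {i. int n \<le> fst i})"
      using measurable_sets[OF measurable_shift[of "{i. 0 \<le> fst i}" "int n" "\<Sum>i<n. z" "{i. int n \<le> fst i}" \<nu>], of A] A
      by (simp add: Tn_def Bplus_eq)
    \<comment> \<open>The slab of \<open>b\<close> ends before time \<open>n\<close>, so
      \<open>A\<close> is exchanged for its \<open>n\<close>-th preimage.\<close>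
    have "measure \<P> (A \<inter> b) = measure \<P> (Tn n \<inter> b)"
      using all[of n] by (intro P.finite_measure_eq_AE) (use AP TnP bP in auto)
    also have "\<dots> = measure \<P> (Tn n) * measure \<P> b"
      by (rule P.indep_setD[OF indep_Bidx T b]) auto
    also have "measure \<P> (Tn n) = measure \<P> A" unfolding Tn_def by (rule mT)
    finally show "P.prob (a \<inter> b) = P.prob a * P.prob b" using a by simp
  qed (use AP in auto)
  have "P.indep_set (sigma_sets (space \<P>) {A}) (sigma_sets (space \<P>) ?G)"
  proof (rule P.indep_set_sigma_sets[OF ind])
    show "Int_stable ?G"
    proof (rule Int_stableI)
      fix a b assume "a \<in> ?G" "b \<in> ?G"
      then obtain n m where nm: "a \<in> sets (Bidx \<nu> {i. 0 \<le> fst i \<and> fst i < int n})" "b \<in> sets (Bidx \<nu> {i. 0 \<le> fst i \<and> fst i < int m})" by blast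
      have "a \<in> sets (Bidx \<nu> {i. 0 \<le> fst i \<and> fst i < int (max n m)})"
        by (rule subsetD[OF sets_Bidx_mono nm(1)]) auto
      moreover have "b \<in> sets (Bidx \<nu> {i. 0 \<le> fst i \<and> fst i < int (max n m)})"
        by (rule subsetD[OF sets_Bidx_mono nm(2)]) auto
      ultimately show "a \<inter> b \<in> ?G" by blast
    qed
  qed (auto simp: Int_stable_def)
  then have "P.prob (a \<inter> b) = P.prob a * P.prob b"
    if "a \<in> sigma_sets (space \<P>) {A}" "b \<in> sigma_sets (space \<P>) ?G" for a b
    using that by (rule P.indep_setD)
  moreover have "A \<in> sigma_sets (space \<P>) ?G"
  proof -
    have "sets (Bidx \<nu> {i. 0 \<le> fst i}) \<subseteq> sigma_sets (space \<P>) ?G"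
      unfolding sets_Bidx[of \<nu> "{i. 0 \<le> fst i}"]
    proof (rule sigma_sets_mono, safe)
      fix i :: "int \<times> (int^'d)" and B assume i: "0 \<le> fst i" "B \<in> sets \<nu>"
      have "(\<lambda>\<omega>. \<omega> i) -` B \<inter> space \<P> \<in> sets (Bidx \<nu> {j. 0 \<le> fst j \<and> fst j < int (nat (fst i + 1))})"
        using measurable_sets[OF measurable_Bidx_component i(2), of i "{j. 0 \<le> fst j \<and> fst j < int (nat (fst i + 1))}"] i(1) by simp
      then show "(\<lambda>\<omega>. \<omega> i) -` B \<inter> space \<P> \<in> sigma_sets (space \<P>) ?G" by blast
    qed
    then show ?thesis using A by (auto simp: Bplus_eq)
  qed
  ultimately have "measure \<P> (A \<inter> A) = measure \<P> A * measure \<P> A" by blast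
  then show ?thesis by simp
qed

lemma ex_harmonic:
  assumes B: "\<And>n. overlap \<theta> n 0 \<le> B"
  obtains u where "u \<in> borel_measurable (Bplus \<nu> 0)" "\<And>\<omega>. u \<omega> > 0" "integrable \<P> u" "(\<integral>\<omega>. u \<omega> \<partial>\<P>) = 1"
    "AE \<omega> in \<P>. u \<omega> = (\<Sum>z\<in>Ustep. \<omega> (0,0) z * step_wt \<nu> \<theta> z * u (shift 1 z \<omega>))"
    "(\<lambda>n. \<integral>\<omega>. \<bar>part_fn \<nu> \<theta> n \<omega> - u \<omega>\<bar> \<partial>\<P>) \<longlonglongrightarrow> 0"
proof -
  let ?U = "part_fn \<nu> \<theta>" and ?w = "step_wt \<nu> \<theta>"
  have sub: "subalgebra \<P> (Bplus \<nu> 0)" unfolding Bplus_eq by (rule subalgebra_Bidx)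
  have UF: "?U n \<in> borel_measurable (Bplus \<nu> 0)" for n
    unfolding Bplus_eq by (rule measurable_Bidx_mono[OF measurable_part_fn]) auto
  obtain v where v: "v \<in> borel_measurable (Bplus \<nu> 0)" "integrable \<P> v" "(\<lambda>n. \<integral>\<omega>. \<bar>?U n \<omega> - v \<omega>\<bar> \<partial>\<P>) \<longlonglongrightarrow> 0"
    by (rule L1_Cauchy_limit[OF sub UF integrable_part_fn part_fn_L1_Cauchy[OF B]])
  \<comment> \<open>The approximants are positive on \<open>good\<close>, so cutting off the
    negative part of the limit cannot increase the distance.\<close>
  define v' where "v' \<omega> = max (v \<omega>) 0" for \<omega>
  have v'F [measurable]: "v' \<in> borel_measurable (Bplus \<nu> 0)" unfolding v'_def[abs_def] using v(1) by measurable
  have v'P [measurable]: "v' \<in> borel_measurable \<P>" by (rule measurable_from_subalg[OF sub v'F])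
  have v'i: "integrable \<P> v'" unfolding v'_def[abs_def] using v(2) by auto
  have lim: "(\<lambda>n. \<integral>\<omega>. \<bar>?U n \<omega> - v' \<omega>\<bar> \<partial>\<P>) \<longlonglongrightarrow> 0"
  proof (rule tendsto_sandwich[OF _ _ tendsto_const v(3)])
    have "(\<integral>\<omega>. \<bar>?U n \<omega> - v' \<omega>\<bar> \<partial>\<P>) \<le> (\<integral>\<omega>. \<bar>?U n \<omega> - v \<omega>\<bar> \<partial>\<P>)" for n
    proof (rule integral_mono_AE)
      show "AE \<omega> in \<P>. \<bar>?U n \<omega> - v' \<omega>\<bar> \<le> \<bar>?U n \<omega> - v \<omega>\<bar>"
        using AE_good
      proof eventually_elim
        case (elim \<omega>)
        then show ?case using part_fn_pos[OF elim, of \<theta> n] by (auto simp: v'_def max_def)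
      qed
    qed (use v(2) v'i integrable_part_fn in auto)
    then show "\<forall>\<^sub>F n in sequentially. (\<integral>\<omega>. \<bar>?U n \<omega> - v' \<omega>\<bar> \<partial>\<P>) \<le> (\<integral>\<omega>. \<bar>?U n \<omega> - v \<omega>\<bar> \<partial>\<P>)" by simp
  qed (auto intro!: always_eventually Bochner_Integration.integral_nonneg)
  have int1: "(\<integral>\<omega>. v' \<omega> \<partial>\<P>) = 1"
  proof -
    have "\<bar>1 - (\<integral>\<omega>. v' \<omega> \<partial>\<P>)\<bar> \<le> (\<integral>\<omega>. \<bar>?U n \<omega> - v' \<omega>\<bar> \<partial>\<P>)" for n
    proof -
      have "1 - (\<integral>\<omega>. v' \<omega> \<partial>\<P>) = (\<integral>\<omega>. ?U n \<omega> - v' \<omega> \<partial>\<P>)"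
        using v'i integrable_part_fn[of \<theta> n] by (simp add: integral_part_fn)
      then show ?thesis using integral_abs_bound[of \<P> "\<lambda>\<omega>. ?U n \<omega> - v' \<omega>"] by simp
    qed
    then have "\<bar>1 - (\<integral>\<omega>. v' \<omega> \<partial>\<P>)\<bar> \<le> 0" by (intro LIMSEQ_le_const[OF lim]) auto
    then show ?thesis by simp
  qed
  \<comment> \<open>The one-step average of the limit. By \<open>part_fn_Suc\<close> the functions
    \<open>part_fn \<nu> \<theta> (Suc n)\<close> converge in L1 to it as well as to
    \<open>v'\<close>.\<close>
  define h where "h \<omega> = (\<Sum>z\<in>Ustep. \<omega> (0,0) z * ?w z * v' (shift 1 z \<omega>))" for \<omega>
  have hterm: "integrable \<P> (\<lambda>\<omega>. \<omega> (0,0) z * ?w z * f (shift 1 z \<omega>))" if "integrable \<P> f" "z \<in> Ustep" for f z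
  proof -
    have "integrable \<P> (\<lambda>\<omega>. ?w z * (\<omega> (0,0) z * f (shift 1 z \<omega>)))"
      using that by (intro integrable_mult_right integrable_mult_bounded[OF _ _ AE_weight[of z]] integrable_shift) auto
    then show ?thesis by (simp add: ac_simps)
  qed
  have hi: "integrable \<P> h" unfolding h_def[abs_def] by (intro Bochner_Integration.integrable_sum hterm v'i)
  have "(\<lambda>n. \<integral>\<omega>. \<bar>?U (Suc n) \<omega> - h \<omega>\<bar> \<partial>\<P>) \<longlonglongrightarrow> 0"
  proof (rule tendsto_sandwich[OF _ _ tendsto_const])
    show "(\<lambda>n. \<Sum>z\<in>Ustep. ?w z * (\<integral>\<omega>. \<bar>?U n \<omega> - v' \<omega>\<bar> \<partial>\<P>)) \<longlonglongrightarrow> 0"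
      by (rule tendsto_eq_intros lim | simp)+
    have "(\<integral>\<omega>. \<bar>?U (Suc n) \<omega> - h \<omega>\<bar> \<partial>\<P>) \<le> (\<Sum>z\<in>Ustep. ?w z * (\<integral>\<omega>. \<bar>?U n \<omega> - v' \<omega>\<bar> \<partial>\<P>))" for n
    proof -
      have di: "integrable \<P> (\<lambda>\<omega>. \<bar>?U n \<omega> - v' \<omega>\<bar>)" using v'i integrable_part_fn[of \<theta> n] by auto
      have "(\<integral>\<omega>. \<bar>?U (Suc n) \<omega> - h \<omega>\<bar> \<partial>\<P>) \<le> (\<integral>\<omega>. (\<Sum>z\<in>Ustep. ?w z * \<bar>?U n (shift 1 z \<omega>) - v' (shift 1 z \<omega>)\<bar>) \<partial>\<P>)"
      proof (rule integral_mono_AE)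
        show "AE \<omega> in \<P>. \<bar>?U (Suc n) \<omega> - h \<omega>\<bar> \<le> (\<Sum>z\<in>Ustep. ?w z * \<bar>?U n (shift 1 z \<omega>) - v' (shift 1 z \<omega>)\<bar>)"
          using AE_good
        proof eventually_elim
          case (elim \<omega>)
          have "?U (Suc n) \<omega> - h \<omega> = (\<Sum>z\<in>Ustep. \<omega> (0,0) z * ?w z * (?U n (shift 1 z \<omega>) - v' (shift 1 z \<omega>)))"
            by (simp add: part_fn_Suc h_def sum_subtractf right_diff_distrib)
          also have "\<bar>\<dots>\<bar> \<le> (\<Sum>z\<in>Ustep. \<bar>\<omega> (0,0) z * ?w z * (?U n (shift 1 z \<omega>) - v' (shift 1 z \<omega>))\<bar>)"
            by (rule sum_abs)
          also have "\<dots> \<le> (\<Sum>z\<in>Ustep. ?w z * \<bar>?U n (shift 1 z \<omega>) - v' (shift 1 z \<omega>)\<bar>)"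
          proof (rule sum_mono)
            fix z :: "int^'d" assume z: "z \<in> Ustep"
            have "\<omega> (0,0) z * ?w z \<le> 1 * ?w z" using good_bounds(2)[OF elim z] by (intro mult_right_mono) (auto simp: less_imp_le)
            then show "\<bar>\<omega> (0,0) z * ?w z * (?U n (shift 1 z \<omega>) - v' (shift 1 z \<omega>))\<bar> \<le> ?w z * \<bar>?U n (shift 1 z \<omega>) - v' (shift 1 z \<omega>)\<bar>"
              using good_pos[OF elim z, of "(0,0)"] by (simp add: abs_mult abs_of_pos[OF step_wt_pos] mult_right_mono)
          qed
          finally show ?case .
        qed
      qed (use hi integrable_part_fn integrable_shift[OF di] in auto)
      also have "\<dots> = (\<Sum>z\<in>Ustep. ?w z * (\<integral>\<omega>. \<bar>?U n \<omega> - v' \<omega>\<bar> \<partial>\<P>))"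
        using integrable_shift[OF di] integral_shift[of "\<lambda>\<omega>. \<bar>?U n \<omega> - v' \<omega>\<bar>"]
        by (subst Bochner_Integration.integral_sum) auto
      finally show ?thesis .
    qed
    then show "\<forall>\<^sub>F n in sequentially. (\<integral>\<omega>. \<bar>?U (Suc n) \<omega> - h \<omega>\<bar> \<partial>\<P>) \<le> (\<Sum>z\<in>Ustep. ?w z * (\<integral>\<omega>. \<bar>?U n \<omega> - v' \<omega>\<bar> \<partial>\<P>))" by simp
  qed (auto intro!: always_eventually Bochner_Integration.integral_nonneg)
  from tendsto_add[OF this LIMSEQ_Suc[OF lim]]
  have lim2: "(\<lambda>n. (\<integral>\<omega>. \<bar>?U (Suc n) \<omega> - h \<omega>\<bar> \<partial>\<P>) + (\<integral>\<omega>. \<bar>?U (Suc n) \<omega> - v' \<omega>\<bar> \<partial>\<P>)) \<longlonglongrightarrow> 0" by simp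
  have "(\<integral>\<omega>. \<bar>v' \<omega> - h \<omega>\<bar> \<partial>\<P>) \<le> (\<integral>\<omega>. \<bar>?U (Suc n) \<omega> - h \<omega>\<bar> \<partial>\<P>) + (\<integral>\<omega>. \<bar>?U (Suc n) \<omega> - v' \<omega>\<bar> \<partial>\<P>)" for n
  proof -
    note ints = hi v'i integrable_part_fn[of \<theta> "Suc n"]
    have "(\<integral>\<omega>. \<bar>v' \<omega> - h \<omega>\<bar> \<partial>\<P>) \<le> (\<integral>\<omega>. \<bar>?U (Suc n) \<omega> - h \<omega>\<bar> + \<bar>?U (Suc n) \<omega> - v' \<omega>\<bar> \<partial>\<P>)"
      by (rule integral_mono) (use ints in auto)
    also have "\<dots> = (\<integral>\<omega>. \<bar>?U (Suc n) \<omega> - h \<omega>\<bar> \<partial>\<P>) + (\<integral>\<omega>. \<bar>?U (Suc n) \<omega> - v' \<omega>\<bar> \<partial>\<P>)"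
      by (rule Bochner_Integration.integral_add) (use ints in auto)
    finally show ?thesis .
  qed
  then have "(\<integral>\<omega>. \<bar>v' \<omega> - h \<omega>\<bar> \<partial>\<P>) \<le> 0" by (intro LIMSEQ_le_const[OF lim2]) auto
  moreover have "0 \<le> (\<integral>\<omega>. \<bar>v' \<omega> - h \<omega>\<bar> \<partial>\<P>)" by simp
  ultimately have "(\<integral>\<omega>. \<bar>v' \<omega> - h \<omega>\<bar> \<partial>\<P>) = 0" by linarith
  then have eq: "AE \<omega> in \<P>. v' \<omega> = h \<omega>"
    using hi v'i by (subst (asm) integral_nonneg_eq_0_iff_AE) auto
  \<comment> \<open>At a zero of \<open>v'\<close> a sum of nonnegative terms with positive weights
    vanishes, so all successors are zeros too. The zero set is thus closed under a step, and mean 1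
    excludes full measure.\<close>
  define A where "A = {\<omega> \<in> space (Bplus \<nu> 0). v' \<omega> = 0}"
  have AF: "A \<in> sets (Bplus \<nu> 0)" unfolding A_def by measurable
  have AP: "A \<in> sets \<P>" using AF sub by (auto simp: subalgebra_def)
  define e where "e = (axis undefined 1 :: int^'d)"
  have e: "e \<in> Ustep" by (simp add: e_def axis_in_Ustep)
  have "AE \<omega> in \<P>. \<omega> \<in> A \<longrightarrow> shift 1 e \<omega> \<in> A"
    using eq AE_good AE_space
  proof eventually_elim
    case (elim \<omega>)
    show ?case
    proof
      assume "\<omega> \<in> A"
      then have "h \<omega> = 0" using elim by (simp add: A_def)
      then have "\<forall>z\<in>Ustep. \<omega> (0,0) z * ?w z * v' (shift 1 z \<omega>) = 0"
        unfolding h_def using good_pos[OF elim(2)]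
        by (subst (asm) sum_nonneg_eq_0_iff) (auto simp: finite_Ustep v'_def less_imp_le)
      then have "v' (shift 1 e \<omega>) = 0" using good_pos[OF elim(2) e, of "(0,0)"] e step_wt_pos[of \<nu> \<theta> e]
        by (metis less_irrefl mult_eq_0_iff)
      then show "shift 1 e \<omega> \<in> A" using elim(3) by (simp add: A_def Bplus_eq shift_in_space)
    qed
  qed
  then have "measure \<P> A = 0 \<or> measure \<P> A = 1" by (rule zero_one_law[OF AF])
  moreover have "measure \<P> A \<noteq> 1"
  proof
    assume "measure \<P> A = 1"
    then have "AE \<omega> in \<P>. \<omega> \<in> A" using P.prob_eq_1[OF AP] by simp
    then have "(\<integral>\<omega>. v' \<omega> \<partial>\<P>) = (\<integral>\<omega>. 0 \<partial>\<P>)" by (intro integral_cong_AE) (auto simp: A_def elim!: eventually_mono)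
    then show False using int1 by simp
  qed
  ultimately have A0: "measure \<P> A = 0" by blast
  then have "AE \<omega> in \<P>. \<omega> \<notin> A" using P.prob_eq_0[OF AP] by simp
  then have nz: "AE \<omega> in \<P>. v' \<omega> \<noteq> 0" using AE_space by eventually_elim (auto simp: A_def Bplus_eq)
  \<comment> \<open>Changing the limit on a null set makes it positive everywhere, so later
    divisions by \<open>u\<close> need no exceptional set.\<close>
  define u where "u \<omega> = (if v' \<omega> = 0 then 1 else v' \<omega>)" for \<omega>
  have uv: "AE \<omega> in \<P>. u \<omega> = v' \<omega>" using nz by eventually_elim (simp add: u_def)
  show ?thesis
  proof (rule that[of u])
    show uF: "u \<in> borel_measurable (Bplus \<nu> 0)" unfolding u_def[abs_def] by measurable
    have uP [measurable]: "u \<in> borel_measurable \<P>" by (rule measurable_from_subalg[OF sub uF])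
    show "u \<omega> > 0" for \<omega> by (auto simp: u_def v'_def)
    show "integrable \<P> u" using v'i uv by (subst integrable_cong_AE[of _ _ v']) auto
    show "(\<integral>\<omega>. u \<omega> \<partial>\<P>) = 1" using int1 uv by (subst integral_cong_AE[of _ _ v']) auto
    have "AE \<omega> in \<P>. \<forall>z\<in>Ustep. u (shift 1 z \<omega>) = v' (shift 1 z \<omega>)"
      using AE_shift[OF uv, of 1] by (intro AE_finite_allI finite_Ustep)
    with eq uv show "AE \<omega> in \<P>. u \<omega> = (\<Sum>z\<in>Ustep. \<omega> (0,0) z * ?w z * u (shift 1 z \<omega>))"
      by eventually_elim (simp add: h_def)
    have "(\<integral>\<omega>. \<bar>?U n \<omega> - u \<omega>\<bar> \<partial>\<P>) = (\<integral>\<omega>. \<bar>?U n \<omega> - v' \<omega>\<bar> \<partial>\<P>)" for n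
      using uv by (intro integral_cong_AE) (auto elim: eventually_mono)
    then show "(\<lambda>n. \<integral>\<omega>. \<bar>?U n \<omega> - u \<omega>\<bar> \<partial>\<P>) \<longlonglongrightarrow> 0" using lim by simp
  qed
qed

end

section \<open>The environment seen from the walker\<close>

text \<open>Uniqueness of measures for a sub-sigma-algebra: the generator \<open>G\<close> may
  generate less than the sets of the two measures, as happens when they agree on one half-space or
  box only.\<close>

lemma emeasure_eq_on_sigma_sets:
  assumes fin: "finite_measure M1" "finite_measure M2" and sp: "space M1 = \<Omega>" "space M2 = \<Omega>"
    and G: "G \<subseteq> sets M1" "G \<subseteq> sets M2" "Int_stable G" "\<Omega> \<in> G"
    and eq: "\<And>X. X \<in> G \<Longrightarrow> emeasure M1 X = emeasure M2 X"
    and D: "D \<in> sigma_sets \<Omega> G"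
  shows "emeasure M1 D = emeasure M2 D"
proof -
  interpret M1: finite_measure M1 by fact
  interpret M2: finite_measure M2 by fact
  have GP: "G \<subseteq> Pow \<Omega>" using G(1) sets.space_closed[of M1] sp by auto
  have s1: "sigma_sets \<Omega> G \<subseteq> sets M1" using sets.sigma_sets_subset[OF G(1)] sp by simp
  have s2: "sigma_sets \<Omega> G \<subseteq> sets M2" using sets.sigma_sets_subset[OF G(2)] sp by simp
  from G(3) GP D show ?thesis
  proof (induction rule: sigma_sets_induct_disjoint)
    case (basic A) then show ?case by (rule eq)
  next
    case empty then show ?case by simp
  next
    case (compl A)
    have "A \<in> sets M1" "A \<in> sets M2" using compl(1) s1 s2 by auto
    then show ?case
      using eq[OF G(4)] compl(2) sp emeasure_compl[of A M1] emeasure_compl[of A M2] by simp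
  next
    case (union A)
    have "range A \<subseteq> sets M1" "range A \<subseteq> sets M2" using union(2) s1 s2 by auto
    then show ?case using union(1,3) by (simp flip: suminf_emeasure)
  qed
qed

section \<open>Cylinders in the space of step sequences\<close>

lemma steps_space_iff: "s \<in> space steps_measure \<longleftrightarrow> (\<forall>i. s i \<in> Ustep)"
  by (auto simp: steps_measure_def space_PiM PiE_iff)

definition cyl :: "(int^'d::finite) list \<Rightarrow> (nat \<Rightarrow> int^'d) set" where
  "cyl a = {s \<in> space steps_measure. \<forall>i<length a. s i = a ! i}"

text \<open>The default is an admissible step, so that the extended sequence stays in the space of
  \<open>steps_measure\<close>.\<close>

definition pad :: "(int^'d::finite) list \<Rightarrow> nat \<Rightarrow> int^'d" where
  "pad a i = (if i < length a then a ! i else axis undefined 1)"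

lemma pad_space: "a \<in> Ulists K \<Longrightarrow> pad a \<in> space steps_measure"
  unfolding steps_space_iff pad_def Ulists_def using axis_in_Ustep(1) by (auto dest: nth_mem)

lemma measurable_step: "(\<lambda>s. s i) \<in> steps_measure \<rightarrow>\<^sub>M count_space Ustep"
  unfolding steps_measure_def by (rule measurable_component_singleton) simp

lemma sets_cyl [measurable]: "cyl a \<in> sets (steps_measure :: (nat \<Rightarrow> int^'d::finite) measure)"
proof -
  let ?S = "steps_measure :: (nat \<Rightarrow> int^'d) measure"
  have one: "{s \<in> space ?S. s i = z} \<in> sets ?S" for i z
  proof (cases "z \<in> Ustep")
    case True
    have "(\<lambda>s. s i) -` {z} \<inter> space ?S \<in> sets ?S"
      by (rule measurable_sets[OF measurable_step]) (use True in simp)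
    moreover have "(\<lambda>s. s i) -` {z} \<inter> space ?S = {s \<in> space ?S. s i = z}" by blast
    ultimately show ?thesis by (simp only:)
  next
    case False
    then have "{s \<in> space ?S. s i = z} = {}" unfolding steps_space_iff by blast
    then show ?thesis by (simp only: sets.empty_sets)
  qed
  have "{s \<in> space ?S. \<forall>i\<in>{..<length a}. s i = a ! i} \<in> sets ?S"
    by (rule sets.sets_Collect_finite_All[OF one finite_lessThan])
  moreover have "{s \<in> space ?S. \<forall>i\<in>{..<length a}. s i = a ! i} = cyl a" unfolding cyl_def by blast
  ultimately show ?thesis by (simp only:)
qed

lemma cyl_Nil [simp]: "cyl [] = space steps_measure"
  by (simp add: cyl_def)

lemma map_upt_Ulists: "s \<in> space steps_measure \<Longrightarrow> map s [0..<K] \<in> Ulists K"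
  by (auto simp: Ulists_def steps_space_iff)

lemma cyl_iff: "a \<in> Ulists K \<Longrightarrow> s \<in> cyl a \<longleftrightarrow> s \<in> space steps_measure \<and> a = map s [0..<K]"
  by (auto simp: cyl_def Ulists_def list_eq_iff_nth_eq)

context rwre
begin

text \<open>The law of the environment seen from the walker has density \<open>back_wt \<theta> N \<omega> * u \<omega>\<close> on \<open>B\<^sub>-\<^sub>N\<^sup>+\<close>: the
  backward path sum accounts for the \<open>N\<close> sites visited before time 0.\<close>
definition back_wt :: "real^'d \<Rightarrow> nat \<Rightarrow> 'd env \<Rightarrow> real" where
  "back_wt \<theta> N \<omega> = (\<Sum>b\<in>Ulists N. path_wt \<nu> \<theta> b (shift (- int N) (- sum_list b) \<omega>))"

lemma back_wt_0 [simp]: "back_wt \<theta> 0 \<omega> = 1"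
  by (simp add: back_wt_def)

lemma measurable_back_wt: "back_wt \<theta> N \<in> borel_measurable (Bidx \<nu> {i. - int N \<le> fst i})"
  unfolding back_wt_def[abs_def]
  by (intro borel_measurable_sum measurable_compose[OF measurable_shift measurable_path_wt]) auto

lemma measurable_back_wt_env [measurable]: "back_wt \<theta> N \<in> borel_measurable \<P>"
  using measurable_back_wt by (rule measurable_Bidx_env)

lemma good_back_wt: "good \<omega> \<Longrightarrow> 0 \<le> back_wt \<theta> N \<omega> \<and> back_wt \<theta> N \<omega> \<le> path_bd \<theta> N"
proof -
  assume g: "good \<omega>"
  have "0 \<le> path_wt \<nu> \<theta> b (shift m y \<omega>) \<and> path_wt \<nu> \<theta> b (shift m y \<omega>) \<le> prod_list (map (step_wt \<nu> \<theta>) b)" if "b \<in> Ulists N" for b m y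
    using path_wt_bounds[OF good_shift[OF g] that, of \<theta> m y] by auto
  then show ?thesis unfolding back_wt_def path_bd_def by (auto intro!: sum_nonneg sum_mono)
qed

lemma AE_abs_back_wt: "AE \<omega> in \<P>. \<bar>back_wt \<theta> N \<omega>\<bar> \<le> path_bd \<theta> N"
  using AE_good
proof eventually_elim
  case (elim \<omega>)
  then show ?case using good_back_wt[OF elim, of \<theta> N] by simp
qed

lemma sets_Bbox_eq: "sets (Bbox \<nu> N M) = sets (Bidx \<nu> {i. - int N \<le> fst i \<and> fst i \<le> int M})"
  using sets_Bbox[OF space_nu_ne] .

lemma measurable_section_pad:
  assumes "f \<in> borel_measurable (Bbox \<nu> N M \<Otimes>\<^sub>M steps_measure)" "a \<in> Ulists K"
  shows "(\<lambda>\<omega>. f (\<omega>, pad a)) \<in> borel_measurable (Bidx \<nu> {i. - int N \<le> fst i \<and> fst i \<le> int M})"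
proof -
  have "(\<lambda>\<omega>. f (\<omega>, pad a)) \<in> borel_measurable (Bbox \<nu> N M)"
    by (intro measurable_compose[OF _ assms(1)] measurable_Pair measurable_ident_sets[OF refl] measurable_const pad_space[OF assms(2)])
  then show ?thesis using measurable_cong_sets[OF sets_Bbox_eq refl] by blast
qed

lemma nth_append3:
  assumes "i < length a" shows "(b @ a @ r) ! (length b + i) = a ! i"
  using assms by (simp add: nth_append)

text \<open>The path of length \<open>N + M + K + 1\<close> is cut into \<open>b @ a @ r\<close>:
  the \<open>N\<close> steps before the walker is observed, the \<open>K\<close> steps that
  \<open>f\<close> sees, and \<open>M + 1\<close> further ones. Stationarity moves the site reached
  at time \<open>N\<close> to the origin; the first block then sums to \<open>back_wt\<close> and
  the last to a partition function.\<close>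

lemma tilted_exp_eq:
  assumes f: "f \<in> borel_measurable (Bbox \<nu> N M \<Otimes>\<^sub>M steps_measure)"
    and B: "\<And>x. \<bar>f x\<bar> \<le> B" and dep: "\<And>\<omega> s s'. (\<And>i. i < K \<Longrightarrow> s i = s' i) \<Longrightarrow> f (\<omega>, s) = f (\<omega>, s')"
  shows "tilted_exp \<nu> \<theta> N M K f =
    (\<Sum>a\<in>Ulists K. \<integral>\<omega>. f (\<omega>, pad a) * (back_wt \<theta> N \<omega> * path_wt \<nu> \<theta> a \<omega> * part_fn \<nu> \<theta> (M + 1) (shift (int K) (sum_list a) \<omega>)) \<partial>\<P>)"
proof -
  let ?W = "path_wt \<nu> \<theta>" and ?U = "part_fn \<nu> \<theta>"
  define G where "G a \<omega> = f (\<omega>, pad a) * (?W a \<omega> * ?U (M + 1) (shift (int K) (sum_list a) \<omega>))" for a \<omega>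
  \<comment> \<open>Recentres so that a walk started at the origin of the shifted environment with
    steps \<open>b\<close> arrives at the old origin at time 0.\<close>
  define S where "S b = shift (- int N) (- sum_list b)" for b :: "(int^'d) list"
  have fP: "(\<lambda>\<omega>. f (\<omega>, pad a)) \<in> borel_measurable \<P>" if "a \<in> Ulists K" for a
    using measurable_section_pad[OF f that] by (rule measurable_Bidx_env)
  have intG: "integrable \<P> (G a)" if a: "a \<in> Ulists K" for a
  proof -
    have "integrable \<P> (\<lambda>\<omega>. ?U (M + 1) (shift (int K) (sum_list a) \<omega>) * ?W a \<omega>)"
      by (rule integrable_part_fn_shift_mult[OF integrable_path_wt[OF a]])
    then show ?thesis unfolding G_def
      by (intro integrable_mult_bounded[OF _ fP[OF a], where B=B]) (auto simp: B mult.commute)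
  qed
  have intSG: "integrable \<P> (\<lambda>\<omega>. ?W b (S b \<omega>) * G a \<omega>)" if "a \<in> Ulists K" "b \<in> Ulists N" for a b
    unfolding S_def
    by (rule integrable_mult_bounded[OF intG[OF that(1)] _ AE_shift[OF AE_abs_path_wt[OF that(2)]]])
       (use that in measurable)
  have cancel: "S b (shift (int N) (sum_list b) \<omega>) = \<omega>" for b \<omega> by (simp add: S_def)
  have GP: "G a \<in> borel_measurable \<P>" if "a \<in> Ulists K" for a using intG[OF that] by auto
  have WP: "(\<lambda>\<omega>. ?W b (S b \<omega>)) \<in> borel_measurable \<P>" if "b \<in> Ulists N" for b
    unfolding S_def using that by measurable
  have sh: "integrable \<P> (\<lambda>\<omega>. ?W b \<omega> * G a (shift (int N) (sum_list b) \<omega>)) \<and>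
     (\<integral>\<omega>. ?W b \<omega> * G a (shift (int N) (sum_list b) \<omega>) \<partial>\<P>) = (\<integral>\<omega>. ?W b (S b \<omega>) * G a \<omega> \<partial>\<P>)"
    if "a \<in> Ulists K" "b \<in> Ulists N" for a b
    using integrable_shift[OF intSG[OF that], of "int N" "sum_list b"]
      integral_shift[of "\<lambda>\<omega>. ?W b (S b \<omega>) * G a \<omega>" "int N" "sum_list b"] WP[OF that(2)] GP[OF that(1)]
    by (simp add: cancel)
  have "tilted_exp \<nu> \<theta> N M K f
    = (\<integral>\<omega>. (\<Sum>zs\<in>Ulists (N + (K + (M + 1))). ?W zs \<omega> * f (shift (int N) (pos zs N) \<omega>, \<lambda>i. zs ! (N + min i (M + K)))) \<partial>\<P>)"
    unfolding tilted_exp_def Let_def Ulists_def[symmetric]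
    by (intro Bochner_Integration.integral_cong refl sum.cong)
       (auto simp: path_wt_eq length_Ulists add_ac)
  also have "\<dots> = (\<integral>\<omega>. (\<Sum>b\<in>Ulists N. \<Sum>a\<in>Ulists K. ?W b \<omega> * G a (shift (int N) (sum_list b) \<omega>)) \<partial>\<P>)"
  proof (intro Bochner_Integration.integral_cong refl)
    fix \<omega>
    have "(\<Sum>r\<in>Ulists (M + 1). ?W (b @ a @ r) \<omega> * f (shift (int N) (pos (b @ a @ r) N) \<omega>, \<lambda>i. (b @ a @ r) ! (N + min i (M + K))))
      = ?W b \<omega> * G a (shift (int N) (sum_list b) \<omega>)" if b: "b \<in> Ulists N" and a: "a \<in> Ulists K" for a b
    proof -
      have "?W (b @ a @ r) \<omega> * f (shift (int N) (pos (b @ a @ r) N) \<omega>, \<lambda>i. (b @ a @ r) ! (N + min i (M + K)))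
        = ?W b \<omega> * (f (shift (int N) (sum_list b) \<omega>, pad a) * (?W a (shift (int N) (sum_list b) \<omega>)
            * ?W r (shift (int K) (sum_list a) (shift (int N) (sum_list b) \<omega>))))" for r
      proof -
        have "pos (b @ a @ r) N = sum_list b" using b by (subst pos_eq_sum_list) (auto simp: length_Ulists)
        \<comment> \<open>For \<open>i < K\<close> the minimum with \<open>M + K\<close> is
          \<open>i\<close>, so exactly the block \<open>a\<close> is read; the other entries do not
          affect \<open>f\<close>.\<close>
        moreover have "f (\<omega>', \<lambda>i. (b @ a @ r) ! (N + min i (M + K))) = f (\<omega>', pad a)" for \<omega>'
          using a b nth_append3[of _ a b r] by (intro dep) (auto simp: pad_def length_Ulists)
        ultimately show ?thesis using a b by (simp add: path_wt_append length_Ulists mult_ac)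
      qed
      then show ?thesis by (simp only: G_def part_fn_def sum_distrib_left)
    qed
    then show "(\<Sum>zs\<in>Ulists (N + (K + (M + 1))). ?W zs \<omega> * f (shift (int N) (pos zs N) \<omega>, \<lambda>i. zs ! (N + min i (M + K))))
      = (\<Sum>b\<in>Ulists N. \<Sum>a\<in>Ulists K. ?W b \<omega> * G a (shift (int N) (sum_list b) \<omega>))"
      by (simp only: sum_Ulists_add cong: sum.cong)
  qed
  also have "\<dots> = (\<Sum>b\<in>Ulists N. \<Sum>a\<in>Ulists K. \<integral>\<omega>. ?W b (S b \<omega>) * G a \<omega> \<partial>\<P>)"
    using sh by (subst Bochner_Integration.integral_sum, force)+ (auto intro!: sum.cong)
  also have "\<dots> = (\<Sum>a\<in>Ulists K. \<Sum>b\<in>Ulists N. \<integral>\<omega>. ?W b (S b \<omega>) * G a \<omega> \<partial>\<P>)" by (rule sum.swap)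
  also have "\<dots> = (\<Sum>a\<in>Ulists K. \<integral>\<omega>. back_wt \<theta> N \<omega> * G a \<omega> \<partial>\<P>)"
    using intSG by (intro sum.cong refl) (simp add: back_wt_def S_def sum_distrib_right)
  finally show ?thesis by (simp add: G_def mult_ac)
qed

text \<open>Density, for the initial steps \<open>a\<close>, of the environment restricted to a box
  reaching back to time \<open>- N\<close>, computed with \<open>n\<close> future steps after
  \<open>a\<close>.\<close>

definition box_dens :: "real^'d \<Rightarrow> nat \<Rightarrow> (int^'d) list \<Rightarrow> nat \<Rightarrow> 'd env \<Rightarrow> real" where
  "box_dens \<theta> N a n \<omega> = back_wt \<theta> N \<omega> * path_wt \<nu> \<theta> a \<omega> * part_fn \<nu> \<theta> n (shift (int (length a)) (sum_list a) \<omega>)"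

lemma measurable_box_dens: "a \<in> Ulists K \<Longrightarrow> box_dens \<theta> N a n \<in> borel_measurable \<P>"
  unfolding box_dens_def[abs_def] by measurable

lemma integrable_box_dens: "a \<in> Ulists K \<Longrightarrow> integrable \<P> (box_dens \<theta> N a n)"
proof -
  assume a: "a \<in> Ulists K"
  have "integrable \<P> (\<lambda>\<omega>. back_wt \<theta> N \<omega> * path_wt \<nu> \<theta> a \<omega>)"
    by (rule integrable_mult_bounded[OF integrable_path_wt[OF a] _ AE_abs_back_wt]) auto
  from integrable_part_fn_shift_mult[OF this] show ?thesis
    unfolding box_dens_def[abs_def] by (simp add: mult_ac)
qed

lemma good_box_dens: "good \<omega> \<Longrightarrow> a \<in> Ulists K \<Longrightarrow> 0 \<le> box_dens \<theta> N a n \<omega>"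
  unfolding box_dens_def
  using good_back_wt[of \<omega> \<theta> N] path_wt_bounds[of \<omega> a K \<theta>] part_fn_pos[OF good_shift, of \<omega>]
  by (intro mult_nonneg_nonneg) (auto intro: less_imp_le)

text \<open>Weighs an event of environments jointly with the initial steps \<open>a\<close>.
  Questions on the product space become questions on finitely many measures on environments;
  \<open>density\<close> carries out the restriction to the cylinder.\<close>

definition cyl_marginal :: "('d env \<times> (nat \<Rightarrow> int^'d)) measure \<Rightarrow> (int^'d) list \<Rightarrow> 'd env measure" where
  "cyl_marginal Mu a = distr (density Mu (indicator (space \<P> \<times> cyl a))) \<P> fst"

lemma sets_cyl_marginal [simp, measurable_cong]: "sets (cyl_marginal Mu a) = sets \<P>"
  by (simp add: cyl_marginal_def)

lemma space_cyl_marginal [simp]: "space (cyl_marginal Mu a) = space \<P>"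
  by (simp add: cyl_marginal_def)

lemma emeasure_cyl_marginal:
  assumes "sets Mu = sets (\<P> \<Otimes>\<^sub>M steps_measure)" "D \<in> sets \<P>"
  shows "emeasure (cyl_marginal Mu a) D = emeasure Mu (D \<times> cyl a)"
proof -
  note [measurable_cong] = assms(1)
  have sp: "space Mu = space \<P> \<times> space steps_measure"
    using sets_eq_imp_space_eq[OF assms(1)] by (simp add: space_pair_measure)
  have C: "space \<P> \<times> cyl a \<in> sets Mu" unfolding assms(1) by measurable
  have f: "fst \<in> Mu \<rightarrow>\<^sub>M \<P>" by measurable
  have D: "fst -` D \<inter> space Mu \<in> sets Mu" using measurable_sets[OF f assms(2)] .
  have "emeasure (cyl_marginal Mu a) D = emeasure (density Mu (indicator (space \<P> \<times> cyl a))) (fst -` D \<inter> space Mu)"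
    unfolding cyl_marginal_def using f assms(2) by (subst emeasure_distr) auto
  also have "\<dots> = emeasure Mu ((space \<P> \<times> cyl a) \<inter> (fst -` D \<inter> space Mu))"
    using C D by (subst emeasure_density) (auto simp: indicator_inter_arith[symmetric])
  also have "(space \<P> \<times> cyl a) \<inter> (fst -` D \<inter> space Mu) = D \<times> cyl a"
    using sets.sets_into_space[OF assms(2)] by (auto simp: sp cyl_def)
  finally show ?thesis .
qed

lemma is_barmuD:
  assumes "is_barmu \<nu> \<theta> Mu" and f: "f \<in> borel_measurable (Bbox \<nu> N M \<Otimes>\<^sub>M steps_measure)"
    and B: "\<And>x. \<bar>f x\<bar> \<le> B" and dep: "\<And>\<omega> s s'. (\<And>i. i < K \<Longrightarrow> s i = s' i) \<Longrightarrow> f (\<omega>, s) = f (\<omega>, s')"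
  shows "integrable Mu f \<and> (\<integral>x. f x \<partial>Mu) = tilted_exp \<nu> \<theta> N M K f"
proof -
  have "\<forall>N M K f. f \<in> borel_measurable (Bbox \<nu> N M \<Otimes>\<^sub>M steps_measure)
        \<and> (\<exists>B. \<forall>x. \<bar>f x\<bar> \<le> B)
        \<and> (\<forall>\<omega> s s'. (\<forall>i<K. s i = s' i) \<longrightarrow> f (\<omega>, s) = f (\<omega>, s'))
        \<longrightarrow> integrable Mu f \<and> (\<integral>x. f x \<partial>Mu) = tilted_exp \<nu> \<theta> N M K f"
    using assms(1) unfolding is_barmu_def by (rule conjunct2)
  from this[THEN spec, THEN spec, THEN spec, THEN spec, of f N M K] show ?thesis
    by (rule mp) (intro conjI f exI[of _ B] allI impI B dep; simp)
qed

lemma barmu_box: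
  assumes "is_barmu \<nu> \<theta> Mu" and a: "a \<in> Ulists K"
    and D: "D \<in> sets (Bidx \<nu> {i. - int N \<le> fst i \<and> fst i \<le> int M})"
  shows "emeasure (cyl_marginal Mu a) D = ennreal (\<integral>\<omega>. indicator D \<omega> * box_dens \<theta> N a (M + 1) \<omega> \<partial>\<P>)"
proof -
  have sM: "sets Mu = sets (\<P> \<Otimes>\<^sub>M steps_measure)" using assms(1) by (simp add: is_barmu_def)
  have sp: "space Mu = space \<P> \<times> space steps_measure"
    using sets_eq_imp_space_eq[OF sM] by (simp add: space_pair_measure)
  have DP: "D \<in> sets \<P>" using D subalgebra_Bidx[of \<nu>] by (auto simp: subalgebra_def)
  \<comment> \<open>The indicator of \<open>cyl a\<close> also tests that later steps are
    admissible, whereas the formula defining the measure asks for dependence on the first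
    \<open>K\<close> entries for all sequences. On the space of \<open>Mu\<close> both
    agree.\<close>
  define g where "g s = (if \<forall>i<K. s i = a ! i then 1 else 0 :: real)" for s :: "nat \<Rightarrow> int^'d"
  define f where "f x = indicator D (fst x) * g (snd x)" for x :: "'d env \<times> (nat \<Rightarrow> int^'d)"
  have C: "{s \<in> space steps_measure. \<forall>i<K. s i = a ! i} = cyl a" using a by (simp add: cyl_def length_Ulists)
  have fm: "f \<in> borel_measurable (Bbox \<nu> N M \<Otimes>\<^sub>M steps_measure)"
  proof -
    have g: "g \<in> borel_measurable steps_measure"
      unfolding g_def[abs_def] by (rule measurable_If) (simp_all only: C sets_cyl measurable_const space_borel UNIV_I)
    have "(indicator D :: 'd env \<Rightarrow> real) \<in> borel_measurable (Bbox \<nu> N M)"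
      by (rule borel_measurable_indicator) (use D in \<open>simp only: sets_Bbox_eq\<close>)
    then show ?thesis unfolding f_def[abs_def]
      by (intro borel_measurable_times measurable_compose[OF measurable_fst] measurable_compose[OF measurable_snd g])
  qed
  have fb: "\<bar>f x\<bar> \<le> 1" for x by (simp add: f_def g_def indicator_def)
  have fd: "f (\<omega>, s) = f (\<omega>, s')" if "\<And>i. i < K \<Longrightarrow> s i = s' i" for \<omega> s s' using that by (simp add: f_def g_def)
  have i: "integrable Mu f" "(\<integral>x. f x \<partial>Mu) = tilted_exp \<nu> \<theta> N M K f"
    using is_barmuD[where K = K, OF assms(1) fm fb fd] by simp_all
  have fi: "f x = indicator (D \<times> cyl a) x" if "x \<in> space Mu" for x
  proof -
    have "snd x \<in> cyl a \<longleftrightarrow> (\<forall>i<K. snd x i = a ! i)" using that unfolding C[symmetric] sp by auto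
    then show ?thesis by (cases x) (simp add: f_def g_def indicator_def)
  qed
  have Ds: "D \<times> cyl a \<in> sets Mu" unfolding sM using DP by measurable
  have "integrable Mu (indicator (D \<times> cyl a) :: _ \<Rightarrow> real)" using i(1) fi by (subst (asm) Bochner_Integration.integrable_cong[OF refl fi]) auto
  then have fin: "emeasure Mu (D \<times> cyl a) < \<infinity>"
    using Ds sets.sets_into_space[OF Ds] by (simp add: integrable_indicator_iff Int_absorb2)
  have "measure Mu (D \<times> cyl a) = (\<integral>x. indicator (D \<times> cyl a) x \<partial>Mu)" using Ds by simp
  also have "\<dots> = (\<integral>x. f x \<partial>Mu)" using fi by (intro Bochner_Integration.integral_cong) auto
  also have "\<dots> = (\<Sum>a'\<in>Ulists K. \<integral>\<omega>. f (\<omega>, pad a') * (back_wt \<theta> N \<omega> * path_wt \<nu> \<theta> a' \<omega> * part_fn \<nu> \<theta> (M + 1) (shift (int K) (sum_list a') \<omega>)) \<partial>\<P>)"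
    unfolding i(2) by (rule tilted_exp_eq[OF fm fb fd])
  also have "\<dots> = (\<Sum>a'\<in>Ulists K. if a' = a then (\<integral>\<omega>. indicator D \<omega> * box_dens \<theta> N a (M + 1) \<omega> \<partial>\<P>) else 0)"
  proof (intro sum.cong refl)
    fix a' :: "(int^'d) list" assume a': "a' \<in> Ulists K"
    have "(\<forall>i<K. pad a' i = a ! i) \<longleftrightarrow> a' = a"
      using a a' by (auto simp: pad_def length_Ulists list_eq_iff_nth_eq)
    then have "f (\<omega>, pad a') = (if a' = a then indicator D \<omega> else 0)" for \<omega> by (simp add: f_def g_def)
    then show "(\<integral>\<omega>. f (\<omega>, pad a') * (back_wt \<theta> N \<omega> * path_wt \<nu> \<theta> a' \<omega> * part_fn \<nu> \<theta> (M + 1) (shift (int K) (sum_list a') \<omega>)) \<partial>\<P>)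
      = (if a' = a then (\<integral>\<omega>. indicator D \<omega> * box_dens \<theta> N a (M + 1) \<omega> \<partial>\<P>) else 0)"
      using a by (simp add: box_dens_def length_Ulists)
  qed
  also have "\<dots> = (\<integral>\<omega>. indicator D \<omega> * box_dens \<theta> N a (M + 1) \<omega> \<partial>\<P>)" using a by simp
  finally have "measure Mu (D \<times> cyl a) = (\<integral>\<omega>. indicator D \<omega> * box_dens \<theta> N a (M + 1) \<omega> \<partial>\<P>)" .
  then show ?thesis
    unfolding emeasure_cyl_marginal[OF sM DP] using fin by (simp add: emeasure_eq_ennreal_measure less_top)
qed

end

lemma (in rwre) emeasure_density_real:
  assumes "integrable \<P> f" "AE \<omega> in \<P>. 0 \<le> (f \<omega> :: real)" "D \<in> sets \<P>"
  shows "emeasure (density \<P> (\<lambda>\<omega>. ennreal (f \<omega>))) D = ennreal (\<integral>\<omega>. indicator D \<omega> * f \<omega> \<partial>\<P>)"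
proof -
  have "emeasure (density \<P> (\<lambda>\<omega>. ennreal (f \<omega>))) D = (\<integral>\<^sup>+\<omega>. ennreal (indicator D \<omega> * f \<omega>) \<partial>\<P>)"
    using assms by (subst emeasure_density) (auto intro!: nn_integral_cong simp: indicator_def)
  also have "\<dots> = ennreal (\<integral>\<omega>. indicator D \<omega> * f \<omega> \<partial>\<P>)"
  proof (rule nn_integral_eq_integral)
    show "integrable \<P> (\<lambda>\<omega>. indicator D \<omega> * f \<omega>)"
      using assms by (intro integrable_mult_bounded[OF assms(1), where B=1]) (auto simp: indicator_def)
    show "AE \<omega> in \<P>. 0 \<le> indicator D \<omega> * f \<omega>" using assms(2) by eventually_elim auto
  qed
  finally show ?thesis .
qed

text \<open>Every site lies in some half-space. This is the generator for each extension from
  half-spaces to all environments.\<close>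

lemma sets_env_sigma:
  "sets (env_measure \<nu>) \<subseteq> sigma_sets (space (env_measure \<nu>)) (\<Union>N::nat. sets (Bidx \<nu> {i. - int N \<le> fst i}))"
  unfolding sets_Bidx_UNIV[symmetric] sets_Bidx[of \<nu> UNIV]
proof (rule sigma_sets_mono, safe)
  fix i :: "int \<times> (int^'a)" and B assume i: "B \<in> sets \<nu>"
  have "- int (nat (- fst i)) \<le> fst i" by simp
  then have "(\<lambda>\<omega>. \<omega> i) -` B \<inter> space (env_measure \<nu>) \<in> sets (Bidx \<nu> {j. - int (nat (- fst i)) \<le> fst j})"
    using measurable_sets[OF measurable_Bidx_component i, of i "{j. - int (nat (- fst i)) \<le> fst j}"] by simp
  then show "(\<lambda>\<omega>. \<omega> i) -` B \<inter> space (env_measure \<nu>)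
    \<in> sigma_sets (space (env_measure \<nu>)) (\<Union>N::nat. sets (Bidx \<nu> {i. - int N \<le> fst i}))" by blast
qed

lemma sets_Bplus_sigma:
  "sets (Bidx \<nu> {i. - int N \<le> fst i}) \<subseteq>
    sigma_sets (space (env_measure \<nu>)) (\<Union>M::nat. sets (Bidx \<nu> {i. - int N \<le> fst i \<and> fst i \<le> int M}))"
  unfolding sets_Bidx[of \<nu> "{i. - int N \<le> fst i}"]
proof (rule sigma_sets_mono, safe)
  fix i :: "int \<times> (int^'a)" and B assume i: "B \<in> sets \<nu>" "- int N \<le> fst i"
  have "fst i \<le> int (nat (fst i))" by simp
  then have "(\<lambda>\<omega>. \<omega> i) -` B \<inter> space (env_measure \<nu>) \<in> sets (Bidx \<nu> {j. - int N \<le> fst j \<and> fst j \<le> int (nat (fst i))})"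
    using measurable_sets[OF measurable_Bidx_component i(1), of i "{j. - int N \<le> fst j \<and> fst j \<le> int (nat (fst i))}"] i(2) by simp
  then show "(\<lambda>\<omega>. \<omega> i) -` B \<inter> space (env_measure \<nu>)
    \<in> sigma_sets (space (env_measure \<nu>)) (\<Union>M::nat. sets (Bidx \<nu> {i. - int N \<le> fst i \<and> fst i \<le> int M}))" by blast
qed

lemma Int_stable_UN_mono:
  assumes "\<And>m n::nat. m \<le> n \<Longrightarrow> sets (F m) \<subseteq> sets (F n)"
  shows "Int_stable (\<Union>n. sets (F n))"
proof (rule Int_stableI)
  fix a b assume "a \<in> (\<Union>n. sets (F n))" "b \<in> (\<Union>n. sets (F n))"
  then obtain m n where mn: "a \<in> sets (F m)" "b \<in> sets (F n)" by blast
  have "a \<in> sets (F (max m n))" by (rule subsetD[OF assms mn(1)]) simp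
  moreover have "b \<in> sets (F (max m n))" by (rule subsetD[OF assms mn(2)]) simp
  ultimately show "a \<inter> b \<in> (\<Union>n. sets (F n))" by blast
qed

section \<open>Limit densities of the tilted measure\<close>

locale rwre_tilt = rwre \<nu> c1 for \<nu> :: "((int^'d::finite) \<Rightarrow> real) measure" and c1 +
  fixes \<theta> :: "real^'d" and u :: "'d env \<Rightarrow> real"
  assumes measurable_u: "u \<in> borel_measurable (Bplus \<nu> 0)"
    and u_pos: "\<And>\<omega>. 0 < u \<omega>"
    and integrable_u: "integrable \<P> u"
    and integral_u: "(\<integral>\<omega>. u \<omega> \<partial>\<P>) = 1"
    and u_harmonic: "AE \<omega> in \<P>. u \<omega> = (\<Sum>z\<in>Ustep. \<omega> (0,0) z * step_wt \<nu> \<theta> z * u (shift 1 z \<omega>))"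
    and part_fn_L1: "(\<lambda>n. \<integral>\<omega>. \<bar>part_fn \<nu> \<theta> n \<omega> - u \<omega>\<bar> \<partial>\<P>) \<longlonglongrightarrow> 0"
begin

lemma u_Bidx: "u \<in> borel_measurable (Bidx \<nu> {i. 0 \<le> fst i})"
  using measurable_u by (simp add: Bplus_eq)

lemma u_shift_Bidx: "- int N \<le> m \<Longrightarrow> (\<lambda>\<omega>. u (shift m y \<omega>)) \<in> borel_measurable (Bidx \<nu> {i. - int N \<le> fst i})"
  by (rule measurable_compose[OF measurable_shift u_Bidx]) auto

lemma measurable_u_env [measurable]: "u \<in> borel_measurable \<P>"
  using u_Bidx by (rule measurable_Bidx_env)

definition dens :: "nat \<Rightarrow> (int^'d) list \<Rightarrow> 'd env \<Rightarrow> real" where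
  "dens N a \<omega> = back_wt \<theta> N \<omega> * path_wt \<nu> \<theta> a \<omega> * u (shift (int (length a)) (sum_list a) \<omega>)"

lemma AE_back_path: "a \<in> Ulists K \<Longrightarrow> AE \<omega> in \<P>. \<bar>back_wt \<theta> N \<omega> * path_wt \<nu> \<theta> a \<omega>\<bar> \<le> path_bd \<theta> N * path_bd \<theta> K"
proof -
  assume a: "a \<in> Ulists K"
  show "AE \<omega> in \<P>. \<bar>back_wt \<theta> N \<omega> * path_wt \<nu> \<theta> a \<omega>\<bar> \<le> path_bd \<theta> N * path_bd \<theta> K"
    using AE_abs_back_wt[of \<theta> N] AE_abs_path_wt[OF a, of \<theta>]
    by eventually_elim (auto simp: abs_mult intro!: mult_mono path_bd_nonneg)
qed

lemma integrable_dens: "a \<in> Ulists K \<Longrightarrow> integrable \<P> (dens N a)"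
  unfolding dens_def[abs_def]
  by (rule integrable_mult_bounded[OF integrable_shift[OF integrable_u] _ AE_back_path]) auto

lemma good_dens: "good \<omega> \<Longrightarrow> a \<in> Ulists K \<Longrightarrow> 0 \<le> dens N a \<omega>"
  unfolding dens_def using good_back_wt[of \<omega> \<theta> N] path_wt_bounds[of \<omega> a K \<theta>] u_pos
  by (intro mult_nonneg_nonneg) (auto intro: less_imp_le)

lemma AE_dens: "a \<in> Ulists K \<Longrightarrow> AE \<omega> in \<P>. 0 \<le> dens N a \<omega>"
proof -
  assume a: "a \<in> Ulists K"
  show "AE \<omega> in \<P>. 0 \<le> dens N a \<omega>" using AE_good by eventually_elim (rule good_dens[OF _ a])
qed

text \<open>Only the last factor depends on \<open>n\<close>; the prefactor is bounded, and the
  shift inside that factor preserves the measure, so the L1 convergence of \<open>part_fn\<close>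
  transfers.\<close>

lemma box_dens_tendsto:
  assumes a: "a \<in> Ulists K" and D: "D \<in> sets \<P>"
  shows "(\<lambda>n. \<integral>\<omega>. indicator D \<omega> * box_dens \<theta> N a n \<omega> \<partial>\<P>) \<longlonglongrightarrow> (\<integral>\<omega>. indicator D \<omega> * dens N a \<omega> \<partial>\<P>)"
proof -
  let ?U = "part_fn \<nu> \<theta>" and ?C = "path_bd \<theta> N * path_bd \<theta> K"
  let ?T = "shift (int (length a)) (sum_list a)"
  have ind: "integrable \<P> (\<lambda>\<omega>. indicator D \<omega> * f \<omega>)" if "integrable \<P> f" for f :: "'d env \<Rightarrow> real"
    using D by (intro integrable_mult_bounded[OF that, where B=1]) (auto simp: indicator_def)
  note i1 = ind[OF integrable_box_dens[OF a, of \<theta> N]] and i2 = ind[OF integrable_dens[OF a, of N]]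
  have di: "integrable \<P> (\<lambda>\<omega>. \<bar>?U n \<omega> - u \<omega>\<bar>)" for n by (intro integrable_abs Bochner_Integration.integrable_diff integrable_u integrable_part_fn)
  have "norm ((\<integral>\<omega>. indicator D \<omega> * box_dens \<theta> N a n \<omega> \<partial>\<P>) - (\<integral>\<omega>. indicator D \<omega> * dens N a \<omega> \<partial>\<P>))
      \<le> ?C * (\<integral>\<omega>. \<bar>?U n \<omega> - u \<omega>\<bar> \<partial>\<P>)" for n
  proof -
    have "(\<integral>\<omega>. indicator D \<omega> * box_dens \<theta> N a n \<omega> \<partial>\<P>) - (\<integral>\<omega>. indicator D \<omega> * dens N a \<omega> \<partial>\<P>)
      = (\<integral>\<omega>. indicator D \<omega> * box_dens \<theta> N a n \<omega> - indicator D \<omega> * dens N a \<omega> \<partial>\<P>)"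
      using i1 i2 by (rule Bochner_Integration.integral_diff[symmetric])
    also have "\<bar>\<dots>\<bar> \<le> (\<integral>\<omega>. \<bar>indicator D \<omega> * box_dens \<theta> N a n \<omega> - indicator D \<omega> * dens N a \<omega>\<bar> \<partial>\<P>)"
      by (rule integral_abs_bound)
    also have "\<dots> \<le> (\<integral>\<omega>. ?C * \<bar>?U n (?T \<omega>) - u (?T \<omega>)\<bar> \<partial>\<P>)"
    proof (rule integral_mono_AE)
      show "integrable \<P> (\<lambda>\<omega>. \<bar>indicator D \<omega> * box_dens \<theta> N a n \<omega> - indicator D \<omega> * dens N a \<omega>\<bar>)"
        by (rule integrable_abs, rule Bochner_Integration.integrable_diff[OF i1 i2])
      show "integrable \<P> (\<lambda>\<omega>. ?C * \<bar>?U n (?T \<omega>) - u (?T \<omega>)\<bar>)"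
        using integrable_shift[OF di] by (rule integrable_mult_right)
      show "AE \<omega> in \<P>. \<bar>indicator D \<omega> * box_dens \<theta> N a n \<omega> - indicator D \<omega> * dens N a \<omega>\<bar> \<le> ?C * \<bar>?U n (?T \<omega>) - u (?T \<omega>)\<bar>"
        using AE_back_path[OF a, of N]
      proof eventually_elim
        case (elim \<omega>)
        have "indicator D \<omega> * box_dens \<theta> N a n \<omega> - indicator D \<omega> * dens N a \<omega>
          = indicator D \<omega> * ((back_wt \<theta> N \<omega> * path_wt \<nu> \<theta> a \<omega>) * (?U n (?T \<omega>) - u (?T \<omega>)))"
          by (simp add: box_dens_def dens_def algebra_simps)
        also have "\<bar>\<dots>\<bar> \<le> 1 * \<bar>(back_wt \<theta> N \<omega> * path_wt \<nu> \<theta> a \<omega>) * (?U n (?T \<omega>) - u (?T \<omega>))\<bar>"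
          unfolding abs_mult[of "indicator D \<omega>"] by (intro mult_right_mono) (auto simp: indicator_def)
        also have "\<dots> \<le> ?C * \<bar>?U n (?T \<omega>) - u (?T \<omega>)\<bar>"
          unfolding abs_mult[of _ "?U n (?T \<omega>) - u (?T \<omega>)"] mult_1 by (intro mult_right_mono elim) simp
        finally show ?case .
      qed
    qed
    also have "\<dots> = ?C * (\<integral>\<omega>. \<bar>?U n \<omega> - u \<omega>\<bar> \<partial>\<P>)"
      using integral_shift[of "\<lambda>\<omega>. \<bar>?U n \<omega> - u \<omega>\<bar>"] by simp
    finally show ?thesis unfolding real_norm_def .
  qed
  moreover have "(\<lambda>n. ?C * (\<integral>\<omega>. \<bar>?U n \<omega> - u \<omega>\<bar> \<partial>\<P>)) \<longlonglongrightarrow> 0"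
    using tendsto_mult_left[OF part_fn_L1, of ?C] by (simp only: mult_zero_right)
  ultimately have "(\<lambda>n. (\<integral>\<omega>. indicator D \<omega> * box_dens \<theta> N a n \<omega> \<partial>\<P>) - (\<integral>\<omega>. indicator D \<omega> * dens N a \<omega> \<partial>\<P>)) \<longlonglongrightarrow> 0"
    by (rule Lim_null_comparison[OF always_eventually[OF allI]])
  then show ?thesis by (rule LIM_zero_cancel)
qed

end

text \<open>An arbitrary measure obeying the defining formula is fixed, so what follows holds for
  each such measure, independently of the existence proof.\<close>

locale barmu = rwre_tilt \<nu> c1 \<theta> u
  for \<nu> :: "((int^'d::finite) \<Rightarrow> real) measure" and c1 \<theta> u +
  fixes Mu :: "('d env \<times> (nat \<Rightarrow> int^'d)) measure"
  assumes barmu: "is_barmu \<nu> \<theta> Mu"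
begin

lemma sets_Mu [measurable_cong]: "sets Mu = sets (\<P> \<Otimes>\<^sub>M steps_measure)"
  using barmu by (simp add: is_barmu_def)

lemma space_Mu: "space Mu = space \<P> \<times> space steps_measure"
  using sets_eq_imp_space_eq[OF sets_Mu] by (simp add: space_pair_measure)

text \<open>A set of the box with upper time \<open>M\<close> belongs to every higher box. The left
  side is thus a constant sequence in the height of the box, while the integrals representing it
  converge to the limit density.\<close>

lemma cyl_marginal_box:
  assumes a: "a \<in> Ulists K" and D: "D \<in> sets (Bidx \<nu> {i. - int N \<le> fst i \<and> fst i \<le> int M})"
  shows "emeasure (cyl_marginal Mu a) D = emeasure (density \<P> (\<lambda>\<omega>. ennreal (dens N a \<omega>))) D"
proof -
  have DP: "D \<in> sets \<P>" using D subalgebra_Bidx[of \<nu>] by (auto simp: subalgebra_def)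
  let ?x = "\<lambda>n. \<integral>\<omega>. indicator D \<omega> * box_dens \<theta> N a n \<omega> \<partial>\<P>"
  have "emeasure (cyl_marginal Mu a) D = ennreal (?x (k + 1))" if "k \<ge> M" for k
  proof (rule barmu_box[OF barmu a])
    show "D \<in> sets (Bidx \<nu> {i. - int N \<le> fst i \<and> fst i \<le> int k})"
      by (rule subsetD[OF sets_Bidx_mono D]) (use that in auto)
  qed
  then have "eventually (\<lambda>k. ennreal (?x (k + 1)) = emeasure (cyl_marginal Mu a) D) sequentially"
    unfolding eventually_sequentially by metis
  then have "(\<lambda>k. ennreal (?x (k + 1))) \<longlonglongrightarrow> emeasure (cyl_marginal Mu a) D" by (rule tendsto_eventually)
  moreover have "(\<lambda>k. ennreal (?x (k + 1))) \<longlonglongrightarrow> ennreal (\<integral>\<omega>. indicator D \<omega> * dens N a \<omega> \<partial>\<P>)"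
    by (intro tendsto_ennrealI LIMSEQ_ignore_initial_segment box_dens_tendsto[OF a DP])
  ultimately have "emeasure (cyl_marginal Mu a) D = ennreal (\<integral>\<omega>. indicator D \<omega> * dens N a \<omega> \<partial>\<P>)"
    by (rule LIMSEQ_unique)
  also have "\<dots> = emeasure (density \<P> (\<lambda>\<omega>. ennreal (dens N a \<omega>))) D"
    by (rule emeasure_density_real[symmetric, OF integrable_dens[OF a] AE_dens[OF a] DP])
  finally show ?thesis .
qed

lemma finite_density_dens: "a \<in> Ulists K \<Longrightarrow> finite_measure (density \<P> (\<lambda>\<omega>. ennreal (dens N a \<omega>)))"
  by (rule finite_measureI) (simp add: emeasure_density_real[OF integrable_dens AE_dens sets.top])

lemma space_in_Bidx: "space \<P> \<in> sets (Bidx \<nu> I)"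
  using sets.top[of "Bidx \<nu> I"] by simp

lemma finite_cyl_marginal: "a \<in> Ulists K \<Longrightarrow> finite_measure (cyl_marginal Mu a)"
  by (rule finite_measureI)
     (simp add: cyl_marginal_box[where N=0 and M=0, OF _ space_in_Bidx]
        emeasure_density_real[OF integrable_dens AE_dens sets.top])

lemma cyl_marginal_Bplus:
  assumes a: "a \<in> Ulists K" and D: "D \<in> sets (Bidx \<nu> {i. - int N \<le> fst i})"
  shows "emeasure (cyl_marginal Mu a) D = emeasure (density \<P> (\<lambda>\<omega>. ennreal (dens N a \<omega>))) D"
proof (rule emeasure_eq_on_sigma_sets[where \<Omega> = "space \<P>"
        and G = "\<Union>M::nat. sets (Bidx \<nu> {i. - int N \<le> fst i \<and> fst i \<le> int M})",
      OF finite_cyl_marginal[OF a] finite_density_dens[OF a]])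
  let ?G = "\<Union>M::nat. sets (Bidx \<nu> {i. - int N \<le> fst i \<and> fst i \<le> int M})"
  show "D \<in> sigma_sets (space \<P>) ?G" using D sets_Bplus_sigma[of \<nu> N] by blast
  show "?G \<subseteq> sets (cyl_marginal Mu a)" "?G \<subseteq> sets (density \<P> (\<lambda>\<omega>. ennreal (dens N a \<omega>)))"
    using subalgebra_Bidx[of \<nu>] by (auto simp: subalgebra_def)
  show "Int_stable ?G" by (rule Int_stable_UN_mono, rule sets_Bidx_mono) auto
  show "space \<P> \<in> ?G" using space_in_Bidx by blast
  show "emeasure (cyl_marginal Mu a) X = emeasure (density \<P> (\<lambda>\<omega>. ennreal (dens N a \<omega>))) X" if "X \<in> ?G" for X
    using that cyl_marginal_box[OF a] by blast
qed simp_all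

text \<open>The total mass is the mean of the harmonic function.\<close>

lemma prob_space_Mu: "prob_space Mu"
proof (rule prob_spaceI)
  have N: "[] \<in> Ulists 0" by simp
  have "emeasure Mu (space Mu) = emeasure (cyl_marginal Mu []) (space \<P>)"
    by (simp add: emeasure_cyl_marginal[OF sets_Mu] space_Mu)
  also have "\<dots> = ennreal (\<integral>\<omega>. indicator (space \<P>) \<omega> * dens 0 [] \<omega> \<partial>\<P>)"
    by (simp only: cyl_marginal_box[where N=0 and M=0, OF N space_in_Bidx]
        emeasure_density_real[OF integrable_dens[OF N] AE_dens[OF N] sets.top])
  also have "(\<integral>\<omega>. indicator (space \<P>) \<omega> * dens 0 [] \<omega> \<partial>\<P>) = (\<integral>\<omega>. u \<omega> \<partial>\<P>)"
    by (intro Bochner_Integration.integral_cong refl) (simp add: dens_def)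
  finally show "emeasure Mu (space Mu) = 1" by (simp add: integral_u)
qed

abbreviation "marg \<equiv> cyl_marginal Mu []"

text \<open>The density is valid only for functions measurable on the half-space in question, hence
  the passage through \<open>restr_to_subalg\<close>.\<close>

lemma nn_integral_marg:
  assumes g: "g \<in> borel_measurable (Bidx \<nu> {i. - int N \<le> fst i})"
  shows "(\<integral>\<^sup>+\<omega>. g \<omega> \<partial>marg) = (\<integral>\<^sup>+\<omega>. ennreal (back_wt \<theta> N \<omega> * u \<omega>) * g \<omega> \<partial>\<P>)"
proof -
  let ?F = "Bidx \<nu> {i. - int N \<le> fst i}"
  let ?Q = "density \<P> (\<lambda>\<omega>. ennreal (dens N [] \<omega>))"
  have s1: "subalgebra marg ?F" and s2: "subalgebra ?Q ?F"
    using subalgebra_Bidx[of \<nu> "{i. - int N \<le> fst i}"] by (auto simp: subalgebra_def)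
  have eq: "restr_to_subalg marg ?F = restr_to_subalg ?Q ?F"
  proof (rule measure_eqI)
    show "sets (restr_to_subalg marg ?F) = sets (restr_to_subalg ?Q ?F)"
      by (simp add: sets_restr_to_subalg[OF s1] sets_restr_to_subalg[OF s2])
    fix A assume "A \<in> sets (restr_to_subalg marg ?F)"
    then have A: "A \<in> sets ?F" by (simp add: sets_restr_to_subalg[OF s1])
    show "emeasure (restr_to_subalg marg ?F) A = emeasure (restr_to_subalg ?Q ?F) A"
      unfolding emeasure_restr_to_subalg[OF s1 A] emeasure_restr_to_subalg[OF s2 A]
      by (rule cyl_marginal_Bplus[where K = 0, OF _ A]) simp
  qed
  have "(\<integral>\<^sup>+\<omega>. g \<omega> \<partial>marg) = (\<integral>\<^sup>+\<omega>. g \<omega> \<partial>?Q)"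
    using nn_integral_subalgebra2[OF s1 g] nn_integral_subalgebra2[OF s2 g] eq by simp
  also have "\<dots> = (\<integral>\<^sup>+\<omega>. ennreal (dens N [] \<omega>) * g \<omega> \<partial>\<P>)"
    using measurable_Bidx_env[OF g] integrable_dens[of "[]" 0 N] by (intro nn_integral_density) auto
  also have "\<dots> = (\<integral>\<^sup>+\<omega>. ennreal (back_wt \<theta> N \<omega> * u \<omega>) * g \<omega> \<partial>\<P>)"
    by (simp add: dens_def)
  finally show ?thesis .
qed

text \<open>Quenched probability of the steps \<open>a\<close> for the Doob transform by
  \<open>u\<close>; for a single step it is \<open>pi_theta\<close>.\<close>

definition path_dens :: "(int^'d) list \<Rightarrow> 'd env \<Rightarrow> real" where
  "path_dens a \<omega> = path_wt \<nu> \<theta> a \<omega> * u (shift (int (length a)) (sum_list a) \<omega>) / u \<omega>"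

lemma measurable_path_dens:
  assumes a: "a \<in> Ulists K" shows "path_dens a \<in> borel_measurable (Bidx \<nu> {i. - int N \<le> fst i})"
  unfolding path_dens_def[abs_def]
  by (intro borel_measurable_divide borel_measurable_times u_shift_Bidx
      measurable_Bidx_mono[OF measurable_path_wt[OF a]] measurable_Bidx_mono[OF u_Bidx]) auto

lemma measurable_path_dens_env [measurable]: "a \<in> Ulists K \<Longrightarrow> path_dens a \<in> borel_measurable \<P>"
  using measurable_path_dens by (rule measurable_Bidx_env)

text \<open>Since \<open>dens N a = back_wt \<theta> N * u * path_dens a\<close>, the backward
  factor belongs to the marginal and the ratio is the same for all \<open>N\<close>. The half-space
  identities therefore fit together to an identity on all events.\<close>

lemma cyl_marginal_eq:
  assumes a: "a \<in> Ulists K" and D: "D \<in> sets \<P>"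
  shows "emeasure (cyl_marginal Mu a) D = emeasure (density marg (\<lambda>\<omega>. ennreal (path_dens a \<omega>))) D"
proof -
  let ?Q = "density marg (\<lambda>\<omega>. ennreal (path_dens a \<omega>))"
  have eq: "emeasure (cyl_marginal Mu a) X = emeasure ?Q X" if X: "X \<in> sets (Bidx \<nu> {i. - int N \<le> fst i})" for X N
  proof -
    have XP: "X \<in> sets \<P>" using X subalgebra_Bidx[of \<nu>] by (auto simp: subalgebra_def)
    have "emeasure ?Q X = (\<integral>\<^sup>+\<omega>. ennreal (path_dens a \<omega>) * indicator X \<omega> \<partial>marg)"
      using a XP by (subst emeasure_density) auto
    also have "\<dots> = (\<integral>\<^sup>+\<omega>. ennreal (back_wt \<theta> N \<omega> * u \<omega>) * (ennreal (path_dens a \<omega>) * indicator X \<omega>) \<partial>\<P>)"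
      using X by (intro nn_integral_marg borel_measurable_times_ennreal measurable_compose[OF measurable_path_dens[OF a] measurable_ennreal]
        borel_measurable_indicator)
    also have "\<dots> = (\<integral>\<^sup>+\<omega>. ennreal (dens N a \<omega>) * indicator X \<omega> \<partial>\<P>)"
    proof (rule nn_integral_cong_AE)
      show "AE \<omega> in \<P>. ennreal (back_wt \<theta> N \<omega> * u \<omega>) * (ennreal (path_dens a \<omega>) * indicator X \<omega>) = ennreal (dens N a \<omega>) * indicator X \<omega>"
        using AE_good
      proof eventually_elim
        case (elim \<omega>)
        have "dens N a \<omega> = (back_wt \<theta> N \<omega> * u \<omega>) * path_dens a \<omega>"
          using u_pos[of \<omega>] by (simp add: dens_def path_dens_def)
        moreover have "0 \<le> back_wt \<theta> N \<omega> * u \<omega>" using good_back_wt[OF elim, of \<theta> N] u_pos[of \<omega>] by simp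
        ultimately have "ennreal (dens N a \<omega>) = ennreal (back_wt \<theta> N \<omega> * u \<omega>) * ennreal (path_dens a \<omega>)"
          by (simp only: ennreal_mult')
        then show ?case by (simp only: mult.assoc)
      qed
    qed
    also have "\<dots> = emeasure (density \<P> (\<lambda>\<omega>. ennreal (dens N a \<omega>))) X"
      using XP integrable_dens[OF a, of N] by (subst emeasure_density) auto
    finally show ?thesis by (simp add: cyl_marginal_Bplus[OF a X])
  qed
  let ?G = "\<Union>N::nat. sets (Bidx \<nu> {i. - int N \<le> fst i})"
  show ?thesis
  proof (rule emeasure_eq_on_sigma_sets[where \<Omega> = "space \<P>" and G = ?G])
    show fin: "finite_measure (cyl_marginal Mu a)" by (rule finite_cyl_marginal[OF a])
    \<comment> \<open>Finiteness of the right-hand measure is read off from the identity itself, at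
      the whole space.\<close>
    have "emeasure ?Q (space \<P>) = emeasure (cyl_marginal Mu a) (space \<P>)"
      by (rule eq[of _ 0, symmetric]) (rule space_in_Bidx)
    then show "finite_measure ?Q"
      using finite_measure.emeasure_finite[OF fin] by (intro finite_measureI) simp
    show "?G \<subseteq> sets (cyl_marginal Mu a)" "?G \<subseteq> sets ?Q"
      using subalgebra_Bidx[of \<nu>] by (auto simp: subalgebra_def)
    show "Int_stable ?G" by (rule Int_stable_UN_mono, rule sets_Bidx_mono) auto
    show "space \<P> \<in> ?G" using space_in_Bidx by blast
    show "emeasure (cyl_marginal Mu a) X = emeasure ?Q X" if "X \<in> ?G" for X using that eq by blast
    show "D \<in> sigma_sets (space \<P>) ?G" using D sets_env_sigma[of \<nu>] by blast
  qed simp_all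
qed

lemma marg_null:
  assumes A: "A \<in> sets (Bidx \<nu> {i. - int N \<le> fst i})" and z: "emeasure \<P> A = 0"
  shows "emeasure marg A = 0"
proof -
  have AP: "A \<in> sets \<P>" using A subalgebra_Bidx[of \<nu>] by (auto simp: subalgebra_def)
  then have "AE \<omega> in \<P>. \<omega> \<notin> A" using z by (intro AE_not_in) auto
  then have "(\<integral>\<^sup>+\<omega>. ennreal (dens N [] \<omega>) * indicator A \<omega> \<partial>\<P>) = (\<integral>\<^sup>+\<omega>. 0 \<partial>\<P>)"
    by (intro nn_integral_cong_AE) (auto elim!: eventually_mono)
  then show ?thesis
    using AP integrable_dens[of "[]" 0 N] by (subst cyl_marginal_Bplus[where K = 0, OF _ A]) (auto simp: emeasure_density)
qed

end

section \<open>Past sigma-algebras of a sequence\<close>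

lemma space_past [simp]: "space (past Om n) = space (PiM UNIV (\<lambda>_::nat. Om))"
  unfolding past_def by (rule space_measure_of) auto

lemma sets_past:
  "sets (past Om n) = sigma_sets (space (PiM UNIV (\<lambda>_::nat. Om)))
     {(\<lambda>w. w i) -` B \<inter> space (PiM UNIV (\<lambda>_. Om)) | i B. i \<le> n \<and> B \<in> sets Om}"
  unfolding past_def by (rule sets_measure_of) auto

lemma sets_past_mono: "m \<le> n \<Longrightarrow> sets (past Om m) \<subseteq> sets (past Om n)"
  unfolding sets_past by (rule sigma_sets_mono') (blast intro: order_trans)

lemma measurable_component_UNIV: "(\<lambda>w. w i) \<in> PiM UNIV (\<lambda>_. Om) \<rightarrow>\<^sub>M Om"
  by (rule measurable_component_singleton) simp

lemma sets_past_subset: "sets (past Om n) \<subseteq> sets (PiM UNIV (\<lambda>_. Om))"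
  unfolding sets_past
proof (rule sets.sigma_sets_subset, safe)
  fix i B assume "i \<le> n" "B \<in> sets Om"
  then show "(\<lambda>w. w i) -` B \<inter> space (PiM UNIV (\<lambda>_. Om)) \<in> sets (PiM UNIV (\<lambda>_. Om))"
    by (rule_tac measurable_sets[OF measurable_component_UNIV])
qed

lemma subalgebra_past: "subalgebra (PiM UNIV (\<lambda>_. Om)) (past Om n)"
  using sets_past_subset[of Om n] by (simp add: subalgebra_def)

lemma measurable_past_component: "i \<le> n \<Longrightarrow> (\<lambda>w. w i) \<in> past Om n \<rightarrow>\<^sub>M Om"
  by (rule measurableI) (auto simp: space_PiM PiE_iff sets_past)

lemma past_agree:
  assumes "A \<in> sets (past Om n)" "w \<in> space (PiM UNIV (\<lambda>_. Om))" "w' \<in> space (PiM UNIV (\<lambda>_. Om))"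
    and "\<And>i. i \<le> n \<Longrightarrow> w i = w' i"
  shows "w \<in> A \<longleftrightarrow> w' \<in> A"
  using assms(1) unfolding sets_past
proof (induction rule: sigma_sets.induct)
  case (Basic a)
  then obtain i B where a: "a = (\<lambda>w. w i) -` B \<inter> space (PiM UNIV (\<lambda>_. Om))" "i \<le> n" by blast
  then show ?case using assms(2-4) by simp
next
  case (Compl a) then show ?case using assms(2,3) by simp
qed simp_all

lemma sets_PiM_past_sigma:
  "sets (PiM UNIV (\<lambda>_. Om)) \<subseteq> sigma_sets (space (PiM UNIV (\<lambda>_. Om))) (\<Union>n. sets (past Om n))"
proof -
  have "sets (PiM UNIV (\<lambda>_. Om)) = sigma_sets (UNIV \<rightarrow>\<^sub>E space Om) {{f \<in> UNIV \<rightarrow>\<^sub>E space Om. f i \<in> A} | i A. i \<in> UNIV \<and> A \<in> sets Om}"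
    by (rule sets_PiM_single)
  also have "\<dots> \<subseteq> sigma_sets (UNIV \<rightarrow>\<^sub>E space Om) (\<Union>n. sets (past Om n))"
  proof (rule sigma_sets_mono, safe)
    fix i :: nat and A assume A: "A \<in> sets Om"
    have "(\<lambda>w. w i) -` A \<inter> space (past Om i) \<in> sets (past Om i)"
      by (rule measurable_sets[OF measurable_past_component A]) simp
    moreover have "(\<lambda>w. w i) -` A \<inter> space (past Om i) = {f \<in> UNIV \<rightarrow>\<^sub>E space Om. f i \<in> A}"
      by (auto simp: space_PiM)
    ultimately show "{f \<in> UNIV \<rightarrow>\<^sub>E space Om. f i \<in> A} \<in> sigma_sets (UNIV \<rightarrow>\<^sub>E space Om) (\<Union>n. sets (past Om n))"
      by (intro sigma_sets.Basic) auto
  qed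
  finally show ?thesis by (simp add: space_PiM)
qed

text \<open>The pasts increase and generate the product, so their union is a suitable
  pi-system.\<close>

lemma PiM_eqI_past:
  assumes fin: "finite_measure M1" "finite_measure M2"
    and s: "sets M1 = sets (PiM UNIV (\<lambda>_. Om))" "sets M2 = sets (PiM UNIV (\<lambda>_. Om))"
    and eq: "\<And>n A. A \<in> sets (past Om n) \<Longrightarrow> emeasure M1 A = emeasure M2 A"
  shows "M1 = M2"
proof (rule measure_eqI)
  show "sets M1 = sets M2" by (simp add: s)
  fix A assume A: "A \<in> sets M1"
  let ?G = "\<Union>n. sets (past Om n)" and ?S = "space (PiM UNIV (\<lambda>_::nat. Om))"
  show "emeasure M1 A = emeasure M2 A"
  proof (rule emeasure_eq_on_sigma_sets[where \<Omega> = ?S and G = ?G, OF fin])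
    show "space M1 = ?S" "space M2 = ?S" using s sets_eq_imp_space_eq by blast+
    show "?G \<subseteq> sets M1" "?G \<subseteq> sets M2" unfolding s using sets_past_subset by blast+
    show "Int_stable ?G" by (rule Int_stable_UN_mono) (rule sets_past_mono)
    show "?S \<in> ?G" using sets.top[of "past Om 0"] by auto
    show "emeasure M1 X = emeasure M2 X" if "X \<in> ?G" for X using that eq by blast
    show "A \<in> sigma_sets ?S ?G" using A sets_PiM_past_sigma[of Om] unfolding s by blast
  qed
qed

section \<open>The chain of environments under the tilted measure\<close>

context barmu
begin

definition walk :: "'d env \<times> (nat \<Rightarrow> int^'d) \<Rightarrow> nat \<Rightarrow> 'd env" where
  "walk x n = shift (int n) (\<Sum>i<n. snd x i) (fst x)"

lemma mu_inf_eq: "mu_inf \<nu> Mu = distr Mu (env_seq_measure \<nu>) walk"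
proof -
  have "(\<lambda>(\<omega>, s) n. shift (int n) (\<Sum>i<n. s i) \<omega>) = walk"
    by (auto simp: fun_eq_iff walk_def)
  then show ?thesis by (simp add: mu_inf_def)
qed

lemma walk_cyl:
  assumes "a \<in> Ulists K" "snd x \<in> cyl a" "n \<le> K"
  shows "walk x n = walk (fst x, pad a) n"
proof -
  have "(\<Sum>i<n. snd x i) = (\<Sum>i<n. pad a i)"
    using assms by (intro sum.cong refl) (auto simp: cyl_def pad_def length_Ulists)
  then show ?thesis by (simp add: walk_def)
qed

lemma sum_pad: "a \<in> Ulists K \<Longrightarrow> (\<Sum>i<K. pad a i) = sum_list a"
  by (simp add: pad_def length_Ulists sum_list_sum_nth atLeast0LessThan)

lemma walk_pad: "a \<in> Ulists K \<Longrightarrow> walk (\<omega>, pad a) K = shift (int K) (sum_list a) \<omega>"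
  by (simp add: walk_def sum_pad)

lemma walk_pad_Cons: "walk (\<omega>, pad (z # a)) (Suc n) = walk (shift 1 z \<omega>, pad a) n"
proof -
  have "(\<Sum>i<Suc n. pad (z # a) i) = z + (\<Sum>i<n. pad a i)"
  proof -
    have "pad (z # a) (Suc i) = pad a i" "pad (z # a) 0 = z" for i by (simp_all add: pad_def)
    then show ?thesis by (simp only: sum.lessThan_Suc_shift)
  qed
  then show ?thesis by (simp add: walk_def add.commute)
qed

lemma walk_in_space: "fst x \<in> space \<P> \<Longrightarrow> walk x n \<in> space \<P>"
  by (simp add: walk_def shift_in_space)

lemma walk_seq_in_space: "fst x \<in> space \<P> \<Longrightarrow> walk x \<in> space (PiM UNIV (\<lambda>_. \<P>))"
  by (simp add: space_PiM PiE_iff walk_in_space)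

lemma measurable_walk_pad: "(\<lambda>\<omega>. walk (\<omega>, pad a)) \<in> \<P> \<rightarrow>\<^sub>M PiM UNIV (\<lambda>_. \<P>)"
proof (rule measurable_PiM_single')
  show "(\<lambda>\<omega>. walk (\<omega>, pad a) n) \<in> \<P> \<rightarrow>\<^sub>M \<P>" for n
    by (simp add: walk_def)
qed (simp add: PiE_iff walk_in_space)

text \<open>On a cylinder of the first \<open>n\<close> steps the \<open>n\<close>-th environment is
  one fixed shift, and finitely many such cylinders cover the space.\<close>

lemma measurable_walk: "walk \<in> Mu \<rightarrow>\<^sub>M PiM UNIV (\<lambda>_. \<P>)"
proof (rule measurable_PiM_single')
  fix n
  show "(\<lambda>x. walk x n) \<in> Mu \<rightarrow>\<^sub>M \<P>"
  proof (rule measurableI)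
    fix B assume B: "B \<in> sets \<P>"
    have "(\<lambda>x. walk x n) -` B \<inter> space Mu = (\<Union>a\<in>Ulists n. (shift (int n) (sum_list a) -` B \<inter> space \<P>) \<times> cyl a)"
    proof (intro set_eqI iffI)
      fix x assume x: "x \<in> (\<lambda>x. walk x n) -` B \<inter> space Mu"
      define a where "a = map (snd x) [0..<n]"
      have s: "snd x \<in> space steps_measure" "fst x \<in> space \<P>" using x by (auto simp: space_Mu)
      have a: "a \<in> Ulists n" "snd x \<in> cyl a" using map_upt_Ulists[OF s(1), of n] cyl_iff[of a n "snd x"] s by (auto simp: a_def)
      have "shift (int n) (sum_list a) (fst x) \<in> B" using x walk_cyl[OF a order_refl] walk_pad[OF a(1)] by simp
      then have "x \<in> (shift (int n) (sum_list a) -` B \<inter> space \<P>) \<times> cyl a" using s a by (simp add: mem_Times_iff)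
      then show "x \<in> (\<Union>a\<in>Ulists n. (shift (int n) (sum_list a) -` B \<inter> space \<P>) \<times> cyl a)" using a(1) by blast
    next
      fix x assume "x \<in> (\<Union>a\<in>Ulists n. (shift (int n) (sum_list a) -` B \<inter> space \<P>) \<times> cyl a)"
      then obtain a where a: "a \<in> Ulists n" "fst x \<in> space \<P>" "shift (int n) (sum_list a) (fst x) \<in> B" "snd x \<in> cyl a" by auto
      then show "x \<in> (\<lambda>x. walk x n) -` B \<inter> space Mu"
        using walk_cyl[OF a(1,4) order_refl] walk_pad[OF a(1)] by (cases x) (auto simp: space_Mu cyl_def)
    qed
    also have "\<dots> \<in> sets (\<P> \<Otimes>\<^sub>M steps_measure)"
      by (intro sets.finite_UN finite_Ulists pair_measureI measurable_sets[OF measurable_shift_env B] sets_cyl)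
    finally show "(\<lambda>x. walk x n) -` B \<inter> space Mu \<in> sets Mu" by (simp only: sets_Mu)
  qed (auto simp: space_Mu walk_in_space)
qed (auto simp: space_Mu PiE_iff walk_in_space)

lemma measurable_walk_n: "(\<lambda>x. walk x n) \<in> Mu \<rightarrow>\<^sub>M \<P>"
  by (rule measurable_compose[OF measurable_walk measurable_component_UNIV])

lemma cyl_marginal_density: "a \<in> Ulists K \<Longrightarrow> cyl_marginal Mu a = density marg (\<lambda>\<omega>. ennreal (path_dens a \<omega>))"
  by (rule measure_eqI) (simp_all add: cyl_marginal_eq)

lemma measurable_marg_iff: "f \<in> borel_measurable marg \<longleftrightarrow> f \<in> borel_measurable \<P>"
  by (simp cong: measurable_cong_sets)

text \<open>A function of the environment and the first \<open>K\<close> steps is split over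
  cylinders; each piece becomes an integral against the marginal, weighted by
  \<open>path_dens\<close>. Computations about the chain pass through this formula.\<close>

lemma nn_integral_Mu:
  assumes G: "\<And>a. a \<in> Ulists K \<Longrightarrow> G a \<in> borel_measurable \<P>"
    and F: "\<And>x a. x \<in> space Mu \<Longrightarrow> a \<in> Ulists K \<Longrightarrow> snd x \<in> cyl a \<Longrightarrow> F x = G a (fst x)"
  shows "(\<integral>\<^sup>+x. F x \<partial>Mu) = (\<Sum>a\<in>Ulists K. \<integral>\<^sup>+\<omega>. ennreal (path_dens a \<omega>) * G a \<omega> \<partial>marg)"
proof -
  have fstM: "fst \<in> Mu \<rightarrow>\<^sub>M \<P>" by measurable
  have sndM: "snd \<in> Mu \<rightarrow>\<^sub>M steps_measure" by measurable
  have mG: "(\<lambda>x. G a (fst x)) \<in> borel_measurable Mu" if "a \<in> Ulists K" for a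
    by (rule measurable_compose[OF fstM G[OF that]])
  have mI: "(\<lambda>x. indicator (cyl a) (snd x) :: ennreal) \<in> borel_measurable Mu" for a
    by (rule measurable_compose[OF sndM]) (rule borel_measurable_indicator[OF sets_cyl])
  have "(\<integral>\<^sup>+x. F x \<partial>Mu) = (\<integral>\<^sup>+x. (\<Sum>a\<in>Ulists K. indicator (cyl a) (snd x) * G a (fst x)) \<partial>Mu)"
  proof (rule nn_integral_cong)
    fix x assume x: "x \<in> space Mu"
    define b where "b = map (snd x) [0..<K]"
    have s: "snd x \<in> space steps_measure" using x by (auto simp: space_Mu)
    have b: "b \<in> Ulists K" unfolding b_def by (rule map_upt_Ulists[OF s])
    have "(\<Sum>a\<in>Ulists K. indicator (cyl a) (snd x) * G a (fst x)) = (\<Sum>a\<in>Ulists K. if a = b then G b (fst x) else 0)"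
      using s by (intro sum.cong refl) (auto simp: indicator_def cyl_iff b_def)
    also have "\<dots> = G b (fst x)" using b by simp
    also have "\<dots> = F x" using b s by (intro F[symmetric] x) (auto simp: cyl_iff b_def)
    finally show "F x = (\<Sum>a\<in>Ulists K. indicator (cyl a) (snd x) * G a (fst x))" by simp
  qed
  also have "\<dots> = (\<Sum>a\<in>Ulists K. \<integral>\<^sup>+x. indicator (cyl a) (snd x) * G a (fst x) \<partial>Mu)"
    by (rule nn_integral_sum) (rule borel_measurable_times_ennreal[OF mI mG])
  also have "\<dots> = (\<Sum>a\<in>Ulists K. \<integral>\<^sup>+\<omega>. ennreal (path_dens a \<omega>) * G a \<omega> \<partial>marg)"
  proof (intro sum.cong refl)
    fix a :: "(int^'d) list" assume a: "a \<in> Ulists K"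
    have iM: "(indicator (space \<P> \<times> cyl a) :: _ \<Rightarrow> ennreal) \<in> borel_measurable Mu"
      by (rule borel_measurable_indicator) (unfold sets_Mu, intro pair_measureI sets.top sets_cyl)
    have "(\<integral>\<^sup>+x. indicator (cyl a) (snd x) * G a (fst x) \<partial>Mu) = (\<integral>\<^sup>+x. indicator (space \<P> \<times> cyl a) x * G a (fst x) \<partial>Mu)"
      by (intro nn_integral_cong) (auto simp: space_Mu indicator_def)
    also have "\<dots> = (\<integral>\<^sup>+x. G a (fst x) \<partial>density Mu (indicator (space \<P> \<times> cyl a)))"
      by (rule nn_integral_density[symmetric, OF iM mG[OF a]])
    also have "\<dots> = (\<integral>\<^sup>+\<omega>. G a \<omega> \<partial>cyl_marginal Mu a)"
      unfolding cyl_marginal_def by (rule nn_integral_distr[symmetric]) (use fstM G[OF a] in auto)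
    also have "\<dots> = (\<integral>\<^sup>+\<omega>. ennreal (path_dens a \<omega>) * G a \<omega> \<partial>marg)"
      unfolding cyl_marginal_density[OF a]
      by (rule nn_integral_density) (use G[OF a] measurable_path_dens_env[OF a] in \<open>simp_all add: measurable_marg_iff\<close>)
    finally show "(\<integral>\<^sup>+x. indicator (cyl a) (snd x) * G a (fst x) \<partial>Mu) = (\<integral>\<^sup>+\<omega>. ennreal (path_dens a \<omega>) * G a \<omega> \<partial>marg)" .
  qed
  finally show ?thesis .
qed

text \<open>\<open>good\<close> involves all times, whereas absolute continuity is known on
  half-spaces only. Each site is therefore treated in a half-space containing it, and countability
  combines the sites.\<close>

lemma AE_marg_good: "AE \<omega> in marg. good \<omega>"
proof -
  have "AE \<omega> in marg. (\<forall>z\<in>Ustep. c1 \<le> \<omega> i z) \<and> (\<Sum>z\<in>Ustep. \<omega> i z) = 1" for i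
  proof -
    let ?F = "Bidx \<nu> {j. - int (nat (- fst i)) \<le> fst j}"
    let ?A = "{\<omega> \<in> space ?F. \<not> ((\<forall>z\<in>Ustep. c1 \<le> \<omega> i z) \<and> (\<Sum>z\<in>Ustep. \<omega> i z) = 1)}"
    have w: "(\<lambda>\<omega>. \<omega> i z) \<in> borel_measurable ?F" if "z \<in> Ustep" for z
      by (rule measurable_weight_Bidx[OF that]) simp
    have "{\<omega> \<in> space ?F. \<forall>z\<in>Ustep. c1 \<le> \<omega> i z} \<in> sets ?F"
      by (intro sets.sets_Collect_finite_All finite_Ustep borel_measurable_le measurable_const w) simp_all
    moreover have "{\<omega> \<in> space ?F. (\<Sum>z\<in>Ustep. \<omega> i z) = 1} \<in> sets ?F"
      by (intro borel_measurable_eq borel_measurable_sum w measurable_const) simp_all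
    ultimately have A: "?A \<in> sets ?F" by (intro sets.sets_Collect_neg sets.sets_Collect_conj)
    then have AP: "?A \<in> sets \<P>" using subalgebra_Bidx[of \<nu>] by (auto simp: subalgebra_def)
    have "AE \<omega> in \<P>. \<omega> \<notin> ?A" using AE_good by eventually_elim (simp add: good_def)
    then have "emeasure \<P> ?A = 0" using AP by (simp add: AE_iff_null_sets null_setsD1)
    then have "emeasure marg ?A = 0" by (rule marg_null[OF A])
    then have "AE \<omega> in marg. \<omega> \<notin> ?A" using AP by (intro AE_not_in) (auto simp: null_sets_def)
    then show ?thesis using AE_space by eventually_elim simp
  qed
  then show ?thesis unfolding good_def by (rule AE_all_countable[THEN iffD2, OF allI])
qed

lemma marg_eq_distr: "marg = distr Mu \<P> fst"
proof (rule measure_eqI)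
  fix A assume "A \<in> sets marg"
  then have A: "A \<in> sets \<P>" by simp
  have fstM: "fst \<in> Mu \<rightarrow>\<^sub>M \<P>" by measurable
  have "fst -` A \<inter> space Mu = A \<times> space steps_measure"
    using sets.sets_into_space[OF A] by (auto simp: space_Mu)
  then show "emeasure marg A = emeasure (distr Mu \<P> fst) A"
    using A by (simp add: emeasure_cyl_marginal[OF sets_Mu A] emeasure_distr[OF fstM A])
qed simp

lemma AE_Mu_good: "AE x in Mu. good (fst x)"
proof -
  have fstM: "fst \<in> Mu \<rightarrow>\<^sub>M \<P>" by measurable
  show ?thesis using AE_distrD[OF fstM] AE_marg_good unfolding marg_eq_distr by blast
qed

lemma path_dens_append:
  "path_dens (a @ b) \<omega> = path_dens a \<omega> * path_dens b (shift (int (length a)) (sum_list a) \<omega>)"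
  using u_pos[of "shift (int (length a)) (sum_list a) \<omega>"]
  by (simp add: path_dens_def path_wt_append add.commute)

lemma path_dens_nonneg: "good \<omega> \<Longrightarrow> a \<in> Ulists K \<Longrightarrow> 0 \<le> path_dens a \<omega>"
  unfolding path_dens_def using path_wt_bounds[of \<omega> a K \<theta>] u_pos
  by (intro divide_nonneg_pos mult_nonneg_nonneg) (auto intro: less_imp_le)

text \<open>Peels off the step that leads into the origin; the remaining steps form the backward sum
  seen from the preceding site.\<close>

lemma back_wt_Suc:
  "back_wt \<theta> (Suc N) \<omega> = (\<Sum>z\<in>Ustep. back_wt \<theta> N (shift (- 1) (- z) \<omega>) * path_wt \<nu> \<theta> [z] (shift (- 1) (- z) \<omega>))"
proof -
  have "back_wt \<theta> (Suc N) \<omega> = (\<Sum>b\<in>Ulists N. \<Sum>z\<in>Ustep. path_wt \<nu> \<theta> (b @ [z]) (shift (- int (Suc N)) (- sum_list (b @ [z])) \<omega>))"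
    unfolding back_wt_def using sum_Ulists_add[of "\<lambda>b. path_wt \<nu> \<theta> b (shift (- int (Suc N)) (- sum_list b) \<omega>)" N "Suc 0"]
    by (simp only: sum_Ulists_1 add_Suc_right add_0_right)
  also have "\<dots> = (\<Sum>b\<in>Ulists N. \<Sum>z\<in>Ustep. path_wt \<nu> \<theta> b (shift (- int N) (- sum_list b) (shift (- 1) (- z) \<omega>)) * path_wt \<nu> \<theta> [z] (shift (- 1) (- z) \<omega>))"
  proof (intro sum.cong refl)
    fix b z :: "(int^'d)" and bs assume "bs \<in> (Ulists N :: (int^'d) list set)"
    then show "path_wt \<nu> \<theta> (bs @ [z]) (shift (- int (Suc N)) (- sum_list (bs @ [z])) \<omega>)
      = path_wt \<nu> \<theta> bs (shift (- int N) (- sum_list bs) (shift (- 1) (- z) \<omega>)) * path_wt \<nu> \<theta> [z] (shift (- 1) (- z) \<omega>)"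
      unfolding path_wt_append by (simp add: length_Ulists algebra_simps del: path_wt.simps)
  qed
  also have "\<dots> = (\<Sum>z\<in>Ustep. back_wt \<theta> N (shift (- 1) (- z) \<omega>) * path_wt \<nu> \<theta> [z] (shift (- 1) (- z) \<omega>))"
    unfolding back_wt_def sum_distrib_right by (rule sum.swap)
  finally show ?thesis .
qed

lemma nn_integral_shift: "f \<in> borel_measurable \<P> \<Longrightarrow> (\<integral>\<^sup>+\<omega>. f (shift m y \<omega>) \<partial>\<P>) = (\<integral>\<^sup>+\<omega>. f \<omega> \<partial>\<P>)"
  using nn_integral_distr[OF measurable_shift_env, of f \<nu> m y] by (simp add: distr_shift)

text \<open>Invariance of the marginal. Taking a step and recentring turns the density at level
  \<open>N\<close> into \<open>back_wt \<theta> (Suc N) * u\<close> by \<open>back_wt_Suc\<close>,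
  which is again the marginal density, now for the half-space reaching one time unit further
  back.\<close>

lemma distr_walk_1: "distr Mu \<P> (\<lambda>x. walk x 1) = marg"
proof (rule measure_eqI)
  let ?M1 = "distr Mu \<P> (\<lambda>x. walk x 1)"
  interpret Mu: prob_space Mu by (rule prob_space_Mu)
  interpret M1: prob_space ?M1 by (rule Mu.prob_space_distr[OF measurable_walk_n])
  let ?G = "\<Union>N::nat. sets (Bidx \<nu> {i. - int N \<le> fst i})"
  have eq: "emeasure ?M1 D = emeasure marg D" if D: "D \<in> sets (Bidx \<nu> {i. - int N \<le> fst i})" for D N
  proof -
    let ?S = "\<lambda>z. shift (- 1) (- z) :: 'd env \<Rightarrow> 'd env"
    have DP: "D \<in> sets \<P>" using D subalgebra_Bidx[of \<nu>] by (auto simp: subalgebra_def)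
    have z1: "[z] \<in> Ulists (Suc 0)" if "z \<in> Ustep" for z :: "int^'d" using that by (simp add: Ulists_def)
    have "emeasure ?M1 D = (\<integral>\<^sup>+x. indicator D (walk x 1) \<partial>Mu)"
      using DP by (subst nn_integral_distr[OF measurable_walk_n, symmetric]) simp_all
    also have "\<dots> = (\<Sum>a\<in>Ulists (Suc 0). \<integral>\<^sup>+\<omega>. ennreal (path_dens a \<omega>) * indicator D (shift 1 (sum_list a) \<omega>) \<partial>marg)"
    proof (rule nn_integral_Mu)
      show "(\<lambda>\<omega>. indicator D (shift 1 (sum_list a) \<omega>) :: ennreal) \<in> borel_measurable \<P>" for a
        by (rule measurable_compose[OF measurable_shift_env borel_measurable_indicator[OF DP]])
      fix x :: "'d env \<times> (nat \<Rightarrow> int^'d)" and a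
      assume "a \<in> (Ulists (Suc 0) :: (int^'d) list set)" "snd x \<in> cyl a"
      then show "(indicator D (walk x 1) :: ennreal) = indicator D (shift 1 (sum_list a) (fst x))"
        using walk_cyl[of a "Suc 0" x "Suc 0"] walk_pad[of a "Suc 0" "fst x"] by simp
    qed
    also have "\<dots> = (\<Sum>z\<in>Ustep. \<integral>\<^sup>+\<omega>. ennreal (path_dens [z] \<omega>) * indicator D (shift 1 z \<omega>) \<partial>marg)"
      by (simp add: sum_Ulists_1)
    also have "\<dots> = (\<Sum>z\<in>Ustep. \<integral>\<^sup>+\<omega>. ennreal (back_wt \<theta> N (?S z \<omega>) * path_wt \<nu> \<theta> [z] (?S z \<omega>)) * (ennreal (u \<omega>) * indicator D \<omega>) \<partial>\<P>)"
    proof (intro sum.cong refl)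
      fix z :: "int^'d" assume z: "z \<in> Ustep"
      have iF: "(\<lambda>\<omega>. indicator D (shift 1 z \<omega>) :: ennreal) \<in> borel_measurable (Bidx \<nu> {i. - int N \<le> fst i})"
        by (rule measurable_compose[OF measurable_shift borel_measurable_indicator[OF D]]) auto
      have "(\<integral>\<^sup>+\<omega>. ennreal (path_dens [z] \<omega>) * indicator D (shift 1 z \<omega>) \<partial>marg)
        = (\<integral>\<^sup>+\<omega>. ennreal (back_wt \<theta> N \<omega> * u \<omega>) * (ennreal (path_dens [z] \<omega>) * indicator D (shift 1 z \<omega>)) \<partial>\<P>)"
        by (intro nn_integral_marg borel_measurable_times_ennreal measurable_compose[OF measurable_path_dens[OF z1[OF z]] measurable_ennreal] iF)
      also have "\<dots> = (\<integral>\<^sup>+\<omega>. ennreal (back_wt \<theta> N \<omega> * path_wt \<nu> \<theta> [z] \<omega>) * (ennreal (u (shift 1 z \<omega>)) * indicator D (shift 1 z \<omega>)) \<partial>\<P>)"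
      proof (rule nn_integral_cong_AE)
        show "AE \<omega> in \<P>. ennreal (back_wt \<theta> N \<omega> * u \<omega>) * (ennreal (path_dens [z] \<omega>) * indicator D (shift 1 z \<omega>))
          = ennreal (back_wt \<theta> N \<omega> * path_wt \<nu> \<theta> [z] \<omega>) * (ennreal (u (shift 1 z \<omega>)) * indicator D (shift 1 z \<omega>))"
          using AE_good
        proof eventually_elim
          case (elim \<omega>)
          have e: "back_wt \<theta> N \<omega> * u \<omega> * path_dens [z] \<omega> = back_wt \<theta> N \<omega> * path_wt \<nu> \<theta> [z] \<omega> * u (shift 1 z \<omega>)"
            using u_pos[of \<omega>] by (simp add: path_dens_def)
          have n1: "0 \<le> path_dens [z] \<omega>" by (rule path_dens_nonneg[OF elim z1[OF z]])
          have n2: "0 \<le> u (shift 1 z \<omega>)" using u_pos less_imp_le by blast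
          have "ennreal (back_wt \<theta> N \<omega> * u \<omega>) * ennreal (path_dens [z] \<omega>)
            = ennreal (back_wt \<theta> N \<omega> * path_wt \<nu> \<theta> [z] \<omega>) * ennreal (u (shift 1 z \<omega>))"
            unfolding ennreal_mult''[OF n1, symmetric] ennreal_mult''[OF n2, symmetric] e ..
          then show ?case by (simp only: mult.assoc[symmetric])
        qed
      qed
      \<comment> \<open>Stationarity of the environment is applied to each step separately;
        afterwards \<open>u\<close> and the event no longer depend on \<open>z\<close>.\<close>
      also have "\<dots> = (\<integral>\<^sup>+\<omega>. ennreal (back_wt \<theta> N (?S z \<omega>) * path_wt \<nu> \<theta> [z] (?S z \<omega>)) * (ennreal (u \<omega>) * indicator D \<omega>) \<partial>\<P>)"
      proof -
        have "(\<lambda>\<omega>. ennreal (back_wt \<theta> N (?S z \<omega>) * path_wt \<nu> \<theta> [z] (?S z \<omega>)) * (ennreal (u \<omega>) * indicator D \<omega>)) \<in> borel_measurable \<P>"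
          using DP z1[OF z] by measurable
        from nn_integral_shift[OF this, of 1 z] show ?thesis by simp
      qed
      finally show "(\<integral>\<^sup>+\<omega>. ennreal (path_dens [z] \<omega>) * indicator D (shift 1 z \<omega>) \<partial>marg)
        = (\<integral>\<^sup>+\<omega>. ennreal (back_wt \<theta> N (?S z \<omega>) * path_wt \<nu> \<theta> [z] (?S z \<omega>)) * (ennreal (u \<omega>) * indicator D \<omega>) \<partial>\<P>)" .
    qed
    also have "\<dots> = (\<integral>\<^sup>+\<omega>. (\<Sum>z\<in>Ustep. ennreal (back_wt \<theta> N (?S z \<omega>) * path_wt \<nu> \<theta> [z] (?S z \<omega>)) * (ennreal (u \<omega>) * indicator D \<omega>)) \<partial>\<P>)"
      by (rule nn_integral_sum[symmetric]) (use DP z1 in measurable)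
    also have "\<dots> = (\<integral>\<^sup>+\<omega>. ennreal (back_wt \<theta> (Suc N) \<omega> * u \<omega>) * indicator D \<omega> \<partial>\<P>)"
    proof (rule nn_integral_cong_AE)
      show "AE \<omega> in \<P>. (\<Sum>z\<in>Ustep. ennreal (back_wt \<theta> N (?S z \<omega>) * path_wt \<nu> \<theta> [z] (?S z \<omega>)) * (ennreal (u \<omega>) * indicator D \<omega>))
        = ennreal (back_wt \<theta> (Suc N) \<omega> * u \<omega>) * indicator D \<omega>"
        using AE_good
      proof eventually_elim
        case (elim \<omega>)
        have nn: "0 \<le> back_wt \<theta> N (?S z \<omega>) * path_wt \<nu> \<theta> [z] (?S z \<omega>)" if "z \<in> Ustep" for z
          using good_back_wt[OF good_shift[OF elim], of \<theta> N "- 1" "- z"] path_wt_bounds[OF good_shift[OF elim] z1[OF that], of \<theta> "- 1" "- z"]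
          by (intro mult_nonneg_nonneg) auto
        have "(\<Sum>z\<in>Ustep. ennreal (back_wt \<theta> N (?S z \<omega>) * path_wt \<nu> \<theta> [z] (?S z \<omega>))) = ennreal (back_wt \<theta> (Suc N) \<omega>)"
          unfolding back_wt_Suc using nn by (rule sum_ennreal)
        moreover have "ennreal (back_wt \<theta> (Suc N) \<omega> * u \<omega>) = ennreal (back_wt \<theta> (Suc N) \<omega>) * ennreal (u \<omega>)"
          by (rule ennreal_mult'') (rule less_imp_le[OF u_pos])
        ultimately show ?case by (simp only: sum_distrib_right[symmetric] mult.assoc)
      qed
    qed
    \<comment> \<open>The event lies in the half-space of level \<open>N\<close>, hence also in that
      of level \<open>Suc N\<close> where this density applies.\<close>
    also have "\<dots> = (\<integral>\<^sup>+\<omega>. indicator D \<omega> \<partial>marg)"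
    proof (rule nn_integral_marg[symmetric])
      show "(indicator D :: _ \<Rightarrow> ennreal) \<in> borel_measurable (Bidx \<nu> {i. - int (Suc N) \<le> fst i})"
        by (rule measurable_Bidx_mono[OF borel_measurable_indicator[OF D]]) auto
    qed
    also have "\<dots> = emeasure marg D" using DP by simp
    finally show ?thesis .
  qed
  fix A assume A: "A \<in> sets ?M1"
  show "emeasure ?M1 A = emeasure marg A"
  proof (rule emeasure_eq_on_sigma_sets[where \<Omega> = "space \<P>" and G = ?G])
    show "finite_measure ?M1" by unfold_locales
    show "finite_measure marg" by (rule finite_cyl_marginal[of "[]" 0]) simp
    show "?G \<subseteq> sets ?M1" "?G \<subseteq> sets marg"
      using subalgebra_Bidx[of \<nu>] by (auto simp: subalgebra_def)
    show "Int_stable ?G" by (rule Int_stable_UN_mono, rule sets_Bidx_mono) auto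
    show "space \<P> \<in> ?G" using space_in_Bidx by blast
    show "emeasure ?M1 X = emeasure marg X" if "X \<in> ?G" for X using that eq by blast
    show "A \<in> sigma_sets (space \<P>) ?G" using A sets_env_sigma[of \<nu>] by auto
  qed simp_all
qed simp

lemma nn_integral_marg_step:
  assumes g: "g \<in> borel_measurable \<P>"
  shows "(\<integral>\<^sup>+\<omega>. g \<omega> \<partial>marg) = (\<Sum>z\<in>Ustep. \<integral>\<^sup>+\<omega>. ennreal (path_dens [z] \<omega>) * g (shift 1 z \<omega>) \<partial>marg)"
proof -
  have "(\<integral>\<^sup>+\<omega>. g \<omega> \<partial>marg) = (\<integral>\<^sup>+x. g (walk x 1) \<partial>Mu)"
    unfolding distr_walk_1[symmetric] by (rule nn_integral_distr[OF measurable_walk_n]) (use g in simp)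
  also have "\<dots> = (\<Sum>a\<in>Ulists (Suc 0). \<integral>\<^sup>+\<omega>. ennreal (path_dens a \<omega>) * g (shift 1 (sum_list a) \<omega>) \<partial>marg)"
  proof (rule nn_integral_Mu)
    show "(\<lambda>\<omega>. g (shift 1 (sum_list a) \<omega>)) \<in> borel_measurable \<P>" for a
      by (rule measurable_compose[OF measurable_shift_env g])
    fix x :: "'d env \<times> (nat \<Rightarrow> int^'d)" and a
      assume "a \<in> (Ulists (Suc 0) :: (int^'d) list set)" "snd x \<in> cyl a"
    then show "g (walk x 1) = g (shift 1 (sum_list a) (fst x))"
      using walk_cyl[of a "Suc 0" x "Suc 0"] walk_pad[of a "Suc 0" "fst x"] by simp
  qed
  also have "\<dots> = (\<Sum>z\<in>Ustep. \<integral>\<^sup>+\<omega>. ennreal (path_dens [z] \<omega>) * g (shift 1 z \<omega>) \<partial>marg)"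
    by (simp add: sum_Ulists_1)
  finally show ?thesis .
qed

end

section \<open>The stationary Markov property\<close>

lemma measurable_seq_shift: "(\<lambda>w n. w (Suc n)) \<in> PiM UNIV (\<lambda>_. Om) \<rightarrow>\<^sub>M PiM UNIV (\<lambda>_::nat. Om)"
proof (rule measurable_PiM_single')
  show "(\<lambda>w. w (Suc i)) \<in> PiM UNIV (\<lambda>_. Om) \<rightarrow>\<^sub>M Om" for i by (rule measurable_component_UNIV)
qed (auto simp: space_PiM PiE_iff)

lemma (in rwre_tilt) tilted_kernel_measurable:
  assumes "B \<in> sets \<P>"
  shows "(\<lambda>\<omega>. tilted_kernel \<nu> \<theta> u \<omega> B) \<in> borel_measurable \<P>"
  unfolding tilted_kernel_def pi_theta_def
  by (intro borel_measurable_sum borel_measurable_times borel_measurable_divide measurable_weight_env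
      measurable_compose[OF measurable_shift_env measurable_u_env] measurable_u_env measurable_const
      measurable_compose[OF measurable_shift_env borel_measurable_indicator[OF assms]]) simp_all

context barmu
begin

abbreviation "mu \<equiv> mu_inf \<nu> Mu"

lemma sets_mu: "sets mu = sets (PiM UNIV (\<lambda>_. \<P>))"
  by (simp add: mu_inf_eq env_seq_measure_def)

lemma walk_measurable_seq: "walk \<in> Mu \<rightarrow>\<^sub>M env_seq_measure \<nu>"
  unfolding env_seq_measure_def by (rule measurable_walk)

lemma prob_space_mu: "prob_space mu"
  unfolding mu_inf_eq by (rule prob_space.prob_space_distr[OF prob_space_Mu walk_measurable_seq])

lemma nn_integral_mu: "f \<in> borel_measurable (PiM UNIV (\<lambda>_. \<P>)) \<Longrightarrow> (\<integral>\<^sup>+w. f w \<partial>mu) = (\<integral>\<^sup>+x. f (walk x) \<partial>Mu)"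
  unfolding mu_inf_eq by (rule nn_integral_distr[OF walk_measurable_seq]) (simp add: env_seq_measure_def)

lemma walk_past_iff:
  assumes "A \<in> sets (past \<P> n)" "x \<in> space Mu" "a \<in> Ulists K" "snd x \<in> cyl a" "n \<le> K"
  shows "walk x \<in> A \<longleftrightarrow> walk (fst x, pad a) \<in> A"
proof (rule past_agree[OF assms(1)])
  have "fst x \<in> space \<P>" using assms(2) by (auto simp: space_Mu)
  then show "walk x \<in> space (PiM UNIV (\<lambda>_. \<P>))" "walk (fst x, pad a) \<in> space (PiM UNIV (\<lambda>_. \<P>))"
    by (simp_all add: walk_seq_in_space)
  show "walk x i = walk (fst x, pad a) i" if "i \<le> n" for i
    using that assms(5) by (intro walk_cyl[OF assms(3,4)]) simp
qed

lemma measurable_ind_walk_pad: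
  assumes "A \<in> sets (past \<P> n)"
  shows "(\<lambda>\<omega>. indicator A (walk (\<omega>, pad a)) :: ennreal) \<in> borel_measurable \<P>"
  by (rule measurable_compose[OF measurable_walk_pad borel_measurable_indicator]) (use assms sets_past_subset in blast)

text \<open>The first \<open>n + 1\<close> environments are functions of the initial one and of
  \<open>n\<close> steps.\<close>

lemma emeasure_mu_past:
  assumes A: "A \<in> sets (past \<P> n)"
  shows "emeasure mu A = (\<Sum>a\<in>Ulists n. \<integral>\<^sup>+\<omega>. ennreal (path_dens a \<omega>) * indicator A (walk (\<omega>, pad a)) \<partial>marg)"
proof -
  have AS: "A \<in> sets (PiM UNIV (\<lambda>_. \<P>))" using A sets_past_subset by blast
  have "emeasure mu A = (\<integral>\<^sup>+w. indicator A w \<partial>mu)" using AS by (simp add: sets_mu)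
  also have "\<dots> = (\<integral>\<^sup>+x. indicator A (walk x) \<partial>Mu)"
    by (rule nn_integral_mu[OF borel_measurable_indicator[OF AS]])
  also have "\<dots> = (\<Sum>a\<in>Ulists n. \<integral>\<^sup>+\<omega>. ennreal (path_dens a \<omega>) * indicator A (walk (\<omega>, pad a)) \<partial>marg)"
    by (rule nn_integral_Mu[OF measurable_ind_walk_pad[OF A]]) (simp add: indicator_def walk_past_iff[OF A _ _ _ order_refl])
  finally show ?thesis .
qed

text \<open>Stationarity is checked on past events. The first step is split off by the cocycle
  property of \<open>path_dens\<close>, and the invariance of the marginal removes it.\<close>

lemma mu_stationary: "distr mu (PiM UNIV (\<lambda>_. \<P>)) (\<lambda>w n. w (Suc n)) = mu"
proof (rule PiM_eqI_past[where Om = \<P>])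
  have smu: "(\<lambda>w n. w (Suc n)) \<in> mu \<rightarrow>\<^sub>M PiM UNIV (\<lambda>_. \<P>)"
    using measurable_seq_shift[of \<P>] measurable_cong_sets[OF sets_mu refl] by blast
  interpret mu: prob_space mu by (rule prob_space_mu)
  interpret d: prob_space "distr mu (PiM UNIV (\<lambda>_. \<P>)) (\<lambda>w n. w (Suc n))" by (rule mu.prob_space_distr[OF smu])
  show "finite_measure mu" by unfold_locales
  show "finite_measure (distr mu (PiM UNIV (\<lambda>_. \<P>)) (\<lambda>w n. w (Suc n)))" by unfold_locales
  show "sets (distr mu (PiM UNIV (\<lambda>_. \<P>)) (\<lambda>w n. w (Suc n))) = sets (PiM UNIV (\<lambda>_. \<P>))" by simp
  show "sets mu = sets (PiM UNIV (\<lambda>_. \<P>))" by (rule sets_mu)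
  fix n A assume A: "A \<in> sets (past \<P> n)"
  have AS: "A \<in> sets (PiM UNIV (\<lambda>_. \<P>))" using A sets_past_subset by blast
  let ?I = "\<lambda>a \<omega>. indicator A (walk (\<omega>, pad a)) :: ennreal"
  have zU: "[z] \<in> Ulists (Suc 0)" if "z \<in> Ustep" for z :: "int^'d" using that by (simp add: Ulists_def)
  have pm: "(\<lambda>\<omega>. ennreal (path_dens a \<omega>)) \<in> borel_measurable \<P>" if "a \<in> Ulists m" for a m
    by (rule measurable_compose[OF measurable_path_dens_env[OF that] measurable_ennreal])
  have gm: "(\<lambda>\<omega>. \<Sum>a\<in>Ulists n. ennreal (path_dens a \<omega>) * ?I a \<omega>) \<in> borel_measurable \<P>"
    by (intro borel_measurable_sum borel_measurable_times_ennreal pm measurable_ind_walk_pad[OF A])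
  have "emeasure (distr mu (PiM UNIV (\<lambda>_. \<P>)) (\<lambda>w n. w (Suc n))) A
    = (\<integral>\<^sup>+w. indicator A w \<partial>distr mu (PiM UNIV (\<lambda>_. \<P>)) (\<lambda>w n. w (Suc n)))"
    by (rule nn_integral_indicator[symmetric]) (simp only: sets_distr AS)
  also have "\<dots> = (\<integral>\<^sup>+w. indicator A (\<lambda>n. w (Suc n)) \<partial>mu)"
    by (rule nn_integral_distr[OF smu]) (simp only: measurable_distr_eq1 borel_measurable_indicator[OF AS])
  also have "\<dots> = (\<integral>\<^sup>+x. indicator A (\<lambda>n. walk x (Suc n)) \<partial>Mu)"
    by (rule nn_integral_mu[OF measurable_compose[OF measurable_seq_shift borel_measurable_indicator[OF AS]]])
  also have "\<dots> = (\<Sum>a\<in>Ulists (Suc n). \<integral>\<^sup>+\<omega>. ennreal (path_dens a \<omega>) * indicator A (\<lambda>k. walk (\<omega>, pad a) (Suc k)) \<partial>marg)"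
  proof (rule nn_integral_Mu)
    fix a :: "(int^'d) list" assume "a \<in> Ulists (Suc n)"
    show "(\<lambda>\<omega>. indicator A (\<lambda>k. walk (\<omega>, pad a) (Suc k)) :: ennreal) \<in> borel_measurable \<P>"
      by (rule measurable_compose[OF measurable_walk_pad
            measurable_compose[OF measurable_seq_shift borel_measurable_indicator[OF AS]]])
  next
    fix x :: "'d env \<times> (nat \<Rightarrow> int^'d)" and a
    assume x: "x \<in> space Mu" "a \<in> (Ulists (Suc n) :: (int^'d) list set)" "snd x \<in> cyl a"
    have f: "fst x \<in> space \<P>" using x by (auto simp: space_Mu)
    have "(\<lambda>n. walk x (Suc n)) \<in> A \<longleftrightarrow> (\<lambda>k. walk (fst x, pad a) (Suc k)) \<in> A"
    proof (rule past_agree[OF A])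
      show "walk x (Suc i) = walk (fst x, pad a) (Suc i)" if "i \<le> n" for i
        using that by (intro walk_cyl[OF x(2,3)]) simp
    qed (use f in \<open>simp_all add: space_PiM PiE_iff walk_in_space\<close>)
    then show "(indicator A (\<lambda>n. walk x (Suc n)) :: ennreal) = indicator A (\<lambda>k. walk (fst x, pad a) (Suc k))"
      by (simp add: indicator_def)
  qed
  also have "\<dots> = (\<Sum>z\<in>Ustep. \<Sum>a\<in>Ulists n. \<integral>\<^sup>+\<omega>. ennreal (path_dens (z # a) \<omega>) * ?I a (shift 1 z \<omega>) \<partial>marg)"
    by (simp only: sum_Ulists_Suc walk_pad_Cons)
  also have "\<dots> = (\<Sum>z\<in>Ustep. \<integral>\<^sup>+\<omega>. ennreal (path_dens [z] \<omega>) * (\<Sum>a\<in>Ulists n. ennreal (path_dens a (shift 1 z \<omega>)) * ?I a (shift 1 z \<omega>)) \<partial>marg)"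
  proof (intro sum.cong refl)
    fix z :: "int^'d" assume z: "z \<in> Ustep"
    have "(\<Sum>a\<in>Ulists n. \<integral>\<^sup>+\<omega>. ennreal (path_dens (z # a) \<omega>) * ?I a (shift 1 z \<omega>) \<partial>marg)
      = (\<integral>\<^sup>+\<omega>. (\<Sum>a\<in>Ulists n. ennreal (path_dens (z # a) \<omega>) * ?I a (shift 1 z \<omega>)) \<partial>marg)"
    proof (rule nn_integral_sum[symmetric], unfold measurable_marg_iff)
      fix a :: "(int^'d) list" assume "a \<in> Ulists n"
      then have "z # a \<in> Ulists (Suc n)" using z by (simp add: Ulists_def)
      then show "(\<lambda>\<omega>. ennreal (path_dens (z # a) \<omega>) * ?I a (shift 1 z \<omega>)) \<in> borel_measurable \<P>"
        by (intro borel_measurable_times_ennreal pm measurable_compose[OF measurable_shift_env measurable_ind_walk_pad[OF A]])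
    qed
    also have "\<dots> = (\<integral>\<^sup>+\<omega>. ennreal (path_dens [z] \<omega>) * (\<Sum>a\<in>Ulists n. ennreal (path_dens a (shift 1 z \<omega>)) * ?I a (shift 1 z \<omega>)) \<partial>marg)"
    proof (rule nn_integral_cong_AE)
      show "AE \<omega> in marg. (\<Sum>a\<in>Ulists n. ennreal (path_dens (z # a) \<omega>) * ?I a (shift 1 z \<omega>))
        = ennreal (path_dens [z] \<omega>) * (\<Sum>a\<in>Ulists n. ennreal (path_dens a (shift 1 z \<omega>)) * ?I a (shift 1 z \<omega>))"
        using AE_marg_good
      proof eventually_elim
        case (elim \<omega>)
        have "ennreal (path_dens (z # a) \<omega>) = ennreal (path_dens [z] \<omega>) * ennreal (path_dens a (shift 1 z \<omega>))" for a
        proof -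
          have "path_dens (z # a) \<omega> = path_dens [z] \<omega> * path_dens a (shift 1 z \<omega>)"
            using path_dens_append[of "[z]" a \<omega>] by simp
          then show ?thesis by (simp only: ennreal_mult'[OF path_dens_nonneg[OF elim zU[OF z]]])
        qed
        from arg_cong2[where f = "(*)", OF this refl] show ?case
          unfolding sum_distrib_left mult.assoc[symmetric] by (intro sum.cong refl)
      qed
    qed
    finally show "(\<Sum>a\<in>Ulists n. \<integral>\<^sup>+\<omega>. ennreal (path_dens (z # a) \<omega>) * ?I a (shift 1 z \<omega>) \<partial>marg)
      = (\<integral>\<^sup>+\<omega>. ennreal (path_dens [z] \<omega>) * (\<Sum>a\<in>Ulists n. ennreal (path_dens a (shift 1 z \<omega>)) * ?I a (shift 1 z \<omega>)) \<partial>marg)" .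
  qed
  \<comment> \<open>Invariance of the marginal, with the sum over the remaining steps as test
    function.\<close>
  also have "\<dots> = (\<integral>\<^sup>+\<omega>. (\<Sum>a\<in>Ulists n. ennreal (path_dens a \<omega>) * ?I a \<omega>) \<partial>marg)"
    by (rule nn_integral_marg_step[OF gm, symmetric])
  also have "\<dots> = (\<Sum>a\<in>Ulists n. \<integral>\<^sup>+\<omega>. ennreal (path_dens a \<omega>) * ?I a \<omega> \<partial>marg)"
    by (rule nn_integral_sum) (intro measurable_marg_iff[THEN iffD2] borel_measurable_times_ennreal pm measurable_ind_walk_pad[OF A])
  also have "\<dots> = emeasure mu A" by (rule emeasure_mu_past[OF A, symmetric])
  finally show "emeasure (distr mu (PiM UNIV (\<lambda>_. \<P>)) (\<lambda>w n. w (Suc n))) A = emeasure mu A" .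
qed

lemma pi_theta_eq: "pi_theta \<nu> \<theta> u \<omega> z = path_dens [z] \<omega>"
  by (simp add: pi_theta_def path_dens_def step_wt_def)

lemma tilted_kernel_eq: "tilted_kernel \<nu> \<theta> u \<omega> B = (\<Sum>z\<in>Ustep. path_dens [z] \<omega> * indicator B (shift 1 z \<omega>))"
  by (simp add: tilted_kernel_def pi_theta_eq)

text \<open>One more step multiplies the path density by the one-step density at the current
  environment, which is what \<open>tilted_kernel\<close> sums over the steps that lead into
  \<open>B\<close>.\<close>

lemma mu_markov:
  assumes A: "A \<in> sets (past \<P> n)" and B: "B \<in> sets \<P>"
  shows "measure mu (A \<inter> {w \<in> space mu. w (Suc n) \<in> B}) = (\<integral>w. indicator A w * tilted_kernel \<nu> \<theta> u (w n) B \<partial>mu)"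
proof -
  let ?K = "\<lambda>\<omega>. tilted_kernel \<nu> \<theta> u \<omega> B"
  let ?S = "PiM UNIV (\<lambda>_::nat. \<P>)"
  have AS: "A \<in> sets ?S" using A sets_past_subset by blast
  have smu: "space mu = space ?S" by (rule sets_eq_imp_space_eq[OF sets_mu])
  \<comment> \<open>The joint event is itself a past event one time later, so
    \<open>emeasure_mu_past\<close> evaluates it as well.\<close>
  define C where "C = A \<inter> {w \<in> space ?S. w (Suc n) \<in> B}"
  have CP: "C \<in> sets (past \<P> (Suc n))"
  proof -
    have "(\<lambda>w. w (Suc n)) -` B \<inter> space (past \<P> (Suc n)) \<in> sets (past \<P> (Suc n))"
      by (rule measurable_sets[OF measurable_past_component B]) simp
    moreover have "A \<in> sets (past \<P> (Suc n))" using A sets_past_mono[of n "Suc n" \<P>] by auto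
    moreover have "C = A \<inter> ((\<lambda>w. w (Suc n)) -` B \<inter> space (past \<P> (Suc n)))" by (auto simp: C_def)
    ultimately show ?thesis by auto
  qed
  have zU: "[z] \<in> Ulists (Suc 0)" if "z \<in> Ustep" for z :: "int^'d" using that by (simp add: Ulists_def)
  have pm: "(\<lambda>\<omega>. ennreal (path_dens a \<omega>)) \<in> borel_measurable \<P>" if "a \<in> Ulists m" for a m
    by (rule measurable_compose[OF measurable_path_dens_env[OF that] measurable_ennreal])
  have Km: "?K \<in> borel_measurable \<P>" by (rule tilted_kernel_measurable[OF B])
  have fm: "(\<lambda>w. indicator A w * ?K (w n)) \<in> borel_measurable ?S"
    by (intro borel_measurable_times borel_measurable_indicator AS measurable_compose[OF measurable_component_UNIV Km])
  have Knn: "0 \<le> ?K \<omega>" if "good \<omega>" for \<omega>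
    unfolding tilted_kernel_eq using path_dens_nonneg[OF that zU] by (intro sum_nonneg mult_nonneg_nonneg) auto
  have "(\<integral>\<^sup>+w. ennreal (indicator A w * ?K (w n)) \<partial>mu) = (\<integral>\<^sup>+x. ennreal (indicator A (walk x) * ?K (walk x n)) \<partial>Mu)"
    by (rule nn_integral_mu[OF measurable_compose[OF fm measurable_ennreal]])
  also have "\<dots> = (\<Sum>a\<in>Ulists n. \<integral>\<^sup>+\<omega>. ennreal (path_dens a \<omega>) * ennreal (indicator A (walk (\<omega>, pad a)) * ?K (walk (\<omega>, pad a) n)) \<partial>marg)"
  proof (rule nn_integral_Mu)
    show "(\<lambda>\<omega>. ennreal (indicator A (walk (\<omega>, pad a)) * ?K (walk (\<omega>, pad a) n))) \<in> borel_measurable \<P>" for a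
      by (rule measurable_compose[OF measurable_walk_pad measurable_compose[OF fm measurable_ennreal]])
    fix x :: "'d env \<times> (nat \<Rightarrow> int^'d)" and a
    assume x: "x \<in> space Mu" "a \<in> (Ulists n :: (int^'d) list set)" "snd x \<in> cyl a"
    then show "ennreal (indicator A (walk x) * ?K (walk x n)) = ennreal (indicator A (walk (fst x, pad a)) * ?K (walk (fst x, pad a) n))"
      using walk_past_iff[OF A x order_refl] walk_cyl[OF x(2,3) order_refl] by (simp add: indicator_def)
  qed
  also have "\<dots> = (\<Sum>a\<in>Ulists n. \<Sum>z\<in>Ustep. \<integral>\<^sup>+\<omega>. ennreal (path_dens (a @ [z]) \<omega>) * indicator C (walk (\<omega>, pad (a @ [z]))) \<partial>marg)"
  proof (intro sum.cong refl)
    fix a :: "(int^'d) list" assume a: "a \<in> Ulists n"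
    have az: "a @ [z] \<in> Ulists (Suc n)" if "z \<in> Ustep" for z using a that by (auto simp: Ulists_def)
    have "(\<integral>\<^sup>+\<omega>. ennreal (path_dens a \<omega>) * ennreal (indicator A (walk (\<omega>, pad a)) * ?K (walk (\<omega>, pad a) n)) \<partial>marg)
      = (\<integral>\<^sup>+\<omega>. (\<Sum>z\<in>Ustep. ennreal (path_dens (a @ [z]) \<omega>) * indicator C (walk (\<omega>, pad (a @ [z])))) \<partial>marg)"
    proof (rule nn_integral_cong_AE)
      have "AE \<omega> in marg. \<omega> \<in> space \<P>" using AE_space[of marg] by simp
      then show "AE \<omega> in marg. ennreal (path_dens a \<omega>) * ennreal (indicator A (walk (\<omega>, pad a)) * ?K (walk (\<omega>, pad a) n))
        = (\<Sum>z\<in>Ustep. ennreal (path_dens (a @ [z]) \<omega>) * indicator C (walk (\<omega>, pad (a @ [z]))))"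
        using AE_marg_good
      proof eventually_elim
        case (elim \<omega>)
        let ?T = "shift (int n) (sum_list a) \<omega>"
        have gT: "good ?T" by (rule good_shift[OF elim(2)])
        have nnT: "0 \<le> path_dens [z] ?T" if "z \<in> Ustep" for z by (rule path_dens_nonneg[OF gT zU[OF that]])
        have t: "ennreal (path_dens (a @ [z]) \<omega>) * indicator C (walk (\<omega>, pad (a @ [z])))
          = ennreal (path_dens a \<omega>) * (indicator A (walk (\<omega>, pad a)) * ennreal (path_dens [z] ?T * indicator B (shift 1 z ?T)))"
          if z: "z \<in> Ustep" for z
        proof -
          have p: "ennreal (path_dens (a @ [z]) \<omega>) = ennreal (path_dens a \<omega>) * ennreal (path_dens [z] ?T)"
            unfolding path_dens_append using a by (simp only: length_Ulists ennreal_mult''[OF nnT[OF z]])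
          have sp: "walk (\<omega>, pad b) \<in> space ?S" for b by (rule walk_seq_in_space) (simp add: elim(1))
          have Aiff: "walk (\<omega>, pad (a @ [z])) \<in> A \<longleftrightarrow> walk (\<omega>, pad a) \<in> A"
          proof (rule past_agree[OF A sp sp])
            fix i assume i: "i \<le> n"
            have "(\<Sum>j<i. pad (a @ [z]) j) = (\<Sum>j<i. pad a j)"
              using a i by (intro sum.cong refl) (auto simp: pad_def length_Ulists nth_append)
            then show "walk (\<omega>, pad (a @ [z])) i = walk (\<omega>, pad a) i" by (simp add: walk_def)
          qed
          have "walk (\<omega>, pad (a @ [z])) (Suc n) = shift 1 z ?T"
            using walk_pad[OF az[OF z], of \<omega>] by (simp add: add.commute)
          then have "walk (\<omega>, pad (a @ [z])) \<in> C \<longleftrightarrow> walk (\<omega>, pad a) \<in> A \<and> shift 1 z ?T \<in> B"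
            using sp Aiff by (simp add: C_def)
          then have "(indicator C (walk (\<omega>, pad (a @ [z]))) :: ennreal) = indicator A (walk (\<omega>, pad a)) * indicator B (shift 1 z ?T)"
            by (simp add: indicator_def)
          moreover have "ennreal (path_dens [z] ?T * indicator B (shift 1 z ?T)) = ennreal (path_dens [z] ?T) * indicator B (shift 1 z ?T)"
            by (simp add: indicator_def)
          ultimately show ?thesis unfolding p by (simp only: mult_ac)
        qed
        have "(\<Sum>z\<in>Ustep. ennreal (path_dens (a @ [z]) \<omega>) * indicator C (walk (\<omega>, pad (a @ [z]))))
          = (\<Sum>z\<in>Ustep. ennreal (path_dens a \<omega>) * (indicator A (walk (\<omega>, pad a)) * ennreal (path_dens [z] ?T * indicator B (shift 1 z ?T))))"
          by (intro sum.cong refl t)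
        also have "\<dots> = ennreal (path_dens a \<omega>) * (indicator A (walk (\<omega>, pad a)) * (\<Sum>z\<in>Ustep. ennreal (path_dens [z] ?T * indicator B (shift 1 z ?T))))"
          by (simp only: sum_distrib_left)
        also have "(\<Sum>z\<in>Ustep. ennreal (path_dens [z] ?T * indicator B (shift 1 z ?T))) = ennreal (?K ?T)"
          unfolding tilted_kernel_eq by (rule sum_ennreal) (use nnT in auto)
        also have "indicator A (walk (\<omega>, pad a)) * ennreal (?K ?T) = ennreal (indicator A (walk (\<omega>, pad a)) * ?K ?T)"
          by (simp add: indicator_def)
        finally show ?case using walk_pad[OF a, of \<omega>] by simp
      qed
    qed
    also have "\<dots> = (\<Sum>z\<in>Ustep. \<integral>\<^sup>+\<omega>. ennreal (path_dens (a @ [z]) \<omega>) * indicator C (walk (\<omega>, pad (a @ [z]))) \<partial>marg)"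
      by (rule nn_integral_sum) (intro measurable_marg_iff[THEN iffD2] borel_measurable_times_ennreal pm[OF az] measurable_ind_walk_pad[OF CP])
    finally show "(\<integral>\<^sup>+\<omega>. ennreal (path_dens a \<omega>) * ennreal (indicator A (walk (\<omega>, pad a)) * ?K (walk (\<omega>, pad a) n)) \<partial>marg)
      = (\<Sum>z\<in>Ustep. \<integral>\<^sup>+\<omega>. ennreal (path_dens (a @ [z]) \<omega>) * indicator C (walk (\<omega>, pad (a @ [z]))) \<partial>marg)" .
  qed
  also have "\<dots> = emeasure mu C"
    unfolding emeasure_mu_past[OF CP]
    using sum_Ulists_add[of "\<lambda>a. \<integral>\<^sup>+\<omega>. ennreal (path_dens a \<omega>) * indicator C (walk (\<omega>, pad a)) \<partial>marg" n "Suc 0"]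
    by (simp only: sum_Ulists_1 add_Suc_right add_0_right)
  finally have eq: "(\<integral>\<^sup>+w. ennreal (indicator A w * ?K (w n)) \<partial>mu) = emeasure mu C" .
  have "(\<integral>w. indicator A w * ?K (w n) \<partial>mu) = enn2real (\<integral>\<^sup>+w. ennreal (indicator A w * ?K (w n)) \<partial>mu)"
  proof (rule integral_eq_nn_integral)
    show "(\<lambda>w. indicator A w * ?K (w n)) \<in> borel_measurable mu"
      using fm measurable_cong_sets[OF sets_mu refl] by blast
    \<comment> \<open>Conversion to a real integral needs a nonnegative kernel along the chain; it
      is nonnegative on good environments, which are stable under shifts.\<close>
    have "AE x in Mu. 0 \<le> indicator A (walk x) * ?K (walk x n)"
      using AE_Mu_good by eventually_elim (auto simp: walk_def intro!: mult_nonneg_nonneg Knn good_shift)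
    moreover have "{w \<in> space ?S. 0 \<le> indicator A w * ?K (w n)} \<in> sets ?S"
      by (intro borel_measurable_le fm) simp_all
    ultimately show "AE w in mu. 0 \<le> indicator A w * ?K (w n)"
      unfolding mu_inf_eq by (subst AE_distr_iff[OF walk_measurable_seq]) (simp_all add: env_seq_measure_def)
  qed
  then show ?thesis by (simp add: eq C_def smu measure_def)
qed

lemma distr_mu_0: "distr mu \<P> (\<lambda>w. w 0) = marg"
proof -
  have "distr mu \<P> (\<lambda>w. w 0) = distr Mu \<P> ((\<lambda>w. w 0) \<circ> walk)"
    unfolding mu_inf_eq
    by (rule distr_distr[OF _ walk_measurable_seq]) (simp add: env_seq_measure_def measurable_component_UNIV)
  also have "(\<lambda>w. w 0) \<circ> walk = fst" by (simp add: fun_eq_iff walk_def)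
  finally show ?thesis by (simp add: marg_eq_distr)
qed

lemma SMP_ac_mu: "SMP_ac \<nu> (tilted_kernel \<nu> \<theta> u) mu"
  unfolding SMP_ac_def stationary_markov_def
proof (intro conjI allI impI)
  show "prob_space mu" by (rule prob_space_mu)
  show "sets mu = sets (PiM UNIV (\<lambda>_. \<P>))" by (rule sets_mu)
  show "distr mu (PiM UNIV (\<lambda>_. \<P>)) (\<lambda>w n. w (Suc n)) = mu" by (rule mu_stationary)
  show "measure mu (A \<inter> {w \<in> space mu. w (Suc n) \<in> B}) = (\<integral>w. indicator A w * tilted_kernel \<nu> \<theta> u (w n) B \<partial>mu)"
    if "A \<in> sets (past \<P> n)" "B \<in> sets \<P>" for n A B using that by (rule mu_markov)
  fix n :: int
  have sub: "subalgebra marg (Bplus \<nu> n)" and subP: "subalgebra \<P> (Bplus \<nu> n)"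
    using subalgebra_Bidx[of \<nu> "{i. n \<le> fst i}"] by (auto simp: subalgebra_def Bplus_eq)
  show "absolutely_continuous (restr_to_subalg \<P> (Bplus \<nu> n)) (restr_to_subalg (distr mu \<P> (\<lambda>w. w 0)) (Bplus \<nu> n))"
    unfolding distr_mu_0 absolutely_continuous_def null_sets_restr_to_subalg[OF sub] null_sets_restr_to_subalg[OF subP]
  proof (intro subsetI IntI)
    fix A assume A: "A \<in> null_sets \<P> \<inter> sets (Bplus \<nu> n)"
    then show "A \<in> sets (Bplus \<nu> n)" by simp
    \<comment> \<open>A half-space that starts after time 0 is enlarged to the one starting at 0,
      hence the \<open>nat\<close>.\<close>
    have "A \<in> sets (Bidx \<nu> {i. - int (nat (- n)) \<le> fst i})"
      by (rule subsetD[OF sets_Bidx_mono[of "{i. n \<le> fst i}"]]) (use A in \<open>auto simp: Bplus_eq\<close>)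
    then have "emeasure marg A = 0" by (rule marg_null) (use A in auto)
    then show "A \<in> null_sets marg" using A by (auto simp: null_sets_def)
  qed
qed

end

section \<open>Uniqueness\<close>

text \<open>Radon-Nikodym after restriction to the sub-sigma-algebra; the derivative is then
  \<open>F\<close>-measurable, but it represents integrals of \<open>F\<close>-measurable functions
  only.\<close>

lemma subalgebra_real_density:
  assumes M: "prob_space M" and m: "prob_space m" and s: "sets m = sets M" and sub: "subalgebra M F"
    and ac: "\<And>A. A \<in> sets F \<Longrightarrow> emeasure M A = 0 \<Longrightarrow> emeasure m A = 0"
  obtains D where "D \<in> borel_measurable F" "\<And>x. 0 \<le> D x" "integrable M D"
    "\<And>g :: 'a \<Rightarrow> real. g \<in> borel_measurable F \<Longrightarrow> (\<integral>x. g x \<partial>m) = (\<integral>x. D x * g x \<partial>M)"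
proof -
  have sub': "subalgebra m F" using sub s sets_eq_imp_space_eq[OF s] by (simp add: subalgebra_def)
  let ?R = "restr_to_subalg M F" and ?N = "restr_to_subalg m F"
  interpret R: prob_space ?R by (rule prob_space_restr_to_subalg[OF sub M])
  interpret N: prob_space ?N by (rule prob_space_restr_to_subalg[OF sub' m])
  have sN: "sets ?N = sets ?R" by (simp only: sets_restr_to_subalg[OF sub] sets_restr_to_subalg[OF sub'])
  have acRN: "absolutely_continuous ?R ?N"
    unfolding absolutely_continuous_def null_sets_restr_to_subalg[OF sub] null_sets_restr_to_subalg[OF sub']
    using ac s by (auto simp: null_sets_def)
  obtain D where D: "D \<in> borel_measurable ?R" "AE x in ?R. RN_deriv ?R ?N x = ennreal (D x)" "\<And>x. 0 \<le> D x"
    by (rule R.real_RN_deriv[OF N.finite_measure_axioms acRN sN]) blast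
  have DF: "D \<in> borel_measurable F" using D(1) measurable_cong_sets[OF sets_restr_to_subalg[OF sub] refl] by blast
  have dens: "density ?R (\<lambda>x. ennreal (D x)) = ?N"
  proof -
    have "density ?R (RN_deriv ?R ?N) = ?N" by (rule R.density_RN_deriv[OF acRN sN])
    moreover have "density ?R (\<lambda>x. ennreal (D x)) = density ?R (RN_deriv ?R ?N)"
      by (rule density_cong) (use D in \<open>auto elim: eventually_mono\<close>)
    ultimately show ?thesis by simp
  qed
  have main: "(\<integral>x. g x \<partial>m) = (\<integral>x. D x * g x \<partial>M)" if g: "g \<in> borel_measurable F" for g :: "'a \<Rightarrow> real"
  proof -
    have gR: "g \<in> borel_measurable ?R" by (rule measurable_in_subalg[OF sub g])
    have "(\<integral>x. g x \<partial>m) = (\<integral>x. g x \<partial>?N)" by (rule integral_subalgebra2[OF sub' g, symmetric])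
    also have "\<dots> = (\<integral>x. D x *\<^sub>R g x \<partial>?R)"
      unfolding dens[symmetric] by (rule integral_density[OF gR D(1)]) (simp add: D(3))
    also have "\<dots> = (\<integral>x. D x * g x \<partial>M)"
      unfolding real_scaleR_def by (rule integral_subalgebra2[OF sub borel_measurable_times[OF DF g]])
    finally show ?thesis .
  qed
  have "integrable M D"
  proof (rule integrableI_bounded)
    show "D \<in> borel_measurable M" by (rule measurable_from_subalg[OF sub DF])
    have "(\<integral>\<^sup>+x. ennreal (D x) \<partial>M) = (\<integral>\<^sup>+x. ennreal (D x) \<partial>?R)"
      by (rule nn_integral_subalgebra2[OF sub, symmetric]) (rule measurable_compose[OF DF measurable_ennreal])
    also have "\<dots> = emeasure (density ?R (\<lambda>x. ennreal (D x))) (space ?R)"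
    proof -
      have "emeasure (density ?R (\<lambda>x. ennreal (D x))) (space ?R) = (\<integral>\<^sup>+x. ennreal (D x) * indicator (space ?R) x \<partial>?R)"
        by (rule emeasure_density) (use D(1) in auto)
      also have "\<dots> = (\<integral>\<^sup>+x. ennreal (D x) \<partial>?R)" by (rule nn_integral_cong) simp
      finally show ?thesis by simp
    qed
    also have "\<dots> < \<infinity>" unfolding dens by (metis N.emeasure_finite infinity_ennreal_def top.not_eq_extremum)
    finally show "(\<integral>\<^sup>+x. ennreal (norm (D x)) \<partial>M) < \<infinity>" using D(3) by simp
  qed
  from that[OF DF D(3) this main] show ?thesis .
qed

lemma measure_eq_on_subalgebra_integral:
  fixes f :: "'a \<Rightarrow> real"
  assumes "subalgebra M1 F" "subalgebra M2 F" "\<And>A. A \<in> sets F \<Longrightarrow> emeasure M1 A = emeasure M2 A"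
    and "f \<in> borel_measurable F"
  shows "(\<integral>x. f x \<partial>M1) = (\<integral>x. f x \<partial>M2)"
proof -
  have "restr_to_subalg M1 F = restr_to_subalg M2 F"
    by (rule measure_eqI)
       (use assms in \<open>auto simp: sets_restr_to_subalg emeasure_restr_to_subalg\<close>)
  then show ?thesis
    using integral_subalgebra2[OF assms(1,4)] integral_subalgebra2[OF assms(2,4)] by simp
qed

context rwre_tilt
begin

abbreviation "\<K> \<equiv> tilted_kernel \<nu> \<theta> u"

text \<open>What a stationary Markov process with the required absolute continuity imposes on its
  one-time marginal.\<close>

definition ac_invariant :: "'d env measure \<Rightarrow> bool" where
  "ac_invariant m \<longleftrightarrow> prob_space m \<and> sets m = sets \<P> \<and>
     (\<forall>n A. A \<in> sets (Bidx \<nu> {i. n \<le> fst i}) \<longrightarrow> emeasure \<P> A = 0 \<longrightarrow> emeasure m A = 0) \<and>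
     (\<forall>B\<in>sets \<P>. measure m B = (\<integral>\<omega>. \<K> \<omega> B \<partial>m))"

text \<open>The kernel evaluates \<open>B\<close> at environments shifted one unit forward, so its
  dependence reaches one unit less far back. It reads time 0 itself, which is why the level is
  truncated at 0.\<close>

lemma kernel_measurable_Bidx:
  assumes "N \<le> M + 1" "0 \<le> N" "B \<in> sets (Bidx \<nu> {i. - N \<le> fst i})"
  shows "(\<lambda>\<omega>. \<K> \<omega> B) \<in> borel_measurable (Bidx \<nu> {i. - int (nat M) \<le> fst i})"
  unfolding tilted_kernel_def pi_theta_def
proof (intro borel_measurable_sum borel_measurable_times borel_measurable_divide)
  let ?F = "Bidx \<nu> {i. - int (nat M) \<le> fst i}"
  fix z :: "int^'d" assume z: "z \<in> Ustep"
  show "(\<lambda>\<omega>. \<omega> (0, 0) z) \<in> borel_measurable ?F" by (rule measurable_weight_Bidx[OF z]) simp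
  show "(\<lambda>\<omega>. u (shift 1 z \<omega>)) \<in> borel_measurable ?F" by (rule u_shift_Bidx) simp
  show "u \<in> borel_measurable ?F" by (rule measurable_Bidx_mono[OF u_Bidx]) auto
  show "(\<lambda>\<omega>. exp (\<theta> \<bullet> vecR z - Lambda_c \<nu> \<theta>)) \<in> borel_measurable ?F" by simp
  show "(\<lambda>\<omega>. indicator B (shift 1 z \<omega>) :: real) \<in> borel_measurable ?F"
    by (rule measurable_compose[OF measurable_shift borel_measurable_indicator[OF assms(3)]]) (use assms(1) in auto)
qed

text \<open>Harmonicity of \<open>u\<close> is the normalization of the transformed kernel;
  positivity comes from ellipticity and \<open>u > 0\<close>.\<close>

lemma AE_kernel:
  "AE \<omega> in \<P>. (\<forall>z\<in>Ustep. 0 < pi_theta \<nu> \<theta> u \<omega> z) \<and> (\<Sum>z\<in>Ustep. pi_theta \<nu> \<theta> u \<omega> z) = 1"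
  using AE_good u_harmonic
proof eventually_elim
  case (elim \<omega>)
  have "pi_theta \<nu> \<theta> u \<omega> z = \<omega> (0,0) z * step_wt \<nu> \<theta> z * u (shift 1 z \<omega>) / u \<omega>" for z
    by (simp add: pi_theta_def step_wt_def)
  then have "(\<Sum>z\<in>Ustep. pi_theta \<nu> \<theta> u \<omega> z) = u \<omega> / u \<omega>"
    using elim(2) by (simp add: sum_divide_distrib[symmetric])
  moreover have "0 < pi_theta \<nu> \<theta> u \<omega> z" if "z \<in> Ustep" for z
    unfolding pi_theta_def using good_pos[OF elim(1) that] u_pos by (intro mult_pos_pos divide_pos_pos) auto
  ultimately show ?case using u_pos[of \<omega>] by simp
qed

text \<open>On this half-space both laws have densities, and the kernel maps its events to functions
  measurable on the same half-space, so both invariance equations can be written with these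
  densities.\<close>

lemma ac_invariant_Bplus_0:
  assumes m1: "ac_invariant m1" and m2: "ac_invariant m2" and E: "E \<in> sets (Bidx \<nu> {i. 0 \<le> fst i})"
  shows "emeasure m1 E = emeasure m2 E"
proof -
  let ?F = "Bidx \<nu> {i. 0 \<le> fst i}"
  have sub: "subalgebra \<P> ?F" by (rule subalgebra_Bidx)
  have p1: "prob_space m1" "sets m1 = sets \<P>" and p2: "prob_space m2" "sets m2 = sets \<P>"
    using m1 m2 by (simp_all add: ac_invariant_def)
  interpret m1: prob_space m1 by (rule p1)
  interpret m2: prob_space m2 by (rule p2)
  have ac1: "A \<in> sets ?F \<Longrightarrow> emeasure \<P> A = 0 \<Longrightarrow> emeasure m1 A = 0" for A
    using m1 unfolding ac_invariant_def by blast
  have ac2: "A \<in> sets ?F \<Longrightarrow> emeasure \<P> A = 0 \<Longrightarrow> emeasure m2 A = 0" for A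
    using m2 unfolding ac_invariant_def by blast
  obtain D1 where D1: "D1 \<in> borel_measurable ?F" "\<And>x. 0 \<le> D1 x" "integrable \<P> D1"
    "\<And>g :: _ \<Rightarrow> real. g \<in> borel_measurable ?F \<Longrightarrow> (\<integral>x. g x \<partial>m1) = (\<integral>x. D1 x * g x \<partial>\<P>)"
    by (rule subalgebra_real_density[OF P.prob_space_axioms p1 sub ac1]) blast+
  obtain D2 where D2: "D2 \<in> borel_measurable ?F" "\<And>x. 0 \<le> D2 x" "integrable \<P> D2"
    "\<And>g :: _ \<Rightarrow> real. g \<in> borel_measurable ?F \<Longrightarrow> (\<integral>x. g x \<partial>m2) = (\<integral>x. D2 x * g x \<partial>\<P>)"
    by (rule subalgebra_real_density[OF P.prob_space_axioms p2 sub ac2]) blast+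
  have D1P: "D1 \<in> borel_measurable \<P>" and D2P: "D2 \<in> borel_measurable \<P>" using D1(3) D2(3) by auto
  have meas1: "measure m1 B = (\<integral>x. D1 x * indicator B x \<partial>\<P>)" if B: "B \<in> sets ?F" for B
  proof -
    have "B \<in> sets m1" using B sub p1(2) by (auto simp: subalgebra_def)
    then show ?thesis using D1(4)[OF borel_measurable_indicator[OF B]] by simp
  qed
  have meas2: "measure m2 B = (\<integral>x. D2 x * indicator B x \<partial>\<P>)" if B: "B \<in> sets ?F" for B
  proof -
    have "B \<in> sets m2" using B sub p2(2) by (auto simp: subalgebra_def)
    then show ?thesis using D2(4)[OF borel_measurable_indicator[OF B]] by simp
  qed
  have ib: "integrable \<P> (\<lambda>x. D x * g x)" if "integrable \<P> D" "g \<in> borel_measurable \<P>" "AE x in \<P>. \<bar>g x\<bar> \<le> 1"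
    for D g :: "'d env \<Rightarrow> real"
    using integrable_mult_bounded[OF that] by (simp add: mult.commute)
  \<comment> \<open>If the zero-one law makes this set null or full, the two densities are ordered
    almost surely; as both have mean 1, they coincide.\<close>
  define A where "A = {x \<in> space ?F. D1 x < D2 x}"
  have AF: "A \<in> sets ?F" unfolding A_def by (rule borel_measurable_less[OF D1(1) D2(1)])
  have AP: "A \<in> sets \<P>" using AF sub by (auto simp: subalgebra_def)
  define k where "k \<omega> = \<K> \<omega> A" for \<omega>
  have kF: "k \<in> borel_measurable ?F"
    unfolding k_def[abs_def] using kernel_measurable_Bidx[of 0 0 A] AF by simp
  have kP: "k \<in> borel_measurable \<P>" by (rule measurable_Bidx_env[OF kF])
  have k01: "AE \<omega> in \<P>. 0 \<le> k \<omega> \<and> k \<omega> \<le> 1"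
    using AE_kernel
  proof eventually_elim
    case (elim \<omega>)
    have "k \<omega> \<le> (\<Sum>z\<in>Ustep. pi_theta \<nu> \<theta> u \<omega> z)"
      unfolding k_def tilted_kernel_def by (intro sum_mono) (use elim in \<open>auto simp: indicator_def less_imp_le\<close>)
    moreover have "0 \<le> k \<omega>"
      unfolding k_def tilted_kernel_def by (intro sum_nonneg) (use elim in \<open>auto simp: indicator_def less_imp_le\<close>)
    ultimately show ?case using elim by simp
  qed
  have kb: "AE \<omega> in \<P>. \<bar>k \<omega>\<bar> \<le> 1" using k01 by eventually_elim auto
  have ibA: "AE \<omega> in \<P>. \<bar>indicator A \<omega> :: real\<bar> \<le> 1" by (simp add: indicator_def)
  have iA: "(indicator A :: _ \<Rightarrow> real) \<in> borel_measurable \<P>" by (rule borel_measurable_indicator[OF AP])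
  \<comment> \<open>Both factors have the same sign because \<open>k\<close> lies between 0 and 1.
    The integral is the difference of the two invariance equations at \<open>A\<close>, hence
    0.\<close>
  define h where "h \<omega> = (D2 \<omega> - D1 \<omega>) * (indicator A \<omega> - k \<omega>)" for \<omega>
  note ints = ib[OF D1(3) iA ibA] ib[OF D2(3) iA ibA] ib[OF D1(3) kP kb] ib[OF D2(3) kP kb]
  have h_eq: "h = (\<lambda>\<omega>. (D2 \<omega> * indicator A \<omega> - D1 \<omega> * indicator A \<omega>) - (D2 \<omega> * k \<omega> - D1 \<omega> * k \<omega>))"
    by (simp add: fun_eq_iff h_def algebra_simps)
  have hi: "integrable \<P> h" unfolding h_eq by (intro Bochner_Integration.integrable_diff ints)
  have "(\<integral>\<omega>. h \<omega> \<partial>\<P>) = ((\<integral>\<omega>. D2 \<omega> * indicator A \<omega> \<partial>\<P>) - (\<integral>\<omega>. D1 \<omega> * indicator A \<omega> \<partial>\<P>))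
      - ((\<integral>\<omega>. D2 \<omega> * k \<omega> \<partial>\<P>) - (\<integral>\<omega>. D1 \<omega> * k \<omega> \<partial>\<P>))"
    unfolding h_eq using ints by simp
  also have "\<dots> = (measure m2 A - measure m1 A) - ((\<integral>\<omega>. k \<omega> \<partial>m2) - (\<integral>\<omega>. k \<omega> \<partial>m1))"
    by (simp only: meas1[OF AF] meas2[OF AF] D1(4)[OF kF] D2(4)[OF kF])
  also have "\<dots> = 0"
    using m1 m2 AP unfolding ac_invariant_def k_def by simp
  finally have h0: "(\<integral>\<omega>. h \<omega> \<partial>\<P>) = 0" .
  have hnn: "AE \<omega> in \<P>. 0 \<le> h \<omega>"
    using k01 AE_space
  proof eventually_elim
    case (elim \<omega>)
    show ?case
    proof (cases "\<omega> \<in> A")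
      case True then show ?thesis using elim by (simp add: h_def A_def)
    next
      case False
      then have "D2 \<omega> \<le> D1 \<omega>" using elim by (simp add: A_def)
      then show ?thesis using elim False by (simp add: h_def mult_nonpos_nonneg)
    qed
  qed
  have hz: "AE \<omega> in \<P>. h \<omega> = 0"
    using integral_nonneg_eq_0_iff_AE[OF hi hnn] h0 by simp
  define e where "e = (axis undefined 1 :: int^'d)"
  have e: "e \<in> Ustep" by (simp add: e_def axis_in_Ustep)
  have "AE \<omega> in \<P>. \<omega> \<in> A \<longrightarrow> shift 1 e \<omega> \<in> A"
    using hz AE_kernel
  proof eventually_elim
    case (elim \<omega>)
    show ?case
    proof (rule impI, rule ccontr)
      assume A: "\<omega> \<in> A" "shift 1 e \<omega> \<notin> A"
      \<comment> \<open>On \<open>A\<close> the first factor of \<open>h\<close> is positive, so the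
        kernel must stay in \<open>A\<close> with probability 1; every single step has positive
        probability.\<close>
      then have "k \<omega> = 1" using elim(1) by (simp add: h_def A_def)
      moreover have "k \<omega> < (\<Sum>z\<in>Ustep. pi_theta \<nu> \<theta> u \<omega> z)"
        unfolding k_def tilted_kernel_def
        by (rule sum_strict_mono_ex1[OF finite_Ustep])
           (use elim(2) e A(2) in \<open>auto simp: indicator_def less_imp_le intro!: bexI[of _ e]\<close>)
      ultimately show False using elim(2) by simp
    qed
  qed
  then have "measure \<P> A = 0 \<or> measure \<P> A = 1" by (rule zero_one_law[unfolded Bplus_eq, OF AF])
  moreover have tot: "(\<integral>\<omega>. D2 \<omega> - D1 \<omega> \<partial>\<P>) = 0"
  proof -
    have "(\<integral>\<omega>. D1 \<omega> \<partial>\<P>) = 1" using D1(4)[of "\<lambda>_. 1"] by (simp add: m1.prob_space)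
    moreover have "(\<integral>\<omega>. D2 \<omega> \<partial>\<P>) = 1" using D2(4)[of "\<lambda>_. 1"] by (simp add: m2.prob_space)
    ultimately show ?thesis using D1(3) D2(3) by simp
  qed
  ultimately have eqD: "AE \<omega> in \<P>. D1 \<omega> = D2 \<omega>"
  proof (elim disjE)
    assume "measure \<P> A = 0"
    then have "AE \<omega> in \<P>. \<omega> \<notin> A" using P.prob_eq_0[OF AP] by simp
    then have le: "AE \<omega> in \<P>. 0 \<le> D1 \<omega> - D2 \<omega>" using AE_space by eventually_elim (auto simp: A_def)
    have "(\<integral>\<omega>. D1 \<omega> - D2 \<omega> \<partial>\<P>) = 0" using tot D1(3) D2(3) by simp
    then have "AE \<omega> in \<P>. D1 \<omega> - D2 \<omega> = 0"
      using integral_nonneg_eq_0_iff_AE[OF Bochner_Integration.integrable_diff[OF D1(3) D2(3)] le] by simp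
    then show ?thesis by eventually_elim simp
  next
    assume "measure \<P> A = 1"
    then have "AE \<omega> in \<P>. \<omega> \<in> A" using P.prob_eq_1[OF AP] by simp
    then have le: "AE \<omega> in \<P>. 0 \<le> D2 \<omega> - D1 \<omega>" by eventually_elim (simp add: A_def)
    have "AE \<omega> in \<P>. D2 \<omega> - D1 \<omega> = 0"
      using integral_nonneg_eq_0_iff_AE[OF Bochner_Integration.integrable_diff[OF D2(3) D1(3)] le] tot by simp
    then show ?thesis by eventually_elim simp
  qed
  have "measure m1 E = measure m2 E"
    unfolding meas1[OF E] meas2[OF E]
  proof (rule integral_cong_AE)
    have EP: "E \<in> sets \<P>" using E sub by (auto simp: subalgebra_def)
    show "(\<lambda>x. D1 x * indicator E x) \<in> borel_measurable \<P>" "(\<lambda>x. D2 x * indicator E x) \<in> borel_measurable \<P>"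
      using EP D1P D2P by measurable
    show "AE x in \<P>. D1 x * indicator E x = D2 x * indicator E x" using eqD by eventually_elim simp
  qed
  then show ?thesis by (simp add: m1.emeasure_eq_measure m2.emeasure_eq_measure)
qed

text \<open>For an event reaching back to \<open>- (N + 1)\<close>, the function integrated in the
  invariance equation reaches back only to \<open>- N\<close>. Agreement therefore propagates into
  the past one time unit at a time, without any density there.\<close>

lemma ac_invariant_unique:
  assumes m1: "ac_invariant m1" and m2: "ac_invariant m2"
  shows "m1 = m2"
proof -
  have p1: "prob_space m1" "sets m1 = sets \<P>" and p2: "prob_space m2" "sets m2 = sets \<P>"
    using m1 m2 by (simp_all add: ac_invariant_def)
  interpret m1: prob_space m1 by (rule p1)
  interpret m2: prob_space m2 by (rule p2)
  have sp1: "space m1 = space \<P>" and sp2: "space m2 = space \<P>"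
    using sets_eq_imp_space_eq[OF p1(2)] sets_eq_imp_space_eq[OF p2(2)] by simp_all
  have sub1: "subalgebra m1 (Bidx \<nu> I)" and sub2: "subalgebra m2 (Bidx \<nu> I)" for I
    using subalgebra_Bidx[of \<nu> I] sp1 sp2 p1(2) p2(2) by (simp_all add: subalgebra_def)
  have eq: "emeasure m1 B = emeasure m2 B" if "B \<in> sets (Bidx \<nu> {i. - int N \<le> fst i})" for N B
    using that
  proof (induction N arbitrary: B)
    case 0 then show ?case by (intro ac_invariant_Bplus_0[OF m1 m2]) simp
  next
    case (Suc N)
    have BP: "B \<in> sets \<P>" using Suc.prems subalgebra_Bidx[of \<nu>] by (auto simp: subalgebra_def)
    have "(\<lambda>\<omega>. \<K> \<omega> B) \<in> borel_measurable (Bidx \<nu> {i. - int (nat (int N)) \<le> fst i})"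
      by (rule kernel_measurable_Bidx[OF _ _ Suc.prems]) simp_all
    then have km: "(\<lambda>\<omega>. \<K> \<omega> B) \<in> borel_measurable (Bidx \<nu> {i. - int N \<le> fst i})" by simp
    have "measure m1 B = (\<integral>\<omega>. \<K> \<omega> B \<partial>m1)" using m1 BP by (simp add: ac_invariant_def)
    also have "\<dots> = (\<integral>\<omega>. \<K> \<omega> B \<partial>m2)"
      by (rule measure_eq_on_subalgebra_integral[OF sub1 sub2 Suc.IH km])
    also have "\<dots> = measure m2 B" using m2 BP by (simp add: ac_invariant_def)
    finally show ?case by (simp add: m1.emeasure_eq_measure m2.emeasure_eq_measure)
  qed
  let ?G = "\<Union>N::nat. sets (Bidx \<nu> {i. - int N \<le> fst i})"
  show ?thesis
  proof (rule measure_eqI)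
    show "sets m1 = sets m2" by (simp add: p1(2) p2(2))
    fix A assume A: "A \<in> sets m1"
    show "emeasure m1 A = emeasure m2 A"
    proof (rule emeasure_eq_on_sigma_sets[where \<Omega> = "space \<P>" and G = ?G])
      show "finite_measure m1" "finite_measure m2" by unfold_locales
      show "?G \<subseteq> sets m1" "?G \<subseteq> sets m2"
        unfolding p1(2) p2(2) using subalgebra_Bidx[of \<nu>] by (auto simp: subalgebra_def)
      show "Int_stable ?G" by (rule Int_stable_UN_mono, rule sets_Bidx_mono) auto
      show "space \<P> \<in> ?G" using sets.top[of "Bidx \<nu> {i. - int 0 \<le> fst i}"] unfolding space_Bidx by blast
      show "emeasure m1 X = emeasure m2 X" if "X \<in> ?G" for X using that eq by blast
      show "A \<in> sigma_sets (space \<P>) ?G" using A sets_env_sigma[of \<nu>] p1(2) by auto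
    qed (simp_all add: sp1 sp2)
  qed
qed

text \<open>The law at time 1 is computed twice: by stationarity, and by the Markov property with
  the trivial past event.\<close>

lemma SMP_ac_invariant:
  assumes "SMP_ac \<nu> \<K> \<mu>"
  shows "ac_invariant (distr \<mu> \<P> (\<lambda>w. w 0))"
proof -
  let ?S = "PiM UNIV (\<lambda>_::nat. \<P>)"
  let ?m = "distr \<mu> \<P> (\<lambda>w. w 0)"
  have SM: "stationary_markov \<P> \<K> \<mu>"
    and ac: "\<And>n. absolutely_continuous (restr_to_subalg \<P> (Bplus \<nu> n)) (restr_to_subalg ?m (Bplus \<nu> n))"
    using assms by (simp_all add: SMP_ac_def)
  have prob: "prob_space \<mu>" and s: "sets \<mu> = sets ?S" and stat: "distr \<mu> ?S (\<lambda>w n. w (Suc n)) = \<mu>"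
    and markov: "\<And>n A B. A \<in> sets (past \<P> n) \<Longrightarrow> B \<in> sets \<P> \<Longrightarrow>
        measure \<mu> (A \<inter> {w \<in> space \<mu>. w (Suc n) \<in> B}) = (\<integral>w. indicator A w * \<K> (w n) B \<partial>\<mu>)"
    using SM unfolding stationary_markov_def by blast+
  interpret mu: prob_space \<mu> by (rule prob)
  have sp: "space \<mu> = space ?S" by (rule sets_eq_imp_space_eq[OF s])
  have c: "(\<lambda>w. w i) \<in> \<mu> \<rightarrow>\<^sub>M \<P>" for i
    using measurable_component_UNIV[of i \<P>] measurable_cong_sets[OF s refl] by blast
  have sh: "(\<lambda>w n. w (Suc n)) \<in> \<mu> \<rightarrow>\<^sub>M ?S"
    using measurable_seq_shift[of \<P>] measurable_cong_sets[OF s refl] by blast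
  show ?thesis
    unfolding ac_invariant_def
  proof (intro conjI allI impI ballI)
    show "prob_space ?m" by (rule mu.prob_space_distr[OF c])
    show "sets ?m = sets \<P>" by simp
  next
    fix n A assume A: "A \<in> sets (Bidx \<nu> {i. n \<le> fst i})" "emeasure \<P> A = 0"
    have subP: "subalgebra \<P> (Bplus \<nu> n)" and subm: "subalgebra ?m (Bplus \<nu> n)"
      using subalgebra_Bidx[of \<nu> "{i. n \<le> fst i}"] by (auto simp: subalgebra_def Bplus_eq)
    have "A \<in> null_sets \<P> \<inter> sets (Bplus \<nu> n)"
      using A subP by (auto simp: null_sets_def Bplus_eq subalgebra_def)
    then have "A \<in> null_sets ?m \<inter> sets (Bplus \<nu> n)"
      using ac[of n] unfolding absolutely_continuous_def null_sets_restr_to_subalg[OF subP] null_sets_restr_to_subalg[OF subm] by blast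
    then show "emeasure ?m A = 0" by auto
  next
    fix B assume B: "B \<in> sets \<P>"
    have km: "(\<lambda>\<omega>. \<K> \<omega> B) \<in> borel_measurable \<P>" by (rule tilted_kernel_measurable[OF B])
    let ?V = "{w \<in> space ?S. w 0 \<in> B}"
    have V: "?V \<in> sets ?S"
      using measurable_sets[OF measurable_component_UNIV[of 0 \<P>] B] by (simp add: vimage_def Int_def conj_commute)
    have "measure ?m B = measure \<mu> ?V"
      using B by (subst measure_distr[OF c B]) (simp add: sp vimage_def Int_def conj_commute)
    also have "\<dots> = measure (distr \<mu> ?S (\<lambda>w n. w (Suc n))) ?V" by (simp only: stat)
    also have "\<dots> = measure \<mu> ((\<lambda>w n. w (Suc n)) -` ?V \<inter> space \<mu>)" by (rule measure_distr[OF sh V])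
    also have "(\<lambda>w n. w (Suc n)) -` ?V \<inter> space \<mu> = space ?S \<inter> {w \<in> space \<mu>. w (Suc 0) \<in> B}"
      by (auto simp: sp space_PiM PiE_iff)
    also have "measure \<mu> \<dots> = (\<integral>w. indicator (space ?S) w * \<K> (w 0) B \<partial>\<mu>)"
      by (rule markov[OF _ B]) (use sets.top[of "past \<P> 0"] in simp)
    also have "\<dots> = (\<integral>w. \<K> (w 0) B \<partial>\<mu>)"
      by (rule Bochner_Integration.integral_cong) (simp_all add: sp)
    also have "\<dots> = (\<integral>\<omega>. \<K> \<omega> B \<partial>?m)" by (rule integral_distr[OF c km, symmetric])
    finally show "measure ?m B = (\<integral>\<omega>. \<K> \<omega> B \<partial>?m)" .
  qed
qed

text \<open>Initial law and kernel determine a Markov process: the Markov property extends agreement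
  from the past up to \<open>n\<close> to rectangles with one more coordinate.\<close>

lemma SMP_ac_unique:
  assumes 1: "SMP_ac \<nu> \<K> \<mu>1" and 2: "SMP_ac \<nu> \<K> \<mu>2"
  shows "\<mu>1 = \<mu>2"
proof -
  let ?S = "PiM UNIV (\<lambda>_::nat. \<P>)"
  have marg: "distr \<mu>1 \<P> (\<lambda>w. w 0) = distr \<mu>2 \<P> (\<lambda>w. w 0)"
    by (rule ac_invariant_unique[OF SMP_ac_invariant[OF 1] SMP_ac_invariant[OF 2]])
  have f: "prob_space \<mu> \<and> sets \<mu> = sets ?S \<and> (\<forall>n A B. A \<in> sets (past \<P> n) \<longrightarrow> B \<in> sets \<P> \<longrightarrow>
        measure \<mu> (A \<inter> {w \<in> space \<mu>. w (Suc n) \<in> B}) = (\<integral>w. indicator A w * \<K> (w n) B \<partial>\<mu>))"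
    if "SMP_ac \<nu> \<K> \<mu>" for \<mu>
    using that unfolding SMP_ac_def stationary_markov_def by (elim conjE) (intro conjI; assumption)
  have markov: "measure \<mu> (A \<inter> {w \<in> space \<mu>. w (Suc n) \<in> B}) = (\<integral>w. indicator A w * \<K> (w n) B \<partial>\<mu>)"
    if "SMP_ac \<nu> \<K> \<mu>" "A \<in> sets (past \<P> n)" "B \<in> sets \<P>" for \<mu> n A B
    using f[OF that(1), THEN conjunct2, THEN conjunct2, rule_format, OF that(2,3)] .
  interpret M1: prob_space \<mu>1 using f[OF 1] by (rule conjunct1)
  interpret M2: prob_space \<mu>2 using f[OF 2] by (rule conjunct1)
  have s1: "sets \<mu>1 = sets ?S" by (rule f[OF 1, THEN conjunct2, THEN conjunct1])
  have s2: "sets \<mu>2 = sets ?S" by (rule f[OF 2, THEN conjunct2, THEN conjunct1])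
  have sp1: "space \<mu>1 = space ?S" and sp2: "space \<mu>2 = space ?S"
    using sets_eq_imp_space_eq[OF s1] sets_eq_imp_space_eq[OF s2] by simp_all
  have c: "(\<lambda>w. w i) \<in> M \<rightarrow>\<^sub>M \<P>" if "sets M = sets ?S" for M i
    using measurable_component_UNIV[of i \<P>] measurable_cong_sets[OF that refl] by blast
  have fin: "finite_measure \<mu>1" "finite_measure \<mu>2" by unfold_locales
  have sub1: "subalgebra \<mu>1 (past \<P> n)" and sub2: "subalgebra \<mu>2 (past \<P> n)" for n
    using subalgebra_past[of \<P> n] sp1 sp2 s1 s2 by (simp_all add: subalgebra_def)
  have eq: "emeasure \<mu>1 A = emeasure \<mu>2 A" if "A \<in> sets (past \<P> n)" for n A
    using that
  proof (induction n arbitrary: A)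
    case 0
    let ?G = "{(\<lambda>w. w i) -` B \<inter> space ?S | i B. i \<le> 0 \<and> B \<in> sets \<P>}"
    show ?case
    proof (rule emeasure_eq_on_sigma_sets[where \<Omega> = "space ?S" and G = ?G, OF fin sp1 sp2])
      have "?G \<subseteq> sets (past \<P> 0)" unfolding sets_past by (rule sigma_sets_superset_generator)
      also have "\<dots> \<subseteq> sets ?S" by (rule sets_past_subset)
      finally have "?G \<subseteq> sets ?S" .
      then show "?G \<subseteq> sets \<mu>1" "?G \<subseteq> sets \<mu>2" by (simp_all only: s1 s2)
      show "Int_stable ?G"
      proof (rule Int_stableI)
        fix a b assume "a \<in> ?G" "b \<in> ?G"
        then obtain B C where "a = (\<lambda>w. w 0) -` B \<inter> space ?S" "b = (\<lambda>w. w 0) -` C \<inter> space ?S" "B \<in> sets \<P>" "C \<in> sets \<P>" by auto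
        then have "a \<inter> b = (\<lambda>w. w 0) -` (B \<inter> C) \<inter> space ?S" "B \<inter> C \<in> sets \<P>" by auto
        then show "a \<inter> b \<in> ?G" by blast
      qed
      have "space ?S = (\<lambda>w. w 0) -` space \<P> \<inter> space ?S" by (auto simp: space_PiM)
      then show "space ?S \<in> ?G" by blast
      show "A \<in> sigma_sets (space ?S) ?G" using 0 unfolding sets_past .
      fix X assume "X \<in> ?G"
      then obtain B where X: "X = (\<lambda>w. w 0) -` B \<inter> space ?S" and B: "B \<in> sets \<P>" by auto
      have "emeasure \<mu>1 X = emeasure (distr \<mu>1 \<P> (\<lambda>w. w 0)) B" by (simp only: emeasure_distr[OF c[OF s1] B] X sp1)
      also have "\<dots> = emeasure \<mu>2 X" unfolding marg by (simp only: emeasure_distr[OF c[OF s2] B] X sp2)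
      finally show "emeasure \<mu>1 X = emeasure \<mu>2 X" .
    qed
  next
    case (Suc n)
    \<comment> \<open>Rectangles of a past event and a condition on the next coordinate; they are
      closed under intersection and generate the next past.\<close>
    let ?G = "{C \<inter> {w \<in> space ?S. w (Suc n) \<in> B} | C B. C \<in> sets (past \<P> n) \<and> B \<in> sets \<P>}"
    have V: "{w \<in> space ?S. w i \<in> B} \<in> sets ?S" if "B \<in> sets \<P>" for i B
      using measurable_sets[OF measurable_component_UNIV[of i \<P>] that] by (simp add: vimage_def Int_def conj_commute)
    have whole: "{w \<in> space ?S. w (Suc n) \<in> space \<P>} = space ?S" by (auto simp: space_PiM)
    show ?case
    proof (rule emeasure_eq_on_sigma_sets[where \<Omega> = "space ?S" and G = ?G, OF fin sp1 sp2])
      show "?G \<subseteq> sets \<mu>1" "?G \<subseteq> sets \<mu>2"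
        unfolding s1 s2 using V sets_past_subset[of \<P> n] by (auto intro!: sets.Int)
      show "Int_stable ?G"
      proof (rule Int_stableI)
        fix a b assume "a \<in> ?G" "b \<in> ?G"
        then obtain C B C' B' where
          "a = C \<inter> {w \<in> space ?S. w (Suc n) \<in> B}" "C \<in> sets (past \<P> n)" "B \<in> sets \<P>"
          "b = C' \<inter> {w \<in> space ?S. w (Suc n) \<in> B'}" "C' \<in> sets (past \<P> n)" "B' \<in> sets \<P>" by blast
        then have "a \<inter> b = (C \<inter> C') \<inter> {w \<in> space ?S. w (Suc n) \<in> B \<inter> B'}" "C \<inter> C' \<in> sets (past \<P> n)" "B \<inter> B' \<in> sets \<P>" by auto
        then show "a \<inter> b \<in> ?G" by blast
      qed
      have "space ?S = space ?S \<inter> {w \<in> space ?S. w (Suc n) \<in> space \<P>}" using whole by auto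
      moreover have "space ?S \<in> sets (past \<P> n)" using sets.top[of "past \<P> n"] by simp
      ultimately show top: "space ?S \<in> ?G" by blast
      show "A \<in> sigma_sets (space ?S) ?G"
      proof -
        have "sets (past \<P> (Suc n)) \<subseteq> sigma_sets (space ?S) ?G"
          unfolding sets_past[of \<P> "Suc n"]
        proof (rule sigma_sets_mono, safe)
          fix i B assume i: "i \<le> Suc n" and B: "B \<in> sets \<P>"
          have "(\<lambda>w. w i) -` B \<inter> space ?S \<in> ?G"
          proof (cases "i = Suc n")
            case True
            then have "(\<lambda>w. w i) -` B \<inter> space ?S = space ?S \<inter> {w \<in> space ?S. w (Suc n) \<in> B}" by auto
            then show ?thesis using B sets.top[of "past \<P> n"] by auto
          next
            case False
            then have "(\<lambda>w. w i) -` B \<inter> space (past \<P> n) \<in> sets (past \<P> n)"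
              using i by (intro measurable_sets[OF measurable_past_component B]) simp
            moreover have "(\<lambda>w. w i) -` B \<inter> space ?S = ((\<lambda>w. w i) -` B \<inter> space ?S) \<inter> {w \<in> space ?S. w (Suc n) \<in> space \<P>}"
              using whole by auto
            ultimately show ?thesis unfolding space_past by blast
          qed
          then show "(\<lambda>w. w i) -` B \<inter> space ?S \<in> sigma_sets (space ?S) ?G" by (rule sigma_sets.Basic)
        qed
        then show ?thesis using Suc.prems by blast
      qed
      fix X assume "X \<in> ?G"
      then obtain C B where X: "X = C \<inter> {w \<in> space ?S. w (Suc n) \<in> B}" and C: "C \<in> sets (past \<P> n)" and B: "B \<in> sets \<P>" by blast
      have km: "(\<lambda>w. indicator C w * \<K> (w n) B) \<in> borel_measurable (past \<P> n)"
        by (rule borel_measurable_times[OF borel_measurable_indicator[OF C]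
            measurable_compose[OF measurable_past_component[OF order_refl] tilted_kernel_measurable[OF B]]])
      have "measure \<mu>1 X = (\<integral>w. indicator C w * \<K> (w n) B \<partial>\<mu>1)"
        unfolding X sp1[symmetric] by (rule markov[OF 1 C B])
      also have "\<dots> = (\<integral>w. indicator C w * \<K> (w n) B \<partial>\<mu>2)"
        by (rule measure_eq_on_subalgebra_integral[OF sub1 sub2 Suc.IH km])
      also have "\<dots> = measure \<mu>2 X"
        unfolding X sp2[symmetric] by (rule markov[OF 2 C B, symmetric])
      finally show "emeasure \<mu>1 X = emeasure \<mu>2 X" by (simp add: M1.emeasure_eq_measure M2.emeasure_eq_measure)
    qed
  qed
  show ?thesis by (rule PiM_eqI_past[OF fin s1 s2 eq])
qed

end

section \<open>Existence of the tilted measure\<close>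

lemma path_wt_prod:
  "path_wt \<nu> \<theta> zs \<omega> = (\<Prod>j<length zs. \<omega> (int j, pos zs j) (zs ! j) * step_wt \<nu> \<theta> (zs ! j))"
proof (induction zs arbitrary: \<omega>)
  case (Cons z zs)
  show ?case
    unfolding length_Cons
    by (subst prod.lessThan_Suc_shift) (simp add: Cons.IH pos_Cons_Suc shift_apply ac_simps)
qed simp

lemma pos_Suc: "pos zs (Suc j) = pos zs j + zs ! j"
  by (simp add: pos_def)

text \<open>Countability of the values makes every binary operation on them measurable.\<close>

lemma measurable_count_space_binop:
  fixes f g :: "'a \<Rightarrow> 'b::countable"
  assumes "f \<in> M \<rightarrow>\<^sub>M count_space UNIV" "g \<in> M \<rightarrow>\<^sub>M count_space UNIV"
  shows "(\<lambda>x. h (f x) (g x)) \<in> M \<rightarrow>\<^sub>M count_space UNIV"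
  by (rule measurable_compose_countable[OF _ assms(1)]) (rule measurable_compose[OF assms(2)], simp)

lemma measurable_count_space_sum:
  fixes f :: "'i \<Rightarrow> 'a \<Rightarrow> int^'d::finite"
  assumes "finite I" "\<And>i. i \<in> I \<Longrightarrow> f i \<in> M \<rightarrow>\<^sub>M count_space UNIV"
  shows "(\<lambda>x. \<Sum>i\<in>I. f i x) \<in> M \<rightarrow>\<^sub>M count_space UNIV"
  using assms
proof (induction I rule: finite_induct)
  case (insert i I)
  have "(\<lambda>x. f i x + (\<Sum>i\<in>I. f i x)) \<in> M \<rightarrow>\<^sub>M count_space UNIV"
    by (rule measurable_count_space_binop) (use insert in auto)
  then show ?case using insert by simp
qed simp

text \<open>Position at time \<open>n\<close>, possibly negative, of the two-sided path through the origin at time 0 with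
  steps \<open>s\<close>.\<close>
definition two_sided_pos :: "(int \<Rightarrow> int^'d::finite) \<Rightarrow> int \<Rightarrow> int^'d" where
  "two_sided_pos s n = (\<Sum>j\<in>{0..<n}. s j) - (\<Sum>j\<in>{n..<0}. s j)"

lemma two_sided_pos_0 [simp]: "two_sided_pos s 0 = 0"
  by (simp add: two_sided_pos_def)

lemma two_sided_pos_Suc: "two_sided_pos s (n + 1) = two_sided_pos s n + s n"
proof (cases "0 \<le> n")
  case True
  then have "{0..<n + 1} = insert n {0..<n}" by auto
  then show ?thesis using True by (simp add: two_sided_pos_def add.commute)
next
  case False
  then have "{n..<0} = insert n {n + 1..<0}" by auto
  then show ?thesis using False by (simp add: two_sided_pos_def)
qed

text \<open>The list is a window of the two-sided path whose entry \<open>N\<close> is taken at time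
  0. The two positions have equal increments, so their difference is constant; the value at
  \<open>N\<close> fixes it.\<close>

lemma two_sided_pos_eq_pos:
  assumes s: "\<And>j. j < length zs \<Longrightarrow> s (int j - int N) = zs ! j" and N: "N \<le> length zs"
  shows "j \<le> length zs \<Longrightarrow> two_sided_pos s (int j - int N) = pos zs j - pos zs N"
proof -
  have d: "two_sided_pos s (int j - int N) - pos zs j = two_sided_pos s (- int N)" if "j \<le> length zs" for j
    using that
  proof (induction j)
    case (Suc j)
    have "two_sided_pos s (int (Suc j) - int N) = two_sided_pos s ((int j - int N) + 1)" by (simp add: algebra_simps)
    also have "\<dots> = two_sided_pos s (int j - int N) + zs ! j" unfolding two_sided_pos_Suc using s[of j] Suc.prems by simp
    finally show ?case using Suc by (simp add: pos_Suc)
  qed simp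
  have N0: "two_sided_pos s (- int N) = - pos zs N" using d[OF N] by simp
  assume "j \<le> length zs"
  from d[OF this] show ?thesis unfolding N0 diff_eq_eq by simp
qed

context rwre
begin

text \<open>Joint law of the chosen step and the transition vector at a visited site: a pair
  \<open>(z, p)\<close> gets weight \<open>step_wt \<nu> \<theta> z * p z\<close>. The sum over
  indicators selects the coordinate of \<open>p\<close>, so measurability is needed only for
  admissible steps.\<close>

definition step_site :: "real^'d \<Rightarrow> ((int^'d) \<times> ((int^'d) \<Rightarrow> real)) measure" where
  "step_site \<theta> = density (count_space Ustep \<Otimes>\<^sub>M \<nu>)
     (\<lambda>x. \<Sum>z\<in>Ustep. indicator {z} (fst x) * ennreal (step_wt \<nu> \<theta> z * snd x z))"

lemma sets_step_site: "sets (step_site \<theta>) = sets (count_space Ustep \<Otimes>\<^sub>M \<nu>)"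
  by (simp add: step_site_def)

lemma space_step_site: "space (step_site \<theta>) = Ustep \<times> space \<nu>"
  by (simp add: step_site_def space_pair_measure)

lemma measurable_wt_weight: "z \<in> Ustep \<Longrightarrow> (\<lambda>p. ennreal (step_wt \<nu> \<theta> z * p z)) \<in> borel_measurable \<nu>"
  by measurable

lemma emeasure_step_site:
  assumes z: "z \<in> Ustep" and B: "B \<in> sets \<nu>"
  shows "emeasure (step_site \<theta>) ({z} \<times> B) = (\<integral>\<^sup>+p. ennreal (step_wt \<nu> \<theta> z * p z) * indicator B p \<partial>\<nu>)"
proof -
  let ?C = "count_space Ustep \<Otimes>\<^sub>M \<nu>"
  let ?h = "\<lambda>z p. ennreal (step_wt \<nu> \<theta> z * p z)"
  have hm: "(\<lambda>x. ?h z' (snd x)) \<in> borel_measurable ?C" if "z' \<in> Ustep" for z'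
    by (rule measurable_compose[OF measurable_snd measurable_wt_weight[OF that]])
  have im: "(\<lambda>x. indicator {z'} (fst x) :: ennreal) \<in> borel_measurable ?C" if "z' \<in> Ustep" for z'
    by (rule measurable_compose[OF measurable_fst borel_measurable_indicator]) (simp add: that)
  have bm: "(\<lambda>x. indicator B (snd x) :: ennreal) \<in> borel_measurable ?C"
    by (rule measurable_compose[OF measurable_snd borel_measurable_indicator[OF B]])
  have zB: "{z} \<times> B \<in> sets ?C" by (rule pair_measureI) (simp_all add: z B)
  have "emeasure (step_site \<theta>) ({z} \<times> B)
    = (\<integral>\<^sup>+x. (\<Sum>z\<in>Ustep. indicator {z} (fst x) * ?h z (snd x)) * indicator ({z} \<times> B) x \<partial>?C)"
    unfolding step_site_def
    by (rule emeasure_density[OF _ zB]) (intro borel_measurable_sum borel_measurable_times_ennreal im hm)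
  also have "\<dots> = (\<integral>\<^sup>+x. indicator {z} (fst x) * (?h z (snd x) * indicator B (snd x)) \<partial>?C)"
  proof (rule nn_integral_cong)
    fix x
    have "(\<Sum>z'\<in>Ustep. indicator {z'} (fst x) * ?h z' (snd x)) = ?h z (snd x)" if "fst x = z"
    proof -
      have "(\<Sum>z'\<in>Ustep. indicator {z'} (fst x) * ?h z' (snd x)) = (\<Sum>z'\<in>Ustep. if z' = z then ?h z (snd x) else 0)"
        by (intro sum.cong refl) (simp add: that indicator_def)
      then show ?thesis using z by (simp add: finite_Ustep)
    qed
    then show "(\<Sum>z\<in>Ustep. indicator {z} (fst x) * ?h z (snd x)) * indicator ({z} \<times> B) x
      = indicator {z} (fst x) * (?h z (snd x) * indicator B (snd x))"
      by (cases x) (auto simp: indicator_def)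
  qed
  also have "\<dots> = (\<integral>\<^sup>+z'. \<integral>\<^sup>+p. indicator {z} z' * (?h z p * indicator B p) \<partial>\<nu> \<partial>count_space Ustep)"
    by (subst nu.nn_integral_fst[symmetric])
       (intro borel_measurable_times_ennreal im hm bm z, simp)
  also have "\<dots> = (\<integral>\<^sup>+z'. indicator {z} z' * (\<integral>\<^sup>+p. ?h z p * indicator B p \<partial>\<nu>) \<partial>count_space Ustep)"
    by (intro nn_integral_cong nn_integral_cmult borel_measurable_times_ennreal measurable_wt_weight[OF z] borel_measurable_indicator[OF B])
  also have "\<dots> = (\<Sum>z'\<in>Ustep. indicator {z} z' * (\<integral>\<^sup>+p. ?h z p * indicator B p \<partial>\<nu>))"
    by (rule nn_integral_count_space_finite[OF finite_Ustep])
  also have "\<dots> = (\<Sum>z'\<in>Ustep. if z' = z then (\<integral>\<^sup>+p. ?h z p * indicator B p \<partial>\<nu>) else 0)"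
    by (intro sum.cong refl) (simp add: indicator_def)
  also have "\<dots> = (\<integral>\<^sup>+p. ?h z p * indicator B p \<partial>\<nu>)" using z by (simp add: finite_Ustep)
  finally show ?thesis .
qed

text \<open>Integrating out the vector leaves the tilted step law, whose total mass is 1.\<close>

lemma prob_space_step_site: "prob_space (step_site \<theta>)"
proof (rule prob_spaceI)
  have sm: "{z} \<times> space \<nu> \<in> sets (step_site \<theta>)" if "z \<in> Ustep" for z
    unfolding sets_step_site by (rule pair_measureI) (simp_all add: that)
  have "emeasure (step_site \<theta>) (space (step_site \<theta>)) = emeasure (step_site \<theta>) (\<Union>z\<in>Ustep. {z} \<times> space \<nu>)"
    by (rule arg_cong[where f = "emeasure (step_site \<theta>)"]) (auto simp: space_step_site)
  also have "\<dots> = (\<Sum>z\<in>Ustep. emeasure (step_site \<theta>) ({z} \<times> space \<nu>))"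
    by (rule sum_emeasure[symmetric]) (auto simp: disjoint_family_on_def finite_Ustep intro: sm)
  also have "\<dots> = (\<Sum>z\<in>Ustep. ennreal (qmean \<nu> z * step_wt \<nu> \<theta> z))"
  proof (intro sum.cong refl)
    fix z :: "int^'d" assume z: "z \<in> Ustep"
    have "emeasure (step_site \<theta>) ({z} \<times> space \<nu>) = (\<integral>\<^sup>+p. ennreal (step_wt \<nu> \<theta> z * p z) \<partial>\<nu>)"
      unfolding emeasure_step_site[OF z sets.top] by (intro nn_integral_cong) simp
    also have "\<dots> = ennreal (\<integral>p. step_wt \<nu> \<theta> z * p z \<partial>\<nu>)"
    proof (rule nn_integral_eq_integral)
      show "integrable \<nu> (\<lambda>p. step_wt \<nu> \<theta> z * p z)" using integrable_weight[OF z] by simp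
      show "AE p in \<nu>. 0 \<le> step_wt \<nu> \<theta> z * p z"
        using elliptic
      proof eventually_elim
        case (elim p)
        then have "0 \<le> p z" using z c1_pos by (meson less_imp_le order_trans)
        then show ?case by (simp add: less_imp_le)
      qed
    qed
    finally show "emeasure (step_site \<theta>) ({z} \<times> space \<nu>) = ennreal (qmean \<nu> z * step_wt \<nu> \<theta> z)"
      by (simp add: qmean_def mult.commute)
  qed
  also have "\<dots> = ennreal (\<Sum>z\<in>Ustep. qmean \<nu> z * step_wt \<nu> \<theta> z)"
    by (rule sum_ennreal) (simp add: qmean_pos less_imp_le)
  finally show "emeasure (step_site \<theta>) (space (step_site \<theta>)) = 1" by (simp add: sum_qmean_step_wt)
qed

section \<open>The two-sided path implanted into an independent environment\<close>

definition two_sided :: "real^'d \<Rightarrow> (int \<Rightarrow> (int^'d) \<times> ((int^'d) \<Rightarrow> real)) measure" where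
  "two_sided \<theta> = PiM UNIV (\<lambda>_. step_site \<theta>)"

abbreviation tpos :: "(int \<Rightarrow> (int^'d) \<times> ((int^'d) \<Rightarrow> real)) \<Rightarrow> int \<Rightarrow> int^'d" where
  "tpos y \<equiv> two_sided_pos (\<lambda>j. fst (y j))"

text \<open>A path in space-time meets each time slice in exactly one site. The vectors along it can
  hence be indexed by time alone, and no site is overwritten twice.\<close>

definition implant :: "(int \<Rightarrow> (int^'d) \<times> ((int^'d) \<Rightarrow> real)) \<times> 'd env \<Rightarrow> 'd env \<times> (nat \<Rightarrow> int^'d)" where
  "implant x = (\<lambda>i. if snd i = tpos (fst x) (fst i) then snd (fst x (fst i)) else snd x i,
     \<lambda>i. fst (fst x (int i)))"

text \<open>Under \<open>\<theta>\<close>-tilting, the steps of the two-sided walk are i.i.d. with mean \<open>\<xi>\<close> and, given the path, the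
  environment is size-biased by the chosen step at the visited sites and unchanged elsewhere.\<close>
definition tilted_measure :: "real^'d \<Rightarrow> ('d env \<times> (nat \<Rightarrow> int^'d)) measure" where
  "tilted_measure \<theta> = distr (two_sided \<theta> \<Otimes>\<^sub>M \<P>) (\<P> \<Otimes>\<^sub>M steps_measure) implant"

lemma space_two_sided: "y \<in> space (two_sided \<theta>) \<longleftrightarrow> (\<forall>j. fst (y j) \<in> Ustep \<and> snd (y j) \<in> space \<nu>)"
  by (auto simp: two_sided_def space_PiM PiE_iff space_step_site mem_Times_iff)

lemma measurable_two_sided_component: "(\<lambda>y. y j) \<in> two_sided \<theta> \<rightarrow>\<^sub>M step_site \<theta>"
  unfolding two_sided_def by (rule measurable_component_singleton) simp

lemma measurable_two_sided_fst: "(\<lambda>y. fst (y j)) \<in> two_sided \<theta> \<rightarrow>\<^sub>M count_space Ustep"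
proof -
  have "fst \<in> step_site \<theta> \<rightarrow>\<^sub>M count_space Ustep"
    using measurable_fst measurable_cong_sets[OF sets_step_site refl] by blast
  then show ?thesis by (rule measurable_compose[OF measurable_two_sided_component])
qed

lemma measurable_two_sided_snd: "(\<lambda>y. snd (y j)) \<in> two_sided \<theta> \<rightarrow>\<^sub>M \<nu>"
proof -
  have "snd \<in> step_site \<theta> \<rightarrow>\<^sub>M \<nu>"
    using measurable_snd measurable_cong_sets[OF sets_step_site refl] by blast
  then show ?thesis by (rule measurable_compose[OF measurable_two_sided_component])
qed

lemma measurable_tpos: "(\<lambda>y. tpos y n) \<in> two_sided \<theta> \<rightarrow>\<^sub>M count_space UNIV"
proof -
  have f: "(\<lambda>y. fst (y j)) \<in> two_sided \<theta> \<rightarrow>\<^sub>M count_space UNIV" for j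
    by (rule measurable_compose[OF measurable_two_sided_fst]) simp
  show ?thesis
    unfolding two_sided_pos_def
    by (intro measurable_count_space_binop[of _ _ _ minus] measurable_count_space_sum f) simp_all
qed

lemma implant_in_space:
  assumes "x \<in> space (two_sided \<theta> \<Otimes>\<^sub>M \<P>)"
  shows "fst (implant x) \<in> space \<P>" "snd (implant x) \<in> space steps_measure"
  using assms by (auto simp: implant_def space_pair_measure space_two_sided space_env_measure_iff steps_space_iff)

lemma measurable_implant: "implant \<in> two_sided \<theta> \<Otimes>\<^sub>M \<P> \<rightarrow>\<^sub>M \<P> \<Otimes>\<^sub>M steps_measure"
proof -
  let ?M = "two_sided \<theta> \<Otimes>\<^sub>M \<P>"
  have 1: "(\<lambda>x. fst (implant x)) \<in> ?M \<rightarrow>\<^sub>M Bidx \<nu> UNIV"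
  proof (rule measurable_BidxI)
    fix i :: "int \<times> (int^'d)"
    have t: "(\<lambda>x. tpos (fst x) (fst i)) \<in> ?M \<rightarrow>\<^sub>M count_space UNIV"
      by (rule measurable_compose[OF measurable_fst measurable_tpos])
    have s: "(\<lambda>x. snd (fst x (fst i))) \<in> ?M \<rightarrow>\<^sub>M \<nu>"
      by (rule measurable_compose[OF measurable_fst measurable_two_sided_snd])
    have e: "(\<lambda>x. snd x i) \<in> ?M \<rightarrow>\<^sub>M \<nu>"
      by (rule measurable_compose[OF measurable_snd measurable_Bidx_env[OF measurable_Bidx_component[of i UNIV]]]) simp
    have "{x \<in> space ?M. snd i = tpos (fst x) (fst i)} = (\<lambda>x. tpos (fst x) (fst i)) -` {snd i} \<inter> space ?M" by auto
    also have "\<dots> \<in> sets ?M" by (rule measurable_sets[OF t]) simp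
    finally have "{x \<in> space ?M. snd i = tpos (fst x) (fst i)} \<in> sets ?M" .
    from measurable_If[OF s e this] show "(\<lambda>x. fst (implant x) i) \<in> ?M \<rightarrow>\<^sub>M \<nu>" by (simp add: implant_def)
  qed (rule implant_in_space(1))
  have 2: "(\<lambda>x. snd (implant x)) \<in> ?M \<rightarrow>\<^sub>M steps_measure"
    unfolding steps_measure_def
  proof (rule measurable_PiM_single')
    show "(\<lambda>x. snd (implant x) i) \<in> ?M \<rightarrow>\<^sub>M count_space Ustep" for i
      unfolding implant_def snd_conv by (rule measurable_compose[OF measurable_fst measurable_two_sided_fst])
  next
    show "(\<lambda>x i. snd (implant x) i) \<in> space ?M \<rightarrow> (\<Pi>\<^sub>E i\<in>UNIV. space (count_space Ustep))"
      using implant_in_space(2) by (auto simp: steps_space_iff)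
  qed
  have env: "(\<lambda>x. fst (implant x)) \<in> ?M \<rightarrow>\<^sub>M \<P>"
    using 1 measurable_cong_sets[OF refl sets_Bidx_UNIV] by blast
  from measurable_Pair[OF env 2] show ?thesis by simp
qed

lemma prob_space_two_sided: "prob_space (two_sided \<theta>)"
  unfolding two_sided_def by (rule prob_space_PiM) (rule prob_space_step_site)

lemma prob_space_tilted_measure: "prob_space (tilted_measure \<theta>)"
proof -
  interpret T: prob_space "two_sided \<theta>" by (rule prob_space_two_sided)
  interpret TP: pair_prob_space "two_sided \<theta>" \<P> ..
  show ?thesis unfolding tilted_measure_def by (rule TP.prob_space_distr[OF measurable_implant])
qed

section \<open>The tilted measure on finite-dimensional rectangles\<close>

definition box_rect :: "(int \<times> (int^'d)) set \<Rightarrow> (int \<times> (int^'d) \<Rightarrow> ((int^'d) \<Rightarrow> real) set) \<Rightarrow> 'd env set" where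
  "box_rect I A = {\<omega> \<in> space \<P>. \<forall>i\<in>I. \<omega> i \<in> A i}"

lemma emeasure_box_rect:
  assumes "finite I" "\<And>i. i \<in> I \<Longrightarrow> A i \<in> sets \<nu>"
  shows "emeasure \<P> (box_rect I A) = (\<Prod>i\<in>I. emeasure \<nu> (A i))"
  unfolding box_rect_def env_measure_def using assms by (intro PP.emeasure_PiM_Collect) auto

lemma nn_integral_prod_sites:
  assumes "finite I" "\<And>i. i \<in> I \<Longrightarrow> F i \<in> borel_measurable \<nu>"
  shows "(\<integral>\<^sup>+\<omega>. (\<Prod>i\<in>I. F i (\<omega> i)) \<partial>\<P>) = (\<Prod>i\<in>I. \<integral>\<^sup>+p. F i p \<partial>\<nu>)"
proof -
  have "P.indep_vars (\<lambda>_. \<nu>) (\<lambda>i \<omega>. \<omega> i) I"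
    by (rule P.indep_vars_subset[OF _ subset_UNIV]) (unfold env_measure_def, rule indep_vars_PiM_UNIV[OF prob_nu])
  then have "P.indep_vars (\<lambda>_. borel) (\<lambda>i \<omega>. F i (\<omega> i)) I"
    by (rule P.indep_vars_compose2) (rule assms(2))
  then have "(\<integral>\<^sup>+\<omega>. (\<Prod>i\<in>I. F i (\<omega> i)) \<partial>\<P>) = (\<Prod>i\<in>I. \<integral>\<^sup>+\<omega>. F i (\<omega> i) \<partial>\<P>)"
    by (rule P.indep_vars_nn_integral[OF assms(1)]) simp
  also have "\<dots> = (\<Prod>i\<in>I. \<integral>\<^sup>+p. F i p \<partial>\<nu>)"
  proof (intro prod.cong refl)
    fix i assume i: "i \<in> I"
    have c: "(\<lambda>\<omega>. \<omega> i) \<in> \<P> \<rightarrow>\<^sub>M \<nu>" by (rule measurable_Bidx_env[OF measurable_Bidx_component[of i UNIV]]) simp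
    have "(\<integral>\<^sup>+p. F i p \<partial>\<nu>) = (\<integral>\<^sup>+p. F i p \<partial>distr \<P> \<nu> (\<lambda>\<omega>. \<omega> i))"
      unfolding env_measure_def by (simp add: PP.PiM_component)
    also have "\<dots> = (\<integral>\<^sup>+\<omega>. F i (\<omega> i) \<partial>\<P>)" by (rule nn_integral_distr[OF c]) (simp add: assms(2)[OF i])
    finally show "(\<integral>\<^sup>+\<omega>. F i (\<omega> i) \<partial>\<P>) = (\<integral>\<^sup>+p. F i p \<partial>\<nu>)" by simp
  qed
  finally show ?thesis .
qed

lemma emeasure_two_sided_cylinder:
  assumes "finite J" "\<And>j. j \<in> J \<Longrightarrow> B j \<in> sets (step_site \<theta>)"
  shows "emeasure (two_sided \<theta>) {y \<in> space (two_sided \<theta>). \<forall>j\<in>J. y j \<in> B j} = (\<Prod>j\<in>J. emeasure (step_site \<theta>) (B j))"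
proof -
  have "product_prob_space (\<lambda>_::int. step_site \<theta>)" by (rule product_prob_spaceI) (rule prob_space_step_site)
  from product_prob_space.emeasure_PiM_Collect[OF this, of J UNIV B] show ?thesis
    unfolding two_sided_def using assms by simp
qed

end

lemma prod_indicator_eq:
  "finite I \<Longrightarrow> (\<Prod>i\<in>I. indicator (A i) (x i) :: ennreal) = (if \<forall>i\<in>I. x i \<in> A i then 1 else 0)"
  by (induction I rule: finite_induct) (auto simp: indicator_def)

context rwre
begin

text \<open>Once the steps \<open>zs\<close> are prescribed, the visited sites are known and the
  event is a product: visited sites follow \<open>step_site\<close>, the others the original law.
  Writing every factor as an integral against \<open>\<nu>\<close> collects the size-biasing weights
  into \<open>path_wt\<close> under the i.i.d. environment.\<close>

lemma emeasure_two_sided_path: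
  fixes \<theta> :: "real^'d" and I :: "(int \<times> (int^'d)) set" and A :: "int \<times> (int^'d) \<Rightarrow> ((int^'d) \<Rightarrow> real) set"
  assumes zs: "zs \<in> Ulists L" and N: "N \<le> L"
    and I: "finite I" "\<And>i. i \<in> I \<Longrightarrow> - int N \<le> fst i \<and> fst i < int L - int N" and A: "\<And>i. i \<in> I \<Longrightarrow> A i \<in> sets \<nu>"
  defines "E \<equiv> {x \<in> space (two_sided \<theta> \<Otimes>\<^sub>M \<P>).
      (\<forall>j<L. fst (fst x (int j - int N)) = zs ! j) \<and> fst (implant x) \<in> box_rect I A}"
  shows "E \<in> sets (two_sided \<theta> \<Otimes>\<^sub>M \<P>)"
    and "emeasure (two_sided \<theta> \<Otimes>\<^sub>M \<P>) E
      = (\<integral>\<^sup>+\<omega>. indicator (box_rect I A) \<omega> * ennreal (path_wt \<nu> \<theta> zs (shift (- int N) (- pos zs N) \<omega>)) \<partial>\<P>)"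
proof -
  have len: "length zs = L" by (rule length_Ulists[OF zs])
  have zU: "zs ! j \<in> Ustep" if "j < L" for j using zs that by (auto simp: Ulists_def)
  define k where "k j = int j - int N" for j
  \<comment> \<open>The space-time site from which step \<open>j\<close> is taken, with the path
    passing the origin after \<open>N\<close> steps.\<close>
  define s where "s j = (k j, pos zs j - pos zs N)" for j
  define idx where "idx i = nat (fst i + int N)" for i :: "int \<times> (int^'d)"
  \<comment> \<open>Visited sites outside \<open>I\<close> are unconstrained but still carry their
    weight.\<close>
  define B where "B i = (if i \<in> I then A i else space \<nu>)" for i
  define I' where "I' = I - s ` {..<L}"
  have idx_s: "idx (s j) = j" for j by (simp add: idx_def s_def k_def)
  have inj: "inj_on s S" for S by (metis idx_s inj_onI)
  have injk: "inj_on k S" for S by (simp add: inj_on_def k_def)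
  have Bs: "B i \<in> sets \<nu>" for i using A by (simp add: B_def)
  define Y0 where "Y0 = {y \<in> space (two_sided \<theta>). \<forall>m\<in>k ` {..<L}. y m \<in> {zs ! nat (m + int N)} \<times> B (s (nat (m + int N)))}"
  have nk: "nat (k j + int N) = j" for j by (simp add: k_def)
  have Y0_alt: "y \<in> Y0 \<longleftrightarrow> y \<in> space (two_sided \<theta>) \<and> (\<forall>j<L. fst (y (k j)) = zs ! j \<and> snd (y (k j)) \<in> B (s j))" for y
    by (auto simp: Y0_def nk mem_Times_iff)
  have E_eq: "E = Y0 \<times> box_rect I' A"
  proof (intro set_eqI)
    fix x :: "(int \<Rightarrow> (int^'d) \<times> ((int^'d) \<Rightarrow> real)) \<times> 'd env"
    obtain y \<omega> where x: "x = (y, \<omega>)" by (cases x)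
    show "x \<in> E \<longleftrightarrow> x \<in> Y0 \<times> box_rect I' A"
    proof (cases "y \<in> space (two_sided \<theta>) \<and> \<omega> \<in> space \<P> \<and> (\<forall>j<L. fst (y (k j)) = zs ! j)")
      case False
      then show ?thesis by (auto simp: x E_def Y0_alt box_rect_def space_pair_measure k_def)
    next
      case True
      have tp: "tpos y (k j) = pos zs j - pos zs N" if "j < L" for j
        unfolding k_def
        by (rule two_sided_pos_eq_pos) (use True that N in \<open>auto simp: len k_def\<close>)
      have im: "fst (implant x) i = (if i = s (idx i) then snd (y (k (idx i))) else \<omega> i)" "idx i < L" if i: "i \<in> I" for i
      proof -
        have ki: "k (idx i) = fst i" using I(2)[OF i] by (simp add: k_def idx_def)
        show l: "idx i < L" using I(2)[OF i] by (simp add: idx_def nat_less_iff)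
        have "snd i = tpos y (fst i) \<longleftrightarrow> i = s (idx i)"
          using tp[OF l] unfolding ki by (auto simp: s_def prod_eq_iff ki)
        then show "fst (implant x) i = (if i = s (idx i) then snd (y (k (idx i))) else \<omega> i)"
          by (simp add: implant_def x ki)
      qed
      have "(\<forall>i\<in>I. fst (implant x) i \<in> A i) \<longleftrightarrow> (\<forall>j<L. snd (y (k j)) \<in> B (s j)) \<and> (\<forall>i\<in>I'. \<omega> i \<in> A i)"
      proof (intro iffI conjI allI impI ballI)
        fix j assume a: "\<forall>i\<in>I. fst (implant x) i \<in> A i" and j: "j < L"
        show "snd (y (k j)) \<in> B (s j)"
        proof (cases "s j \<in> I")
          case True2: True
          then have "fst (implant x) (s j) \<in> A (s j)" using a by blast
          then show ?thesis using im(1)[OF True2] True2 by (simp add: idx_s B_def)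
        next
          case False
          then show ?thesis using True by (simp add: B_def space_two_sided)
        qed
      next
        fix i assume a: "\<forall>i\<in>I. fst (implant x) i \<in> A i" and i: "i \<in> I'"
        then have iI: "i \<in> I" "i \<noteq> s (idx i)" using im(2)[of i] by (auto simp: I'_def)
        then have "fst (implant x) i \<in> A i" using a by blast
        then show "\<omega> i \<in> A i" using im(1)[OF iI(1)] iI(2) by simp
      next
        fix i assume a: "(\<forall>j<L. snd (y (k j)) \<in> B (s j)) \<and> (\<forall>i\<in>I'. \<omega> i \<in> A i)" and i: "i \<in> I"
        show "fst (implant x) i \<in> A i"
        proof (cases "i = s (idx i)")
          case True3: True
          have "snd (y (k (idx i))) \<in> B (s (idx i))" using a im(2)[OF i] by blast
          then show ?thesis using im(1)[OF i] True3 i by (simp add: B_def)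
        next
          case False
          then have "i \<in> I'" using i idx_s by (auto simp: I'_def)
          then show ?thesis using im(1)[OF i] False a by simp
        qed
      qed
      moreover have "x \<in> space (two_sided \<theta> \<Otimes>\<^sub>M \<P>)" using True by (simp add: x space_pair_measure)
      ultimately show ?thesis
        using True implant_in_space(1)[of x \<theta>]
        by (simp add: E_def x Y0_alt box_rect_def k_def)
    qed
  qed
  have Bk: "{zs ! nat (m + int N)} \<times> B (s (nat (m + int N))) \<in> sets (step_site \<theta>)" if m: "m \<in> k ` {..<L}" for m
  proof -
    obtain j where "m = k j" "j < L" using m by blast
    then show ?thesis unfolding sets_step_site by (intro pair_measureI Bs) (simp add: nk zU)
  qed
  have Y0s: "Y0 \<in> sets (two_sided \<theta>)"
  proof -
    have one: "{y \<in> space (two_sided \<theta>). y m \<in> C} \<in> sets (two_sided \<theta>)" if "C \<in> sets (step_site \<theta>)" for m C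
      using measurable_sets[OF measurable_two_sided_component that] by (simp add: vimage_def Int_def conj_commute)
    show ?thesis unfolding Y0_def by (rule sets.sets_Collect_finite_All[OF one[OF Bk]]) simp_all
  qed
  have fI': "finite I'" using I(1) by (simp add: I'_def)
  have AI': "A i \<in> sets \<nu>" if "i \<in> I'" for i using that A by (simp add: I'_def)
  have Rs: "box_rect I' A \<in> sets \<P>"
  proof -
    have "{\<omega> \<in> space \<P>. \<omega> i \<in> A i} \<in> sets \<P>" if "i \<in> I'" for i
    proof -
      have "(\<lambda>\<omega>. \<omega> i) \<in> \<P> \<rightarrow>\<^sub>M \<nu>" by (rule measurable_Bidx_env[OF measurable_Bidx_component[of i UNIV]]) simp
      from measurable_sets[OF this AI'[OF that]] show ?thesis by (simp add: vimage_def Int_def conj_commute)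
    qed
    then show ?thesis unfolding box_rect_def by (intro sets.sets_Collect_finite_All fI')
  qed
  show "E \<in> sets (two_sided \<theta> \<Otimes>\<^sub>M \<P>)" unfolding E_eq by (rule pair_measureI[OF Y0s Rs])
  \<comment> \<open>Visited sites together with the unvisited constrained ones. The union is
    disjoint and \<open>s\<close> is injective, so both products merge into one over distinct
    sites.\<close>
  define T where "T = s ` {..<L} \<union> I'"
  define F where "F i = (if i \<in> s ` {..<L} then (\<lambda>p. ennreal (step_wt \<nu> \<theta> (zs ! idx i) * p (zs ! idx i)) * indicator (B i) p)
     else (indicator (A i) :: _ \<Rightarrow> ennreal))" for i
  have fT: "finite T" using fI' by (simp add: T_def)
  have prodT: "(\<Prod>i\<in>T. g i) = (\<Prod>j<L. g (s j)) * (\<Prod>i\<in>I'. g i)" for g :: "int \<times> (int^'d) \<Rightarrow> ennreal"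
  proof -
    have "(\<Prod>i\<in>T. g i) = (\<Prod>i\<in>s ` {..<L}. g i) * (\<Prod>i\<in>I'. g i)"
      unfolding T_def by (rule prod.union_disjoint) (use fI' in \<open>auto simp: I'_def\<close>)
    then show ?thesis by (simp add: prod.reindex[OF inj])
  qed
  have Fm: "F i \<in> borel_measurable \<nu>" if i: "i \<in> T" for i
  proof (cases "i \<in> s ` {..<L}")
    case True
    then obtain j where j: "i = s j" "j < L" by blast
    have "zs ! idx i \<in> Ustep" using j by (simp add: idx_s zU)
    from borel_measurable_times_ennreal[OF measurable_wt_weight[OF this] borel_measurable_indicator[OF Bs]] True
    show ?thesis by (simp add: F_def)
  next
    case False
    then have "i \<in> I'" using i by (simp add: T_def)
    then show ?thesis using False AI' by (simp add: F_def)
  qed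
  have "emeasure (two_sided \<theta> \<Otimes>\<^sub>M \<P>) E = emeasure (two_sided \<theta>) Y0 * emeasure \<P> (box_rect I' A)"
    unfolding E_eq by (rule P.emeasure_pair_measure_Times[OF Y0s Rs])
  also have "emeasure \<P> (box_rect I' A) = (\<Prod>i\<in>I'. \<integral>\<^sup>+p. F i p \<partial>\<nu>)"
  proof -
    have "emeasure \<P> (box_rect I' A) = (\<Prod>i\<in>I'. emeasure \<nu> (A i))" by (rule emeasure_box_rect[OF fI' AI'])
    also have "\<dots> = (\<Prod>i\<in>I'. \<integral>\<^sup>+p. F i p \<partial>\<nu>)"
    proof (rule prod.cong[OF refl])
      fix i assume i: "i \<in> I'"
      then have "F i = indicator (A i)" by (simp add: F_def I'_def)
      then show "emeasure \<nu> (A i) = (\<integral>\<^sup>+p. F i p \<partial>\<nu>)" using AI'[OF i] by simp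
    qed
    finally show ?thesis .
  qed
  also have "emeasure (two_sided \<theta>) Y0 = (\<Prod>m\<in>k ` {..<L}. emeasure (step_site \<theta>) ({zs ! nat (m + int N)} \<times> B (s (nat (m + int N)))))"
    unfolding Y0_def by (rule emeasure_two_sided_cylinder[OF _ Bk]) simp_all
  also have "\<dots> = (\<Prod>j<L. emeasure (step_site \<theta>) ({zs ! j} \<times> B (s j)))"
    by (simp add: prod.reindex[OF injk] nk)
  also have "\<dots> = (\<Prod>j<L. \<integral>\<^sup>+p. F (s j) p \<partial>\<nu>)"
  proof (intro prod.cong refl)
    fix j assume "j \<in> {..<L}"
    then have j: "j < L" by simp
    have "F (s j) = (\<lambda>p. ennreal (step_wt \<nu> \<theta> (zs ! j) * p (zs ! j)) * indicator (B (s j)) p)"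
      using j by (auto simp: F_def idx_s)
    then show "emeasure (step_site \<theta>) ({zs ! j} \<times> B (s j)) = (\<integral>\<^sup>+p. F (s j) p \<partial>\<nu>)"
      by (simp only: emeasure_step_site[OF zU[OF j] Bs])
  qed
  also have "(\<Prod>j<L. \<integral>\<^sup>+p. F (s j) p \<partial>\<nu>) * (\<Prod>i\<in>I'. \<integral>\<^sup>+p. F i p \<partial>\<nu>) = (\<Prod>i\<in>T. \<integral>\<^sup>+p. F i p \<partial>\<nu>)"
    by (rule prodT[symmetric])
  also have "\<dots> = (\<integral>\<^sup>+\<omega>. (\<Prod>i\<in>T. F i (\<omega> i)) \<partial>\<P>)"
    by (rule nn_integral_prod_sites[OF fT Fm, symmetric])
  also have "\<dots> = (\<integral>\<^sup>+\<omega>. indicator (box_rect I A) \<omega> * ennreal (path_wt \<nu> \<theta> zs (shift (- int N) (- pos zs N) \<omega>)) \<partial>\<P>)"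
  proof (rule nn_integral_cong_AE)
    show "AE \<omega> in \<P>. (\<Prod>i\<in>T. F i (\<omega> i)) = indicator (box_rect I A) \<omega> * ennreal (path_wt \<nu> \<theta> zs (shift (- int N) (- pos zs N) \<omega>))"
      using AE_good AE_space
    proof eventually_elim
      case (elim \<omega>)
      have Fs: "F (s j) (\<omega> (s j)) = ennreal (step_wt \<nu> \<theta> (zs ! j) * \<omega> (s j) (zs ! j)) * indicator (B (s j)) (\<omega> (s j))" if "j < L" for j
        using that by (auto simp: F_def idx_s)
      have "(\<Prod>j<L. F (s j) (\<omega> (s j))) = (\<Prod>j<L. ennreal (step_wt \<nu> \<theta> (zs ! j) * \<omega> (s j) (zs ! j)) * indicator (B (s j)) (\<omega> (s j)))"
        by (intro prod.cong refl Fs) simp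
      also have "\<dots> = (\<Prod>j<L. ennreal (step_wt \<nu> \<theta> (zs ! j) * \<omega> (s j) (zs ! j))) * (\<Prod>j<L. indicator (B (s j)) (\<omega> (s j)))"
        by (rule prod.distrib)
      also have "(\<Prod>j<L. ennreal (step_wt \<nu> \<theta> (zs ! j) * \<omega> (s j) (zs ! j))) = ennreal (\<Prod>j<L. step_wt \<nu> \<theta> (zs ! j) * \<omega> (s j) (zs ! j))"
        by (rule prod_ennreal) (use good_pos[OF elim(1) zU] in \<open>simp add: less_imp_le\<close>)
      also have "(\<Prod>j<L. step_wt \<nu> \<theta> (zs ! j) * \<omega> (s j) (zs ! j)) = path_wt \<nu> \<theta> zs (shift (- int N) (- pos zs N) \<omega>)"
        unfolding path_wt_prod len by (intro prod.cong refl) (simp add: shift_apply s_def k_def mult.commute)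
      also have "(\<Prod>j<L. indicator (B (s j)) (\<omega> (s j)) :: ennreal) = (if \<forall>j\<in>{..<L}. \<omega> (s j) \<in> B (s j) then 1 else 0)"
        by (rule prod_indicator_eq[where A = "\<lambda>j. B (s j)" and x = "\<lambda>j. \<omega> (s j)"]) simp
      finally have 1: "(\<Prod>j<L. F (s j) (\<omega> (s j))) = ennreal (path_wt \<nu> \<theta> zs (shift (- int N) (- pos zs N) \<omega>))
        * (if \<forall>j\<in>{..<L}. \<omega> (s j) \<in> B (s j) then 1 else 0)" .
      have "(\<Prod>i\<in>I'. F i (\<omega> i)) = (\<Prod>i\<in>I'. indicator (A i) (\<omega> i))"
        by (intro prod.cong refl) (simp add: F_def I'_def)
      also have "\<dots> = (if \<forall>i\<in>I'. \<omega> i \<in> A i then 1 else 0)" by (rule prod_indicator_eq[OF fI'])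
      finally have 2: "(\<Prod>i\<in>I'. F i (\<omega> i)) = (if \<forall>i\<in>I'. \<omega> i \<in> A i then 1 else 0)" .
      have "\<omega> \<in> box_rect I A \<longleftrightarrow> (\<forall>j\<in>{..<L}. \<omega> (s j) \<in> B (s j)) \<and> (\<forall>i\<in>I'. \<omega> i \<in> A i)"
      proof
        assume "\<omega> \<in> box_rect I A"
        then show "(\<forall>j\<in>{..<L}. \<omega> (s j) \<in> B (s j)) \<and> (\<forall>i\<in>I'. \<omega> i \<in> A i)"
          using elim(2) by (auto simp: box_rect_def B_def I'_def space_env_measure_iff)
      next
        assume a: "(\<forall>j\<in>{..<L}. \<omega> (s j) \<in> B (s j)) \<and> (\<forall>i\<in>I'. \<omega> i \<in> A i)"
        have "\<omega> i \<in> A i" if i: "i \<in> I" for i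
        proof (cases "i \<in> s ` {..<L}")
          case True
          then obtain j where j: "j \<in> {..<L}" "i = s j" by blast
          have "\<omega> (s j) \<in> B (s j)" using a j(1) by blast
          then show ?thesis using i j(2) by (simp add: B_def)
        next
          case False then show ?thesis using a i by (simp add: I'_def)
        qed
        then show "\<omega> \<in> box_rect I A" using elim(2) by (simp add: box_rect_def)
      qed
      then show ?case unfolding prodT 1 2 by (simp add: indicator_def)
    qed
  qed
  finally show "emeasure (two_sided \<theta> \<Otimes>\<^sub>M \<P>) E
      = (\<integral>\<^sup>+\<omega>. indicator (box_rect I A) \<omega> * ennreal (path_wt \<nu> \<theta> zs (shift (- int N) (- pos zs N) \<omega>)) \<partial>\<P>)" .
qed


lemma sets_tilted_measure: "sets (tilted_measure \<theta>) = sets (\<P> \<Otimes>\<^sub>M steps_measure)"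
  by (simp add: tilted_measure_def)

lemma space_tilted_measure: "space (tilted_measure \<theta>) = space \<P> \<times> space steps_measure"
  by (simp add: tilted_measure_def space_pair_measure)

lemma box_rect_sets:
  assumes "finite I" "I \<subseteq> J" "\<And>i. i \<in> I \<Longrightarrow> A i \<in> sets \<nu>"
  shows "box_rect I A \<in> sets (Bidx \<nu> J)"
proof -
  have "{\<omega> \<in> space (Bidx \<nu> J). \<omega> i \<in> A i} \<in> sets (Bidx \<nu> J)" if "i \<in> I" for i
  proof -
    have "i \<in> J" using that assms(2) by blast
    from measurable_sets[OF measurable_Bidx_component[OF this] assms(3)[OF that]]
    show ?thesis by (simp add: vimage_def Int_def conj_commute)
  qed
  then have "{\<omega> \<in> space (Bidx \<nu> J). \<forall>i\<in>I. \<omega> i \<in> A i} \<in> sets (Bidx \<nu> J)"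
    by (intro sets.sets_Collect_finite_All assms(1))
  then show ?thesis by (simp add: box_rect_def)
qed

lemma box_dens_sum:
  assumes a: "a \<in> Ulists K"
  shows "box_dens \<theta> N a n \<omega>
    = (\<Sum>(b, r)\<in>Ulists N \<times> Ulists n. path_wt \<nu> \<theta> (b @ a @ r) (shift (- int N) (- sum_list b) \<omega>))"
proof -
  have "box_dens \<theta> N a n \<omega> = (\<Sum>b\<in>Ulists N. \<Sum>r\<in>Ulists n. path_wt \<nu> \<theta> b (shift (- int N) (- sum_list b) \<omega>)
      * (path_wt \<nu> \<theta> a \<omega> * path_wt \<nu> \<theta> r (shift (int (length a)) (sum_list a) \<omega>)))"
    unfolding box_dens_def back_wt_def part_fn_def mult.assoc sum_distrib_left[symmetric] sum_distrib_right[symmetric] ..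
  also have "\<dots> = (\<Sum>b\<in>Ulists N. \<Sum>r\<in>Ulists n. path_wt \<nu> \<theta> (b @ a @ r) (shift (- int N) (- sum_list b) \<omega>))"
    by (intro sum.cong refl) (simp add: path_wt_append length_Ulists)
  finally show ?thesis by (simp add: sum.cartesian_product)
qed

lemma AE_box_dens: "a \<in> Ulists K \<Longrightarrow> AE \<omega> in \<P>. 0 \<le> box_dens \<theta> N a n \<omega>"
proof -
  assume a: "a \<in> Ulists K"
  show "AE \<omega> in \<P>. 0 \<le> box_dens \<theta> N a n \<omega>" using AE_good by eventually_elim (rule good_box_dens[OF _ a])
qed

text \<open>Conditioning on the \<open>K\<close> observed steps leaves the \<open>N\<close> earlier
  and \<open>M + 1\<close> later ones free. Summing over these completions splits the event into
  disjoint events with a fully prescribed path, and the weights add up to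
  \<open>box_dens\<close>.\<close>

lemma tilted_measure_rect:
  assumes a: "a \<in> Ulists K" and I: "finite I" "\<And>i. i \<in> I \<Longrightarrow> - int N \<le> fst i \<and> fst i \<le> int M"
    and A: "\<And>i. i \<in> I \<Longrightarrow> A i \<in> sets \<nu>"
  shows "emeasure (cyl_marginal (tilted_measure \<theta>) a) (box_rect I A)
    = emeasure (density \<P> (\<lambda>\<omega>. ennreal (box_dens \<theta> N a (M + 1) \<omega>))) (box_rect I A)"
proof -
  let ?D = "box_rect I A" and ?M = "two_sided \<theta> \<Otimes>\<^sub>M \<P>" and ?n = "M + 1"
  let ?S = "\<lambda>b. shift (- int N) (- sum_list b) :: 'd env \<Rightarrow> 'd env"
  \<comment> \<open>The horizon of \<open>tilted_exp\<close>. Times in the box are at most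
    \<open>M\<close>, below \<open>L - N = K + M + 1\<close>, so within the box the prescribed steps
    decide which sites are visited.\<close>
  define L where "L = N + (K + ?n)"
  define Z where "Z = (\<lambda>(b, r). b @ a @ r :: (int^'d) list)"
  define E where "E zs = {x \<in> space ?M. (\<forall>j<L. fst (fst x (int j - int N)) = zs ! j) \<and> fst (implant x) \<in> ?D}" for zs
  let ?P = "Ulists N \<times> Ulists ?n :: ((int^'d) list \<times> (int^'d) list) set"
  have DP: "?D \<in> sets \<P>" using box_rect_sets[OF I(1) subset_UNIV A] by (simp add: sets_Bidx_UNIV)
  have ZU: "Z br \<in> Ulists L" if "br \<in> ?P" for br
    using that a by (auto simp: Z_def L_def Ulists_def)
  have posN: "pos (Z (b, r)) N = sum_list b" if "b \<in> Ulists N" for b r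
    using that by (subst pos_eq_sum_list) (auto simp: Z_def length_Ulists)
  have NL: "N \<le> L" by (simp add: L_def)
  have IL: "- int N \<le> fst i \<and> fst i < int L - int N" if "i \<in> I" for i using I(2)[OF that] by (simp add: L_def)
  note path = emeasure_two_sided_path[where \<theta> = \<theta>, OF ZU NL I(1) IL A]
  have C: "?D \<times> cyl a \<in> sets (\<P> \<Otimes>\<^sub>M steps_measure)" by (rule pair_measureI[OF DP sets_cyl])
  have "emeasure (cyl_marginal (tilted_measure \<theta>) a) ?D = emeasure (tilted_measure \<theta>) (?D \<times> cyl a)"
    by (rule emeasure_cyl_marginal[OF sets_tilted_measure DP])
  also have "\<dots> = emeasure ?M (implant -` (?D \<times> cyl a) \<inter> space ?M)"
    unfolding tilted_measure_def by (rule emeasure_distr[OF measurable_implant C])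
  also have "implant -` (?D \<times> cyl a) \<inter> space ?M = (\<Union>br\<in>?P. E (Z br))"
  proof (intro set_eqI iffI)
    fix x assume x: "x \<in> implant -` (?D \<times> cyl a) \<inter> space ?M"
    then have i: "fst (implant x) \<in> ?D" "snd (implant x) \<in> cyl a" "x \<in> space ?M" by (auto simp: mem_Times_iff)
    have st: "fst (fst x j) \<in> Ustep" for j using i(3) by (auto simp: space_pair_measure space_two_sided)
    define b where "b = map (\<lambda>j. fst (fst x (int j - int N))) [0..<N]"
    define r where "r = map (\<lambda>j. fst (fst x (int K + int j))) [0..<?n]"
    have br: "(b, r) \<in> ?P" using st by (auto simp: b_def r_def Ulists_def)
    have lb: "length b = N" "length r = ?n" by (simp_all add: b_def r_def)
    have aj: "fst (fst x (int j)) = a ! j" if "j < K" for j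
      using i(2) that a by (simp add: cyl_def implant_def length_Ulists)
    have "fst (fst x (int j - int N)) = Z (b, r) ! j" if j: "j < L" for j
    proof -
      consider "j < N" | "N \<le> j" "j < N + K" | "N + K \<le> j" by linarith
      then show ?thesis
      proof cases
        case 1 then show ?thesis by (simp add: Z_def nth_append lb) (simp add: b_def)
      next
        case 2
        then have jN: "j - N < K" by linarith
        then have "Z (b, r) ! j = a ! (j - N)" using a 2 by (simp add: Z_def nth_append lb length_Ulists)
        then show ?thesis using aj[of "j - N"] 2 by (simp add: of_nat_diff)
      next
        case 3
        then have "\<not> j < N" "\<not> j - N < K" by linarith+
        then have "Z (b, r) ! j = r ! (j - N - K)" using a by (simp add: Z_def nth_append lb length_Ulists)
        moreover have "j - N - K < ?n" using j 3 by (simp add: L_def)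
        ultimately show ?thesis using 3 by (simp add: r_def of_nat_diff del: upt_Suc)
      qed
    qed
    then have "x \<in> E (Z (b, r))" using i by (simp add: E_def)
    then show "x \<in> (\<Union>br\<in>?P. E (Z br))" using br by blast
  next
    fix x assume "x \<in> (\<Union>br\<in>?P. E (Z br))"
    then obtain b r where br: "b \<in> Ulists N" "r \<in> Ulists ?n" and x: "x \<in> E (Z (b, r))" by auto
    have sp: "x \<in> space ?M" using x by (simp add: E_def)
    have "fst (fst x (int j)) = a ! j" if "j < K" for j
    proof -
      have "\<forall>j<L. fst (fst x (int j - int N)) = Z (b, r) ! j" using x by (simp add: E_def)
      moreover have "N + j < L" using that by (simp add: L_def)
      ultimately have "fst (fst x (int (N + j) - int N)) = Z (b, r) ! (N + j)" by blast
      also have "\<dots> = a ! j" using that a br by (simp add: Z_def nth_append length_Ulists)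
      finally show ?thesis by simp
    qed
    then have "snd (implant x) \<in> cyl a"
      using implant_in_space(2)[OF sp] a by (simp add: cyl_def length_Ulists) (simp add: implant_def)
    then show "x \<in> implant -` (?D \<times> cyl a) \<inter> space ?M" using x sp by (simp add: E_def mem_Times_iff)
  qed
  also have "emeasure ?M \<dots> = (\<Sum>br\<in>?P. emeasure ?M (E (Z br)))"
  proof (rule sum_emeasure[symmetric])
    show "(\<lambda>br. E (Z br)) ` ?P \<subseteq> sets ?M"
      unfolding E_def by (rule image_subsetI) (rule path(1))
    show "disjoint_family_on (\<lambda>br. E (Z br)) ?P"
      unfolding disjoint_family_on_def
    proof (intro ballI impI)
      fix p q assume pq: "p \<in> ?P" "q \<in> ?P" "p \<noteq> q"
      \<comment> \<open>The blocks have fixed lengths, so a path determines its completion.\<close>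
      have "Z p \<noteq> Z q" using pq by (auto simp: Z_def length_Ulists)
      moreover have "length (Z p) = L" "length (Z q) = L" using ZU[OF pq(1)] ZU[OF pq(2)] by (simp_all add: length_Ulists)
      ultimately obtain j where j: "j < L" "Z p ! j \<noteq> Z q ! j" by (auto simp: list_eq_iff_nth_eq)
      then show "E (Z p) \<inter> E (Z q) = {}" by (auto simp: E_def)
    qed
  qed simp
  also have "\<dots> = (\<Sum>(b, r)\<in>?P. \<integral>\<^sup>+\<omega>. indicator ?D \<omega> * ennreal (path_wt \<nu> \<theta> (b @ a @ r) (?S b \<omega>)) \<partial>\<P>)"
  proof (intro sum.cong refl)
    fix br assume br: "br \<in> ?P"
    obtain b r where e: "br = (b, r)" by (cases br)
    have "b \<in> Ulists N" using br e by simp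
    then show "emeasure ?M (E (Z br)) = (case br of (b, r) \<Rightarrow> \<integral>\<^sup>+\<omega>. indicator ?D \<omega> * ennreal (path_wt \<nu> \<theta> (b @ a @ r) (?S b \<omega>)) \<partial>\<P>)"
      using path(2)[OF br] posN[of b r] unfolding E_def e by (simp add: Z_def)
  qed
  also have "\<dots> = (\<integral>\<^sup>+\<omega>. (\<Sum>(b, r)\<in>?P. indicator ?D \<omega> * ennreal (path_wt \<nu> \<theta> (b @ a @ r) (?S b \<omega>))) \<partial>\<P>)"
    unfolding split_beta'
  proof (rule nn_integral_sum[symmetric])
    fix br assume br: "br \<in> ?P"
    have "path_wt \<nu> \<theta> (fst br @ a @ snd br) \<in> borel_measurable \<P>"
      using measurable_path_wt_env[OF ZU[OF br]] by (simp add: Z_def split_beta')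
    from measurable_compose[OF measurable_shift_env this]
    show "(\<lambda>\<omega>. indicator ?D \<omega> * ennreal (path_wt \<nu> \<theta> (fst br @ a @ snd br) (?S (fst br) \<omega>))) \<in> borel_measurable \<P>"
      by (intro borel_measurable_times_ennreal borel_measurable_indicator[OF DP] measurable_compose[OF _ measurable_ennreal])
  qed
  also have "\<dots> = (\<integral>\<^sup>+\<omega>. ennreal (box_dens \<theta> N a ?n \<omega>) * indicator ?D \<omega> \<partial>\<P>)"
  proof (rule nn_integral_cong_AE)
    show "AE \<omega> in \<P>. (\<Sum>(b, r)\<in>?P. indicator ?D \<omega> * ennreal (path_wt \<nu> \<theta> (b @ a @ r) (?S b \<omega>))) = ennreal (box_dens \<theta> N a ?n \<omega>) * indicator ?D \<omega>"
      using AE_good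
    proof eventually_elim
      case (elim \<omega>)
      have "(\<Sum>(b, r)\<in>?P. indicator ?D \<omega> * ennreal (path_wt \<nu> \<theta> (b @ a @ r) (?S b \<omega>)))
        = indicator ?D \<omega> * (\<Sum>br\<in>?P. ennreal (path_wt \<nu> \<theta> (Z br) (?S (fst br) \<omega>)))"
        unfolding sum_distrib_left by (intro sum.cong refl) (simp add: Z_def split_beta')
      also have "(\<Sum>br\<in>?P. ennreal (path_wt \<nu> \<theta> (Z br) (?S (fst br) \<omega>))) = ennreal (\<Sum>br\<in>?P. path_wt \<nu> \<theta> (Z br) (?S (fst br) \<omega>))"
        by (rule sum_ennreal) (rule less_imp_le[OF conjunct1[OF path_wt_bounds[OF good_shift[OF elim] ZU]]])
      also have "(\<Sum>br\<in>?P. path_wt \<nu> \<theta> (Z br) (?S (fst br) \<omega>)) = box_dens \<theta> N a ?n \<omega>"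
        unfolding box_dens_sum[OF a] by (intro sum.cong refl) (simp add: Z_def split_beta')
      finally show ?case by (simp add: mult.commute)
    qed
  qed
  also have "\<dots> = emeasure (density \<P> (\<lambda>\<omega>. ennreal (box_dens \<theta> N a ?n \<omega>))) ?D"
    by (rule emeasure_density[OF measurable_compose[OF measurable_box_dens[OF a] measurable_ennreal] DP, symmetric])
  finally show ?thesis .
qed

lemma finite_cyl_marginal_tilted: "finite_measure (cyl_marginal (tilted_measure \<theta>) a)"
proof (rule finite_measureI)
  interpret T: prob_space "tilted_measure \<theta>" by (rule prob_space_tilted_measure)
  show "emeasure (cyl_marginal (tilted_measure \<theta>) a) (space (cyl_marginal (tilted_measure \<theta>) a)) \<noteq> \<infinity>"
    unfolding space_cyl_marginal emeasure_cyl_marginal[OF sets_tilted_measure sets.top]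
    using T.emeasure_finite by simp
qed

text \<open>Rectangles over finite subsets of the box are closed under intersection, after filling
  missing coordinates with the whole space, and they generate the box.\<close>

lemma tilted_measure_box:
  assumes a: "a \<in> Ulists K" and D: "D \<in> sets (Bidx \<nu> {i. - int N \<le> fst i \<and> fst i \<le> int M})"
  shows "emeasure (cyl_marginal (tilted_measure \<theta>) a) D
    = emeasure (density \<P> (\<lambda>\<omega>. ennreal (box_dens \<theta> N a (M + 1) \<omega>))) D"
proof -
  let ?J = "{i. - int N \<le> fst i \<and> fst i \<le> int M} :: (int \<times> (int^'d)) set"
  let ?G = "{box_rect I A | I A. finite I \<and> I \<subseteq> ?J \<and> (\<forall>i\<in>I. A i \<in> sets \<nu>)}"
  have GP: "?G \<subseteq> sets \<P>"
  proof safe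
    fix I :: "(int \<times> (int^'d)) set" and A assume "finite I" "\<forall>i\<in>I. A i \<in> sets \<nu>"
    then show "box_rect I A \<in> sets \<P>" using box_rect_sets[OF _ subset_UNIV, of I A] by (simp add: sets_Bidx_UNIV)
  qed
  show ?thesis
  proof (rule emeasure_eq_on_sigma_sets[where \<Omega> = "space \<P>" and G = ?G])
    show "finite_measure (cyl_marginal (tilted_measure \<theta>) a)" by (rule finite_cyl_marginal_tilted)
    show "finite_measure (density \<P> (\<lambda>\<omega>. ennreal (box_dens \<theta> N a (M + 1) \<omega>)))"
      by (rule finite_measureI) (simp add: emeasure_density_real[OF integrable_box_dens[OF a] AE_box_dens[OF a] sets.top])
    show "?G \<subseteq> sets (cyl_marginal (tilted_measure \<theta>) a)" "?G \<subseteq> sets (density \<P> (\<lambda>\<omega>. ennreal (box_dens \<theta> N a (M + 1) \<omega>)))"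
      using GP by simp_all
    show "Int_stable ?G"
    proof (rule Int_stableI)
      fix X Y assume "X \<in> ?G" "Y \<in> ?G"
      then obtain I A J B where X: "X = box_rect I A" "finite I" "I \<subseteq> ?J" "\<forall>i\<in>I. A i \<in> sets \<nu>"
        and Y: "Y = box_rect J B" "finite J" "J \<subseteq> ?J" "\<forall>i\<in>J. B i \<in> sets \<nu>" by blast
      define C where "C i = (if i \<in> I then A i else space \<nu>) \<inter> (if i \<in> J then B i else space \<nu>)" for i
      have "X \<inter> Y = box_rect (I \<union> J) C"
        unfolding X(1) Y(1) box_rect_def C_def by (auto simp: space_env_measure_iff split: if_splits)
      moreover have "finite (I \<union> J)" "I \<union> J \<subseteq> ?J" "\<forall>i\<in>I \<union> J. C i \<in> sets \<nu>"
        using X Y by (auto simp: C_def)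
      ultimately show "X \<inter> Y \<in> ?G" by blast
    qed
    have "space \<P> = box_rect {} (\<lambda>_. {})" by (simp add: box_rect_def)
    then show "space \<P> \<in> ?G" by blast
    show "emeasure (cyl_marginal (tilted_measure \<theta>) a) X = emeasure (density \<P> (\<lambda>\<omega>. ennreal (box_dens \<theta> N a (M + 1) \<omega>))) X"
      if X: "X \<in> ?G" for X
    proof -
      obtain I A where "X = box_rect I A" "finite I" "I \<subseteq> ?J" "\<forall>i\<in>I. A i \<in> sets \<nu>" using X by blast
      then show ?thesis using tilted_measure_rect[OF a, of I N M A \<theta>] by blast
    qed
    have "sets (Bidx \<nu> ?J) \<subseteq> sigma_sets (space \<P>) ?G"
      unfolding sets_Bidx
    proof (rule sigma_sets_mono, safe)
      fix i :: "int \<times> (int^'d)" and B assume i: "- int N \<le> fst i" "fst i \<le> int M" and B: "B \<in> sets \<nu>"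
      have "(\<lambda>\<omega>. \<omega> i) -` B \<inter> space \<P> = box_rect {i} (\<lambda>_. B)" by (auto simp: box_rect_def)
      then have "(\<lambda>\<omega>. \<omega> i) -` B \<inter> space \<P> \<in> ?G" using i B by blast
      then show "(\<lambda>\<omega>. \<omega> i) -` B \<inter> space \<P> \<in> sigma_sets (space \<P>) ?G" by (rule sigma_sets.Basic)
    qed
    then show "D \<in> sigma_sets (space \<P>) ?G" using D by blast
  qed simp_all
qed

text \<open>On each cylinder of the first \<open>K\<close> steps the test function depends on the
  box environment only, so the box marginals determine its integral; \<open>tilted_exp_eq\<close>
  expands the required value into the same sum.\<close>

lemma is_barmu_tilted_measure: "is_barmu \<nu> \<theta> (tilted_measure \<theta>)"
  unfolding is_barmu_def
proof (intro conjI allI impI)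
  show "sets (tilted_measure \<theta>) = sets (\<P> \<Otimes>\<^sub>M steps_measure)" by (rule sets_tilted_measure)
  fix N M K :: nat and f :: "'d env \<times> (nat \<Rightarrow> int^'d) \<Rightarrow> real"
  assume H: "f \<in> borel_measurable (Bbox \<nu> N M \<Otimes>\<^sub>M steps_measure) \<and> (\<exists>B. \<forall>x. \<bar>f x\<bar> \<le> B)
    \<and> (\<forall>\<omega> s s'. (\<forall>i<K. s i = s' i) \<longrightarrow> f (\<omega>, s) = f (\<omega>, s'))"
  then obtain B where fm: "f \<in> borel_measurable (Bbox \<nu> N M \<Otimes>\<^sub>M steps_measure)" and B: "\<And>x. \<bar>f x\<bar> \<le> B"
    and dep: "\<And>\<omega> s s'. (\<And>i. i < K \<Longrightarrow> s i = s' i) \<Longrightarrow> f (\<omega>, s) = f (\<omega>, s')" by blast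
  let ?T = "tilted_measure \<theta>"
  let ?J = "{i. - int N \<le> fst i \<and> fst i \<le> int M} :: (int \<times> (int^'d)) set"
  interpret T: prob_space ?T by (rule prob_space_tilted_measure)
  have fstT: "fst \<in> ?T \<rightarrow>\<^sub>M \<P>" using measurable_fst measurable_cong_sets[OF sets_tilted_measure refl] by blast
  have sndT: "snd \<in> ?T \<rightarrow>\<^sub>M steps_measure" using measurable_snd measurable_cong_sets[OF sets_tilted_measure refl] by blast
  have gB: "(\<lambda>\<omega>. f (\<omega>, pad a)) \<in> borel_measurable (Bidx \<nu> ?J)" if "a \<in> Ulists K" for a
    by (rule measurable_section_pad[OF fm that])
  have gP: "(\<lambda>\<omega>. f (\<omega>, pad a)) \<in> borel_measurable \<P>" if "a \<in> Ulists K" for a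
    using gB[OF that] by (rule measurable_Bidx_env)
  have gT: "(\<lambda>x. f (fst x, pad a)) \<in> borel_measurable ?T" if "a \<in> Ulists K" for a
    by (rule measurable_compose[OF fstT gP[OF that]])
  have iT: "(\<lambda>x. indicator (cyl a) (snd x) :: real) \<in> borel_measurable ?T" for a
    by (rule measurable_compose[OF sndT borel_measurable_indicator[OF sets_cyl]])
  have iC: "(indicator (space \<P> \<times> cyl a) :: _ \<Rightarrow> real) \<in> borel_measurable ?T" for a
    by (rule borel_measurable_indicator) (unfold sets_tilted_measure, intro pair_measureI sets.top sets_cyl)
  \<comment> \<open>Exactly one cylinder contains the given steps, and replacing the later ones by
    the padding does not change \<open>f\<close>.\<close>
  have dec: "f x = (\<Sum>a\<in>Ulists K. indicator (cyl a) (snd x) * f (fst x, pad a))" if x: "x \<in> space ?T" for x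
  proof -
    define b where "b = map (snd x) [0..<K]"
    have s: "snd x \<in> space steps_measure" using x by (auto simp: space_tilted_measure)
    have b: "b \<in> Ulists K" unfolding b_def by (rule map_upt_Ulists[OF s])
    have "(\<Sum>a\<in>Ulists K. indicator (cyl a) (snd x) * f (fst x, pad a)) = (\<Sum>a\<in>Ulists K. if a = b then f (fst x, pad b) else 0)"
      using s by (intro sum.cong refl) (auto simp: indicator_def cyl_iff b_def)
    also have "\<dots> = f (fst x, pad b)" using b by simp
    also have "\<dots> = f (fst x, snd x)" by (rule dep) (simp add: pad_def b_def)
    finally show ?thesis by simp
  qed
  have ib: "integrable ?T (\<lambda>x. indicator (cyl a) (snd x) * f (fst x, pad a))" if a: "a \<in> Ulists K" for a
  proof (rule T.integrable_const_bound[where B = B])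
    show "(\<lambda>x. indicator (cyl a) (snd x) * f (fst x, pad a)) \<in> borel_measurable ?T"
      by (rule borel_measurable_times[OF iT gT[OF a]])
    have "\<bar>indicator (cyl a) (snd x) * f (fst x, pad a)\<bar> \<le> B" for x
      using B[of "(fst x, pad a)"] by (auto simp: indicator_def intro: order_trans[OF abs_ge_zero])
    then show "AE x in ?T. norm (indicator (cyl a) (snd x) * f (fst x, pad a)) \<le> B" by simp
  qed
  have isum: "integrable ?T (\<lambda>x. \<Sum>a\<in>Ulists K. indicator (cyl a) (snd x) * f (fst x, pad a))"
    by (rule Bochner_Integration.integrable_sum[OF ib])
  show "integrable ?T f"
    by (rule Bochner_Integration.integrable_cong[THEN iffD2, OF refl dec isum])
  have "(\<integral>x. f x \<partial>?T) = (\<integral>x. (\<Sum>a\<in>Ulists K. indicator (cyl a) (snd x) * f (fst x, pad a)) \<partial>?T)"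
    by (rule Bochner_Integration.integral_cong[OF refl dec])
  also have "\<dots> = (\<Sum>a\<in>Ulists K. \<integral>x. indicator (cyl a) (snd x) * f (fst x, pad a) \<partial>?T)"
    by (rule Bochner_Integration.integral_sum[OF ib])
  also have "\<dots> = (\<Sum>a\<in>Ulists K. \<integral>\<omega>. f (\<omega>, pad a) * (back_wt \<theta> N \<omega> * path_wt \<nu> \<theta> a \<omega> * part_fn \<nu> \<theta> (M + 1) (shift (int K) (sum_list a) \<omega>)) \<partial>\<P>)"
  proof (intro sum.cong refl)
    fix a :: "(int^'d) list" assume a: "a \<in> Ulists K"
    let ?g = "\<lambda>\<omega>. f (\<omega>, pad a)"
    let ?Q = "density \<P> (\<lambda>\<omega>. ennreal (box_dens \<theta> N a (M + 1) \<omega>))"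
    have fC: "fst \<in> density ?T (indicator (space \<P> \<times> cyl a)) \<rightarrow>\<^sub>M \<P>" using fstT by simp
    have "(\<integral>x. indicator (cyl a) (snd x) * ?g (fst x) \<partial>?T) = (\<integral>x. indicator (space \<P> \<times> cyl a) x *\<^sub>R ?g (fst x) \<partial>?T)"
      by (rule Bochner_Integration.integral_cong) (auto simp: space_tilted_measure indicator_def)
    also have "\<dots> = (\<integral>x. ?g (fst x) \<partial>density ?T (\<lambda>x. ennreal (indicator (space \<P> \<times> cyl a) x)))"
      by (rule integral_density[symmetric, OF gT[OF a] iC]) simp
    also have "\<dots> = (\<integral>x. ?g (fst x) \<partial>density ?T (indicator (space \<P> \<times> cyl a)))"
      by (simp add: ennreal_indicator)
    also have "\<dots> = (\<integral>\<omega>. ?g \<omega> \<partial>cyl_marginal ?T a)"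
      unfolding cyl_marginal_def by (rule integral_distr[OF fC gP[OF a], symmetric])
    also have "\<dots> = (\<integral>\<omega>. ?g \<omega> \<partial>?Q)"
      by (rule measure_eq_on_subalgebra_integral[OF _ _ tilted_measure_box[OF a] gB[OF a]])
         (use subalgebra_Bidx[of \<nu> ?J] in \<open>simp_all add: subalgebra_def\<close>)
    also have "\<dots> = (\<integral>\<omega>. box_dens \<theta> N a (M + 1) \<omega> *\<^sub>R ?g \<omega> \<partial>\<P>)"
      by (rule integral_density[OF gP[OF a] measurable_box_dens[OF a] AE_box_dens[OF a]])
    also have "\<dots> = (\<integral>\<omega>. ?g \<omega> * (back_wt \<theta> N \<omega> * path_wt \<nu> \<theta> a \<omega> * part_fn \<nu> \<theta> (M + 1) (shift (int K) (sum_list a) \<omega>)) \<partial>\<P>)"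
      using a by (intro Bochner_Integration.integral_cong refl) (simp add: box_dens_def length_Ulists mult.commute)
    finally show "(\<integral>x. indicator (cyl a) (snd x) * ?g (fst x) \<partial>?T)
      = (\<integral>\<omega>. ?g \<omega> * (back_wt \<theta> N \<omega> * path_wt \<nu> \<theta> a \<omega> * part_fn \<nu> \<theta> (M + 1) (shift (int K) (sum_list a) \<omega>)) \<partial>\<P>)" .
  qed
  also have "\<dots> = tilted_exp \<nu> \<theta> N M K f" by (rule tilted_exp_eq[OF fm B dep, symmetric])
  finally show "(\<integral>x. f x \<partial>?T) = tilted_exp \<nu> \<theta> N M K f" .
qed

lemma ex_tilted_walk:
  assumes "CARD('d) \<ge> 3"
  shows "\<exists>r>0. \<forall>\<theta>. norm \<theta> < r \<longrightarrow> (\<exists>u. rwre_tilt \<nu> c1 \<theta> u)"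
proof -
  obtain r B where r: "r > 0" and B: "\<And>\<theta> n. norm \<theta> < r \<Longrightarrow> overlap \<theta> n 0 \<le> B"
    using overlap_bounded[OF assms] by blast
  have "\<exists>u. rwre_tilt \<nu> c1 \<theta> u" if th: "norm \<theta> < r" for \<theta>
  proof -
    obtain u where "u \<in> borel_measurable (Bplus \<nu> 0)" "\<And>\<omega>. u \<omega> > 0" "integrable \<P> u" "(\<integral>\<omega>. u \<omega> \<partial>\<P>) = 1"
      "AE \<omega> in \<P>. u \<omega> = (\<Sum>z\<in>Ustep. \<omega> (0,0) z * step_wt \<nu> \<theta> z * u (shift 1 z \<omega>))"
      "(\<lambda>n. \<integral>\<omega>. \<bar>part_fn \<nu> \<theta> n \<omega> - u \<omega>\<bar> \<partial>\<P>) \<longlonglongrightarrow> 0"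
      by (rule ex_harmonic[OF B[OF th]]) blast
    then have "rwre_tilt \<nu> c1 \<theta> u"
      by (intro rwre_tilt.intro rwre_tilt_axioms.intro rwre_axioms)
    then show ?thesis by blast
  qed
  then show ?thesis using r by blast
qed

end

theorem theorem1p20:
  fixes \<nu> :: "((int^'d::finite) \<Rightarrow> real) measure" and c1 :: real
  assumes "CARD('d) \<ge> 3"
    and "prob_space \<nu>"
    and "sets \<nu> = sets (PiM Ustep (\<lambda>_. borel))"
    and "c1 > 0"
    and "AE p in \<nu>. (\<forall>z\<in>Ustep. p z \<ge> c1) \<and> (\<Sum>z\<in>Ustep. p z) = 1"
  shows "\<exists>\<eta>>0. \<forall>\<xi>::real^'d. norm (\<xi> - xi_o \<nu>) < \<eta> \<longrightarrow>
     (\<exists>!\<theta>. (Lambda_c \<nu> has_derivative (\<lambda>h. \<xi> \<bullet> h)) (at \<theta>)) \<and>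
     (\<forall>\<theta>. (Lambda_c \<nu> has_derivative (\<lambda>h. \<xi> \<bullet> h)) (at \<theta>) \<longrightarrow>
       (\<exists>u. u \<in> borel_measurable (Bplus \<nu> 0)
          \<and> (\<forall>\<omega>\<in>space (env_measure \<nu>). u \<omega> > 0)
          \<and> integrable (env_measure \<nu>) u \<and> (\<integral>\<omega>. u \<omega> \<partial>env_measure \<nu>) = 1
          \<and> (AE \<omega> in env_measure \<nu>.
               u \<omega> = (\<Sum>z\<in>Ustep. \<omega> (0,0) z * exp (\<theta> \<bullet> vecR z - Lambda_c \<nu> \<theta>) * u (shift 1 z \<omega>)))
          \<and> (\<exists>Mu. is_barmu \<nu> \<theta> Mu)
          \<and> (\<forall>Mu. is_barmu \<nu> \<theta> Mu \<longrightarrow>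
               SMP_ac \<nu> (tilted_kernel \<nu> \<theta> u) (mu_inf \<nu> Mu)
               \<and> (\<forall>\<mu>. SMP_ac \<nu> (tilted_kernel \<nu> \<theta> u) \<mu> \<longrightarrow> \<mu> = mu_inf \<nu> Mu))))"
proof -
  interpret rwre \<nu> c1
    by (rule rwre.intro) (use assms in auto)
  obtain r where r: "r > 0" and u: "\<And>\<theta>. norm \<theta> < r \<Longrightarrow> \<exists>u. rwre_tilt \<nu> c1 \<theta> u"
    using ex_tilted_walk[OF assms(1)] by blast
  \<comment> \<open>The radius is dictated by the second moment bound; \<open>\<eta>\<close> is then
    chosen so that every conjugate tilt lies within it.\<close>
  obtain \<eta> where \<eta>: "\<eta> > 0"
    and crit: "\<And>\<xi>. norm (\<xi> - xi_o \<nu>) < \<eta> \<Longrightarrow>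
      (\<exists>!\<theta>. (Lambda_c \<nu> has_derivative (\<lambda>h. \<xi> \<bullet> h)) (at \<theta>)) \<and>
      (\<forall>\<theta>. (Lambda_c \<nu> has_derivative (\<lambda>h. \<xi> \<bullet> h)) (at \<theta>) \<longrightarrow> norm \<theta> < r)"
    using ex_tilt[OF r] by blast
  show ?thesis
  proof (intro exI[of _ \<eta>] conjI allI impI \<eta>)
    fix \<xi> :: "real^'d" assume \<xi>: "norm (\<xi> - xi_o \<nu>) < \<eta>"
    show "\<exists>!\<theta>. (Lambda_c \<nu> has_derivative (\<lambda>h. \<xi> \<bullet> h)) (at \<theta>)" using crit[OF \<xi>] by (rule conjunct1)
    fix \<theta> assume "(Lambda_c \<nu> has_derivative (\<lambda>h. \<xi> \<bullet> h)) (at \<theta>)"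
    then have "norm \<theta> < r" using crit[OF \<xi>] by blast
    then obtain u where tilt: "rwre_tilt \<nu> c1 \<theta> u" using u by blast
    interpret T: rwre_tilt \<nu> c1 \<theta> u by (rule tilt)
    show "\<exists>u. u \<in> borel_measurable (Bplus \<nu> 0)
          \<and> (\<forall>\<omega>\<in>space (env_measure \<nu>). u \<omega> > 0)
          \<and> integrable (env_measure \<nu>) u \<and> (\<integral>\<omega>. u \<omega> \<partial>env_measure \<nu>) = 1
          \<and> (AE \<omega> in env_measure \<nu>.
               u \<omega> = (\<Sum>z\<in>Ustep. \<omega> (0,0) z * exp (\<theta> \<bullet> vecR z - Lambda_c \<nu> \<theta>) * u (shift 1 z \<omega>)))
          \<and> (\<exists>Mu. is_barmu \<nu> \<theta> Mu)
          \<and> (\<forall>Mu. is_barmu \<nu> \<theta> Mu \<longrightarrow>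
               SMP_ac \<nu> (tilted_kernel \<nu> \<theta> u) (mu_inf \<nu> Mu)
               \<and> (\<forall>\<mu>. SMP_ac \<nu> (tilted_kernel \<nu> \<theta> u) \<mu> \<longrightarrow> \<mu> = mu_inf \<nu> Mu))"
    proof (intro exI[of _ u] conjI allI impI ballI)
      show "\<exists>Mu. is_barmu \<nu> \<theta> Mu" using is_barmu_tilted_measure by blast
      show "AE \<omega> in env_measure \<nu>.
          u \<omega> = (\<Sum>z\<in>Ustep. \<omega> (0,0) z * exp (\<theta> \<bullet> vecR z - Lambda_c \<nu> \<theta>) * u (shift 1 z \<omega>))"
        using T.u_harmonic by (simp only: step_wt_def)
    next
      fix Mu assume "is_barmu \<nu> \<theta> Mu"
      then have B: "barmu \<nu> c1 \<theta> u Mu" by (intro barmu.intro barmu_axioms.intro tilt)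
      show ac: "SMP_ac \<nu> (tilted_kernel \<nu> \<theta> u) (mu_inf \<nu> Mu)" by (rule barmu.SMP_ac_mu[OF B])
      show "\<mu> = mu_inf \<nu> Mu" if "SMP_ac \<nu> (tilted_kernel \<nu> \<theta> u) \<mu>" for \<mu>
        by (rule T.SMP_ac_unique[OF that ac])
    qed (rule T.measurable_u T.u_pos T.integrable_u T.integral_u)+
  qed
qed

end
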